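(* Let $1<p<\infty$, let $T>0$, let $\Omega\subset\mathbb{R}^n$ be a bounded Lipschitz domain, $\Omega_T=\Omega\times(0,T)$, and let $\psi\in C(\overline{\Omega_T})\cap L^p(0,T;W^{1,p}(\Omega))$. Suppose that the lateral boundary values are monotone in time, i.e. either $\psi(x,t)\le\psi(x,s)$ for all $x\in\partial\Omega$ and all $0<t<s<T$, or $\psi(x,t)\ge\psi(x,s)$ for all $x\in\partial\Omega$ and all $0<t<s<T$. Then the weak solution of $\partial_t(|u|^{p-2}u)=\operatorname{div}(|\nabla u|^{p-2}\nabla u)$ in $\Omega_T$ with boundary values $\psi$ is unique: if $u$ and $v$ are two weak solutions with boundary values $\psi$, then $u=v$ almost everywhere in $\Omega_T$.
   Context: Notation: $b(z):=|z|^{p-2}z$ with $b(0)=0$; $\nabla$ is the spatial gradient. Solutions may change sign. The space $L^p(0,T;W^{1,p}(\Omega))$ consists of measurable $u:\Omega_T\to\mathbb{R}$ such that $x\mapsto u(x,t)$ belongs to $W^{1,p}(\Omega)$ for a.e. $t\in(0,T)$ and $\int_0^T\int_\Omega(|u|^p+|\nabla u|^p)\,dx\,dt<\infty$; $L^p(0,T;W^{1,p}_0(\Omega))$ is defined analogously. Weak solution: let $\psi\in C(\overline{\Omega_T})\cap L^p(0,T;W^{1,p}(\Omega))$ and $u\in L^p(0,T;W^{1,p}(\Omega))$. Then $u$ is a weak solution with boundary values $\psi$ if (1) $u-\psi\in L^p(0,T;W_0^{1,p}(\Omega))$; (2) for every $\gamma\in C_0^\infty(\Omega_T)$, $\int_0^T\int_\Omega\bigl(-b(u)\,\partial_t\gamma+\langle|\nabla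 u|^{p-2}\nabla u,\nabla\gamma\rangle\bigr)\,dx\,dt=0$; (3) $\lim_{t\to0+}\int_\Omega|b(u(x,t))-b(\psi(x,t))|\,dx=0$. *)

theory Defs
  imports "HOL-Analysis.Analysis"
begin

definition lipschitz_domain :: "'a::euclidean_space set \<Rightarrow> bool" where
  "lipschitz_domain \<Omega> \<longleftrightarrow> open \<Omega> \<and> connected \<Omega> \<and> \<Omega> \<noteq> {} \<and>
     (\<forall>x\<^sub>0\<in>frontier \<Omega>. \<exists>r>0. \<exists>e g L. norm e = 1 \<and> L-lipschitz_on {y. y \<bullet> e = 0} g \<and>
        \<Omega> \<inter> ball x\<^sub>0 r = {y \<in> ball x\<^sub>0 r. y \<bullet> e > g (y - (y \<bullet> e) *\<^sub>R e)})"
  \<comment> \<open>The unit vector \<open>e\<close> is the last axis of a rotated coordinate system: near \<open>x\<^sub>0\<close> the domain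
    lies above the graph, over the hyperplane orthogonal to \<open>e\<close>, of the Lipschitz function \<open>g\<close>.\<close>

primrec C_k :: "nat \<Rightarrow> ('a::euclidean_space \<Rightarrow> real) \<Rightarrow> bool" where
  "C_k 0 f \<longleftrightarrow> continuous_on UNIV f"
| "C_k (Suc k) f \<longleftrightarrow> (\<forall>x. f differentiable at x) \<and>
     (\<forall>i\<in>Basis. C_k k (\<lambda>x. frechet_derivative f (at x) i))"

definition test_functions :: "'a::euclidean_space set \<Rightarrow> ('a \<Rightarrow> real) set" where
  "test_functions U = {\<phi>. (\<forall>k. C_k k \<phi>) \<and>
     compact (closure {x. \<phi> x \<noteq> 0}) \<and> closure {x. \<phi> x \<noteq> 0} \<subseteq> U}"
  \<comment> \<open>\<open>C\<^sub>0\<^sup>\<infinity>(U)\<close>, each function being extended by zero to the whole space.\<close>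

definition grad :: "('a::euclidean_space \<Rightarrow> real) \<Rightarrow> 'a \<Rightarrow> 'a" where
  "grad f x = (THE D. GDERIV f x :> D)"

definition space_grad :: "('a::euclidean_space \<times> real \<Rightarrow> real) \<Rightarrow> 'a \<times> real \<Rightarrow> 'a" where
  "space_grad \<gamma> z = grad (\<lambda>y. \<gamma> (y, snd z)) (fst z)"

definition time_deriv :: "('a \<times> real \<Rightarrow> real) \<Rightarrow> 'a \<times> real \<Rightarrow> real" where
  "time_deriv \<gamma> z = deriv (\<lambda>s. \<gamma> (fst z, s)) (snd z)"

definition Lp :: "real \<Rightarrow> 'a::euclidean_space set \<Rightarrow> ('a \<Rightarrow> 'b::euclidean_space) set" where
  "Lp p U = {f \<in> borel_measurable (lebesgue_on U). integrable (lebesgue_on U) (\<lambda>x. norm (f x) powr p)}"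

definition has_weak_gradient ::
    "'a::euclidean_space set \<Rightarrow> ('a \<Rightarrow> real) \<Rightarrow> ('a \<Rightarrow> 'a) \<Rightarrow> bool" where
  "has_weak_gradient \<Omega> f G \<longleftrightarrow>
     (\<forall>K. compact K \<and> K \<subseteq> \<Omega> \<longrightarrow> set_integrable lebesgue K f \<and> set_integrable lebesgue K G) \<and>
     (\<forall>\<phi>\<in>test_functions \<Omega>.
        (LINT x:\<Omega>|lebesgue. f x *\<^sub>R grad \<phi> x) = - (LINT x:\<Omega>|lebesgue. \<phi> x *\<^sub>R G x))"

definition W1p :: "real \<Rightarrow> 'a::euclidean_space set \<Rightarrow> ('a \<Rightarrow> real) set" where
  "W1p p \<Omega> = {f. f \<in> Lp p \<Omega> \<and> (\<exists>G. has_weak_gradient \<Omega> f G \<and> G \<in> Lp p \<Omega>)}"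

text \<open>The closure of the test functions with respect to the norm of \<open>W1p p \<Omega>\<close>.\<close>

definition W1p0 :: "real \<Rightarrow> 'a::euclidean_space set \<Rightarrow> ('a \<Rightarrow> real) set" where
  "W1p0 p \<Omega> = {f. f \<in> Lp p \<Omega> \<and> (\<exists>G. has_weak_gradient \<Omega> f G \<and> G \<in> Lp p \<Omega> \<and>
     (\<exists>\<phi>. (\<forall>k::nat. \<phi> k \<in> test_functions \<Omega>) \<and>
        (\<lambda>k. \<integral>\<^sup>+x. ennreal (\<bar>f x - \<phi> k x\<bar> powr p + norm (G x - grad (\<phi> k) x) powr p)
               \<partial>lebesgue_on \<Omega>) \<longlonglongrightarrow> 0))}"

abbreviation cylinder :: "'a set \<Rightarrow> real \<Rightarrow> ('a \<times> real) set" where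
  "cylinder \<Omega> T \<equiv> \<Omega> \<times> {0<..<T}"

text \<open>
  The weak gradients of the time slices are determined almost everywhere only. The spatial
  gradient of a function on the cylinder is a jointly measurable choice of them; it is unique
  up to a null set of the cylinder.
\<close>

definition has_spatial_gradient ::
    "'a::euclidean_space set \<Rightarrow> real \<Rightarrow> ('a \<times> real \<Rightarrow> real) \<Rightarrow> ('a \<times> real \<Rightarrow> 'a) \<Rightarrow> bool" where
  "has_spatial_gradient \<Omega> T u G \<longleftrightarrow> G \<in> borel_measurable (lebesgue_on (cylinder \<Omega> T)) \<and>
     (AE t in lebesgue_on {0<..<T}. has_weak_gradient \<Omega> (\<lambda>x. u (x, t)) (\<lambda>x. G (x, t)))"

text \<open>The space \<open>L\<^sup>p(0,T;X)\<close>, to be used with \<open>X = W1p p \<Omega>\<close> and \<open>X = W1p0 p \<Omega>\<close>.\<close>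

definition Lp_time ::
    "real \<Rightarrow> 'a::euclidean_space set \<Rightarrow> real \<Rightarrow> ('a \<Rightarrow> real) set \<Rightarrow> ('a \<times> real \<Rightarrow> real) set" where
  "Lp_time p \<Omega> T X = {u \<in> borel_measurable (lebesgue_on (cylinder \<Omega> T)).
     (AE t in lebesgue_on {0<..<T}. (\<lambda>x. u (x, t)) \<in> X) \<and>
     (\<exists>G. has_spatial_gradient \<Omega> T u G \<and>
        integrable (lebesgue_on (cylinder \<Omega> T)) (\<lambda>z. \<bar>u z\<bar> powr p + norm (G z) powr p))}"

text \<open>Since \<open>0 powr a = 0\<close> for every \<open>a\<close>, this satisfies \<open>b_pow p 0 = 0\<close> also for \<open>p < 2\<close>; the same
  convention applies to the flux in \<open>weak_solution\<close> where the gradient vanishes.\<close>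

definition b_pow :: "real \<Rightarrow> real \<Rightarrow> real" where
  "b_pow p z = \<bar>z\<bar> powr (p - 2) * z"

text \<open>
  The initial condition uses the nonnegative integral, because the Bochner integral of a
  non-integrable function is \<open>0\<close>.
\<close>

definition weak_solution ::
    "real \<Rightarrow> 'a::euclidean_space set \<Rightarrow> real \<Rightarrow> ('a \<times> real \<Rightarrow> real) \<Rightarrow> ('a \<times> real \<Rightarrow> real) \<Rightarrow> bool" where
  "weak_solution p \<Omega> T \<psi> u \<longleftrightarrow>
     u \<in> Lp_time p \<Omega> T (W1p p \<Omega>) \<and>
     (\<lambda>z. u z - \<psi> z) \<in> Lp_time p \<Omega> T (W1p0 p \<Omega>) \<and>
     (\<exists>G. has_spatial_gradient \<Omega> T u G \<and>
        (\<forall>\<gamma>\<in>test_functions (cylinder \<Omega> T).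
           (LINT z:cylinder \<Omega> T|lebesgue.
              - b_pow p (u z) * time_deriv \<gamma> z
              + (norm (G z) powr (p - 2) *\<^sub>R G z) \<bullet> space_grad \<gamma> z) = 0)) \<and>
     ((\<lambda>t. \<integral>\<^sup>+x. ennreal \<bar>b_pow p (u (x, t)) - b_pow p (\<psi> (x, t))\<bar> \<partial>lebesgue_on \<Omega>) \<longlongrightarrow> 0) (at_right 0)"

end

theory Submission
  imports Defs "HOL-Computational_Algebra.Polynomial"
begin

text \<open>
  Monotone lateral boundary values make \<open>(u(t) - v(s))\<^sup>+\<close> an element of \<open>W\<^sub>0\<^sup>1\<^sup>,\<^sup>p(\<Omega>)\<close> as soon as
  \<open>\<sigma> (s - t) > 0\<close>, where \<open>\<sigma> = 1\<close> for increasing and \<open>\<sigma> = -1\<close> for decreasing data. So one doubles the time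
  variable: the equation of \<open>u\<close> in \<open>t\<close> and that of \<open>v\<close> in \<open>s\<close> are tested with a smooth Heaviside
  function of \<open>(u(t) - v(s)) / \<delta>\<close> times a weight concentrated on \<open>0 < \<sigma> (s - t) < \<epsilon>\<close>. The difference of the
  elliptic terms has a sign because the flux is monotone. Letting \<open>\<delta> \<rightarrow> 0\<close> and then \<open>\<epsilon> \<rightarrow> 0\<close> shows that
  \<open>\<integral> (b(u) - b(v))\<^sup>+ dx\<close> is nonincreasing in time, and it tends to \<open>0\<close> at the initial time. No time
  derivative of \<open>u\<close> is needed: a discrete chain rule for the primitives of the Heaviside function
  replaces it.
\<close>

section \<open>Smooth functions\<close>

text \<open>The chain rule is what forces the doubling. At a common time the test function
  \<open>smooth_step ((u - v) / \<delta>)\<close> would be paired with the time derivative of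
  \<open>b_pow p u - b_pow p v\<close>; as \<open>b_pow p\<close> is nonlinear in general, this is
  not the time derivative of a function of \<open>u\<close> and \<open>v\<close>. With
  \<open>v\<close> frozen at a time \<open>s\<close> it is:
  \<open>smooth_step ((u - k) / \<delta>)\<close> has a primitive with respect to
  \<open>b_pow p u\<close> for each constant \<open>k\<close>. The price is paid at the boundary:
  \<open>u(t) - v(s)\<close> has lateral values \<open>\<psi>(t) - \<psi>(s)\<close>, whose positive
  part is only known to vanish for one order of \<open>t\<close> and \<open>s\<close>. Hence all
  weights come from a bump supported in the positive half line, never from a symmetric one. The
  doubled weight is \<open>\<omega>(t) \<rho>(s - t)\<close>. The sum of its two time derivatives is
  \<open>\<omega>'(t) \<rho>(s - t)\<close>: the derivative of \<open>\<rho>\<close>, of order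
  \<open>1 / \<epsilon>^2\<close>, cancels once both primitives have the same limit as
  \<open>\<delta> \<rightarrow> 0\<close>. Since \<open>u\<close> and \<open>v\<close> share their
  data, the same \<open>\<sigma>\<close> serves when they are exchanged, so the comparison can be
  used in both directions.\<close>

lemma C_k_SucD: "C_k (Suc k) f \<Longrightarrow> C_k k f"
proof (induct k arbitrary: f)
  case 0
  then show ?case
    by (auto simp: continuous_on_eq_continuous_at intro!: differentiable_imp_continuous_within)
next
  case (Suc k)
  then show ?case by (metis C_k.simps(2))
qed

text \<open>Translates a derivative found by the rules for \<open>has_derivative\<close> into the
  \<open>frechet_derivative\<close> in which \<open>C_k\<close> is phrased; the basic closure
  properties below all go through it.\<close>

lemma C_k_SucI:
  assumes "\<And>x. (f has_derivative f' x) (at x)" "\<And>i. i \<in> Basis \<Longrightarrow> C_k k (\<lambda>x. f' x i)"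
  shows "C_k (Suc k) f"
proof -
  have "frechet_derivative f (at x) = f' x" for x
    using assms(1) frechet_derivative_at by metis
  then show ?thesis using assms by (auto simp: differentiable_def)
qed

lemma C_k_has_derivative:
  assumes "C_k (Suc k) f"
  shows "(f has_derivative frechet_derivative f (at x)) (at x)"
  using assms by (simp add: frechet_derivative_works[symmetric])

lemma C_k_const: "C_k k (\<lambda>x. c)"
proof (induct k arbitrary: c)
  case (Suc k)
  show ?case by (rule C_k_SucI[where f'="\<lambda>_ _. 0"]) (auto intro: Suc)
qed simp

lemma C_k_add: "C_k k f \<Longrightarrow> C_k k g \<Longrightarrow> C_k k (\<lambda>x. f x + g x)"
proof (induct k arbitrary: f g)
  case (Suc k)
  show ?case
    by (rule C_k_SucI, rule has_derivative_add[OF C_k_has_derivative[OF Suc(2)] C_k_has_derivative[OF Suc(3)]])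
       (use Suc in auto)
qed (auto intro: continuous_intros)

lemma C_k_sum: "(\<And>i. i \<in> I \<Longrightarrow> C_k k (f i)) \<Longrightarrow> C_k k (\<lambda>x. \<Sum>i\<in>I. f i x)"
  by (induct I rule: infinite_finite_induct) (auto intro: C_k_add C_k_const)

lemma C_k_mult: "C_k k f \<Longrightarrow> C_k k g \<Longrightarrow> C_k k (\<lambda>x. f x * g x)"
proof (induct k arbitrary: f g)
  case (Suc k)
  have "C_k k f" "C_k k g" using Suc C_k_SucD by auto
  have d: "((\<lambda>x. f x * g x) has_derivative
      (\<lambda>h. f x * frechet_derivative g (at x) h + frechet_derivative f (at x) h * g x)) (at x)" for x
    by (rule has_derivative_mult[OF C_k_has_derivative[OF Suc(2)] C_k_has_derivative[OF Suc(3)]])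
  show ?case
    by (rule C_k_SucI[OF d], intro C_k_add Suc(1)) (use Suc(2,3) \<open>C_k k f\<close> \<open>C_k k g\<close> in auto)
qed (auto intro: continuous_intros)

lemma C_k_prod: "(\<And>i. i \<in> I \<Longrightarrow> C_k k (f i)) \<Longrightarrow> C_k k (\<lambda>x. \<Prod>i\<in>I. f i x)"
  by (induct I rule: infinite_finite_induct) (auto intro: C_k_mult C_k_const)

lemma C_k_affine:
  fixes l :: "'a::euclidean_space \<Rightarrow> 'b::euclidean_space"
  assumes "bounded_linear l"
  shows "C_k k g \<Longrightarrow> C_k k (\<lambda>x. g (c + l x))"
proof (induct k arbitrary: g)
  case 0
  have "continuous_on UNIV (\<lambda>x. c + l x)"
    using assms by (intro continuous_intros linear_continuous_on)
  with 0 show ?case using continuous_on_compose2[of UNIV g UNIV "\<lambda>x. c + l x"] by auto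
next
  case (Suc k)
  let ?D = "\<lambda>y. frechet_derivative g (at y)"
  have d: "(g has_derivative ?D y) (at y)" for y by (rule C_k_has_derivative[OF Suc(2)])
  have "((\<lambda>x. c + l x) has_derivative l) (at x)" for x
    using bounded_linear_imp_has_derivative[OF assms] has_derivative_add[OF has_derivative_const] by fastforce
  from diff_chain_at[OF this d]
  have 1: "((\<lambda>x. g (c + l x)) has_derivative (\<lambda>v. ?D (c + l x) (l v))) (at x)" for x
    by (simp add: o_def)
  \<comment> \<open>The chain rule produces derivatives in the directions \<open>l i\<close>, while
    \<open>C_k\<close> only speaks of directions in \<open>Basis\<close>. Expanding
    \<open>l i\<close> in the basis leaves constants times partial derivatives, to which the
    induction hypothesis applies.\<close>
  have 2: "?D y (l i) = (\<Sum>j\<in>Basis. (l i \<bullet> j) * ?D y j)" for y i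
  proof -
    have "linear (?D y)" using d has_derivative_linear by blast
    then have "?D y (\<Sum>j\<in>Basis. (l i \<bullet> j) *\<^sub>R j) = (\<Sum>j\<in>Basis. (l i \<bullet> j) *\<^sub>R ?D y j)"
      by (simp add: linear_sum linear_cmul)
    then show ?thesis by (simp add: euclidean_representation)
  qed
  show ?case
  proof (rule C_k_SucI[OF 1])
    fix i :: 'a assume "i \<in> Basis"
    have "C_k k (\<lambda>x. ?D (c + l x) j)" if "j \<in> Basis" for j
      using Suc(1)[of "\<lambda>y. ?D y j"] Suc(2) that by simp
    then show "C_k k (\<lambda>x. ?D (c + l x) (l i))"
      unfolding 2 by (intro C_k_sum C_k_mult C_k_const)
  qed
qed

lemma C_k_compose_real:
  fixes h :: "real \<Rightarrow> real"
  shows "C_k k h \<Longrightarrow> C_k k f \<Longrightarrow> C_k k (\<lambda>x. h (f x))"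
proof (induct k arbitrary: h f)
  case 0
  then show ?case using continuous_on_compose2[of UNIV h UNIV f] by auto
next
  case (Suc k)
  let ?h = "\<lambda>y. frechet_derivative h (at y) 1"
  let ?D = "\<lambda>y. frechet_derivative f (at y)"
  have h: "(h has_derivative (\<lambda>v. v * ?h y)) (at y)" for y
  proof -
    have "linear (frechet_derivative h (at y))"
      using C_k_has_derivative[OF Suc(2)] has_derivative_linear by blast
    then have "frechet_derivative h (at y) = (\<lambda>v. v * ?h y)"
      by (metis linear_cmul mult.right_neutral real_scaleR_def)
    with C_k_has_derivative[OF Suc(2), of y] show ?thesis by simp
  qed
  have 1: "((\<lambda>x. h (f x)) has_derivative (\<lambda>v. ?D x v * ?h (f x))) (at x)" for x
    using diff_chain_at[OF C_k_has_derivative[OF Suc(3)] h] by (simp add: o_def)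
  have "C_k k f" using Suc(3) C_k_SucD by blast
  moreover have "C_k k ?h" using Suc(2) by simp
  ultimately have "C_k k (\<lambda>x. ?h (f x))" by (rule Suc(1)[rotated])
  then show ?case
    by (intro C_k_SucI[OF 1] C_k_mult) (use Suc(3) in simp_all)
qed

definition smooth :: "('a::euclidean_space \<Rightarrow> real) \<Rightarrow> bool" where
  "smooth f \<longleftrightarrow> (\<forall>k. C_k k f)"

lemma smooth_const: "smooth (\<lambda>x. c)" by (simp add: smooth_def C_k_const)
lemma smooth_add: "smooth f \<Longrightarrow> smooth g \<Longrightarrow> smooth (\<lambda>x. f x + g x)" by (simp add: smooth_def C_k_add)
lemma smooth_mult: "smooth f \<Longrightarrow> smooth g \<Longrightarrow> smooth (\<lambda>x. f x * g x)" by (simp add: smooth_def C_k_mult)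
lemma smooth_diff: "smooth f \<Longrightarrow> smooth g \<Longrightarrow> smooth (\<lambda>x. f x - g x)"
  using smooth_add[of f "\<lambda>x. (-1) * g x"] smooth_mult[OF smooth_const, of g "-1"] by simp
lemma smooth_prod: "(\<And>i. i \<in> I \<Longrightarrow> smooth (f i)) \<Longrightarrow> smooth (\<lambda>x. \<Prod>i\<in>I. f i x)"
  by (simp add: smooth_def C_k_prod)
lemma smooth_affine: "bounded_linear l \<Longrightarrow> smooth g \<Longrightarrow> smooth (\<lambda>x. g (c + l x))"
  by (simp add: smooth_def C_k_affine)
lemma smooth_compose_real: "smooth h \<Longrightarrow> smooth f \<Longrightarrow> smooth (\<lambda>x. h (f x))"
  by (simp add: smooth_def C_k_compose_real)

lemma smooth_has_derivative:
  "smooth f \<Longrightarrow> (f has_derivative frechet_derivative f (at x)) (at x)"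
  unfolding smooth_def using C_k_has_derivative by blast

lemma smooth_derivative: "smooth f \<Longrightarrow> i \<in> Basis \<Longrightarrow> smooth (\<lambda>x. frechet_derivative f (at x) i)"
  unfolding smooth_def by (metis C_k.simps(2))

lemma smooth_continuous: "smooth f \<Longrightarrow> continuous_on UNIV f"
  unfolding smooth_def by (metis C_k.simps(1))

lemma smooth_borel: "smooth f \<Longrightarrow> f \<in> borel_measurable borel"
  using smooth_continuous borel_measurable_continuous_onI by blast

lemma smooth_realI:
  fixes f :: "real \<Rightarrow> real"
  assumes "\<And>x. (f has_field_derivative f' x) (at x)" "smooth f'"
  shows "smooth f"
  unfolding smooth_def
proof
  fix k show "C_k k f"
  proof -
    have "C_k (Suc k) f"
      by (rule C_k_SucI[where f'="\<lambda>x v. f' x * v"])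
        (use assms in \<open>auto simp: has_field_derivative_def smooth_def intro!: C_k_mult C_k_const\<close>)
    then show ?thesis by (rule C_k_SucD)
  qed
qed

section \<open>Gradients, test functions and their bounds\<close>

lemma GDERIV_grad:
  assumes "GDERIV f x :> D" shows "grad f x = D"
proof -
  have "E = D" if "GDERIV f x :> E" for E
  proof -
    have "(\<lambda>h. h \<bullet> E) = (\<lambda>h. h \<bullet> D)"
      using has_derivative_unique assms that unfolding gderiv_def by blast
    then show ?thesis by (metis inner_commute vector_eq_ldot)
  qed
  with assms show ?thesis unfolding grad_def by blast
qed

lemma grad_has_derivative:
  assumes "(f has_derivative f') (at x)"
  shows "GDERIV f x :> grad f x" "f' = (\<lambda>h. h \<bullet> grad f x)"
proof -
  have l: "linear f'" using assms has_derivative_linear by blast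
  have "f' = (\<lambda>h. h \<bullet> (\<Sum>i\<in>Basis. f' i *\<^sub>R i))"
  proof
    fix h
    have "f' h = f' (\<Sum>i\<in>Basis. (h \<bullet> i) *\<^sub>R i)" by (simp add: euclidean_representation)
    also have "\<dots> = (\<Sum>i\<in>Basis. (h \<bullet> i) * f' i)"
      using l by (simp add: linear_sum linear_cmul)
    finally show "f' h = h \<bullet> (\<Sum>i\<in>Basis. f' i *\<^sub>R i)"
      by (simp add: inner_sum_right mult.commute)
  qed
  then have "GDERIV f x :> (\<Sum>i\<in>Basis. f' i *\<^sub>R i)"
    using assms unfolding gderiv_def by simp
  with GDERIV_grad show "GDERIV f x :> grad f x" by metis
  then show "f' = (\<lambda>h. h \<bullet> grad f x)"
    using assms has_derivative_unique unfolding gderiv_def by blast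
qed

lemma smooth_grad:
  assumes "smooth f"
  shows "GDERIV f x :> grad f x" "frechet_derivative f (at x) = (\<lambda>h. h \<bullet> grad f x)"
  using grad_has_derivative[OF smooth_has_derivative[OF assms]] by auto

lemma smooth_grad_continuous:
  assumes "smooth f" shows "continuous_on UNIV (grad f)"
proof -
  have "grad f = (\<lambda>x. \<Sum>i\<in>Basis. frechet_derivative f (at x) i *\<^sub>R i)"
    by (simp add: smooth_grad(2)[OF assms] inner_commute[of _ "grad f _"] euclidean_representation)
  then show ?thesis
    using smooth_continuous[OF smooth_derivative[OF assms]] by (auto intro!: continuous_intros)
qed

lemma smooth_grad_borel: "smooth f \<Longrightarrow> grad f \<in> borel_measurable borel"
  using smooth_grad_continuous borel_measurable_continuous_onI by blast

lemma grad_eq_0: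
  assumes "x \<notin> closure {x. f x \<noteq> 0}" shows "grad f x = 0"
proof -
  have z: "((\<lambda>_. 0::real) has_derivative (\<lambda>h. 0)) (at x)" by simp
  have 0: "f y = 0" if "y \<in> - closure {x. f x \<noteq> 0}" for y
    using that closure_subset[of "{x. f x \<noteq> 0}"] by auto
  have "(f has_derivative (\<lambda>h. 0)) (at x)"
    by (rule has_derivative_transform_within_open[OF z open_Compl[OF closed_closure[of "{x. f x \<noteq> 0}"]]])
      (use assms in blast, erule 0[symmetric])
  then have "GDERIV f x :> 0" by (simp add: gderiv_def)
  then show ?thesis by (rule GDERIV_grad)
qed

text \<open>Any compact set off which \<open>f\<close> vanishes may be used; the closure in the
  definition is then a closed subset of it.\<close>

lemma test_functionsI:
  assumes "smooth f" "compact K" "K \<subseteq> U" "\<And>x. x \<notin> K \<Longrightarrow> f x = 0"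
  shows "f \<in> test_functions U"
proof -
  have "closure {x. f x \<noteq> 0} \<subseteq> K"
    using assms by (intro closure_minimal compact_imp_closed) auto
  moreover from this have "compact (closure {x. f x \<noteq> 0})"
    using compact_Int_closed[OF assms(2) closed_closure, of "{x. f x \<noteq> 0}"] by (simp add: inf.absorb2)
  ultimately show ?thesis using assms(1,3)
    by (auto simp: test_functions_def smooth_def)
qed

lemma test_functionsD:
  assumes "f \<in> test_functions U"
  shows "smooth f" "compact (closure {x. f x \<noteq> 0})" "closure {x. f x \<noteq> 0} \<subseteq> U"
    "x \<notin> closure {x. f x \<noteq> 0} \<Longrightarrow> f x = 0" "x \<notin> closure {x. f x \<noteq> 0} \<Longrightarrow> grad f x = 0"
  using assms closure_subset[of "{x. f x \<noteq> 0}"] grad_eq_0[of x f]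
  by (auto simp: test_functions_def smooth_def)

lemma bounded_of_compact_support:
  fixes f :: "'a::euclidean_space \<Rightarrow> 'b::real_normed_vector"
  assumes "continuous_on UNIV f" "compact K" "\<And>x. x \<notin> K \<Longrightarrow> f x = 0"
  obtains M where "M > 0" "\<And>x. norm (f x) \<le> M"
proof -
  have "compact (f ` K)" using assms compact_continuous_image continuous_on_subset by blast
  then obtain M where "M > 0" "\<And>y. y \<in> f ` K \<Longrightarrow> norm y \<le> M"
    using compact_imp_bounded bounded_pos by metis
  with assms(3) have "norm (f x) \<le> M" for x by (cases "x \<in> K") auto
  with \<open>M > 0\<close> that show ?thesis by blast
qed

lemma test_function_bounded:
  assumes "f \<in> test_functions U"
  obtains M where "M > 0" "\<And>x. \<bar>f x\<bar> \<le> M" "\<And>x. norm (grad f x) \<le> M"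
proof -
  note t = test_functionsD[OF assms]
  obtain M1 where "M1 > 0" "\<And>x. norm (f x) \<le> M1"
    using bounded_of_compact_support[OF smooth_continuous[OF t(1)] t(2) t(4)] by blast
  moreover obtain M2 where "M2 > 0" "\<And>x. norm (grad f x) \<le> M2"
    using bounded_of_compact_support[OF smooth_grad_continuous[OF t(1)] t(2) t(5)] by blast
  ultimately show ?thesis
    by (intro that[of "max M1 M2"]) (auto simp: le_max_iff_disj)
qed

lemma test_functions_derivative:
  assumes "f \<in> test_functions U" "i \<in> Basis"
  shows "(\<lambda>x. frechet_derivative f (at x) i) \<in> test_functions U"
proof (rule test_functionsI)
  note t = test_functionsD[OF assms(1)]
  show "smooth (\<lambda>x. frechet_derivative f (at x) i)" using t(1) assms smooth_derivative by blast
  show "compact (closure {x. f x \<noteq> 0})" "closure {x. f x \<noteq> 0} \<subseteq> U" by fact+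
  show "\<And>x. x \<notin> closure {x. f x \<noteq> 0} \<Longrightarrow> frechet_derivative f (at x) i = 0"
    by (simp add: smooth_grad(2)[OF t(1)] t(5))
qed

section \<open>Cut-off functions and mollifiers\<close>

text \<open>The function \<open>exp (- 1 / x)\<close> alone is not closed under differentiation, but
  its products with polynomials in \<open>1 / x\<close> are. With the polynomial as a parameter,
  smoothness becomes an induction on the order that is general in \<open>P\<close>.\<close>

definition exp_flat :: "real poly \<Rightarrow> real \<Rightarrow> real" where
  "exp_flat P x = (if x \<le> 0 then 0 else poly P (1/x) * exp (- (1/x)))"

lemma poly_exp_tendsto_0: "((\<lambda>y. poly P y * exp (- y)) \<longlongrightarrow> 0) (at_top :: real filter)"
proof -
  have "(\<lambda>y. poly P y * exp (- y)) = (\<lambda>y. \<Sum>i\<le>degree P. coeff P i * (y ^ i / exp y))"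
    by (auto simp: poly_altdef sum_distrib_right exp_minus divide_inverse mult.assoc)
  moreover have "((\<lambda>y. \<Sum>i\<le>degree P. coeff P i * (y ^ i / exp y)) \<longlongrightarrow> (\<Sum>i\<le>degree P. coeff P i * 0)) (at_top :: real filter)"
    by (intro tendsto_intros tendsto_power_div_exp_0)
  ultimately show ?thesis by simp
qed

lemma exp_flat_tendsto_0: "((\<lambda>x. poly P (1/x) * exp (- (1/x))) \<longlongrightarrow> 0) (at_right (0::real))"
  using filterlim_compose[OF poly_exp_tendsto_0 filterlim_inverse_at_top_right] by (simp add: inverse_eq_divide)

text \<open>In the variable \<open>y = 1 / x\<close> the chain rule contributes the factor
  \<open>- y^2\<close>, and \<open>P(y) exp(- y)\<close> has derivative
  \<open>(P' - P)(y) exp(- y)\<close>. The product is \<open>(P - P') y^2\<close>, and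
  \<open>[:0,0,1:]\<close> is \<open>y^2\<close>.\<close>

lemma exp_flat_derivative:
  "(exp_flat P has_field_derivative exp_flat ((P - pderiv P) * [:0,0,1:]) x) (at x)"
proof -
  consider "x < 0" | "x = 0" | "x > 0" by linarith
  then show ?thesis
  proof cases
    case 1
    have "(exp_flat P has_field_derivative 0) (at x)"
        by (rule has_field_derivative_transform_within_open[of "\<lambda>_. 0" _ _ "{..<0}"])
        (use 1 in \<open>auto simp: exp_flat_def\<close>)
    with 1 show ?thesis by (simp add: exp_flat_def)
  next
    case 3
    have "((\<lambda>x. poly P (1/x) * exp (- (1/x))) has_field_derivative
        poly ((P - pderiv P) * [:0,0,1:]) (1/x) * exp (- (1/x))) (at x)"
      using 3 by (auto intro!: derivative_eq_intros DERIV_chain2[OF poly_DERIV] simp: field_simps power2_eq_square)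
    then have "(exp_flat P has_field_derivative poly ((P - pderiv P) * [:0,0,1:]) (1/x) * exp (- (1/x))) (at x)"
      by (rule has_field_derivative_transform_within_open[where S="{0<..}"]) (use 3 in \<open>auto simp: exp_flat_def\<close>)
    then show ?thesis using 3 by (simp add: exp_flat_def)
  next
    case 2
    \<comment> \<open>Dividing by \<open>h\<close> multiplies the polynomial by
      \<open>1 / h\<close>, that is by \<open>[:0,1:]\<close>. The difference quotient at 0 is thus
      of the same type and tends to 0.\<close>
    have "((\<lambda>h. exp_flat P h / h) \<longlongrightarrow> 0) (at_right 0)"
    proof (rule Lim_transform_eventually[OF exp_flat_tendsto_0[of "P * [:0,1:]"]])
      show "\<forall>\<^sub>F x in at_right 0. poly (P * [:0,1:]) (1/x) * exp (-(1/x)) = exp_flat P x / x"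
        by (auto simp: eventually_at_filter exp_flat_def)
    qed
    moreover have "((\<lambda>h. exp_flat P h / h) \<longlongrightarrow> 0) (at_left 0)"
      by (rule Lim_transform_eventually[OF tendsto_const]) (auto simp: eventually_at_filter exp_flat_def)
    ultimately have "((\<lambda>h. exp_flat P h / h) \<longlongrightarrow> 0) (at 0)"
      using filterlim_split_at_real by blast
    then show ?thesis using 2 by (simp add: DERIV_def exp_flat_def)
  qed
qed

lemma smooth_exp_flat: "smooth (exp_flat P)"
proof -
  have "C_k k (exp_flat P)" for k P
  proof (induct k arbitrary: P)
    case 0
    show ?case using DERIV_continuous_on[OF exp_flat_derivative] by auto
  next
    case (Suc k)
    show ?case
      by (rule C_k_SucI[OF exp_flat_derivative[unfolded has_field_derivative_def]])
        (auto intro: Suc)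
  qed
  then show ?thesis by (simp add: smooth_def)
qed

text \<open>Positive exactly on \<open>(0, 1)\<close>. The support lies on one side of 0 on purpose:
  every kernel in time built from it sees strictly positive arguments only, and this is what puts
  the two doubled times into a strict order.\<close>

definition raw_bump :: "real \<Rightarrow> real" where
  "raw_bump x = exp_flat 1 x * exp_flat 1 (1 - x)"

lemma smooth_raw_bump: "smooth raw_bump"
proof -
  have "smooth (\<lambda>x. exp_flat 1 (1 + (- x)))"
    by (rule smooth_affine) (auto intro: smooth_exp_flat bounded_linear_minus bounded_linear_ident)
  then show ?thesis unfolding raw_bump_def[abs_def] by (intro smooth_mult smooth_exp_flat) simp
qed

lemma raw_bump_nonneg: "raw_bump x \<ge> 0"
  and raw_bump_pos: "0 < x \<Longrightarrow> x < 1 \<Longrightarrow> raw_bump x > 0"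
  and raw_bump_0: "x \<le> 0 \<or> x \<ge> 1 \<Longrightarrow> raw_bump x = 0"
  by (auto simp: raw_bump_def exp_flat_def)

lemma compact_support_integrable:
  fixes f :: "'a::euclidean_space \<Rightarrow> 'b::euclidean_space"
  assumes "continuous_on UNIV f" "compact K" "\<And>x. x \<notin> K \<Longrightarrow> f x = 0"
  shows "integrable lborel f"
proof -
  have "integrable lborel (\<lambda>x. indicator K x *\<^sub>R f x)"
    using borel_integrable_compact[OF assms(2), of f] assms(1) continuous_on_subset by blast
  moreover have "(\<lambda>x. indicator K x *\<^sub>R f x) = f" using assms(3) by (auto simp: indicator_def)
  ultimately show ?thesis by simp
qed

lemma raw_bump_integrable: "integrable lborel raw_bump"
  by (rule compact_support_integrable[OF smooth_continuous[OF smooth_raw_bump], of "{0..1}"])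
    (use raw_bump_0 in \<open>auto simp: not_le\<close>)

lemma raw_bump_integral_pos: "(LINT x|lborel. raw_bump x) > 0"
proof -
  have "(LINT x|lborel. raw_bump x) \<noteq> 0"
  proof
    assume "(LINT x|lborel. raw_bump x) = 0"
    then have "AE x in lborel. raw_bump x = 0"
      using integral_nonneg_eq_0_iff_AE[OF raw_bump_integrable] raw_bump_nonneg by auto
    then have "AE x in lborel. x \<notin> {0<..<1::real}"
      by (rule AE_mp) (use raw_bump_pos in \<open>force intro!: AE_I2\<close>)
    then have "emeasure lborel {0<..<1::real} = 0"
      by (subst (asm) AE_iff_measurable[where N="{0<..<1::real}"]) auto
    moreover have "emeasure lborel {0<..<1::real} = 1" by simp
    ultimately show False by (metis zero_neq_one)
  qed
  then show ?thesis using integral_nonneg_AE[of raw_bump lborel] raw_bump_nonneg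
    by (metis AE_I2 less_eq_real_def)
qed

definition bump :: "real \<Rightarrow> real" where
  "bump x = raw_bump x / (LINT y|lborel. raw_bump y)"

lemma smooth_bump: "smooth bump"
  unfolding bump_def[abs_def] divide_inverse by (intro smooth_mult smooth_raw_bump smooth_const)

lemma bump_nonneg: "bump x \<ge> 0"
  and bump_pos: "0 < x \<Longrightarrow> x < 1 \<Longrightarrow> bump x > 0"
  and bump_0: "x \<le> 0 \<or> x \<ge> 1 \<Longrightarrow> bump x = 0"
  and bump_integrable: "integrable lborel bump"
  and bump_integral: "(LINT x|lborel. bump x) = 1"
  using raw_bump_integral_pos raw_bump_nonneg raw_bump_pos raw_bump_0 raw_bump_integrable
  by (auto simp: bump_def[abs_def])

lemma bump_borel[measurable]: "bump \<in> borel_measurable borel"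
  by (rule smooth_borel[OF smooth_bump])

text \<open>The primitive of \<open>bump\<close>, written as an average of Heaviside functions:
  \<open>indicator {..r} x\<close> is the Heaviside function of \<open>r - x\<close>. The primitives
  of the doubling argument are built on this form.\<close>

definition smooth_step :: "real \<Rightarrow> real" where
  "smooth_step r = (LINT x|lborel. bump x * indicator {..r} x)"

lemma bump_ind_integrable: "integrable lborel (\<lambda>x. bump x * indicator {..r} x)"
  by (rule Bochner_Integration.integrable_bound[OF bump_integrable]) (auto simp: indicator_def bump_nonneg)

lemma smooth_step_0: "r \<le> 0 \<Longrightarrow> smooth_step r = 0"
proof -
  assume "r \<le> 0"
  then have "(\<lambda>x. bump x * indicator {..r} x) = (\<lambda>_. 0)" by (intro ext) (auto simp: indicator_def intro: bump_0)
  then show ?thesis by (simp add: smooth_step_def)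
qed

lemma smooth_step_1: "r \<ge> 1 \<Longrightarrow> smooth_step r = 1"
proof -
  assume "r \<ge> 1"
  then have "(\<lambda>x. bump x * indicator {..r} x) = bump" by (intro ext) (auto simp: indicator_def intro: bump_0)
  then show ?thesis by (simp add: smooth_step_def bump_integral)
qed

lemma smooth_step_mono: "r \<le> s \<Longrightarrow> smooth_step r \<le> smooth_step s"
  unfolding smooth_step_def
  by (intro integral_mono bump_ind_integrable) (auto simp: indicator_def bump_nonneg)

lemma smooth_step_bounds: "0 \<le> smooth_step r" "smooth_step r \<le> 1"
  using smooth_step_mono[of "min r 0" r] smooth_step_mono[of r "max r 1"] smooth_step_0[of "min r 0"] smooth_step_1[of "max r 1"]
  by auto

lemma smooth_step_derivative: "(smooth_step has_field_derivative bump x) (at x)"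
proof -
  \<comment> \<open>A starting point to the left of both \<open>x\<close> and the support of
    \<open>bump\<close>: integrals from \<open>a\<close> agree with \<open>smooth_step\<close> in a
    neighbourhood of \<open>x\<close>, where the fundamental theorem applies.\<close>
  define a where "a = min x 0 - 1"
  have eq: "smooth_step r = integral {a..r} bump" if "r > a" for r
  proof -
    have "set_integrable lborel {a..r} bump"
      unfolding set_integrable_def
      by (rule Bochner_Integration.integrable_bound[OF bump_integrable]) (auto simp: indicator_def bump_nonneg)
    from set_borel_integral_eq_integral(2)[OF this]
    have "integral {a..r} bump = (LINT x|lborel. indicator {a..r} x *\<^sub>R bump x)"
      by (simp add: set_lebesgue_integral_def)
    also have "(\<lambda>x. indicator {a..r} x *\<^sub>R bump x) = (\<lambda>x. bump x * indicator {..r} x)"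
      by (intro ext) (auto simp: indicator_def a_def intro: bump_0)
    finally show ?thesis by (simp add: smooth_step_def)
  qed
  have c: "continuous_on {a..x+1} bump" using smooth_continuous[OF smooth_bump] continuous_on_subset by blast
  have "((\<lambda>r. integral {a..r} bump) has_field_derivative bump x) (at x within {a..x+1})"
    by (rule integral_has_real_derivative[OF c]) (auto simp: a_def)
  moreover have "at x within {a..x+1} = at x" by (rule at_within_interior) (auto simp: a_def)
  ultimately have "((\<lambda>r. integral {a..r} bump) has_field_derivative bump x) (at x)" by simp
  then show ?thesis
    by (rule has_field_derivative_transform_within_open[where S="{a<..}"]) (auto simp: a_def intro!: eq[symmetric, unfolded a_def])
qed

lemma smooth_smooth_step: "smooth smooth_step"
  by (rule smooth_realI[OF smooth_step_derivative smooth_bump])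

lemma smooth_step_borel[measurable]: "smooth_step \<in> borel_measurable borel"
  by (rule smooth_borel[OF smooth_smooth_step])

lemma bump_bounded: obtains M where "M > 0" "\<And>x. bump x \<le> M"
proof -
  have z: "bump x = 0" if "x \<notin> {0..1}" for x using that by (auto intro: bump_0)
  obtain M where "M > 0" "\<And>x. norm (bump x) \<le> M"
    using bounded_of_compact_support[OF smooth_continuous[OF smooth_bump] compact_Icc z] by blast
  then show ?thesis using that[of M] bump_nonneg by simp
qed

text \<open>The support is the cube with sides \<open>[0, r]\<close>, not a ball around 0. The cube
  lies in the ball of radius \<open>DIM('a) * r\<close> by comparison with the \<open>l^1\<close>
  norm, which is the origin of the factor \<open>DIM('a)\<close> in all later smallness
  conditions.\<close>

definition mollifier :: "real \<Rightarrow> 'a::euclidean_space \<Rightarrow> real" where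
  "mollifier r x = (\<Prod>i\<in>Basis. bump ((x \<bullet> i) / r) / r)"

lemma smooth_mollifier: "smooth (mollifier r)"
  unfolding mollifier_def[abs_def]
proof (rule smooth_prod)
  fix i :: 'a
  have "smooth (\<lambda>x. bump (0 + (inverse r * (x \<bullet> i))))"
    by (rule smooth_affine[OF _ smooth_bump])
      (intro bounded_linear_const_mult bounded_linear_inner_left)
  then have "smooth (\<lambda>x. bump ((x \<bullet> i) / r))" by (simp add: divide_inverse mult.commute)
  then show "smooth (\<lambda>x. bump ((x \<bullet> i) / r) / r)"
    unfolding divide_inverse[of "bump _"] by (intro smooth_mult smooth_const)
qed

lemma mollifier_borel[measurable]: "mollifier r \<in> borel_measurable borel"
  by (rule smooth_borel[OF smooth_mollifier])

lemma mollifier_nonneg: "r > 0 \<Longrightarrow> mollifier r x \<ge> 0"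
  by (auto simp: mollifier_def bump_nonneg intro!: prod_nonneg)

lemma mollifier_0:
  fixes x :: "'a::euclidean_space" and r :: real
  assumes "r > 0" "norm x \<ge> DIM('a) * r"
  shows "mollifier r x = 0"
proof (rule ccontr)
  assume "mollifier r x \<noteq> 0"
  then have "0 < x \<bullet> i \<and> x \<bullet> i < r" if "i \<in> Basis" for i
    using that assms(1) bump_0[of "(x \<bullet> i)/r"] by (force simp: mollifier_def not_le field_simps)
  then have "\<bar>x \<bullet> i\<bar> < r" if "i \<in> Basis" for i
    using that by fastforce
  then have "norm x < (\<Sum>i\<in>(Basis::'a set). r)"
    by (intro order.strict_trans1[OF norm_le_l1] sum_strict_mono) auto
  with assms show False by simp
qed

lemma mollifier_nn_integral:
  assumes "r > 0"
  shows "(\<integral>\<^sup>+x. ennreal (mollifier r (x::'a::euclidean_space)) \<partial>lborel) = 1"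
proof -
  have "(\<integral>\<^sup>+t. ennreal (bump (t / r) / r) \<partial>lborel) = 1"
  proof -
    have "(\<integral>\<^sup>+t. ennreal (bump (t / r) / r) \<partial>lborel) = r * (\<integral>\<^sup>+t. ennreal (bump ((0 + r * t) / r) / r) \<partial>lborel)"
      using nn_integral_real_affine[of "\<lambda>t. ennreal (bump (t / r) / r)" r 0] assms by simp
    also have "\<dots> = (\<integral>\<^sup>+t. ennreal r * ennreal (bump t / r) \<partial>lborel)"
      using assms by (subst nn_integral_cmult) auto
    also have "\<dots> = (\<integral>\<^sup>+t. ennreal (bump t) \<partial>lborel)"
      using assms by (intro nn_integral_cong) (simp add: ennreal_mult'[symmetric])
    also have "\<dots> = 1" using nn_integral_eq_integral[OF bump_integrable] bump_nonneg bump_integral by simp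
    finally show ?thesis .
  qed
  moreover have "(\<integral>\<^sup>+x. ennreal (mollifier r (x::'a)) \<partial>lborel) = (\<integral>\<^sup>+x. (\<Prod>i\<in>Basis. ennreal (bump ((x \<bullet> i) / r) / r)) \<partial>(lborel :: 'a measure))"
    using assms by (intro nn_integral_cong) (auto simp: mollifier_def prod_ennreal bump_nonneg)
  ultimately show ?thesis
    by (subst (asm) nn_integral_lborel_prod) (auto simp: bump_nonneg assms)
qed

lemma mollifier_integrable: "r > 0 \<Longrightarrow> integrable lborel (mollifier r :: 'a::euclidean_space \<Rightarrow> real)"
  by (rule integrableI_nonneg) (auto simp: mollifier_nonneg mollifier_nn_integral)

lemma mollifier_integral: "r > 0 \<Longrightarrow> (LINT x|lborel. mollifier r (x::'a::euclidean_space)) = 1"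
  by (subst integral_eq_nn_integral) (auto simp: mollifier_nonneg mollifier_nn_integral)

lemma mollifier_test:
  fixes r :: real
  assumes "r > 0" "cball x (DIM('a) * r) \<subseteq> U"
  shows "(\<lambda>y::'a::euclidean_space. mollifier r (x - y)) \<in> test_functions U"
proof (rule test_functionsI[OF _ compact_cball assms(2)])
  have "smooth (\<lambda>y. mollifier r (x + - y))"
    by (rule smooth_affine[OF _ smooth_mollifier]) (auto intro: bounded_linear_minus bounded_linear_ident)
  then show "smooth (\<lambda>y. mollifier r (x - y))" by simp
  show "mollifier r (x - y) = 0" if "y \<notin> cball x (DIM('a) * r)" for y
    using mollifier_0[OF assms(1), of "x - y"] that by (auto simp: dist_norm)
qed

text \<open>Since \<open>grad K\<close> is continuous with compact support, it is uniformly
  continuous, so the linearisation error of \<open>K\<close> is small compared with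
  \<open>norm h\<close> uniformly in the base point and can be integrated against \<open>f\<close>.
  Higher orders follow because the partial derivatives of \<open>K\<close> are again test
  functions.\<close>

lemma smooth_convolution:
  fixes f :: "'a::euclidean_space \<Rightarrow> real"
  assumes f: "integrable lborel f" and K: "K \<in> test_functions UNIV"
  shows "smooth (\<lambda>x. LINT y|lborel. f y * K (x - y))"
    and "((\<lambda>x. LINT y|lborel. f y * K (x - y)) has_derivative
          (\<lambda>h. LINT y|lborel. f y * frechet_derivative K (at (x - y)) h)) (at x)"
proof -
  have int: "integrable lborel (\<lambda>y. f y * k (x - y))"
    if k: "k \<in> borel_measurable borel" and b: "\<And>x. \<bar>k x\<bar> \<le> M" for k :: "'a \<Rightarrow> real" and M x
    by (rule Bochner_Integration.integrable_bound[OF integrable_mult_left[OF integrable_abs[OF f], of M]])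
      (use k b[of "x - _"] f in \<open>auto simp: abs_mult intro!: mult_left_mono order_trans[OF b]\<close>)
  have der: "((\<lambda>x. LINT y|lborel. f y * K (x - y)) has_derivative
          (\<lambda>h. LINT y|lborel. f y * frechet_derivative K (at (x - y)) h)) (at x)"
    if K: "K \<in> test_functions UNIV" for K x
  proof -
    note t = test_functionsD[OF K]
    obtain M where M: "M > 0" "\<And>x. \<bar>K x\<bar> \<le> M" "\<And>x. norm (grad K x) \<le> M"
      using test_function_bounded[OF K] by blast
    have Dm: "(\<lambda>x. frechet_derivative K (at x) h) \<in> borel_measurable borel" for h
      using smooth_grad_borel[OF t(1)] by (simp add: smooth_grad(2)[OF t(1)])
    have Db: "\<bar>frechet_derivative K (at x) h\<bar> \<le> norm h * M" for h x
      using M(3)[of x] Cauchy_Schwarz_ineq2[of h "grad K x"]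
      by (simp add: smooth_grad(2)[OF t(1)]) (meson mult_left_mono norm_ge_zero order_trans)
    have I1: "integrable lborel (\<lambda>y. f y * K (x - y))" for x
      by (rule int[of K M]) (use M t(1) smooth_borel in auto)
    have I2: "integrable lborel (\<lambda>y. f y * frechet_derivative K (at (x - y)) h)" for x h
      using int[OF Dm Db] .
    have uc: "uniformly_continuous_on UNIV (grad K)"
    proof -
      have "\<exists>\<delta>>0. \<forall>x y. dist y x < \<delta> \<longrightarrow> dist (grad K y) (grad K x) < e" if "e > 0" for e
      proof -
        \<comment> \<open>The closed 1-neighbourhood of the support. If two points are closer than 1
          and one of them is in the support, both lie in \<open>S\<close>; if neither is, both
          gradients vanish.\<close>
        define S where "S = {x + y |x y. x \<in> closure {x. K x \<noteq> 0} \<and> y \<in> cball (0::'a) 1}"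
        have "compact S" unfolding S_def by (rule compact_sums[OF t(2) compact_cball])
        moreover have "continuous_on S (grad K)"
          using smooth_grad_continuous[OF t(1)] continuous_on_subset by blast
        ultimately have "uniformly_continuous_on S (grad K)"
          using compact_uniformly_continuous by blast
        from this[unfolded uniformly_continuous_on_def, rule_format, OF that]
        obtain d where d: "d > 0" "\<And>x y. x \<in> S \<Longrightarrow> y \<in> S \<Longrightarrow> dist y x < d \<Longrightarrow> dist (grad K y) (grad K x) < e"
          by blast
        have S1: "y \<in> S" if "x \<in> closure {x. K x \<noteq> 0}" "dist y x \<le> 1" for x y
        proof -
          have "y = x + (y - x)" "y - x \<in> cball 0 1" using that by (auto simp: dist_norm norm_minus_commute)
          with that(1) show ?thesis unfolding S_def by blast
        qed
        have "dist (grad K y) (grad K x) < e" if xy: "dist y x < min d 1" for x y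
        proof (cases "x \<in> closure {x. K x \<noteq> 0} \<or> y \<in> closure {x. K x \<noteq> 0}")
          case True
          then have "x \<in> S \<and> y \<in> S"
            using S1[of x x] S1[of x y] S1[of y x] S1[of y y] xy by (auto simp: dist_commute)
          then show ?thesis using d xy by auto
        next
          case False
          then have "grad K x = 0" "grad K y = 0" by (blast intro: t(5))+
          then show ?thesis using \<open>e > 0\<close> by simp
        qed
        then show ?thesis using d by (intro exI[of _ "min d 1"]) auto
      qed
      then show ?thesis unfolding uniformly_continuous_on_def by blast
    qed
    \<comment> \<open>The summand 1 keeps \<open>L\<close> positive when \<open>f\<close> vanishes.
      A linearisation error of at most \<open>e / L * norm h\<close> then integrates to
      \<open>(L - 1) / L * e * norm h\<close>, which is below the required bound.\<close>
    define L where "L = (LINT y|lborel. \<bar>f y\<bar>) + 1"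
    have L: "L > 0" unfolding L_def by (smt (verit) integral_nonneg_AE AE_I2)
    show ?thesis
      unfolding has_derivative_at_alt
    proof (intro conjI allI impI)
      show "bounded_linear (\<lambda>h. LINT y|lborel. f y * frechet_derivative K (at (x - y)) h)"
      proof (intro linear_conv_bounded_linear[THEN iffD1] linearI)
        fix a b :: 'a
        show "(LINT y|lborel. f y * frechet_derivative K (at (x - y)) (a + b)) =
          (LINT y|lborel. f y * frechet_derivative K (at (x - y)) a) + (LINT y|lborel. f y * frechet_derivative K (at (x - y)) b)"
          using I2 by (subst Bochner_Integration.integral_add[symmetric]) (auto simp: smooth_grad(2)[OF t(1)] inner_add_left algebra_simps)
      next
        fix c and a :: 'a
        show "(LINT y|lborel. f y * frechet_derivative K (at (x - y)) (c *\<^sub>R a)) = c *\<^sub>R (LINT y|lborel. f y * frechet_derivative K (at (x - y)) a)"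
          by (simp add: smooth_grad(2)[OF t(1)] mult.left_commute)
      qed
      fix e :: real assume "e > 0"
      then have "e / L > 0" using L by simp
      with uc obtain d where d: "d > 0" "\<And>x y. dist y x < d \<Longrightarrow> dist (grad K y) (grad K x) < e / L"
        unfolding uniformly_continuous_on_def by (metis UNIV_I)
      have key: "\<bar>K (z + h) - K z - frechet_derivative K (at z) h\<bar> \<le> e / L * norm h" if h: "norm h < d" for z h
      proof -
        have "norm (K (z + h) - K z - frechet_derivative K (at z) ((z + h) - z)) \<le> norm ((z + h) - z) * (e / L)"
        proof (rule differentiable_bound_linearization[where S="ball z d" and f="K" and f'="\<lambda>z. frechet_derivative K (at z)"])
          show "z + t *\<^sub>R (z + h - z) \<in> ball z d" if "t \<in> {0..1}" for t
          proof -
            have "norm (t *\<^sub>R h) \<le> norm h" using that by (simp add: mult_left_le_one_le)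
            then show ?thesis using h by (simp add: dist_norm)
          qed
          show "(K has_derivative frechet_derivative K (at y)) (at y within ball z d)" if "y \<in> ball z d" for y
            using smooth_has_derivative[OF t(1)] has_derivative_at_withinI by blast
          show "onorm (frechet_derivative K (at y) - frechet_derivative K (at z)) \<le> e / L" if "y \<in> ball z d" for y
          proof (rule onorm_bound)
            show "0 \<le> e / L" using \<open>e / L > 0\<close> by simp
            fix v
            have "norm (grad K y - grad K z) \<le> e / L"
              using d(2)[of y z] that by (auto simp: dist_norm norm_minus_commute)
            then have "\<bar>v \<bullet> (grad K y - grad K z)\<bar> \<le> norm v * (e / L)"
              using Cauchy_Schwarz_ineq2[of v "grad K y - grad K z"] by (meson mult_left_mono norm_ge_zero order_trans)
            then show "norm ((frechet_derivative K (at y) - frechet_derivative K (at z)) v) \<le> e / L * norm v"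
              by (simp add: smooth_grad(2)[OF t(1)] inner_diff_right mult.commute)
          qed
        qed (use d in auto)
        then show ?thesis by (simp add: mult.commute)
      qed
      show "\<exists>d>0. \<forall>y. norm (y - x) < d \<longrightarrow> norm ((LINT ya|lborel. f ya * K (y - ya)) - (LINT y|lborel. f y * K (x - y)) -
           (LINT ya|lborel. f ya * frechet_derivative K (at (x - ya)) (y - x))) \<le> e * norm (y - x)"
      proof (intro exI[of _ d] conjI allI impI d(1))
        fix y assume y: "norm (y - x) < d"
        have "(LINT z|lborel. f z * K (y - z)) - (LINT z|lborel. f z * K (x - z)) -
            (LINT z|lborel. f z * frechet_derivative K (at (x - z)) (y - x))
          = (LINT z|lborel. f z * (K ((x - z) + (y - x)) - K (x - z) - frechet_derivative K (at (x - z)) (y - x)))"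
          using I1[of y] I1[of x] I2[of x "y - x"] by (simp add: algebra_simps)
        also have "norm \<dots> \<le> (LINT z|lborel. \<bar>f z\<bar> * (e / L * norm (y - x)))"
        proof (rule Bochner_Integration.integral_norm_bound_integral)
          show "integrable lborel (\<lambda>z. f z * (K ((x - z) + (y - x)) - K (x - z) - frechet_derivative K (at (x - z)) (y - x)))"
            using Bochner_Integration.integrable_diff[OF Bochner_Integration.integrable_diff[OF I1[of y] I1[of x]] I2[of x "y - x"]]
            by (simp add: algebra_simps)
          show "integrable lborel (\<lambda>z. \<bar>f z\<bar> * (e / L * norm (y - x)))" using f by auto
          show "norm (f z * (K ((x - z) + (y - x)) - K (x - z) - frechet_derivative K (at (x - z)) (y - x))) \<le> \<bar>f z\<bar> * (e / L * norm (y - x))" for z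
            using mult_left_mono[OF key[OF y, of "x - z"] abs_ge_zero[of "f z"]] by (simp add: abs_mult)
        qed
        also have "\<dots> = (L - 1) / L * (e * norm (y - x))" by (simp add: L_def)
        also have "\<dots> \<le> 1 * (e * norm (y - x))"
          using L \<open>e > 0\<close> by (intro mult_right_mono) auto
        finally show "norm ((LINT ya|lborel. f ya * K (y - ya)) - (LINT y|lborel. f y * K (x - y)) -
           (LINT ya|lborel. f ya * frechet_derivative K (at (x - ya)) (y - x))) \<le> e * norm (y - x)" by simp
      qed
    qed
  qed
  show "((\<lambda>x. LINT y|lborel. f y * K (x - y)) has_derivative
          (\<lambda>h. LINT y|lborel. f y * frechet_derivative K (at (x - y)) h)) (at x)"
    by (rule der[OF K])
  have "C_k k (\<lambda>x. LINT y|lborel. f y * K (x - y))" if "K \<in> test_functions UNIV" for k K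
    using that
  proof (induct k arbitrary: K)
    case 0
    have "continuous_on UNIV (\<lambda>x. LINT y|lborel. f y * K (x - y))"
      using has_derivative_continuous[OF der[OF 0]] by (simp add: continuous_on_eq_continuous_at)
    then show ?case by simp
  next
    case (Suc k)
    show ?case by (rule C_k_SucI[OF der[OF Suc(2)]]) (intro Suc(1) test_functions_derivative Suc(2))
  qed
  then show "smooth (\<lambda>x. LINT y|lborel. f y * K (x - y))" using K by (simp add: smooth_def)
qed

section \<open>Translations and mollification in Lebesgue spaces\<close>

lemma ennreal_tendsto_0_iff:
  "((f :: 'a \<Rightarrow> ennreal) \<longlongrightarrow> 0) F \<longleftrightarrow> (\<forall>e>0. eventually (\<lambda>x. f x < ennreal e) F)"
proof
  assume "(f \<longlongrightarrow> 0) F"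
  then show "\<forall>e>0. eventually (\<lambda>x. f x < ennreal e) F"
    by (auto intro: order_tendstoD)
next
  assume *: "\<forall>e>0. eventually (\<lambda>x. f x < ennreal e) F"
  show "(f \<longlongrightarrow> 0) F"
  proof (rule order_tendstoI)
    fix a :: ennreal assume "0 < a"
    then obtain e where "0 < e" "e < a" using dense by blast
    then have "e < top" using top.not_eq_extremum order.strict_trans2 by fastforce
    with \<open>0 < e\<close> obtain r where "e = ennreal r" "r > 0"
      by (metis ennreal_cases ennreal_less_zero_iff order_less_irrefl top.not_eq_extremum)
    with * \<open>e < a\<close> show "eventually (\<lambda>x. f x < a) F"
      by (auto elim!: eventually_mono)
  qed auto
qed

lemma nn_integral_translate:
  fixes f :: "'a::euclidean_space \<Rightarrow> ennreal"
  assumes [measurable]: "f \<in> borel_measurable borel"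
  shows "(\<integral>\<^sup>+x. f (x + h) \<partial>lborel) = (\<integral>\<^sup>+x. f x \<partial>lborel)"
proof -
  have "(\<integral>\<^sup>+x. f x \<partial>lborel) = (\<integral>\<^sup>+x. f x \<partial>distr lborel borel ((+) h))"
    by (simp add: lborel_distr_plus)
  also have "\<dots> = (\<integral>\<^sup>+x. f (h + x) \<partial>lborel)" by (rule nn_integral_distr) auto
  finally show ?thesis by (simp add: add.commute)
qed

text \<open>The \<open>p\<close>-th power of the norm in \<open>L^p\<close>, without the root and
  with values in \<open>ennreal\<close>, so that no integrability has to be known before it can be
  estimated. The triangle inequality survives up to the factor \<open>2 powr p\<close>, which is
  harmless in all limits.\<close>

definition Np :: "real \<Rightarrow> ('a::euclidean_space \<Rightarrow> 'b::euclidean_space) \<Rightarrow> ennreal" where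
  "Np p f = (\<integral>\<^sup>+x. ennreal (norm (f x) powr p) \<partial>lborel)"

text \<open>Going through the larger of the two norms avoids convexity of the power, so the bound
  holds for every positive exponent; only finiteness of the constant matters.\<close>

lemma norm_add_powr_le:
  assumes "p > 0"
  shows "norm (a + b :: 'b::real_normed_vector) powr p \<le> 2 powr p * (norm a powr p + norm b powr p)"
proof -
  have "norm (a + b) \<le> 2 * max (norm a) (norm b)" using norm_triangle_ineq[of a b] by linarith
  then have "norm (a + b) powr p \<le> (2 * max (norm a) (norm b)) powr p"
    using assms by (intro powr_mono2) auto
  also have "\<dots> = 2 powr p * max (norm a) (norm b) powr p" by (simp add: powr_mult)
  also have "\<dots> \<le> 2 powr p * (norm a powr p + norm b powr p)"
    by (intro mult_left_mono) (auto simp: max_def)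
  finally show ?thesis .
qed

lemma nn_integral_powr_add_le:
  assumes "p > 0" and [measurable]: "f \<in> borel_measurable M" "g \<in> borel_measurable M"
  shows "(\<integral>\<^sup>+x. ennreal (norm (f x + g x :: 'b::euclidean_space) powr p) \<partial>M) \<le>
    ennreal (2 powr p) * ((\<integral>\<^sup>+x. ennreal (norm (f x) powr p) \<partial>M) + (\<integral>\<^sup>+x. ennreal (norm (g x) powr p) \<partial>M))"
proof -
  have "(\<integral>\<^sup>+x. ennreal (norm (f x + g x) powr p) \<partial>M) \<le>
      (\<integral>\<^sup>+x. ennreal (2 powr p) * (ennreal (norm (f x) powr p) + ennreal (norm (g x) powr p)) \<partial>M)"
    using norm_add_powr_le[OF assms(1)]
    by (intro nn_integral_mono) (auto simp: ennreal_mult'[symmetric] ennreal_plus[symmetric] simp del: ennreal_plus)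
  also have "\<dots> = ennreal (2 powr p) * ((\<integral>\<^sup>+x. ennreal (norm (f x) powr p) \<partial>M) + (\<integral>\<^sup>+x. ennreal (norm (g x) powr p) \<partial>M))"
    by (simp add: nn_integral_cmult nn_integral_add)
  finally show ?thesis .
qed

lemma Np_add:
  assumes "p > 0" and "f \<in> borel_measurable borel" "g \<in> borel_measurable borel"
  shows "Np p (\<lambda>x. f x + g x) \<le> ennreal (2 powr p) * (Np p f + Np p g)"
  unfolding Np_def using nn_integral_powr_add_le[OF assms(1), of f lborel g] assms by simp

lemma Np_translate:
  assumes "f \<in> borel_measurable borel"
  shows "Np p (\<lambda>x. f (x + h)) = Np p f"
  unfolding Np_def using nn_integral_translate[of "\<lambda>x. ennreal (norm (f x) powr p)" h] assms by simp

lemma Np_uminus: "Np p (\<lambda>x. - f x) = Np p f"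
  and Np_minus_commute: "Np p (\<lambda>x. f x - g x) = Np p (\<lambda>x. g x - f x)"
  by (simp_all add: Np_def norm_minus_commute)

section \<open>Continuity of translations in Lebesgue spaces\<close>

definition translation_continuous :: "real \<Rightarrow> ('a::euclidean_space \<Rightarrow> 'b::euclidean_space) \<Rightarrow> bool" where
  "translation_continuous p f \<longleftrightarrow> ((\<lambda>h. Np p (\<lambda>x. f (x + h) - f x)) \<longlongrightarrow> 0) (nhds 0)"

text \<open>The difference \<open>f(x + h) - f(x)\<close> is split through an approximant
  \<open>s i\<close>. The two approximation errors coincide because \<open>Np\<close> is invariant
  under translations, so \<open>i\<close> can be fixed before \<open>h\<close> is made
  small.\<close>

lemma translation_continuous_approx:
  fixes f :: "'a::euclidean_space \<Rightarrow> 'b::euclidean_space"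
  assumes p: "p > 0" and f[measurable]: "f \<in> borel_measurable borel"
    and s: "\<And>i. s i \<in> borel_measurable borel" "\<And>i::nat. translation_continuous p (s i)"
    and lim: "(\<lambda>i. Np p (\<lambda>x. s i x - f x)) \<longlonglongrightarrow> 0"
  shows "translation_continuous p f"
  unfolding translation_continuous_def ennreal_tendsto_0_iff
proof (intro allI impI)
  fix e :: real assume "e > 0"
  note [measurable] = s(1)
  define C where "C = (2::real) powr p"
  have C: "C > 0" by (simp add: C_def)
  \<comment> \<open>Two uses of \<open>Np_add\<close> bound the three terms by
    \<open>C * (d + C * (d + d))\<close>; the summand 1 in the denominator makes the resulting
    inequality strict.\<close>
  define d where "d = e / (C * (1 + 2 * C) + 1)"
  have d: "d > 0" "C * (1 + 2 * C) * d < e"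
  proof -
    have K: "C * (1 + 2 * C) > 0" using C by (intro mult_pos_pos) auto
    then show "d > 0" using \<open>e > 0\<close> by (simp add: d_def)
    have "C * (1 + 2 * C) * d = (C * (1 + 2 * C)) / (C * (1 + 2 * C) + 1) * e" by (simp add: d_def)
    also have "\<dots> < 1 * e" using K \<open>e > 0\<close> by (intro mult_strict_right_mono) auto
    finally show "C * (1 + 2 * C) * d < e" by simp
  qed
  obtain i where i: "Np p (\<lambda>x. s i x - f x) < ennreal d"
    using lim d(1) unfolding ennreal_tendsto_0_iff by (meson eventually_sequentially order_refl)
  have "eventually (\<lambda>h. Np p (\<lambda>x. s i (x + h) - s i x) < ennreal d) (nhds 0)"
    using s(2)[of i] d(1) unfolding translation_continuous_def ennreal_tendsto_0_iff by blast
  then show "eventually (\<lambda>h. Np p (\<lambda>x. f (x + h) - f x) < ennreal e) (nhds 0)"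
  proof eventually_elim
    case (elim h)
    have 1: "Np p (\<lambda>x. f (x + h) - s i (x + h)) = Np p (\<lambda>x. s i x - f x)"
      using Np_translate[of "\<lambda>x. f x - s i x" p h] Np_minus_commute by simp
    have 2: "Np p (\<lambda>x. (f (x + h) - s i (x + h)) + (s i x - f x)) \<le> ennreal C * (ennreal d + ennreal d)"
      using Np_add[OF p, of "\<lambda>x. f (x + h) - s i (x + h)" "\<lambda>x. s i x - f x"] i
      unfolding C_def 1
      by (auto elim!: order_trans intro!: mult_left_mono add_mono)
    have "Np p (\<lambda>x. f (x + h) - f x) = Np p (\<lambda>x. (s i (x + h) - s i x) + ((f (x + h) - s i (x + h)) + (s i x - f x)))"
      by (simp add: Np_def)
    also have "\<dots> \<le> ennreal C * (ennreal d + ennreal C * (ennreal d + ennreal d))"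
      unfolding C_def
      by (rule order_trans[OF Np_add[OF p]])
        (use 2 elim in \<open>auto intro!: mult_left_mono add_mono simp: C_def\<close>)
    also have "\<dots> = ennreal (C * (1 + 2 * C) * d)"
      using C d(1) by (simp add: ennreal_mult'[symmetric] ennreal_plus[symmetric] algebra_simps del: ennreal_plus)
    also have "\<dots> < ennreal e" using d C by (intro ennreal_lessI) (auto simp: \<open>e > 0\<close>)
    finally show ?case .
  qed
qed

text \<open>Regularity of the measure encloses \<open>A\<close> between a closed \<open>K\<close>
  and an open \<open>U\<close> with small gaps. As \<open>A\<close> is bounded, \<open>K\<close> is
  compact, so small shifts of \<open>K\<close> stay in \<open>U\<close>. If just one of
  \<open>x\<close> and \<open>x + h\<close> is in \<open>A\<close>, then either it lies in
  \<open>A - K\<close>, or it lies in \<open>K\<close> and the other point is in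
  \<open>U - A\<close>. Two gaps at each of the two points give the factor 4 in
  \<open>d\<close>.\<close>

lemma translation_continuous_indicator_bounded:
  fixes A :: "'a::euclidean_space set" and c :: "'b::euclidean_space"
  assumes A[measurable]: "A \<in> sets borel" and "bounded A"
  shows "translation_continuous 1 (\<lambda>x. indicator A x *\<^sub>R c)"
  unfolding translation_continuous_def ennreal_tendsto_0_iff
proof (intro allI impI)
  fix e :: real assume "e > 0"
  define d where "d = e / (4 * norm c + 1)"
  have d: "d > 0" "4 * norm c * d < e"
    using \<open>e > 0\<close> by (auto simp: d_def field_simps add_pos_nonneg intro!: divide_pos_pos)
  have AL: "A \<in> sets lebesgue" using A by simp
  obtain U where U: "open U" "A \<subseteq> U" "emeasure lebesgue (U - A) < ennreal d"
    using sets_lebesgue_outer_open[OF AL d(1)] by metis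
  obtain K where K: "closed K" "K \<subseteq> A" "emeasure lebesgue (A - K) < ennreal d"
    using sets_lebesgue_inner_closed[OF AL d(1)] by metis
  have [measurable]: "K \<in> sets borel" "U \<in> sets borel" using K(1) U(1) by simp_all
  have "compact K" using K \<open>bounded A\<close> bounded_subset compact_eq_bounded_closed by blast
  then obtain r where r: "r > 0" "(\<Union>x\<in>K. cball x r) \<subseteq> U"
    using compact_subset_open_imp_cball_epsilon_subset[of K U] U K by blast
  have mU: "(\<integral>\<^sup>+x. indicator (U - A) x \<partial>lborel) < ennreal d" and mK: "(\<integral>\<^sup>+x. indicator (A - K) x \<partial>lborel) < ennreal d"
    using U(3) K(3) by auto
  have "Np 1 (\<lambda>x. indicator A (x + h) *\<^sub>R c - indicator A x *\<^sub>R c) < ennreal e" if h: "dist h 0 < r" for h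
  proof -
    have h1: "x + h \<in> U" "x - h \<in> U" if "x \<in> K" for x
    proof -
      have "x + h \<in> cball x r" "x - h \<in> cball x r" using h by (simp_all add: dist_norm)
      then show "x + h \<in> U" "x - h \<in> U" using r(2) that by blast+
    qed
    have "Np 1 (\<lambda>x. indicator A (x + h) *\<^sub>R c - indicator A x *\<^sub>R c) \<le>
       (\<integral>\<^sup>+x. ennreal (norm c) * (indicator (A - K) x + indicator (U - A) (x + h) + (indicator (A - K) (x + h) + indicator (U - A) x)) \<partial>lborel)"
      unfolding Np_def
    proof (rule nn_integral_mono)
      fix x
      show "ennreal (norm (indicator A (x + h) *\<^sub>R c - indicator A x *\<^sub>R c) powr 1) \<le>
         ennreal (norm c) * (indicator (A - K) x + indicator (U - A) (x + h) + (indicator (A - K) (x + h) + indicator (U - A) x))"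
      proof (cases "x \<in> A \<longleftrightarrow> x + h \<in> A")
        case True then show ?thesis by (auto simp: indicator_def)
      next
        case False
        have "1 \<le> indicator (A - K) x + indicator (U - A) (x + h) + (indicator (A - K) (x + h) + indicator (U - A) x :: ennreal)"
          using False h1[of x] h1(2)[of "x + h"] K(2) by (auto simp: indicator_def)
        then have "ennreal (norm c) * 1 \<le> ennreal (norm c) * (indicator (A - K) x + indicator (U - A) (x + h) + (indicator (A - K) (x + h) + indicator (U - A) x))"
          by (rule mult_left_mono) simp
        moreover have "norm (indicator A (x + h) *\<^sub>R c - indicator A x *\<^sub>R c) = norm c"
          using False by (auto simp: indicator_def)
        ultimately show ?thesis by simp
      qed
    qed
    also have "\<dots> = ennreal (norm c) * ((\<integral>\<^sup>+x. indicator (A - K) x \<partial>lborel) + (\<integral>\<^sup>+x. indicator (U - A) x \<partial>lborel) + ((\<integral>\<^sup>+x. indicator (A - K) x \<partial>lborel) + (\<integral>\<^sup>+x. indicator (U - A) x \<partial>lborel)))"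
      using nn_integral_translate[of "indicator (U - A)" h] nn_integral_translate[of "indicator (A - K)" h]
      by (simp add: nn_integral_cmult nn_integral_add)
    also have "\<dots> \<le> ennreal (norm c) * (ennreal d + ennreal d + (ennreal d + ennreal d))"
      using mU mK by (intro mult_left_mono add_mono) auto
    also have "\<dots> = ennreal (4 * norm c * d)"
      using d(1) by (simp add: ennreal_mult'[symmetric] ennreal_plus[symmetric] algebra_simps del: ennreal_plus)
    also have "\<dots> < ennreal e" using d by (intro ennreal_lessI \<open>e > 0\<close>)
    finally show ?thesis .
  qed
  then show "eventually (\<lambda>h. Np 1 (\<lambda>x. indicator A (x + h) *\<^sub>R c - indicator A x *\<^sub>R c) < ennreal e) (nhds 0)"
    using r(1) unfolding eventually_nhds_metric by blast
qed

lemma Np_tendsto_0_dominated: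
  fixes s :: "nat \<Rightarrow> 'a::euclidean_space \<Rightarrow> 'b::euclidean_space"
  assumes p: "p > 0" and [measurable]: "\<And>i. s i \<in> borel_measurable borel" "g \<in> borel_measurable borel"
    and lim: "AE x in lborel. (\<lambda>i. s i x) \<longlonglongrightarrow> 0"
    and le: "\<And>i. AE x in lborel. norm (s i x) \<le> g x" and fin: "Np p g < \<infinity>"
  shows "(\<lambda>i. Np p (s i)) \<longlonglongrightarrow> 0"
proof -
  have "(\<lambda>i. \<integral>\<^sup>+x. ennreal (norm (s i x) powr p) \<partial>lborel) \<longlonglongrightarrow> (\<integral>\<^sup>+x. 0 \<partial>(lborel::'a measure))"
  proof (rule nn_integral_dominated_convergence[where w="\<lambda>x. ennreal (norm (g x) powr p)"])
    show "AE x in lborel. ennreal (norm (s i x) powr p) \<le> ennreal (norm (g x) powr p)" for i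
      using le[of i]
    proof eventually_elim
      case (elim x)
      then have "norm (s i x) \<le> norm (g x)" by simp
      then show ?case using p by (intro ennreal_leI powr_mono2) auto
    qed
    show "AE x in lborel. (\<lambda>i. ennreal (norm (s i x) powr p)) \<longlonglongrightarrow> 0"
      using lim
    proof eventually_elim
      case (elim x)
      have "(\<lambda>i. norm (s i x) powr p) \<longlonglongrightarrow> 0 powr p"
        using tendsto_norm[OF elim] p by (intro tendsto_powr') auto
      then show ?case using tendsto_ennrealI by fastforce
    qed
    show "(\<integral>\<^sup>+x. ennreal (norm (g x) powr p) \<partial>lborel) < \<infinity>" using fin by (simp add: Np_def)
  qed auto
  then show ?thesis by (simp add: Np_def)
qed

lemma Np_1: "integrable lborel f \<Longrightarrow> Np 1 f < \<infinity>"
  by (simp add: Np_def integrable_iff_bounded)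

text \<open>Density argument over simple functions. The sets in the base case have finite measure
  but may be unbounded, so they are first exhausted by their intersections with balls.\<close>

lemma translation_continuous_L1:
  fixes f :: "'a::euclidean_space \<Rightarrow> 'b::euclidean_space"
  assumes "integrable lborel f"
  shows "translation_continuous 1 f"
  using assms
proof (induct rule: integrable_induct)
  case (base A c)
  have [measurable]: "A \<in> sets borel" using base by simp
  show ?case
  proof (rule translation_continuous_approx)
    show "translation_continuous 1 (\<lambda>x. indicator (A \<inter> cball 0 (real i)) x *\<^sub>R c)" for i
      by (rule translation_continuous_indicator_bounded) auto
    show "(\<lambda>x. indicator (A \<inter> cball 0 (real i)) x *\<^sub>R c) \<in> borel_measurable borel" for i
    proof -
      have [measurable]: "cball (0::'a) (real i) \<in> sets borel" by auto
      show ?thesis by measurable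
    qed
    show "(\<lambda>i. Np 1 (\<lambda>x. indicator (A \<inter> cball 0 (real i)) x *\<^sub>R c - indicator A x *\<^sub>R c)) \<longlonglongrightarrow> 0"
    proof (rule Np_tendsto_0_dominated[where g="\<lambda>x. indicator A x *\<^sub>R norm c"])
      show "AE x in lborel. (\<lambda>i. indicator (A \<inter> cball 0 (real i)) x *\<^sub>R c - indicator A x *\<^sub>R c) \<longlonglongrightarrow> 0"
      proof (rule AE_I2)
        fix x :: 'a
        obtain n where "norm x \<le> real n" using real_arch_simple by blast
        then have "\<forall>i\<ge>n. indicator (A \<inter> cball 0 (real i)) x *\<^sub>R c - indicator A x *\<^sub>R c = 0"
          by (auto simp: indicator_def)
        then show "(\<lambda>i. indicator (A \<inter> cball 0 (real i)) x *\<^sub>R c - indicator A x *\<^sub>R c) \<longlonglongrightarrow> 0"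
          by (intro tendsto_eventually) (auto simp: eventually_sequentially)
      qed
      have "integrable lborel (\<lambda>x. indicator A x *\<^sub>R norm c)"
        using base by (intro integrable_scaleR_left) (auto simp: less_top)
      then show "Np 1 (\<lambda>x. indicator A x *\<^sub>R norm c) < \<infinity>" by (rule Np_1)
    qed (auto simp: indicator_def)
  qed auto
next
  case (add f g)
  have [measurable]: "f \<in> borel_measurable borel" "g \<in> borel_measurable borel" using add by auto
  show ?case
    unfolding translation_continuous_def
  proof (rule tendsto_sandwich[OF _ _ tendsto_const])
    show "((\<lambda>h. ennreal (2 powr 1) * (Np 1 (\<lambda>x. f (x + h) - f x) + Np 1 (\<lambda>x. g (x + h) - g x))) \<longlongrightarrow> 0) (nhds 0)"
      using add(2,4) unfolding translation_continuous_def
      by (auto intro!: tendsto_eq_intros ennreal_tendsto_cmult)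
    show "\<forall>\<^sub>F h in nhds 0. Np 1 (\<lambda>x. f (x + h) + g (x + h) - (f x + g x)) \<le>
        ennreal (2 powr 1) * (Np 1 (\<lambda>x. f (x + h) - f x) + Np 1 (\<lambda>x. g (x + h) - g x))"
      using Np_add[of 1 "\<lambda>x. f (x + _) - f x" "\<lambda>x. g (x + _) - g x"]
      by (intro always_eventually allI) (simp add: add_diff_add)
  qed auto
next
  case (lim f s)
  have [measurable]: "f \<in> borel_measurable borel" "\<And>i. s i \<in> borel_measurable borel" using lim by auto
  show ?case
  proof (rule translation_continuous_approx[OF _ _ _ lim(2)])
    show "(\<lambda>i. Np 1 (\<lambda>x. s i x - f x)) \<longlonglongrightarrow> 0"
    proof (rule Np_tendsto_0_dominated[where g="\<lambda>x. 3 * norm (f x)"])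
      show "AE x in lborel. (\<lambda>i. s i x - f x) \<longlonglongrightarrow> 0"
        using lim(3) by (intro AE_I2 LIM_zero) auto
      show "AE x in lborel. norm (s i x - f x) \<le> 3 * norm (f x)" for i
        using lim(4)[of _ i] norm_triangle_ineq4[of "s i _" "f _"] by (auto intro!: AE_I2) (smt (verit) )
      have "integrable lborel (\<lambda>x. 3 * norm (f x))" using lim by auto
      then show "Np 1 (\<lambda>x. 3 * norm (f x)) < \<infinity>" by (rule Np_1)
    qed auto
  qed auto
qed

text \<open>Cutting \<open>f\<close> to \<open>1 / (n + 1) \<le> norm (f x) \<le> n + 1\<close>
  serves two purposes. The lower bound puts the cut function into \<open>L^1\<close>; the upper
  bound makes its differences \<open>w\<close> satisfy
  \<open>w powr p \<le> (2 * (n + 1)) powr (p - 1) * w\<close>, so that continuity in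
  \<open>L^1\<close> carries over to exponent \<open>p\<close>.\<close>

lemma translation_continuous_Lp:
  fixes f :: "'a::euclidean_space \<Rightarrow> 'b::euclidean_space"
  assumes p: "p \<ge> 1" and f[measurable]: "f \<in> borel_measurable borel" and fin: "Np p f < \<infinity>"
  shows "translation_continuous p f"
proof -
  define A where "A n = {x. 1 / Suc n \<le> norm (f x) \<and> norm (f x) \<le> Suc n}" for n
  have [measurable]: "A n \<in> sets borel" for n unfolding A_def by measurable
  let ?s = "\<lambda>n x. indicator (A n) x *\<^sub>R f x"
  show ?thesis
  proof (rule translation_continuous_approx[where s="?s"])
    show "(\<lambda>i. Np p (\<lambda>x. ?s i x - f x)) \<longlonglongrightarrow> 0"
    proof (rule Np_tendsto_0_dominated[where g="\<lambda>x. norm (f x)"])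
      show "AE x in lborel. (\<lambda>i. ?s i x - f x) \<longlonglongrightarrow> 0"
      proof (rule AE_I2)
        fix x
        show "(\<lambda>i. ?s i x - f x) \<longlonglongrightarrow> 0"
        proof (cases "f x = 0")
          case False
          obtain n where n: "max (1 / norm (f x)) (norm (f x)) \<le> real n" using real_arch_simple by blast
          have "?s i x - f x = 0" if "i \<ge> n" for i
          proof -
            have i: "1 / norm (f x) \<le> real (Suc i)" "norm (f x) \<le> real (Suc i)" using n that by auto
            have "norm (f x) > 0" using False by simp
            then have "1 / real (Suc i) \<le> norm (f x)" using i(1) by (simp add: field_simps)
            with i have "x \<in> A i" by (simp add: A_def)
            then show ?thesis by simp
          qed
          then show ?thesis by (intro tendsto_eventually) (auto simp: eventually_sequentially)
        qed simp
      qed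
      show "Np p (\<lambda>x. norm (f x)) < \<infinity>" using fin by (simp add: Np_def)
    qed (use p in \<open>auto simp: indicator_def\<close>)
    fix n
    show [measurable]: "?s n \<in> borel_measurable borel" by measurable
    have "integrable lborel (?s n)"
    proof (rule integrableI_bounded)
      have "(\<integral>\<^sup>+x. ennreal (norm (?s n x)) \<partial>lborel) \<le> (\<integral>\<^sup>+x. ennreal (Suc n powr (p - 1)) * ennreal (norm (f x) powr p) \<partial>lborel)"
      proof (rule nn_integral_mono)
        fix x
        show "ennreal (norm (?s n x)) \<le> ennreal (Suc n powr (p - 1)) * ennreal (norm (f x) powr p)"
        proof (cases "x \<in> A n")
          case True
          then have "1 / Suc n \<le> norm (f x)" by (simp add: A_def)
          then have pos: "norm (f x) > 0" and "1 \<le> norm (f x) * Suc n"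
            by (auto simp: field_simps intro: less_le_trans[of 0 "1 / Suc n"])
          then have "1 \<le> (norm (f x) * Suc n) powr (p - 1)" using p by (simp add: ge_one_powr_ge_zero)
          then have "norm (f x) * 1 \<le> norm (f x) * (norm (f x) * Suc n) powr (p - 1)"
            by (rule mult_left_mono) simp
          also have "\<dots> = norm (f x) powr (1 + (p - 1)) * Suc n powr (p - 1)"
            using pos by (subst powr_add) (simp add: powr_mult)
          finally have "norm (f x) \<le> Suc n powr (p - 1) * norm (f x) powr p" by (simp add: mult.commute)
          then show ?thesis by (simp add: True ennreal_mult'[symmetric])
        qed simp
      qed
      also have "\<dots> < \<infinity>" using fin by (simp add: nn_integral_cmult Np_def ennreal_mult_less_top)
      finally show "(\<integral>\<^sup>+x. ennreal (norm (?s n x)) \<partial>lborel) < \<infinity>" .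
    qed simp
    then have L1: "((\<lambda>h. Np 1 (\<lambda>x. ?s n (x + h) - ?s n x)) \<longlongrightarrow> 0) (nhds 0)"
      using translation_continuous_L1 unfolding translation_continuous_def by blast
    show "translation_continuous p (?s n)"
      unfolding translation_continuous_def
    proof (rule tendsto_sandwich[OF _ _ tendsto_const])
      show "((\<lambda>h. ennreal ((2 * Suc n) powr (p - 1)) * Np 1 (\<lambda>x. ?s n (x + h) - ?s n x)) \<longlongrightarrow> 0) (nhds 0)"
        using ennreal_tendsto_cmult[OF _ L1, of "ennreal ((2 * Suc n) powr (p - 1))"] by simp
      have "Np p (\<lambda>x. ?s n (x + h) - ?s n x) \<le> ennreal ((2 * Suc n) powr (p - 1)) * Np 1 (\<lambda>x. ?s n (x + h) - ?s n x)" for h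
      proof -
        have "Np p (\<lambda>x. ?s n (x + h) - ?s n x) \<le> (\<integral>\<^sup>+x. ennreal ((2 * Suc n) powr (p - 1)) * ennreal (norm (?s n (x + h) - ?s n x) powr 1) \<partial>lborel)"
          unfolding Np_def
        proof (rule nn_integral_mono)
          fix x
          have b: "norm (?s n x) \<le> Suc n" for x by (auto simp: indicator_def A_def)
          define w where "w = norm (?s n (x + h) - ?s n x)"
          have w: "0 \<le> w" "w \<le> 2 * Suc n" unfolding w_def using norm_triangle_ineq4[of "?s n (x+h)" "?s n x"] b[of x] b[of "x+h"] by auto
          have "w powr p \<le> (2 * Suc n) powr (p - 1) * w"
          proof (cases "w = 0")
            case False
            then have "w powr p = w powr (p - 1) * w" using w by (simp add: powr_diff)
            also have "\<dots> \<le> (2 * Suc n) powr (p - 1) * w"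
              using w p by (intro mult_right_mono powr_mono2) auto
            finally show ?thesis .
          qed simp
          then show "ennreal (norm (?s n (x + h) - ?s n x) powr p) \<le> ennreal ((2 * Suc n) powr (p - 1)) * ennreal (norm (?s n (x + h) - ?s n x) powr 1)"
            unfolding w_def[symmetric] using w by (simp add: ennreal_mult'[symmetric] ennreal_leI)
        qed
        then show ?thesis by (simp add: nn_integral_cmult Np_def)
      qed
      then show "\<forall>\<^sub>F h in nhds 0. Np p (\<lambda>x. ?s n (x + h) - ?s n x) \<le> ennreal ((2 * Suc n) powr (p - 1)) * Np 1 (\<lambda>x. ?s n (x + h) - ?s n x)"
        by simp
    qed auto
  qed (use p in auto)
qed

text \<open>Young's inequality for \<open>c * a\<close> and \<open>b / c\<close>, with the factors
  \<open>1 / q\<close> and \<open>1 / p\<close> dropped. With the free scale \<open>c\<close> it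
  takes the place of Hoelder's inequality, and no norms have to be divided by.\<close>

lemma scaled_Young:
  fixes p c a b :: real
  assumes "p > 1" "c > 0" "a \<ge> 0" "b \<ge> 0"
  shows "a * b \<le> c powr (p / (p - 1)) * a powr (p / (p - 1)) + c powr (- p) * b powr p"
proof -
  define q where "q = p / (p - 1)"
  have "p - 1 > 0" "p > 0" using assms(1) by auto
  then have q: "q > 1" "1 / q + 1 / p = 1"
    by (simp_all add: q_def pos_less_divide_eq diff_divide_distrib)
  have "a * b = (c * a) * (b / c)" using assms by simp
  also have "\<dots> \<le> (c * a) powr q / q + (b / c) powr p / p"
    by (rule Youngs_inequality[of q p]) (use assms q in auto)
  also have "\<dots> \<le> (c * a) powr q + (b / c) powr p"
    using q assms by (intro add_mono) (auto simp: divide_le_eq mult_le_cancel_left1)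
  also have "\<dots> = c powr q * a powr q + c powr (- p) * b powr p"
    using assms by (simp add: powr_mult powr_divide powr_minus field_simps)
  finally show ?thesis by (simp add: q_def)
qed

lemma nn_integral_scaled_Young:
  fixes F :: "'a \<Rightarrow> 'b::euclidean_space" and G :: "'a \<Rightarrow> 'c::euclidean_space"
  assumes "p > 1" "c > 0" and [measurable]: "F \<in> borel_measurable M" "G \<in> borel_measurable M"
  shows "(\<integral>\<^sup>+x. ennreal (norm (F x) * norm (G x)) \<partial>M) \<le>
    ennreal (c powr (p / (p - 1))) * (\<integral>\<^sup>+x. ennreal (norm (F x) powr (p / (p - 1))) \<partial>M) +
    ennreal (c powr (- p)) * (\<integral>\<^sup>+x. ennreal (norm (G x) powr p) \<partial>M)"
proof -
  have "(\<integral>\<^sup>+x. ennreal (norm (F x) * norm (G x)) \<partial>M) \<le>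
    (\<integral>\<^sup>+x. ennreal (c powr (p / (p - 1))) * ennreal (norm (F x) powr (p / (p - 1))) + ennreal (c powr (- p)) * ennreal (norm (G x) powr p) \<partial>M)"
    using scaled_Young[OF assms(1,2)]
    by (intro nn_integral_mono) (auto simp: ennreal_mult'[symmetric] ennreal_plus[symmetric] simp del: ennreal_plus)
  then show ?thesis by (simp add: nn_integral_cmult nn_integral_add)
qed

text \<open>First \<open>c\<close> is chosen so small that the \<open>A\<close> term is at most
  \<open>e / 2\<close> for all indices; only afterwards is the smallness of \<open>B i\<close> used,
  against the now fixed factor \<open>c powr (- p)\<close>. The denominator contains
  \<open>a + 1\<close> so that \<open>A = 0\<close> needs no separate treatment.\<close>

lemma tendsto_0_scaled:
  fixes X B :: "'i \<Rightarrow> ennreal"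
  assumes "q > 0" "A < \<infinity>" "(B \<longlongrightarrow> 0) F"
    and le: "\<And>c. c > 0 \<Longrightarrow> eventually (\<lambda>i. X i \<le> ennreal (c powr q) * A + ennreal (c powr (- p)) * B i) F"
  shows "(X \<longlongrightarrow> 0) F"
  unfolding ennreal_tendsto_0_iff
proof (intro allI impI)
  fix e :: real assume "e > 0"
  obtain a where a: "A = ennreal a" "a \<ge> 0" using assms(2) by (cases A) auto
  define c where "c = (e / (2 * (a + 1))) powr (1 / q)"
  have c: "c > 0" "c powr q = e / (2 * (a + 1))"
    using \<open>e > 0\<close> a assms(1) by (auto simp: c_def powr_powr)
  have "c powr q * a = (e / 2) * (a / (a + 1))" by (simp add: c(2))
  also have "\<dots> \<le> (e / 2) * 1"
    using a \<open>e > 0\<close> by (intro mult_left_mono) (auto simp: divide_le_eq)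
  finally have ca: "c powr q * a \<le> e / 2" by simp
  have "e / (2 * c powr (- p)) > 0" using \<open>e > 0\<close> c by simp
  then have "eventually (\<lambda>i. B i < ennreal (e / (2 * c powr (- p)))) F"
    using assms(3) unfolding ennreal_tendsto_0_iff by blast
  with le[OF c(1)] show "eventually (\<lambda>i. X i < ennreal e) F"
  proof eventually_elim
    case (elim i)
    obtain b where b: "B i = ennreal b" "b \<ge> 0" using elim(2) by (cases "B i") auto
    have "b < e / (2 * c powr (- p))" using elim(2) b by (simp add: ennreal_less_iff)
    then have "c powr (- p) * b < e / 2" using c by (simp add: field_simps powr_minus)
    with ca have *: "c powr q * a + c powr (- p) * b < e" by simp
    have "X i \<le> ennreal (c powr q * a + c powr (- p) * b)"
      using elim(1) a b by (simp add: ennreal_mult')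
    also have "\<dots> < ennreal e" using * \<open>e > 0\<close> by (intro ennreal_lessI)
    finally show ?case .
  qed
qed

lemma Holder_tendsto_0:
  fixes F :: "'a \<Rightarrow> 'b::euclidean_space" and G :: "'i \<Rightarrow> 'a \<Rightarrow> 'c::euclidean_space"
  assumes p: "p > 1" and [measurable]: "F \<in> borel_measurable M" "\<And>i. G i \<in> borel_measurable M"
    and F: "(\<integral>\<^sup>+x. ennreal (norm (F x) powr (p / (p - 1))) \<partial>M) < \<infinity>"
    and G: "((\<lambda>i. \<integral>\<^sup>+x. ennreal (norm (G i x) powr p) \<partial>M) \<longlongrightarrow> 0) L"
  shows "((\<lambda>i. \<integral>\<^sup>+x. ennreal (norm (F x) * norm (G i x)) \<partial>M) \<longlongrightarrow> 0) L"
  by (rule tendsto_0_scaled[OF _ F G]) (use p in \<open>auto intro!: always_eventually nn_integral_scaled_Young\<close>)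

section \<open>Mollification\<close>

lemma lborel_distr_reflect:
  fixes x :: "'a::euclidean_space"
  shows "distr lborel borel (\<lambda>y. x - y) = lborel"
  using lborel_affine[of "-1" x] by (simp add: density_1)

lemma lborel_integral_reflect:
  fixes f :: "'a::euclidean_space \<Rightarrow> 'b::euclidean_space"
  assumes [measurable]: "f \<in> borel_measurable borel"
  shows "(LINT y|lborel. f (x - y)) = (LINT y|lborel. f y)"
proof -
  have "(LINT y|lborel. f y) = (LINT y|distr lborel borel (\<lambda>y. x - y). f y)"
    by (simp add: lborel_distr_reflect)
  then show ?thesis by (simp add: integral_distr)
qed

lemma integrable_lborel_reflect:
  fixes f :: "'a::euclidean_space \<Rightarrow> 'b::euclidean_space"
  assumes "integrable lborel f"
  shows "integrable lborel (\<lambda>y. f (x - y))"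
proof -
  have "integrable (distr lborel borel (\<lambda>y. x - y)) f" using assms by (simp add: lborel_distr_reflect)
  then show ?thesis by (rule integrable_distr[rotated]) simp
qed

text \<open>The tangent inequality for \<open>t powr p\<close> at the mean \<open>m\<close>, in the
  form of Young's inequality for \<open>m powr (p - 1) * g y\<close>. Integrating it against the
  density \<open>\<eta>\<close> gives \<open>m powr p * (1 - 1 / q)\<close> on the left, and
  \<open>1 - 1 / q = 1 / p\<close>.\<close>

lemma Jensen_powr:
  fixes \<eta> g :: "'a::euclidean_space \<Rightarrow> real"
  assumes p: "p \<ge> 1" and [measurable]: "\<eta> \<in> borel_measurable borel" "g \<in> borel_measurable borel"
    and \<eta>: "\<And>y. \<eta> y \<ge> 0" "(LINT y|lborel. \<eta> y) = 1" "integrable lborel \<eta>"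
    and g: "\<And>y. g y \<ge> 0" "integrable lborel (\<lambda>y. \<eta> y * g y)"
  shows "ennreal ((LINT y|lborel. \<eta> y * g y) powr p) \<le> (\<integral>\<^sup>+y. ennreal (\<eta> y * g y powr p) \<partial>lborel)"
proof (cases "(\<integral>\<^sup>+y. ennreal (\<eta> y * g y powr p) \<partial>lborel) = \<infinity>")
  case False
  define m where "m = (LINT y|lborel. \<eta> y * g y)"
  have m: "m \<ge> 0" unfolding m_def using \<eta> g by (intro integral_nonneg_AE) auto
  have int: "integrable lborel (\<lambda>y. \<eta> y * g y powr p)"
    by (rule integrableI_nonneg) (use \<eta> g False in \<open>auto simp: less_top[symmetric]\<close>)
  have nn: "(\<integral>\<^sup>+y. ennreal (\<eta> y * g y powr p) \<partial>lborel) = ennreal (LINT y|lborel. \<eta> y * g y powr p)"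
    by (rule nn_integral_eq_integral[OF int]) (use \<eta> in auto)
  have "m powr p \<le> (LINT y|lborel. \<eta> y * g y powr p)"
  proof (cases "p = 1")
    case True
    then show ?thesis using m g by (simp add: m_def)
  next
    case False
    with p have p1: "p > 1" by simp
    define q where "q = p / (p - 1)"
    have "p - 1 > 0" "p > 0" using p1 by auto
    then have q: "q > 1" "1 / q + 1 / p = 1" "(p - 1) * q = p"
      by (simp_all add: q_def pos_less_divide_eq diff_divide_distrib)
    have pw: "m powr (p - 1) * m = m powr p"
      using m p1 by (cases "m = 0") (simp_all add: powr_diff)
    have "m powr (p - 1) * g y \<le> m powr p / q + g y powr p / p" for y
      using Youngs_inequality[of q p "m powr (p - 1)" "g y"] q p1 g m by (simp add: powr_powr)
    then have "\<eta> y * (m powr (p - 1) * g y) \<le> \<eta> y * (m powr p / q + g y powr p / p)" for y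
      using \<eta>(1) by (rule mult_left_mono)
    then have le: "m powr (p - 1) * (\<eta> y * g y) \<le> (m powr p / q) * \<eta> y + (1 / p) * (\<eta> y * g y powr p)" for y
      by (simp add: algebra_simps)
    have "m powr (p - 1) * m = (LINT y|lborel. m powr (p - 1) * (\<eta> y * g y))"
      by (simp add: m_def)
    also have "\<dots> \<le> (LINT y|lborel. (m powr p / q) * \<eta> y + (1 / p) * (\<eta> y * g y powr p))"
      by (rule integral_mono[OF _ _ le]) (use int \<eta> g in auto)
    also have "\<dots> = (m powr p / q) + (1 / p) * (LINT y|lborel. \<eta> y * g y powr p)"
      using int \<eta> by (subst Bochner_Integration.integral_add) auto
    finally have "m powr p * (1 - 1 / q) \<le> (1 / p) * (LINT y|lborel. \<eta> y * g y powr p)"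
      unfolding pw by (simp add: algebra_simps)
    then have "m powr p * (1 / p) \<le> (LINT y|lborel. \<eta> y * g y powr p) * (1 / p)"
      using q(2) by (metis add_diff_cancel_left' mult.commute)
    then show ?thesis using p1 by (simp add: divide_le_cancel)
  qed
  then show ?thesis unfolding nn m_def by (rule ennreal_leI)
qed simp

definition mollify :: "real \<Rightarrow> ('a::euclidean_space \<Rightarrow> 'b::euclidean_space) \<Rightarrow> 'a \<Rightarrow> 'b" where
  "mollify r f x = (LINT y|lborel. mollifier r y *\<^sub>R f (x - y))"

lemma mollifier_bounded:
  fixes r :: real
  assumes "r > 0"
  obtains M where "M > 0" "\<And>x::'a::euclidean_space. mollifier r x \<le> M"
proof -
  have z: "mollifier r x = 0" if "x \<notin> cball 0 (real DIM('a) * r)" for x :: 'a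
    using that by (intro mollifier_0 assms) auto
  obtain M where "M > 0" "\<And>x::'a. norm (mollifier r x) \<le> M"
    using bounded_of_compact_support[OF smooth_continuous[OF smooth_mollifier] compact_cball z] by blast
  then show ?thesis by (intro that[of M]) (auto simp: abs_le_iff)
qed

lemma mollifier_integrable_mult:
  fixes f :: "'a::euclidean_space \<Rightarrow> 'b::euclidean_space"
  assumes "r > 0" "integrable lborel f"
  shows "integrable lborel (\<lambda>y. mollifier r y *\<^sub>R f (x - y))"
proof -
  obtain M where M: "M > 0" "\<And>x::'a. mollifier r x \<le> M" using mollifier_bounded[OF assms(1)] by blast
  have [measurable]: "f \<in> borel_measurable borel" using assms(2) by auto
  have "integrable lborel (\<lambda>y. M * norm (f (x - y)))"
    using integrable_lborel_reflect[OF assms(2)] by auto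
  then show ?thesis
    by (rule Bochner_Integration.integrable_bound)
      (use M mollifier_nonneg[OF assms(1), where 'a='a] in \<open>auto intro!: AE_I2 mult_right_mono simp: abs_of_nonneg\<close>)
qed

lemma mollify_alt:
  fixes f :: "'a::euclidean_space \<Rightarrow> 'b::euclidean_space"
  assumes [measurable]: "f \<in> borel_measurable borel"
  shows "mollify r f x = (LINT y|lborel. mollifier r (x - y) *\<^sub>R f y)"
  unfolding mollify_def using lborel_integral_reflect[of "\<lambda>y. mollifier r (x - y) *\<^sub>R f y" x] by simp

text \<open>The mollification error is an average of translation errors. Jensen's inequality moves
  the power inside the average and Tonelli exchanges the integrals; only shifts in the support of
  the mollifier contribute.\<close>

lemma Np_mollify:
  fixes f :: "'a::euclidean_space \<Rightarrow> 'b::euclidean_space"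
  assumes p: "p \<ge> 1" and r: "r > 0" and f: "integrable lborel f"
    and e: "\<And>y. norm y \<le> real DIM('a) * r \<Longrightarrow> Np p (\<lambda>x. f (x - y) - f x) \<le> e"
  shows "Np p (\<lambda>x. mollify r f x - f x) \<le> e"
proof -
  have [measurable]: "f \<in> borel_measurable borel" using f by auto
  have pt: "ennreal (norm (mollify r f x - f x) powr p) \<le> (\<integral>\<^sup>+y. ennreal (mollifier r y * norm (f (x - y) - f x) powr p) \<partial>lborel)" for x
  proof -
    note i1 = mollifier_integrable_mult[OF r f, of x]
    have i2: "integrable lborel (\<lambda>y::'a. mollifier r y *\<^sub>R f x)"
      using mollifier_integrable[OF r, where 'a='a] by (intro integrable_scaleR_left) auto
    have i3: "integrable lborel (\<lambda>y. mollifier r y *\<^sub>R (f (x - y) - f x))"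
      using Bochner_Integration.integrable_diff[OF i1 i2] by (simp add: scaleR_diff_right)
    then have i4: "integrable lborel (\<lambda>y. mollifier r y * norm (f (x - y) - f x))"
      using integrable_norm[OF i3] mollifier_nonneg[OF r, where 'a='a] by (simp add: abs_of_nonneg)
    have "mollify r f x - f x = (LINT y|lborel. mollifier r y *\<^sub>R (f (x - y) - f x))"
      unfolding mollify_def scaleR_diff_right using i1 i2 mollifier_integral[OF r, where 'a='a] mollifier_integrable[OF r, where 'a='a] by simp
    then have "norm (mollify r f x - f x) \<le> (LINT y|lborel. norm (mollifier r y *\<^sub>R (f (x - y) - f x)))"
      by (simp only: integral_norm_bound)
    also have "\<dots> = (LINT y|lborel. mollifier r y * norm (f (x - y) - f x))"
      using mollifier_nonneg[OF r, where 'a='a] by (simp add: abs_of_nonneg)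
    finally have "norm (mollify r f x - f x) powr p \<le> (LINT y|lborel. mollifier r y * norm (f (x - y) - f x)) powr p"
      using p by (intro powr_mono2) auto
    then have "ennreal (norm (mollify r f x - f x) powr p) \<le> ennreal ((LINT y|lborel. mollifier r y * norm (f (x - y) - f x)) powr p)"
      by (rule ennreal_leI)
    also have "\<dots> \<le> (\<integral>\<^sup>+y. ennreal (mollifier r y * norm (f (x - y) - f x) powr p) \<partial>lborel)"
      by (rule Jensen_powr[OF p])
        (use i4 mollifier_nonneg[OF r, where 'a='a] mollifier_integral[OF r, where 'a='a] mollifier_integrable[OF r, where 'a='a] in auto)
    finally show ?thesis .
  qed
  have "Np p (\<lambda>x. mollify r f x - f x) \<le> (\<integral>\<^sup>+x. \<integral>\<^sup>+y. ennreal (mollifier r y * norm (f (x - y) - f x) powr p) \<partial>lborel \<partial>lborel)"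
    unfolding Np_def by (rule nn_integral_mono) (rule pt)
  also have "\<dots> = (\<integral>\<^sup>+y. \<integral>\<^sup>+x. ennreal (mollifier r y * norm (f (x - y) - f x) powr p) \<partial>lborel \<partial>lborel)"
    by (rule lborel_pair.Fubini') measurable
  also have "\<dots> = (\<integral>\<^sup>+y. ennreal (mollifier r y) * Np p (\<lambda>x. f (x - y) - f x) \<partial>lborel)"
    unfolding Np_def using mollifier_nonneg[OF r, where 'a='a]
    by (intro nn_integral_cong) (simp add: ennreal_mult' nn_integral_cmult)
  also have "\<dots> \<le> (\<integral>\<^sup>+y. ennreal (mollifier r (y::'a)) * e \<partial>lborel)"
  proof (rule nn_integral_mono)
    fix y :: 'a
    show "ennreal (mollifier r y) * Np p (\<lambda>x. f (x - y) - f x) \<le> ennreal (mollifier r y) * e"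
      using e[of y] mollifier_0[OF r, of y] by (cases "norm y \<le> real DIM('a) * r") (auto intro: mult_left_mono)
  qed
  also have "\<dots> = e" using mollifier_nn_integral[OF r, where 'a='a] by (simp add: nn_integral_multc)
  finally show ?thesis .
qed

lemma mollify_tendsto:
  fixes f :: "'a::euclidean_space \<Rightarrow> 'b::euclidean_space"
  assumes p: "p \<ge> 1" and f: "integrable lborel f" "Np p f < \<infinity>"
  shows "((\<lambda>r. Np p (\<lambda>x. mollify r f x - f x)) \<longlongrightarrow> 0) (at_right 0)"
  unfolding ennreal_tendsto_0_iff
proof (intro allI impI)
  fix e :: real assume e: "e > 0"
  have "translation_continuous p f" by (rule translation_continuous_Lp[OF p _ f(2)]) (use f in auto)
  from this[unfolded translation_continuous_def ennreal_tendsto_0_iff, rule_format, of "e / 2"]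
  have "eventually (\<lambda>h. Np p (\<lambda>x. f (x + h) - f x) < ennreal (e / 2)) (nhds 0)"
    using e by simp
  then obtain d where d: "d > 0" "\<And>h. dist h 0 < d \<Longrightarrow> Np p (\<lambda>x. f (x + h) - f x) < ennreal (e / 2)"
    unfolding eventually_nhds_metric by blast
  have "Np p (\<lambda>x. mollify r f x - f x) < ennreal e" if r: "r > 0" "r < d / DIM('a)" for r
  proof -
    have "Np p (\<lambda>x. mollify r f x - f x) \<le> ennreal (e / 2)"
    proof (rule Np_mollify[OF p r(1) f(1)])
      fix y :: 'a assume "norm y \<le> real DIM('a) * r"
      also have "real DIM('a) * r < d" using r(2) by (simp add: field_simps)
      finally show "Np p (\<lambda>x. f (x - y) - f x) \<le> ennreal (e / 2)"
        using d(2)[of "-y"] by simp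
    qed
    also have "\<dots> < ennreal e" using e by (intro ennreal_lessI) auto
    finally show ?thesis .
  qed
  then show "eventually (\<lambda>r. Np p (\<lambda>x. mollify r f x - f x) < ennreal e) (at_right 0)"
    using d(1) unfolding eventually_at_right_field by (intro exI[of _ "d / DIM('a)"]) auto
qed

section \<open>Weak gradients and zero boundary values\<close>

text \<open>Fubini is used for Borel functions on products of \<open>lborel\<close>, whereas slices
  of a Lebesgue measurable function are measurable only for almost every parameter. All data are
  therefore replaced by Borel representatives; working coordinatewise reduces this to the real
  case.\<close>

lemma lebesgue_borel_version:
  fixes f :: "'a::euclidean_space \<Rightarrow> 'b::euclidean_space"
  assumes "f \<in> borel_measurable lebesgue"
  obtains f' where "f' \<in> borel_measurable borel" "AE x in lborel. f x = f' x"
proof -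
  have "\<exists>g\<in>borel_measurable lborel. AE x in lborel. f x \<bullet> i = g x" for i
    by (rule completion_ex_borel_measurable_real) (use assms in measurable)
  then obtain g where g: "\<And>i. g i \<in> borel_measurable lborel" "\<And>i. AE x in lborel. f x \<bullet> i = g i x"
    by metis
  show ?thesis
  proof (rule that[of "\<lambda>x. \<Sum>i\<in>Basis. g i x *\<^sub>R i"])
    have "AE x in lborel. \<forall>i\<in>Basis. f x \<bullet> i = g i x"
      using g(2) by (intro AE_finite_allI) auto
    then show "AE x in lborel. f x = (\<Sum>i\<in>Basis. g i x *\<^sub>R i)"
    proof eventually_elim
      case (elim x)
      have "f x = (\<Sum>i\<in>Basis. (f x \<bullet> i) *\<^sub>R i)" by (simp add: euclidean_representation)
      also have "\<dots> = (\<Sum>i\<in>Basis. g i x *\<^sub>R i)" using elim by (intro sum.cong) auto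
      finally show ?case .
    qed
  qed (use g(1) in simp)
qed

lemma integrable_lebesgue_AE_borel:
  fixes f f' :: "'a::euclidean_space \<Rightarrow> 'b::euclidean_space"
  assumes f: "integrable lebesgue f" and f'[measurable]: "f' \<in> borel_measurable borel" and "AE x in lborel. f x = f' x"
  shows "integrable lborel f'" "(LINT x|lebesgue. f x) = (LINT x|lborel. f' x)"
proof -
  have ae: "AE x in lebesgue. f x = f' x" using assms(3) by (rule AE_completion)
  have m: "f' \<in> borel_measurable lebesgue" using f' by (simp add: measurable_completion)
  have "integrable lebesgue f'"
    using integrable_cong_AE[OF borel_measurable_integrable[OF f] m ae] f by blast
  then show "integrable lborel f'" by (simp add: integrable_completion)
  have "(LINT x|lebesgue. f x) = (LINT x|lebesgue. f' x)"
    by (rule integral_cong_AE[OF borel_measurable_integrable[OF f] m ae])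
  then show "(LINT x|lebesgue. f x) = (LINT x|lborel. f' x)" by (simp add: integral_completion)
qed

lemma eventually_at_right_small:
  assumes "0 < d"
  shows "eventually (\<lambda>r. 0 < r \<and> real n * r < d) (at_right (0::real))"
proof -
  have "real n * r < d" if "0 < r" "r < d / (real n + 1)" for r
  proof -
    have "real n * r \<le> (real n + 1) * r" using that(1) by (intro mult_right_mono) auto
    also have "\<dots> < d" using that(2) by (simp add: pos_less_divide_eq mult.commute)
    finally show ?thesis .
  qed
  moreover have "0 < d / (real n + 1)" using assms by simp
  ultimately show ?thesis unfolding eventually_at_right_field by blast
qed

text \<open>The fundamental lemma of the calculus of variations. Near a compact \<open>C n\<close>
  the mollifications of \<open>D\<close> are themselves test integrals, hence 0 on
  \<open>C n\<close>, while they converge to \<open>D\<close> in \<open>L^1\<close> after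
  \<open>D\<close> has been cut off to a compact neighbourhood \<open>K\<close> of
  \<open>C n\<close>.\<close>

lemma AE_0_of_test_integrals:
  fixes D :: "'a::euclidean_space \<Rightarrow> 'b::euclidean_space"
  assumes "open \<Omega>" and D: "\<And>K. compact K \<Longrightarrow> K \<subseteq> \<Omega> \<Longrightarrow> set_integrable lebesgue K D"
    and zero: "\<And>\<phi>. \<phi> \<in> test_functions \<Omega> \<Longrightarrow> (LINT x:\<Omega>|lebesgue. \<phi> x *\<^sub>R D x) = 0"
  shows "AE x in lborel. x \<in> \<Omega> \<longrightarrow> D x = 0"
proof -
  obtain C where C: "\<And>n::nat. compact (C n)" "\<And>n. C n \<subseteq> \<Omega>" "\<Union>(range C) = \<Omega>"
    using open_Union_compact_subsets[OF assms(1)] by metis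
  have "AE x in lborel. x \<in> C n \<longrightarrow> D x = 0" for n
  proof -
    obtain d where d: "d > 0" "(\<Union>x\<in>C n. cball x d) \<subseteq> \<Omega>"
      using compact_subset_open_imp_cball_epsilon_subset[OF C(1) assms(1) C(2)] by blast
    define K where "K = {x + y |x y. x \<in> C n \<and> y \<in> cball (0::'a) d}"
    have K: "compact K" unfolding K_def by (rule compact_sums[OF C(1) compact_cball])
    have KO: "K \<subseteq> \<Omega>" using d(2) by (force simp: K_def dist_norm)
    have CK: "C n \<subseteq> K" unfolding K_def using d(1) by force
    have [measurable]: "K \<in> sets borel" "C n \<in> sets borel" using K C(1) by (auto simp: compact_imp_closed borel_closed)
    have Di: "integrable lebesgue (\<lambda>x. indicator K x *\<^sub>R D x)"
      using D[OF K KO] by (simp add: set_integrable_def)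
    obtain D1 where D1[measurable]: "D1 \<in> borel_measurable borel" and D1e: "AE x in lborel. indicator K x *\<^sub>R D x = D1 x"
      using lebesgue_borel_version[OF borel_measurable_integrable[OF Di]] by blast
    note D1i = integrable_lebesgue_AE_borel(1)[OF Di D1 D1e]
    have m0: "mollify r D1 x = 0" if r: "r > 0" "real DIM('a) * r \<le> d" and x: "x \<in> C n" for r x
    proof -
      have sub: "cball x (real DIM('a) * r) \<subseteq> K"
      proof
        fix y assume "y \<in> cball x (real DIM('a) * r)"
        then have "y - x \<in> cball 0 d" using r by (auto simp: dist_norm norm_minus_commute)
        moreover have "y = x + (y - x)" by simp
        ultimately show "y \<in> K" using x unfolding K_def by blast
      qed
      then have t: "(\<lambda>y. mollifier r (x - y)) \<in> test_functions \<Omega>"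
        using KO by (intro mollifier_test r) auto
      have z: "mollifier r (x - y) = 0" if "y \<notin> K" for y
      proof (rule mollifier_0[OF r(1)])
        have "y \<notin> cball x (real DIM('a) * r)" using sub that by blast
        then show "real DIM('a) * r \<le> norm (x - y)" by (simp add: dist_norm)
      qed
      obtain M where M: "M > 0" "\<And>x::'a. mollifier r x \<le> M" using mollifier_bounded[OF r(1)] by blast
      have eq: "indicator \<Omega> y *\<^sub>R (mollifier r (x - y) *\<^sub>R D y) = mollifier r (x - y) *\<^sub>R (indicator K y *\<^sub>R D y)" for y
        using z[of y] KO by (auto simp: indicator_def)
      have "integrable lebesgue (\<lambda>y. M * norm (indicator K y *\<^sub>R D y))" by (intro integrable_mult_right integrable_norm Di)
      then have int: "integrable lebesgue (\<lambda>y. mollifier r (x - y) *\<^sub>R (indicator K y *\<^sub>R D y))"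
      proof (rule Bochner_Integration.integrable_bound)
        have "(\<lambda>y. mollifier r (x - y)) \<in> borel_measurable lebesgue" by (intro measurable_completion) simp
        then show "(\<lambda>y. mollifier r (x - y) *\<^sub>R (indicator K y *\<^sub>R D y)) \<in> borel_measurable lebesgue"
          using borel_measurable_integrable[OF Di] by (rule borel_measurable_scaleR)
      qed (use M mollifier_nonneg[OF r(1), where 'a='a] in \<open>auto simp: mult.assoc intro!: AE_I2 mult_right_mono\<close>)
      have "mollify r D1 x = (LINT y|lborel. mollifier r (x - y) *\<^sub>R D1 y)" by (rule mollify_alt) simp
      also have "\<dots> = (LINT y|lebesgue. mollifier r (x - y) *\<^sub>R (indicator K y *\<^sub>R D y))"
      proof (rule integrable_lebesgue_AE_borel(2)[OF int, symmetric])
        show "AE y in lborel. mollifier r (x - y) *\<^sub>R (indicator K y *\<^sub>R D y) = mollifier r (x - y) *\<^sub>R D1 y"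
          by (rule eventually_mono[OF D1e]) (erule arg_cong)
      qed simp
      also have "\<dots> = 0" using zero[OF t] unfolding set_lebesgue_integral_def eq .
      finally show ?thesis .
    qed
    \<comment> \<open>As the mollification vanishes on \<open>C n\<close>, the \<open>L^1\<close>
      norm of \<open>D1\<close> over \<open>C n\<close> is bounded by the mollification error,
      whatever the scale.\<close>
    let ?I = "\<integral>\<^sup>+x. indicator (C n) x * ennreal (norm (D1 x)) \<partial>lborel"
    have "?I \<le> Np 1 (\<lambda>x. mollify r D1 x - D1 x)" if "r > 0" "real DIM('a) * r \<le> d" for r
      unfolding Np_def using m0[OF that] by (intro nn_integral_mono) (auto simp: indicator_def)
    then have "eventually (\<lambda>r. ?I \<le> Np 1 (\<lambda>x. mollify r D1 x - D1 x)) (at_right 0)"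
      by (intro eventually_mono[OF eventually_at_right_small[OF d(1), of "DIM('a)"]]) (metis less_imp_le)
    then have "?I \<le> 0"
      by (rule tendsto_lowerbound[OF mollify_tendsto[OF order_refl D1i Np_1[OF D1i]]]) auto
    then have "AE x in lborel. indicator (C n) x * ennreal (norm (D1 x)) = 0"
      by (subst (asm) le_zero_eq, subst (asm) nn_integral_0_iff_AE) auto
    with D1e show ?thesis
    proof eventually_elim
      case (elim x)
      then show ?case using CK by (auto simp: indicator_def split: if_splits)
    qed
  qed
  then have "AE x in lborel. \<forall>n. x \<in> C n \<longrightarrow> D x = 0" by (subst AE_all_countable) blast
  then show ?thesis
  proof eventually_elim
    case (elim x)
    then show ?case using C(3) by blast
  qed
qed

lemma test_function_set_integrable:
  fixes G :: "'a::euclidean_space \<Rightarrow> 'b::euclidean_space"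
  assumes "\<And>K. compact K \<Longrightarrow> K \<subseteq> \<Omega> \<Longrightarrow> set_integrable lebesgue K G" "\<phi> \<in> test_functions \<Omega>"
  shows "set_integrable lebesgue \<Omega> (\<lambda>x. \<phi> x *\<^sub>R G x)"
proof -
  note t = test_functionsD[OF assms(2)]
  define K where "K = closure {x. \<phi> x \<noteq> 0}"
  obtain M where M: "M > 0" "\<And>x. \<bar>\<phi> x\<bar> \<le> M" using test_function_bounded[OF assms(2)] by metis
  have Gi: "integrable lebesgue (\<lambda>x. indicator K x *\<^sub>R G x)"
    using assms(1)[OF t(2,3)] unfolding K_def set_integrable_def .
  have "\<phi> x = 0" if "x \<notin> K" for x using that unfolding K_def by (rule t(4))
  then have eq: "(\<lambda>x. indicator \<Omega> x *\<^sub>R (\<phi> x *\<^sub>R G x)) = (\<lambda>x. \<phi> x *\<^sub>R (indicator K x *\<^sub>R G x))"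
    using t(3) unfolding K_def[symmetric] by (intro ext) (auto simp: indicator_def)
  have "integrable lebesgue (\<lambda>x. M * norm (indicator K x *\<^sub>R G x))" by (intro integrable_mult_right integrable_norm Gi)
  then have "integrable lebesgue (\<lambda>x. \<phi> x *\<^sub>R (indicator K x *\<^sub>R G x))"
  proof (rule Bochner_Integration.integrable_bound)
    have "\<phi> \<in> borel_measurable lebesgue" using smooth_borel[OF t(1)] by (intro measurable_completion) simp
    then show "(\<lambda>x. \<phi> x *\<^sub>R (indicator K x *\<^sub>R G x)) \<in> borel_measurable lebesgue"
      using borel_measurable_integrable[OF Gi] by (rule borel_measurable_scaleR)
  qed (use M in \<open>auto simp: mult.assoc abs_mult intro!: AE_I2 mult_right_mono\<close>)
  then show ?thesis unfolding set_integrable_def eq .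
qed

lemma test_function_grad_set_integrable:
  fixes f :: "'a::euclidean_space \<Rightarrow> real"
  assumes "\<And>K. compact K \<Longrightarrow> K \<subseteq> \<Omega> \<Longrightarrow> set_integrable lebesgue K f" "\<phi> \<in> test_functions \<Omega>"
  shows "set_integrable lebesgue \<Omega> (\<lambda>x. f x *\<^sub>R grad \<phi> x)"
proof -
  have "set_integrable lebesgue \<Omega> (\<lambda>x. frechet_derivative \<phi> (at x) i *\<^sub>R (f x))" if "i \<in> Basis" for i
    by (rule test_function_set_integrable[OF assms(1) test_functions_derivative[OF assms(2) that]])
  then have "set_integrable lebesgue \<Omega> (\<lambda>x. \<Sum>i\<in>Basis. (frechet_derivative \<phi> (at x) i *\<^sub>R (f x)) *\<^sub>R i)"
    unfolding set_integrable_def scaleR_sum_right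
    by (intro Bochner_Integration.integrable_sum) (auto dest!: integrable_scaleR_left)
  moreover have "(\<Sum>i\<in>Basis. (frechet_derivative \<phi> (at x) i *\<^sub>R (f x)) *\<^sub>R i) = f x *\<^sub>R grad \<phi> x" for x
  proof -
    have "f x *\<^sub>R grad \<phi> x = f x *\<^sub>R (\<Sum>i\<in>Basis. (grad \<phi> x \<bullet> i) *\<^sub>R i)" by (simp add: euclidean_representation)
    also have "\<dots> = (\<Sum>i\<in>Basis. (frechet_derivative \<phi> (at x) i *\<^sub>R (f x)) *\<^sub>R i)"
      by (simp add: scaleR_sum_right smooth_grad(2)[OF test_functionsD(1)[OF assms(2)]] inner_commute mult.commute)
    finally show ?thesis ..
  qed
  ultimately show ?thesis by simp
qed

lemma has_weak_gradient_diff: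
  assumes "has_weak_gradient \<Omega> f F" "has_weak_gradient \<Omega> g G"
  shows "has_weak_gradient \<Omega> (\<lambda>x. f x - g x) (\<lambda>x. F x - G x)"
proof -
  have i: "set_integrable lebesgue K f" "set_integrable lebesgue K F" "set_integrable lebesgue K g" "set_integrable lebesgue K G"
    if "compact K" "K \<subseteq> \<Omega>" for K
    using assms that by (auto simp: has_weak_gradient_def)
  show ?thesis
    unfolding has_weak_gradient_def
  proof (intro conjI allI impI ballI)
    fix \<phi> assume t: "\<phi> \<in> test_functions \<Omega>"
    note s = test_function_grad_set_integrable[OF i(1) t] test_function_grad_set_integrable[OF i(3) t]
      test_function_set_integrable[OF i(2) t] test_function_set_integrable[OF i(4) t]
    show "(LINT x:\<Omega>|lebesgue. (f x - g x) *\<^sub>R grad \<phi> x) = - (LINT x:\<Omega>|lebesgue. \<phi> x *\<^sub>R (F x - G x))"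
      unfolding scaleR_diff_left scaleR_diff_right
      using assms t s by (simp add: set_integral_diff has_weak_gradient_def)
  qed (use i in \<open>auto intro!: set_integral_diff\<close>)
qed

lemma weak_gradient_unique:
  assumes "open \<Omega>" "has_weak_gradient \<Omega> f F" "has_weak_gradient \<Omega> f G"
  shows "AE x in lborel. x \<in> \<Omega> \<longrightarrow> F x = G x"
proof -
  have "AE x in lborel. x \<in> \<Omega> \<longrightarrow> F x - G x = 0"
    using has_weak_gradient_diff[OF assms(2,3)]
    by (intro AE_0_of_test_integrals[OF assms(1)]) (auto simp: has_weak_gradient_def set_lebesgue_integral_def)
  then show ?thesis by simp
qed

lemma smooth_grad_add: "smooth f \<Longrightarrow> smooth g \<Longrightarrow> grad (\<lambda>x. f x + g x) x = grad f x + grad g x"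
  by (intro GDERIV_grad GDERIV_add smooth_grad(1))

lemma smooth_grad_diff: "smooth f \<Longrightarrow> smooth g \<Longrightarrow> grad (\<lambda>x. f x - g x) x = grad f x - grad g x"
  by (intro GDERIV_grad GDERIV_diff smooth_grad(1))

lemma smooth_grad_const: "grad (\<lambda>x. c) x = 0"
  by (intro GDERIV_grad) (simp add: gderiv_def)

lemma smooth_mollify:
  fixes f :: "'a::euclidean_space \<Rightarrow> real"
  assumes r: "r > 0" and f: "integrable lborel f"
  shows "smooth (mollify r f)"
    and "grad (mollify r f) x = (LINT y|lborel. f y *\<^sub>R grad (mollifier r) (x - y))"
proof -
  have [measurable]: "f \<in> borel_measurable borel" using f by auto
  have K: "(mollifier r :: 'a \<Rightarrow> real) \<in> test_functions UNIV"
    by (rule test_functionsI[OF smooth_mollifier compact_cball[of 0 "real DIM('a) * r"]])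
      (auto intro!: mollifier_0[OF r])
  have eq: "mollify r f = (\<lambda>x. LINT y|lborel. f y * mollifier r (x - y))"
    by (auto simp: mollify_alt mult.commute)
  show "smooth (mollify r f)" unfolding eq by (rule smooth_convolution(1)[OF f K])
  obtain M where M: "M > 0" "\<And>x::'a. norm (grad (mollifier r) x) \<le> M"
    using test_function_bounded[OF K] by metis
  have [measurable]: "grad (mollifier r :: 'a \<Rightarrow> real) \<in> borel_measurable borel"
    by (rule smooth_grad_borel[OF smooth_mollifier])
  have int: "integrable lborel (\<lambda>y. f y *\<^sub>R grad (mollifier r) (x - y))" for x
    by (rule Bochner_Integration.integrable_bound[of _ "\<lambda>y. M * norm (f y)"])
      (use f M in \<open>auto intro!: AE_I2 mult_left_mono simp: mult.commute[of M]\<close>)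
  have "((\<lambda>x. LINT y|lborel. f y * mollifier r (x - y)) has_derivative
     (\<lambda>h. h \<bullet> (LINT y|lborel. f y *\<^sub>R grad (mollifier r) (x - y)))) (at x)" for x
    using smooth_convolution(2)[OF f K, of x] int[of x]
    by (simp add: smooth_grad(2)[OF smooth_mollifier] flip: integral_inner_right)
  then show "grad (mollify r f) x = (LINT y|lborel. f y *\<^sub>R grad (mollifier r) (x - y))"
    unfolding eq by (intro GDERIV_grad) (simp add: gderiv_def)
qed

lemma grad_reflect:
  assumes "smooth f" shows "grad (\<lambda>y. f (x - y)) z = - grad f (x - z)"
proof -
  have "((\<lambda>y. x - y) has_derivative (\<lambda>h. - h)) (at z)"
    by (auto intro!: derivative_eq_intros)
  from diff_chain_at[OF this smooth_has_derivative[OF assms]]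
  have "((\<lambda>y. f (x - y)) has_derivative (\<lambda>h. h \<bullet> (- grad f (x - z)))) (at z)"
    by (simp add: o_def smooth_grad(2)[OF assms])
  then show ?thesis by (intro GDERIV_grad) (simp add: gderiv_def)
qed

text \<open>The derivative falls on the kernel. Reflection turns it, up to a sign, into the gradient
  in \<open>y\<close> of \<open>mollifier r (x - y)\<close>, which is a test function because the
  ball fits into \<open>\<Omega>\<close>; the sign of the weak gradient identity cancels the one
  from the reflection.\<close>

lemma grad_mollify_weak_gradient:
  fixes g :: "'a::euclidean_space \<Rightarrow> real"
  assumes r: "r > 0" and wg: "has_weak_gradient \<Omega> g G" and [measurable]: "\<Omega> \<in> sets borel"
    and gi: "integrable lborel (\<lambda>x. indicator \<Omega> x *\<^sub>R g x)" and [measurable]: "G \<in> borel_measurable borel"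
    and G0: "\<And>x. x \<notin> \<Omega> \<Longrightarrow> G x = 0" and x: "cball x (real DIM('a) * r) \<subseteq> \<Omega>"
  shows "grad (mollify r (\<lambda>x. indicator \<Omega> x *\<^sub>R g x)) x = mollify r G x"
proof -
  have [measurable]: "(\<lambda>x. indicator \<Omega> x *\<^sub>R g x) \<in> borel_measurable borel" using gi by auto
  have [measurable]: "grad (mollifier r :: 'a \<Rightarrow> real) \<in> borel_measurable borel"
    by (rule smooth_grad_borel[OF smooth_mollifier])
  have "grad (mollify r (\<lambda>x. indicator \<Omega> x *\<^sub>R g x)) x
      = (LINT y|lborel. (indicator \<Omega> y *\<^sub>R g y) *\<^sub>R grad (mollifier r) (x - y))"
    by (rule smooth_mollify(2)[OF r gi])
  also have "\<dots> = - (LINT y|lborel. (indicator \<Omega> y *\<^sub>R g y) *\<^sub>R grad (\<lambda>y. mollifier r (x - y)) y)"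
    by (simp add: grad_reflect[OF smooth_mollifier])
  also have "(LINT y|lborel. (indicator \<Omega> y *\<^sub>R g y) *\<^sub>R grad (\<lambda>y. mollifier r (x - y)) y)
     = (LINT y:\<Omega>|lebesgue. g y *\<^sub>R grad (\<lambda>y. mollifier r (x - y)) y)"
  proof -
    have "(\<lambda>y. (indicator \<Omega> y *\<^sub>R g y) *\<^sub>R - grad (mollifier r) (x - y)) \<in> borel_measurable lborel"
      by measurable
    from integral_completion[OF this] show ?thesis
      unfolding set_lebesgue_integral_def grad_reflect[OF smooth_mollifier] by simp
  qed
  also have "\<dots> = - (LINT y:\<Omega>|lebesgue. mollifier r (x - y) *\<^sub>R G y)"
    using wg mollifier_test[OF r x] unfolding has_weak_gradient_def by blast
  also have "(LINT y:\<Omega>|lebesgue. mollifier r (x - y) *\<^sub>R G y) = (LINT y|lborel. mollifier r (x - y) *\<^sub>R G y)"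
  proof -
    have "indicator \<Omega> y *\<^sub>R (mollifier r (x - y) *\<^sub>R G y) = mollifier r (x - y) *\<^sub>R G y" for y
      using G0[of y] by (auto simp: indicator_def)
    note eq = this
    show ?thesis unfolding set_lebesgue_integral_def eq by (rule integral_completion) simp
  qed
  also have "\<dots> = mollify r G x" by (rule mollify_alt[symmetric]) simp
  finally show ?thesis by simp
qed

text \<open>This says that \<open>w\<^sup>+\<close> belongs to \<open>W\<^sub>0\<^sup>1\<^sup>,\<^sup>p(\<Omega>)\<close> with gradient \<open>G\<close> on \<open>{w > 0}\<close>. The approximants are
  not truncated, so that smooth functions of them vanishing on \<open>{..0}\<close> are test functions.\<close>

definition approximable :: "real \<Rightarrow> 'a::euclidean_space set \<Rightarrow> ('a \<Rightarrow> real) \<Rightarrow> ('a \<Rightarrow> 'a) \<Rightarrow> bool" where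
  "approximable p \<Omega> w G \<longleftrightarrow> (\<exists>W. (\<forall>j::nat. smooth (W j) \<and> (\<exists>K. compact K \<and> K \<subseteq> \<Omega> \<and> (\<forall>x. x \<notin> K \<longrightarrow> W j x \<le> 0))) \<and>
    (\<lambda>j. Np p (\<lambda>x. indicator \<Omega> x *\<^sub>R (W j x - w x))) \<longlonglongrightarrow> 0 \<and>
    (\<lambda>j. Np p (\<lambda>x. indicator {x. W j x > 0} x *\<^sub>R (grad (W j) x - G x))) \<longlonglongrightarrow> 0)"

text \<open>Membership in \<open>W1p0\<close> with a prescribed gradient \<open>F\<close>. Naming
  \<open>F\<close> allows one jointly measurable gradient on the cylinder to be the limit on almost
  every time slice, instead of a new choice on each slice.\<close>

definition W0_limit :: "real \<Rightarrow> 'a::euclidean_space set \<Rightarrow> ('a \<Rightarrow> real) \<Rightarrow> ('a \<Rightarrow> 'a) \<Rightarrow> bool" where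
  "W0_limit p \<Omega> f F \<longleftrightarrow> (\<exists>\<phi>. (\<forall>k::nat. \<phi> k \<in> test_functions \<Omega>) \<and>
    (\<lambda>k. Np p (\<lambda>x. indicator \<Omega> x *\<^sub>R (\<phi> k x - f x))) \<longlonglongrightarrow> 0 \<and>
    (\<lambda>k. Np p (\<lambda>x. indicator \<Omega> x *\<^sub>R (grad (\<phi> k) x - F x))) \<longlonglongrightarrow> 0)"

lemma tendsto_0_le_ennreal:
  fixes f g :: "'i \<Rightarrow> ennreal"
  assumes "(g \<longlongrightarrow> 0) F" "\<And>i. f i \<le> g i"
  shows "(f \<longlongrightarrow> 0) F"
  by (rule tendsto_sandwich[OF _ _ tendsto_const assms(1)]) (simp_all add: assms(2))

lemma Np_mono:
  assumes "p \<ge> 0" "\<And>x. norm (f x) \<le> norm (g x)"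
  shows "Np p f \<le> Np p g"
  unfolding Np_def using assms by (intro nn_integral_mono ennreal_leI powr_mono2) auto

lemma Np_sum3_tendsto:
  assumes p: "p > 0" and [measurable]: "\<And>i. a i \<in> borel_measurable borel" "\<And>i. b i \<in> borel_measurable borel" "\<And>i. c i \<in> borel_measurable borel"
    and a: "((\<lambda>i. Np p (a i)) \<longlongrightarrow> 0) F" and b: "((\<lambda>i. Np p (b i)) \<longlongrightarrow> 0) F" and c: "((\<lambda>i. Np p (c i)) \<longlongrightarrow> 0) F"
  shows "((\<lambda>i. Np p (\<lambda>x. a i x + (b i x + c i x))) \<longlongrightarrow> 0) F"
proof (rule tendsto_sandwich[OF _ _ tendsto_const])
  show "((\<lambda>i. ennreal (2 powr p) * (Np p (a i) + ennreal (2 powr p) * (Np p (b i) + Np p (c i)))) \<longlongrightarrow> 0) F"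
    using a b c by (auto intro!: tendsto_eq_intros ennreal_tendsto_cmult)
  show "\<forall>\<^sub>F i in F. Np p (\<lambda>x. a i x + (b i x + c i x)) \<le> ennreal (2 powr p) * (Np p (a i) + ennreal (2 powr p) * (Np p (b i) + Np p (c i)))"
  proof (intro always_eventually allI)
    fix i
    have "Np p (\<lambda>x. a i x + (b i x + c i x)) \<le> ennreal (2 powr p) * (Np p (a i) + Np p (\<lambda>x. b i x + c i x))"
      by (rule Np_add[OF p]) auto
    also have "\<dots> \<le> ennreal (2 powr p) * (Np p (a i) + ennreal (2 powr p) * (Np p (b i) + Np p (c i)))"
      using Np_add[OF p, of "b i" "c i"] by (intro mult_left_mono add_mono) auto
    finally show "Np p (\<lambda>x. a i x + (b i x + c i x)) \<le> ennreal (2 powr p) * (Np p (a i) + ennreal (2 powr p) * (Np p (b i) + Np p (c i)))" .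
  qed
qed auto

text \<open>The obstacle \<open>g\<close> is only nonpositive on the boundary, so it is lowered by \<open>e\<close> before
  mollification; then the approximant is nonpositive outside a compact subset of \<open>\<Omega>\<close>.\<close>

lemma smooth_approximant:
  fixes g :: "'a::euclidean_space \<Rightarrow> real"
  assumes p: "p \<ge> 1" and "open \<Omega>" "bounded \<Omega>" and e: "e > 0" and d: "d > 0"
    and \<phi>: "\<phi> \<in> test_functions \<Omega>" and \<theta>: "\<theta> \<in> test_functions \<Omega>"
    and g: "continuous_on (closure \<Omega>) g" "\<And>x. x \<in> frontier \<Omega> \<Longrightarrow> g x \<le> 0" "has_weak_gradient \<Omega> g G"
    and G[measurable]: "G \<in> borel_measurable borel" and G0: "\<And>x. x \<notin> \<Omega> \<Longrightarrow> G x = 0"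
    and Gi: "integrable lborel G" "Np p G < \<infinity>"
  obtains h K where "smooth h" "compact K" "K \<subseteq> \<Omega>" "\<And>x. x \<notin> K \<Longrightarrow> \<phi> x - \<theta> x + h x - e \<le> 0"
    "\<And>x. x \<notin> K \<Longrightarrow> h x - e < 0"
    "Np p (\<lambda>x. h x - indicator \<Omega> x *\<^sub>R g x) < ennreal d" "Np p (\<lambda>x. indicator K x *\<^sub>R (grad h x - G x)) < ennreal d"
proof -
  have cc: "compact (closure \<Omega>)" using assms(3) by (simp add: compact_closure)
  have [measurable]: "\<Omega> \<in> sets borel" using assms(2) by auto
  define gt where "gt = (\<lambda>x. indicator \<Omega> x *\<^sub>R g x)"
  have gm[measurable]: "gt \<in> borel_measurable borel"
    unfolding gt_def using g(1) closure_subset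
    by (intro borel_measurable_continuous_on_indicator) (auto intro: continuous_on_subset)
  have "compact (g ` closure \<Omega>)" using compact_continuous_image[OF g(1) cc] .
  then obtain M where M: "M > 0" "\<And>x. x \<in> closure \<Omega> \<Longrightarrow> \<bar>g x\<bar> \<le> M"
    using compact_imp_bounded bounded_pos by (metis image_eqI real_norm_def)
  have gtM: "\<bar>gt x\<bar> \<le> M * indicator \<Omega> x" for x
    using M closure_subset[of \<Omega>] by (auto simp: gt_def indicator_def)
  have finO: "emeasure lborel \<Omega> < \<infinity>" using assms(3) emeasure_bounded_finite by auto
  have gi: "integrable lborel gt"
    by (rule Bochner_Integration.integrable_bound[of _ "\<lambda>x. M * indicator \<Omega> x"])
      (use gtM finO M in \<open>auto intro!: AE_I2 integrable_mult_right simp: less_top\<close>)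
  have "Np p gt \<le> (\<integral>\<^sup>+x. ennreal (M powr p) * indicator \<Omega> x \<partial>lborel)"
    unfolding Np_def
  proof (rule nn_integral_mono)
    fix x show "ennreal (norm (gt x) powr p) \<le> ennreal (M powr p) * indicator \<Omega> x"
      using gtM[of x] p M(1) by (cases "x \<in> \<Omega>") (auto intro!: ennreal_leI powr_mono2)
  qed
  also have "\<dots> < \<infinity>" using finO by (simp add: nn_integral_cmult ennreal_mult_less_top)
  finally have gN: "Np p gt < \<infinity>" .
  \<comment> \<open>Off \<open>S\<close> both test functions vanish and \<open>g\<close>, extended
    by 0 outside \<open>\<Omega>\<close>, stays below \<open>e / 2\<close>. Since
    \<open>g \<le> 0\<close> on the frontier, the superlevel set does not reach it, so
    \<open>S\<close> is a compact subset of \<open>\<Omega>\<close>.\<close>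
  define S where "S = closure {x. \<phi> x \<noteq> 0} \<union> closure {x. \<theta> x \<noteq> 0} \<union> {x \<in> closure \<Omega>. e / 2 \<le> g x}"
  have "closed (closure \<Omega> \<inter> g -` {e / 2..})"
    by (rule continuous_closed_preimage[OF g(1) closed_closure closed_atLeast])
  then have "compact (closure \<Omega> \<inter> (closure \<Omega> \<inter> g -` {e / 2..}))"
    by (rule compact_Int_closed[OF cc])
  moreover have "closure \<Omega> \<inter> (closure \<Omega> \<inter> g -` {e / 2..}) = {x \<in> closure \<Omega>. e / 2 \<le> g x}"
    by auto
  ultimately have "compact {x \<in> closure \<Omega>. e / 2 \<le> g x}" by simp
  then have S: "compact S" unfolding S_def using test_functionsD(2)[OF \<phi>] test_functionsD(2)[OF \<theta>]
    by (intro compact_Un)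
  have SO: "S \<subseteq> \<Omega>"
  proof -
    have "x \<in> \<Omega>" if "x \<in> closure \<Omega>" "e / 2 \<le> g x" for x
    proof (rule ccontr)
      assume "x \<notin> \<Omega>"
      then have "x \<in> frontier \<Omega>" using that(1) assms(2) by (simp add: frontier_def interior_open)
      with g(2)[of x] that(2) e show False by simp
    qed
    then show ?thesis unfolding S_def using test_functionsD(3)[OF \<phi>] test_functionsD(3)[OF \<theta>] by auto
  qed
  obtain \<delta> where \<delta>: "\<delta> > 0" "(\<Union>x\<in>S. cball x \<delta>) \<subseteq> \<Omega>"
    using compact_subset_open_imp_cball_epsilon_subset[OF S assms(2) SO] by blast
  \<comment> \<open>Half of the available radius is spent on either side: off \<open>K\<close> a
    mollification at scale below \<open>\<delta> / 2\<close> averages only values taken off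
    \<open>S\<close>, and around each point of \<open>K\<close> a ball of radius
    \<open>\<delta> / 2\<close> remains in \<open>\<Omega>\<close>, where gradient and mollification
    commute.\<close>
  define K where "K = {x + y |x y. x \<in> S \<and> y \<in> cball (0::'a) (\<delta> / 2)}"
  have K: "compact K" unfolding K_def by (rule compact_sums[OF S compact_cball])
  have [measurable]: "K \<in> sets borel" using K by (auto simp: compact_imp_closed borel_closed)
  have Kball: "cball x (\<delta> / 2) \<subseteq> \<Omega>" if xK: "x \<in> K" for x
  proof
    fix z assume z: "z \<in> cball x (\<delta> / 2)"
    obtain s y where sy: "x = s + y" "s \<in> S" "norm y \<le> \<delta> / 2" using xK by (auto simp: K_def)
    have "dist s z \<le> dist s x + dist x z" by (rule dist_triangle)
    also have "\<dots> \<le> \<delta>" using sy z by (auto simp: dist_norm)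
    finally have "z \<in> cball s \<delta>" by simp
    then show "z \<in> \<Omega>" using \<delta>(2) sy(2) by blast
  qed
  have KO: "K \<subseteq> \<Omega>" using Kball \<delta>(1) by (meson centre_in_cball half_gt_zero less_imp_le subsetD subsetI)
  have "eventually (\<lambda>r. Np p (\<lambda>x. mollify r gt x - gt x) < ennreal d) (at_right 0)"
    using mollify_tendsto[OF p gi gN] d unfolding ennreal_tendsto_0_iff by blast
  moreover have "eventually (\<lambda>r. Np p (\<lambda>x. mollify r G x - G x) < ennreal d) (at_right 0)"
    using mollify_tendsto[OF p Gi] d unfolding ennreal_tendsto_0_iff by blast
  moreover have "eventually (\<lambda>r. r > 0 \<and> real DIM('a) * r < \<delta> / 2) (at_right 0)"
    by (rule eventually_at_right_small) (use \<delta>(1) in simp)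
  ultimately have "eventually (\<lambda>r. Np p (\<lambda>x. mollify r gt x - gt x) < ennreal d \<and> Np p (\<lambda>x. mollify r G x - G x) < ennreal d \<and> r > 0 \<and> real DIM('a) * r < \<delta> / 2) (at_right 0)"
    by eventually_elim auto
  then obtain r where r: "Np p (\<lambda>x. mollify r gt x - gt x) < ennreal d" "Np p (\<lambda>x. mollify r G x - G x) < ennreal d"
    "r > 0" "real DIM('a) * r < \<delta> / 2"
    using eventually_happens'[OF trivial_limit_at_right_real] by blast
  have hK: "mollify r gt x \<le> e / 2" if "x \<notin> K" for x
  proof -
    have pt: "mollifier r y *\<^sub>R gt (x - y) \<le> mollifier r y * (e / 2)" for y
    proof (cases "norm y \<le> \<delta> / 2")
      case True
      have "x - y \<notin> S"
      proof
        assume "x - y \<in> S"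
        moreover have "x = (x - y) + y" by simp
        ultimately have "x \<in> K" unfolding K_def using True by (intro CollectI exI[of _ "x - y"] exI[of _ y]) auto
        with that show False ..
      qed
      then have "gt (x - y) \<le> e / 2" using e closure_subset[of \<Omega>] by (auto simp: S_def gt_def indicator_def)
      then show ?thesis unfolding real_scaleR_def by (rule mult_left_mono[OF _ mollifier_nonneg[OF r(3)]])
    next
      case False
      then show ?thesis using mollifier_0[OF r(3), of y] r(4) by simp
    qed
    have "mollify r gt x \<le> (LINT y|lborel. mollifier r (y::'a) * (e / 2))"
      unfolding mollify_def
      by (rule integral_mono[OF mollifier_integrable_mult[OF r(3) gi] _ pt])
        (use mollifier_integrable[OF r(3), where 'a='a] in auto)
    also have "\<dots> = e / 2" using mollifier_integral[OF r(3), where 'a='a] by simp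
    finally show ?thesis .
  qed
  show ?thesis
  proof (rule that[of "mollify r gt" K])
    show "smooth (mollify r gt)" by (rule smooth_mollify(1)[OF r(3) gi])
    show "compact K" "K \<subseteq> \<Omega>" by fact+
    show "\<phi> x - \<theta> x + mollify r gt x - e \<le> 0" if "x \<notin> K" for x
    proof -
      have "x \<notin> S"
      proof
        assume "x \<in> S"
        moreover have "x = x + 0" by simp
        ultimately have "x \<in> K" unfolding K_def using \<delta>(1) by (intro CollectI exI[of _ "x"] exI[of _ 0]) auto
        with that show False ..
      qed
      then have "\<phi> x = 0" "\<theta> x = 0" unfolding S_def
        using test_functionsD(4)[OF \<phi>] test_functionsD(4)[OF \<theta>] by blast+
      then show ?thesis using hK[OF that] e by simp
    qed
    show "mollify r gt x - e < 0" if "x \<notin> K" for x using hK[OF that] e by simp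
    show "Np p (\<lambda>x. mollify r gt x - indicator \<Omega> x *\<^sub>R g x) < ennreal d" using r(1) by (simp add: gt_def)
    have "grad (mollify r gt) x = mollify r G x" if "x \<in> K" for x
      unfolding gt_def
    proof (rule grad_mollify_weak_gradient[OF r(3) g(3) _ _ G G0])
      show "integrable lborel (\<lambda>x. indicator \<Omega> x *\<^sub>R g x)" using gi by (simp add: gt_def)
      show "cball x (real DIM('a) * r) \<subseteq> \<Omega>" using Kball[OF that] r(4) by (meson less_imp_le subset_cball subset_trans)
    qed simp_all
    then have "Np p (\<lambda>x. indicator K x *\<^sub>R (grad (mollify r gt) x - G x)) \<le> Np p (\<lambda>x. mollify r G x - G x)"
      using p by (intro Np_mono) (auto simp: indicator_def)
    with r(2) show "Np p (\<lambda>x. indicator K x *\<^sub>R (grad (mollify r gt) x - G x)) < ennreal d" by (rule order.strict_trans1[rotated])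
  qed
qed

text \<open>Intended for \<open>f1 = u(t) - \<psi>(t)\<close>, \<open>f2 = v(s) - \<psi>(s)\<close>
  and \<open>g = \<psi>(t) - \<psi>(s)\<close>, whose combination is \<open>u(t) - v(s)\<close>. The
  first two are approximated by test functions; \<open>g\<close> has no zero boundary values, only
  the right sign there, and is replaced by a lowered mollification.\<close>

lemma approximable_if_W0_limits:
  fixes g :: "'a::euclidean_space \<Rightarrow> real"
  assumes p: "p \<ge> 1" and "open \<Omega>" "bounded \<Omega>"
    and fm[measurable]: "f1 \<in> borel_measurable borel" "F1 \<in> borel_measurable borel" "f2 \<in> borel_measurable borel" "F2 \<in> borel_measurable borel"
    and f1: "W0_limit p \<Omega> f1 F1" and f2: "W0_limit p \<Omega> f2 F2"
    and g: "continuous_on (closure \<Omega>) g" "\<And>x. x \<in> frontier \<Omega> \<Longrightarrow> g x \<le> 0" "has_weak_gradient \<Omega> g G"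
    and G[measurable]: "G \<in> borel_measurable borel" and G0: "\<And>x. x \<notin> \<Omega> \<Longrightarrow> G x = 0"
    and Gi: "integrable lborel G" "Np p G < \<infinity>"
  shows "approximable p \<Omega> (\<lambda>x. f1 x - f2 x + g x) (\<lambda>x. F1 x - F2 x + G x)"
proof -
  have p0: "p > 0" using p by simp
  have [measurable]: "\<Omega> \<in> sets borel" using assms(2) by auto
  obtain \<phi> where \<phi>: "\<And>k::nat. \<phi> k \<in> test_functions \<Omega>"
    "(\<lambda>k. Np p (\<lambda>x. indicator \<Omega> x *\<^sub>R (\<phi> k x - f1 x))) \<longlonglongrightarrow> 0"
    "(\<lambda>k. Np p (\<lambda>x. indicator \<Omega> x *\<^sub>R (grad (\<phi> k) x - F1 x))) \<longlonglongrightarrow> 0"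
    using f1 unfolding W0_limit_def by blast
  obtain \<theta> where \<theta>: "\<And>k::nat. \<theta> k \<in> test_functions \<Omega>"
    "(\<lambda>k. Np p (\<lambda>x. indicator \<Omega> x *\<^sub>R (\<theta> k x - f2 x))) \<longlonglongrightarrow> 0"
    "(\<lambda>k. Np p (\<lambda>x. indicator \<Omega> x *\<^sub>R (grad (\<theta> k) x - F2 x))) \<longlonglongrightarrow> 0"
    using f2 unfolding W0_limit_def by blast
  \<comment> \<open>One null sequence is used three times: as the amount by which \<open>g\<close>
    is lowered and as the tolerance for the mollified function and for its gradient.\<close>
  define e where "e k = 1 / real (Suc k)" for k
  have e: "e k > 0" for k by (simp add: e_def)
  have e0: "e \<longlonglongrightarrow> 0" unfolding e_def by (rule LIMSEQ_Suc[OF lim_1_over_n])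
  define Q where "Q k h K \<longleftrightarrow> smooth h \<and> compact K \<and> K \<subseteq> \<Omega> \<and> (\<forall>x. x \<notin> K \<longrightarrow> \<phi> k x - \<theta> k x + h x - e k \<le> 0) \<and>
    Np p (\<lambda>x. h x - indicator \<Omega> x *\<^sub>R g x) < ennreal (e k) \<and> Np p (\<lambda>x. indicator K x *\<^sub>R (grad h x - G x)) < ennreal (e k)" for k h K
  have "\<exists>h K. Q k h K" for k
  proof (rule smooth_approximant[OF p assms(2,3) e[of k] e[of k] \<phi>(1)[of k] \<theta>(1)[of k] g G G0 Gi])
    fix h K
    assume a: "smooth h" "compact K" "K \<subseteq> \<Omega>" "\<And>x. x \<notin> K \<Longrightarrow> \<phi> k x - \<theta> k x + h x - e k \<le> 0"
      "Np p (\<lambda>x. h x - indicator \<Omega> x *\<^sub>R g x) < ennreal (e k)" "Np p (\<lambda>x. indicator K x *\<^sub>R (grad h x - G x)) < ennreal (e k)"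
    show ?thesis unfolding Q_def by (rule exI[of _ h], rule exI[of _ K], intro conjI allI impI a, assumption)
  qed
  then obtain h K where Q: "\<And>k. Q k (h k) (K k)" by metis
  have hK: "\<And>k. smooth (h k)" "\<And>k. compact (K k)" "\<And>k. K k \<subseteq> \<Omega>"
    "\<And>k x. x \<notin> K k \<Longrightarrow> \<phi> k x - \<theta> k x + h k x - e k \<le> 0"
    "\<And>k. Np p (\<lambda>x. h k x - indicator \<Omega> x *\<^sub>R g x) < ennreal (e k)"
    "\<And>k. Np p (\<lambda>x. indicator (K k) x *\<^sub>R (grad (h k) x - G x)) < ennreal (e k)"
    using Q unfolding Q_def by blast+
  define W where "W k x = \<phi> k x - \<theta> k x + h k x - e k" for k x
  note s\<phi> = test_functionsD(1)[OF \<phi>(1)] and s\<theta> = test_functionsD(1)[OF \<theta>(1)]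
  have Ws: "smooth (W k)" for k
    unfolding W_def by (intro smooth_diff smooth_add s\<phi> s\<theta> hK(1) smooth_const)
  have Wg: "grad (W k) x = grad (\<phi> k) x - grad (\<theta> k) x + grad (h k) x" for k x
    unfolding W_def
    by (simp add: smooth_grad_diff smooth_grad_add smooth_diff smooth_add smooth_const s\<phi> s\<theta> hK(1) smooth_grad_const)
  note [measurable] = smooth_borel[OF s\<phi>] smooth_borel[OF s\<theta>] smooth_grad_borel[OF s\<phi>] smooth_grad_borel[OF s\<theta>]
    smooth_borel[OF hK(1)] smooth_grad_borel[OF hK(1)] smooth_borel[OF Ws]
  have [measurable]: "K k \<in> sets borel" for k using hK(2) by (auto simp: compact_imp_closed borel_closed)
  have gm[measurable]: "(\<lambda>x. indicator \<Omega> x *\<^sub>R g x) \<in> borel_measurable borel"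
    using g(1) closure_subset
    by (intro borel_measurable_continuous_on_indicator) (auto intro: continuous_on_subset)
  have en0: "(\<lambda>k. ennreal (e k)) \<longlonglongrightarrow> 0" using tendsto_ennrealI[OF e0] by simp
  have h0: "(\<lambda>k. Np p (\<lambda>x. h k x - indicator \<Omega> x *\<^sub>R g x)) \<longlonglongrightarrow> 0"
    by (rule tendsto_0_le_ennreal[OF en0 less_imp_le[OF hK(5)]])
  have H0: "(\<lambda>k. Np p (\<lambda>x. indicator (K k) x *\<^sub>R (grad (h k) x - G x))) \<longlonglongrightarrow> 0"
    by (rule tendsto_0_le_ennreal[OF en0 less_imp_le[OF hK(6)]])
  have finO: "emeasure lborel \<Omega> < \<infinity>" using assms(3) emeasure_bounded_finite by auto
  have c0: "(\<lambda>k. Np p (\<lambda>x. indicator \<Omega> x *\<^sub>R (- e k))) \<longlonglongrightarrow> 0"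
  proof (rule Np_tendsto_0_dominated[where g="indicator \<Omega>", OF p0])
    show "AE x in lborel. (\<lambda>k. indicator \<Omega> x *\<^sub>R - e k) \<longlonglongrightarrow> 0"
      using e0 by (intro AE_I2) (auto intro!: tendsto_eq_intros)
    show "AE x in lborel. norm (indicator \<Omega> x *\<^sub>R - e k) \<le> indicator \<Omega> x" for k
      by (auto simp: e_def indicator_def)
    have "Np p (indicator \<Omega> :: 'a \<Rightarrow> real) = (\<integral>\<^sup>+x. indicator \<Omega> x \<partial>lborel)"
      unfolding Np_def by (intro nn_integral_cong) (auto simp: indicator_def)
    then show "Np p (indicator \<Omega> :: 'a \<Rightarrow> real) < \<infinity>" using finO by simp
  qed auto
  show ?thesis
    unfolding approximable_def
  proof (intro exI[of _ W] conjI allI)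
    fix j
    show "smooth (W j)" by (rule Ws)
    show "\<exists>K. compact K \<and> K \<subseteq> \<Omega> \<and> (\<forall>x. x \<notin> K \<longrightarrow> W j x \<le> 0)"
      unfolding W_def by (rule exI[of _ "K j"], intro conjI allI impI hK(2,3)) (erule hK(4))
  next
    have z0: "(\<lambda>k::nat. Np p (\<lambda>x::'a. 0::real)) \<longlonglongrightarrow> 0" by (simp add: Np_def)
    have t0: "(\<lambda>k. Np p (\<lambda>x. - (indicator \<Omega> x *\<^sub>R (\<theta> k x - f2 x)))) \<longlonglongrightarrow> 0"
      using \<theta>(2) by (simp only: Np_uminus)
    have "(\<lambda>k. Np p (\<lambda>x. indicator \<Omega> x *\<^sub>R (\<phi> k x - f1 x) + (- (indicator \<Omega> x *\<^sub>R (\<theta> k x - f2 x)) +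
        ((h k x - indicator \<Omega> x *\<^sub>R g x) + (indicator \<Omega> x *\<^sub>R (- e k) + 0))))) \<longlonglongrightarrow> 0"
      by (rule Np_sum3_tendsto[OF p0 _ _ _ \<phi>(2) t0 Np_sum3_tendsto[OF p0 _ _ _ h0 c0 z0]]) measurable
    then show "(\<lambda>j. Np p (\<lambda>x. indicator \<Omega> x *\<^sub>R (W j x - (f1 x - f2 x + g x)))) \<longlonglongrightarrow> 0"
    proof (rule tendsto_0_le_ennreal)
      fix j
      show "Np p (\<lambda>x. indicator \<Omega> x *\<^sub>R (W j x - (f1 x - f2 x + g x))) \<le>
        Np p (\<lambda>x. indicator \<Omega> x *\<^sub>R (\<phi> j x - f1 x) + (- (indicator \<Omega> x *\<^sub>R (\<theta> j x - f2 x)) +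
        ((h j x - indicator \<Omega> x *\<^sub>R g x) + (indicator \<Omega> x *\<^sub>R (- e j) + 0))))"
        using p by (intro Np_mono) (auto simp: W_def indicator_def)
    qed
  next
    have t1: "(\<lambda>k. Np p (\<lambda>x. - (indicator \<Omega> x *\<^sub>R (grad (\<theta> k) x - F2 x)))) \<longlonglongrightarrow> 0"
      using \<theta>(3) by (simp only: Np_uminus)
    have "(\<lambda>k. Np p (\<lambda>x. indicator \<Omega> x *\<^sub>R (grad (\<phi> k) x - F1 x) + (- (indicator \<Omega> x *\<^sub>R (grad (\<theta> k) x - F2 x)) +
        indicator (K k) x *\<^sub>R (grad (h k) x - G x)))) \<longlonglongrightarrow> 0"
      by (rule Np_sum3_tendsto[OF p0 _ _ _ \<phi>(3) t1 H0]) measurable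
    moreover have "Np p (\<lambda>x. indicator {x. W k x > 0} x *\<^sub>R (grad (W k) x - (F1 x - F2 x + G x))) \<le>
      Np p (\<lambda>x. indicator \<Omega> x *\<^sub>R (grad (\<phi> k) x - F1 x) + (- (indicator \<Omega> x *\<^sub>R (grad (\<theta> k) x - F2 x)) +
        indicator (K k) x *\<^sub>R (grad (h k) x - G x)))" for k
    proof (rule Np_mono)
      fix x
      show "norm (indicator {x. W k x > 0} x *\<^sub>R (grad (W k) x - (F1 x - F2 x + G x))) \<le>
        norm (indicator \<Omega> x *\<^sub>R (grad (\<phi> k) x - F1 x) + (- (indicator \<Omega> x *\<^sub>R (grad (\<theta> k) x - F2 x)) +
        indicator (K k) x *\<^sub>R (grad (h k) x - G x)))"
      proof (cases "W k x > 0")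
        case True
        \<comment> \<open>Positivity of \<open>W k\<close> forces the point into \<open>K k\<close>,
          the only region where \<open>grad (h k)\<close> is controlled. This is why
          \<open>approximable\<close> asks for convergence of gradients on \<open>{W > 0}\<close>
          alone.\<close>
        then have "x \<in> K k" using hK(4)[of x k] by (force simp: W_def)
        then have "x \<in> \<Omega>" using hK(3) by blast
        with \<open>x \<in> K k\<close> True show ?thesis by (simp add: Wg algebra_simps)
      qed simp
    qed (use p in simp)
    ultimately show "(\<lambda>j. Np p (\<lambda>x. indicator {x. W j x > 0} x *\<^sub>R (grad (W j) x - (F1 x - F2 x + G x)))) \<longlonglongrightarrow> 0"
      by (rule tendsto_0_le_ennreal)
  qed
qed

section \<open>The evolution identity\<close>

lemma fst_borel[measurable]: "fst \<in> borel_measurable (borel :: ('a::euclidean_space \<times> 'b::euclidean_space) measure)"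
  and snd_borel[measurable]: "snd \<in> borel_measurable (borel :: ('a::euclidean_space \<times> 'b::euclidean_space) measure)"
  by (intro borel_measurable_continuous_onI continuous_intros)+

lemma nn_integral_lborel_pair:
  fixes f :: "'a::euclidean_space \<times> 'b::euclidean_space \<Rightarrow> ennreal"
  assumes [measurable]: "f \<in> borel_measurable borel"
  shows "(\<integral>\<^sup>+z. f z \<partial>lborel) = (\<integral>\<^sup>+x. \<integral>\<^sup>+t. f (x, t) \<partial>lborel \<partial>lborel)"
    and "(\<integral>\<^sup>+z. f z \<partial>lborel) = (\<integral>\<^sup>+t. \<integral>\<^sup>+x. f (x, t) \<partial>lborel \<partial>lborel)"
proof -
  have m: "f \<in> borel_measurable (lborel \<Otimes>\<^sub>M lborel)" unfolding lborel_prod by simp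
  show "(\<integral>\<^sup>+z. f z \<partial>lborel) = (\<integral>\<^sup>+x. \<integral>\<^sup>+t. f (x, t) \<partial>lborel \<partial>lborel)"
    using lborel.nn_integral_fst[OF m] unfolding lborel_prod by simp
  then show "(\<integral>\<^sup>+z. f z \<partial>lborel) = (\<integral>\<^sup>+t. \<integral>\<^sup>+x. f (x, t) \<partial>lborel \<partial>lborel)"
    using lborel_pair.Fubini[OF m] by simp
qed

lemma integral_lborel_pair:
  fixes f :: "'a::euclidean_space \<times> 'b::euclidean_space \<Rightarrow> 'c::euclidean_space"
  assumes "integrable lborel f"
  shows "(LINT z|lborel. f z) = (LINT x|lborel. LINT t|lborel. f (x, t))"
    and "(LINT z|lborel. f z) = (LINT t|lborel. LINT x|lborel. f (x, t))"
    and "AE x in lborel. integrable lborel (\<lambda>t. f (x, t))"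
    and "AE t in lborel. integrable lborel (\<lambda>x. f (x, t))"
    and "integrable lborel (\<lambda>x. LINT t|lborel. f (x, t))"
    and "integrable lborel (\<lambda>t. LINT x|lborel. f (x, t))"
proof -
  have i: "integrable (lborel \<Otimes>\<^sub>M lborel) (case_prod (\<lambda>x t. f (x, t)))"
    using assms unfolding lborel_prod by simp
  show "AE x in lborel. integrable lborel (\<lambda>t. f (x, t))" using lborel_pair.AE_integrable_fst[OF i] by simp
  show "AE t in lborel. integrable lborel (\<lambda>x. f (x, t))" using lborel_pair.AE_integrable_snd[OF i] by simp
  show "integrable lborel (\<lambda>x. LINT t|lborel. f (x, t))" using lborel_pair.integrable_fst[OF i] by simp
  show "integrable lborel (\<lambda>t. LINT x|lborel. f (x, t))" using lborel_pair.integrable_snd[OF i] by simp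
  show "(LINT z|lborel. f z) = (LINT x|lborel. LINT t|lborel. f (x, t))"
    using lborel_pair.integral_fst[OF i] by (simp add: lborel_prod)
  show "(LINT z|lborel. f z) = (LINT t|lborel. LINT x|lborel. f (x, t))"
    using lborel_pair.integral_snd[OF i] by (simp add: lborel_prod)
qed

lemma AE_lborel_pair:
  assumes "AE z in (lborel :: ('a::euclidean_space \<times> 'b::euclidean_space) measure). P z"
  shows "AE x in lborel. AE t in lborel. P (x, t)" "AE t in lborel. AE x in lborel. P (x, t)"
proof -
  have a: "AE z in (lborel :: 'a measure) \<Otimes>\<^sub>M (lborel :: 'b measure). P z" using assms unfolding lborel_prod .
  then show "AE x in lborel. AE t in lborel. P (x, t)" by (rule lborel_pair.AE_pair)
  have "AE z in lborel \<Otimes>\<^sub>M lborel. P (snd z, fst z)"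
  proof -
    have "AE z in distr (lborel \<Otimes>\<^sub>M lborel) (lborel \<Otimes>\<^sub>M lborel) (\<lambda>(x, y). (y, x)). P z"
      by (subst lborel_pair.distr_pair_swap[symmetric]) (rule a)
    then show ?thesis
      by (rule AE_distrD[rotated, THEN AE_mp]) (auto simp: case_prod_beta)
  qed
  then show "AE t in lborel. AE x in lborel. P (x, t)"
    using lborel_pair.AE_pair[of "\<lambda>z. P (snd z, fst z)"] by simp
qed

section \<open>Averages in time\<close>

lemma mollifier_real: "mollifier h (t::real) = bump (t / h) / h"
  by (simp add: mollifier_def)

lemma smooth_step_scaled_derivative:
  assumes "h > 0"
  shows "((\<lambda>t. smooth_step ((t - c) / h)) has_field_derivative mollifier h (t - c)) (at t)"
proof -
  have "((\<lambda>t. (t - c) / h) has_field_derivative 1 / h) (at t)"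
    using assms by (auto intro!: derivative_eq_intros)
  from DERIV_chain2[OF smooth_step_derivative this] show ?thesis by (simp add: mollifier_real)
qed

lemma smooth_scaled_step: "smooth (\<lambda>t. smooth_step ((t - c) / h))"
proof -
  have "smooth (\<lambda>t::real. smooth_step (- c / h + t * inverse h))"
    by (rule smooth_affine[OF bounded_linear_mult_left smooth_smooth_step])
  then show ?thesis by (simp add: divide_inverse algebra_simps)
qed

lemma smooth_step_tendsto:
  assumes "h \<longlonglongrightarrow> 0" "\<And>j. h j > 0"
  shows "(\<lambda>j. smooth_step (r / h j)) \<longlonglongrightarrow> (if r > 0 then 1 else 0)"
proof (cases "r > 0")
  case True
  have "eventually (\<lambda>j. h j < r) sequentially" using assms(1) True by (rule order_tendstoD)
  then have "eventually (\<lambda>j. smooth_step (r / h j) = 1) sequentially"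
    by eventually_elim (rule smooth_step_1, use assms(2) in \<open>simp add: pos_le_divide_eq\<close>)
  then show ?thesis using True by (simp add: tendsto_eventually)
next
  case False
  have "smooth_step (r / h j) = 0" for j
    using False assms(2)[of j] by (intro smooth_step_0) (simp add: divide_nonpos_pos)
  then show ?thesis using False by simp
qed

text \<open>The average looks forward, over times between \<open>t\<close> and \<open>t + h\<close>.
  Its kernel is the time derivative of \<open>smooth_step ((\<tau> - t) / h)\<close>, so these
  averages are what a smoothed time cut-off produces when it is differentiated.\<close>

definition time_mollify :: "real \<Rightarrow> ('a::euclidean_space \<times> real \<Rightarrow> real) \<Rightarrow> 'a \<times> real \<Rightarrow> real" where
  "time_mollify h \<beta> z = (LINT \<tau>|lborel. mollifier h (\<tau> - snd z) * \<beta> (fst z, \<tau>))"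

lemma time_mollify_borel[measurable]:
  assumes [measurable]: "\<beta> \<in> borel_measurable borel"
  shows "time_mollify h \<beta> \<in> borel_measurable borel"
proof -
  have "(\<lambda>z. LINT \<tau>|lborel. mollifier h (\<tau> - snd z) * \<beta> (fst z, \<tau>)) \<in> borel_measurable (borel :: ('a \<times> real) measure)"
    by (rule lborel.borel_measurable_lebesgue_integral) (simp add: case_prod_beta borel_prod[symmetric])
  then show ?thesis by (simp add: time_mollify_def[abs_def])
qed

text \<open>Averaging of translation errors as for spatial mollification, with exponent 1.
  Integrability of the time slices is known for almost every \<open>x\<close> only, but for such an
  \<open>x\<close> the pointwise bound holds at all times, which is what the order of integration
  requires.\<close>

lemma Np_time_mollify:
  fixes \<beta> :: "'a::euclidean_space \<times> real \<Rightarrow> real"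
  assumes h: "h > 0" and \<beta>: "integrable lborel \<beta>"
    and e: "\<And>s. 0 \<le> s \<Longrightarrow> s \<le> h \<Longrightarrow> Np 1 (\<lambda>z. \<beta> (z + (0, s)) - \<beta> z) \<le> e"
  shows "(\<integral>\<^sup>+t. \<integral>\<^sup>+x. ennreal \<bar>time_mollify h \<beta> (x, t) - \<beta> (x, t)\<bar> \<partial>lborel \<partial>lborel) \<le> e"
proof -
  have [measurable]: "\<beta> \<in> borel_measurable borel" using \<beta> by auto
  have m0: "mollifier h s = 0" if "s \<le> 0 \<or> s \<ge> h" for s :: real
    using that h by (auto simp: mollifier_real intro!: bump_0 simp: divide_nonpos_pos)
  have shift: "time_mollify h \<beta> (x, t) = (LINT s|lborel. mollifier h s * \<beta> (x, t + s))" for x t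
    using lborel_integral_real_affine[of 1 "\<lambda>\<tau>. mollifier h (\<tau> - t) * \<beta> (x, \<tau>)" t] by (simp add: time_mollify_def)
  have "AE x in lborel. integrable lborel (\<lambda>t. \<beta> (x, t))" by (rule integral_lborel_pair(3)[OF \<beta>])
  then have "AE x in lborel. \<forall>t. ennreal \<bar>time_mollify h \<beta> (x, t) - \<beta> (x, t)\<bar> \<le>
      (\<integral>\<^sup>+s. ennreal (mollifier h s * \<bar>\<beta> (x, t + s) - \<beta> (x, t)\<bar>) \<partial>lborel)"
  proof eventually_elim
    case (elim x)
    show ?case
    proof
      fix t
      obtain M where M: "M > 0" "\<And>s::real. mollifier h s \<le> M" using mollifier_bounded[OF h] by blast
      have "integrable lborel (\<lambda>s. \<beta> (x, t + 1 * s))"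
        using lborel_integrable_real_affine[OF elim, of 1 t] by simp
      then have "integrable lborel (\<lambda>s. M * \<bar>\<beta> (x, t + s)\<bar>)" by auto
      then have i1: "integrable lborel (\<lambda>s. mollifier h s * \<beta> (x, t + s))"
        by (rule Bochner_Integration.integrable_bound)
          (use M mollifier_nonneg[OF h, where 'a=real] in \<open>auto simp: abs_mult intro!: AE_I2 mult_right_mono\<close>)
      have i2: "integrable lborel (\<lambda>s. mollifier h (s::real) * \<beta> (x, t))"
        using mollifier_integrable[OF h, where 'a=real] by auto
      have i3: "integrable lborel (\<lambda>s. mollifier h s * (\<beta> (x, t + s) - \<beta> (x, t)))"
        using Bochner_Integration.integrable_diff[OF i1 i2] by (simp add: right_diff_distrib)
      have "time_mollify h \<beta> (x, t) - \<beta> (x, t) = (LINT s|lborel. mollifier h s * (\<beta> (x, t + s) - \<beta> (x, t)))"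
        unfolding shift right_diff_distrib using i1 i2 mollifier_integral[OF h, where 'a=real] mollifier_integrable[OF h, where 'a=real] by simp
      then have "ennreal \<bar>time_mollify h \<beta> (x, t) - \<beta> (x, t)\<bar> = ennreal (norm (LINT s|lborel. mollifier h s * (\<beta> (x, t + s) - \<beta> (x, t))))"
        by simp
      also have "\<dots> \<le> (\<integral>\<^sup>+s. ennreal (norm (mollifier h s * (\<beta> (x, t + s) - \<beta> (x, t)))) \<partial>lborel)"
        by (rule integral_norm_bound_ennreal[OF i3])
      also have "\<dots> = (\<integral>\<^sup>+s. ennreal (mollifier h s * \<bar>\<beta> (x, t + s) - \<beta> (x, t)\<bar>) \<partial>lborel)"
        using mollifier_nonneg[OF h, where 'a=real] by (simp add: abs_mult)
      finally show "ennreal \<bar>time_mollify h \<beta> (x, t) - \<beta> (x, t)\<bar> \<le> (\<integral>\<^sup>+s. ennreal (mollifier h s * \<bar>\<beta> (x, t + s) - \<beta> (x, t)\<bar>) \<partial>lborel)" .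
    qed
  qed
  note pt = this
  have "(\<integral>\<^sup>+t. \<integral>\<^sup>+x. ennreal \<bar>time_mollify h \<beta> (x, t) - \<beta> (x, t)\<bar> \<partial>lborel \<partial>lborel) \<le>
    (\<integral>\<^sup>+t. \<integral>\<^sup>+x. \<integral>\<^sup>+s. ennreal (mollifier h s * \<bar>\<beta> (x, t + s) - \<beta> (x, t)\<bar>) \<partial>lborel \<partial>lborel \<partial>lborel)"
    by (intro nn_integral_mono nn_integral_mono_AE eventually_mono[OF pt]) blast
  also have "\<dots> = (\<integral>\<^sup>+t. \<integral>\<^sup>+s. \<integral>\<^sup>+x. ennreal (mollifier h s * \<bar>\<beta> (x, t + s) - \<beta> (x, t)\<bar>) \<partial>lborel \<partial>lborel \<partial>lborel)"
    by (intro nn_integral_cong lborel_pair.Fubini') measurable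
  also have "\<dots> = (\<integral>\<^sup>+s. \<integral>\<^sup>+t. \<integral>\<^sup>+x. ennreal (mollifier h s * \<bar>\<beta> (x, t + s) - \<beta> (x, t)\<bar>) \<partial>lborel \<partial>lborel \<partial>lborel)"
    by (rule lborel_pair.Fubini') measurable
  also have "\<dots> = (\<integral>\<^sup>+s. ennreal (mollifier h s) * Np 1 (\<lambda>z. \<beta> (z + (0, s)) - \<beta> z) \<partial>lborel)"
  proof (rule nn_integral_cong)
    fix s :: real
    have "(\<integral>\<^sup>+t. \<integral>\<^sup>+x. ennreal (mollifier h s * \<bar>\<beta> (x, t + s) - \<beta> (x, t)\<bar>) \<partial>lborel \<partial>lborel)
      = (\<integral>\<^sup>+t. \<integral>\<^sup>+x. ennreal (mollifier h s) * ennreal \<bar>\<beta> ((x, t) + (0, s)) - \<beta> (x, t)\<bar> \<partial>lborel \<partial>lborel)"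
      using mollifier_nonneg[OF h, where 'a=real] by (simp add: ennreal_mult')
    also have "\<dots> = (\<integral>\<^sup>+z. ennreal (mollifier h s) * ennreal \<bar>\<beta> (z + (0, s)) - \<beta> z\<bar> \<partial>lborel)"
      by (rule nn_integral_lborel_pair(2)[symmetric]) measurable
    also have "\<dots> = ennreal (mollifier h s) * Np 1 (\<lambda>z. \<beta> (z + (0, s)) - \<beta> z)"
      unfolding Np_def by (subst nn_integral_cmult) auto
    finally show "(\<integral>\<^sup>+t. \<integral>\<^sup>+x. ennreal (mollifier h s * \<bar>\<beta> (x, t + s) - \<beta> (x, t)\<bar>) \<partial>lborel \<partial>lborel)
      = ennreal (mollifier h s) * Np 1 (\<lambda>z. \<beta> (z + (0, s)) - \<beta> z)" .
  qed
  also have "\<dots> \<le> (\<integral>\<^sup>+s. ennreal (mollifier h (s::real)) * e \<partial>lborel)"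
  proof (rule nn_integral_mono)
    fix s :: real
    show "ennreal (mollifier h s) * Np 1 (\<lambda>z. \<beta> (z + (0, s)) - \<beta> z) \<le> ennreal (mollifier h s) * e"
      using e[of s] m0[of s] by (cases "0 \<le> s \<and> s \<le> h") (auto intro: mult_left_mono)
  qed
  also have "\<dots> = e" using mollifier_nn_integral[OF h, where 'a=real] by (simp add: nn_integral_multc)
  finally show ?thesis .
qed

lemma nn_integral_tendsto_0_AE_subseq:
  fixes D :: "nat \<Rightarrow> 'a \<Rightarrow> ennreal"
  assumes [measurable]: "\<And>j. D j \<in> borel_measurable M" and lim: "(\<lambda>j. \<integral>\<^sup>+x. D j x \<partial>M) \<longlonglongrightarrow> 0"
  obtains r where "strict_mono r" "AE x in M. (\<lambda>j. D (r j) x) \<longlonglongrightarrow> 0"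
proof -
  have "eventually (\<lambda>j. (\<integral>\<^sup>+x. D j x \<partial>M) < ennreal 1) sequentially"
    using lim unfolding ennreal_tendsto_0_iff using zero_less_one by blast
  then obtain n0 where n0: "\<And>j. j \<ge> n0 \<Longrightarrow> (\<integral>\<^sup>+x. D j x \<partial>M) < ennreal 1"
    unfolding eventually_sequentially by blast
  \<comment> \<open>The shift by \<open>n0\<close> discards the members whose integral might be
    infinite; the remaining ones are almost everywhere finite and can be treated as real
    functions.\<close>
  define u where "u j x = enn2real (D (j + n0) x)" for j x
  have fin: "AE x in M. D (j + n0) x \<noteq> \<infinity>" for j
    by (rule nn_integral_PInf_AE) (use n0[of "j + n0"] in auto)
  have nn: "(\<integral>\<^sup>+x. ennreal (u j x) \<partial>M) = (\<integral>\<^sup>+x. D (j + n0) x \<partial>M)" for j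
    by (rule nn_integral_cong_AE) (use fin[of j] in \<open>auto simp: u_def less_top elim!: eventually_mono\<close>)
  have um[measurable]: "u j \<in> borel_measurable M" for j unfolding u_def by measurable
  have ui: "integrable M (u j)" for j
    by (rule integrableI_nonneg) (use nn[of j] n0[of "j + n0"] in \<open>auto simp: u_def intro: order.strict_trans\<close>)
  have "(\<lambda>j. \<integral>x. norm (u j x) \<partial>M) \<longlonglongrightarrow> 0"
  proof -
    have "ennreal (\<integral>x. norm (u j x) \<partial>M) = (\<integral>\<^sup>+x. D (j + n0) x \<partial>M)" for j
      using nn_integral_eq_integral[OF integrable_norm[OF ui[of j]]] nn[of j] by (simp add: u_def)
    then have "(\<lambda>j. ennreal (\<integral>x. norm (u j x) \<partial>M)) \<longlonglongrightarrow> ennreal 0"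
      using LIMSEQ_ignore_initial_segment[OF lim, of n0] by simp
    then show ?thesis by (subst (asm) tendsto_ennreal_iff) (auto intro!: always_eventually)
  qed
  from tendsto_L1_AE_subseq[OF ui this]
  obtain r where r: "strict_mono r" "AE x in M. (\<lambda>n. u (r n) x) \<longlonglongrightarrow> 0" by blast
  show ?thesis
  proof (rule that[of "\<lambda>j. r j + n0"])
    show "strict_mono (\<lambda>j. r j + n0)" using r(1) by (simp add: strict_mono_def)
    have "AE x in M. \<forall>j. D (j + n0) x \<noteq> \<infinity>" using fin by (subst AE_all_countable) blast
    with r(2) show "AE x in M. (\<lambda>j. D (r j + n0) x) \<longlonglongrightarrow> 0"
    proof eventually_elim
      case (elim x)
      have "(\<lambda>j. ennreal (u (r j) x)) \<longlonglongrightarrow> ennreal 0" using elim(1) by (rule tendsto_ennrealI)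
      moreover have "ennreal (u (r j) x) = D (r j + n0) x" for j using elim(2) by (simp add: u_def less_top)
      ultimately show ?case by simp
    qed
  qed
qed

text \<open>Convergence in \<open>L^1\<close> of space-time becomes, along a subsequence,
  convergence in \<open>L^1\<close> of space at almost every time. The good times are thereby fixed
  before any test function is chosen.\<close>

lemma time_mollify_subseq:
  fixes \<beta> :: "'a::euclidean_space \<times> real \<Rightarrow> real"
  assumes \<beta>: "integrable lborel \<beta>"
  obtains h where "\<And>j::nat. h j > 0" "h \<longlonglongrightarrow> 0"
    "AE t in lborel. (\<lambda>j. \<integral>\<^sup>+x. ennreal \<bar>time_mollify (h j) \<beta> (x, t) - \<beta> (x, t)\<bar> \<partial>lborel) \<longlonglongrightarrow> 0"
proof -
  have [measurable]: "\<beta> \<in> borel_measurable borel" using \<beta> by auto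
  have lim: "(\<lambda>j. \<integral>\<^sup>+t. \<integral>\<^sup>+x. ennreal \<bar>time_mollify (1 / Suc j) \<beta> (x, t) - \<beta> (x, t)\<bar> \<partial>lborel \<partial>lborel) \<longlonglongrightarrow> 0"
    unfolding ennreal_tendsto_0_iff
  proof (intro allI impI)
    fix e :: real assume e: "e > 0"
    from translation_continuous_L1[OF \<beta>, unfolded translation_continuous_def ennreal_tendsto_0_iff, rule_format, of "e / 2"]
    have "eventually (\<lambda>h. Np 1 (\<lambda>z. \<beta> (z + h) - \<beta> z) < ennreal (e / 2)) (nhds 0)" using e by simp
    then obtain d where d: "d > 0" "\<And>h. dist h 0 < d \<Longrightarrow> Np 1 (\<lambda>z. \<beta> (z + h) - \<beta> z) < ennreal (e / 2)"
      unfolding eventually_nhds_metric by blast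
    have "eventually (\<lambda>j. 1 / real (Suc j) < d) sequentially"
      using order_tendstoD(2)[OF LIMSEQ_Suc[OF lim_1_over_n] d(1)] by simp
    then show "eventually (\<lambda>j. (\<integral>\<^sup>+t. \<integral>\<^sup>+x. ennreal \<bar>time_mollify (1 / Suc j) \<beta> (x, t) - \<beta> (x, t)\<bar> \<partial>lborel \<partial>lborel) < ennreal e) sequentially"
    proof eventually_elim
      case (elim j)
      have "(\<integral>\<^sup>+t. \<integral>\<^sup>+x. ennreal \<bar>time_mollify (1 / Suc j) \<beta> (x, t) - \<beta> (x, t)\<bar> \<partial>lborel \<partial>lborel) \<le> ennreal (e / 2)"
      proof (rule Np_time_mollify[OF _ \<beta>])
        fix s assume s: "0 \<le> s" "s \<le> 1 / real (Suc j)"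
        then have "dist (0::'a, s) 0 < d" using elim by (simp add: dist_norm norm_Pair)
        then show "Np 1 (\<lambda>z. \<beta> (z + (0, s)) - \<beta> z) \<le> ennreal (e / 2)" using d(2) less_imp_le by blast
      qed simp
      also have "\<dots> < ennreal e" using e by (intro ennreal_lessI) auto
      finally show ?case .
    qed
  qed
  have m: "(\<lambda>t. \<integral>\<^sup>+x. ennreal \<bar>time_mollify (1 / Suc j) \<beta> (x, t) - \<beta> (x, t)\<bar> \<partial>lborel) \<in> borel_measurable lborel" for j
    by measurable
  obtain r where r: "strict_mono r" "AE t in lborel. (\<lambda>j. \<integral>\<^sup>+x. ennreal \<bar>time_mollify (1 / Suc (r j)) \<beta> (x, t) - \<beta> (x, t)\<bar> \<partial>lborel) \<longlonglongrightarrow> 0"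
    by (rule nn_integral_tendsto_0_AE_subseq[OF m lim])
  show ?thesis
  proof (rule that[of "\<lambda>j. 1 / Suc (r j)", OF _ _ r(2)])
    show "(\<lambda>j. 1 / real (Suc (r j))) \<longlonglongrightarrow> 0"
      using LIMSEQ_subseq_LIMSEQ[OF LIMSEQ_Suc[OF lim_1_over_n] r(1)] by (simp add: o_def)
  qed simp
qed

text \<open>Testing with \<open>\<phi>\<close> times a smoothed indicator of
  \<open>{t1<..t2}\<close> leaves the time averages of \<open>\<beta>\<close> at \<open>t1\<close>
  and \<open>t2\<close>, which converge for times in \<open>S\<close>. It is essential that
  \<open>S\<close> does not depend on \<open>\<phi>\<close>: the test functions used later are built
  from the solutions at the time \<open>t2\<close> itself.\<close>

lemma evolution_identity:
  fixes \<beta> :: "'a::euclidean_space \<times> real \<Rightarrow> real" and A :: "'a \<times> real \<Rightarrow> 'a"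
  assumes \<beta>: "integrable lborel \<beta>" and A: "integrable lborel A"
    and eq: "\<And>\<phi> \<theta>. \<phi> \<in> test_functions \<Omega> \<Longrightarrow> \<theta> \<in> test_functions {0<..<T} \<Longrightarrow>
      (LINT z|lborel. - \<beta> z * (\<phi> (fst z) * deriv \<theta> (snd z)) + A z \<bullet> (\<theta> (snd z) *\<^sub>R grad \<phi> (fst z))) = 0"
  obtains S where "AE t in lborel. t \<in> S"
    "\<And>t. t \<in> S \<Longrightarrow> integrable lborel (\<lambda>x. \<beta> (x, t))"
    "\<And>t1 t2 \<phi>. t1 \<in> S \<Longrightarrow> t2 \<in> S \<Longrightarrow> 0 < t1 \<Longrightarrow> t1 < t2 \<Longrightarrow> t2 < T \<Longrightarrow> \<phi> \<in> test_functions \<Omega> \<Longrightarrow>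
      (LINT x|lborel. (\<beta> (x, t2) - \<beta> (x, t1)) * \<phi> x) = - (LINT z|lborel. indicator {t1<..t2} (snd z) * (A z \<bullet> grad \<phi> (fst z)))"
proof -
  have [measurable]: "\<beta> \<in> borel_measurable borel" "A \<in> borel_measurable borel" using \<beta> A by auto
  obtain h where h: "\<And>j::nat. h j > 0" "h \<longlonglongrightarrow> 0"
    "AE t in lborel. (\<lambda>j. \<integral>\<^sup>+x. ennreal \<bar>time_mollify (h j) \<beta> (x, t) - \<beta> (x, t)\<bar> \<partial>lborel) \<longlonglongrightarrow> 0"
    using time_mollify_subseq[OF \<beta>] by blast
  define S where "S = {t. integrable lborel (\<lambda>x. \<beta> (x, t)) \<and>
    (\<lambda>j. \<integral>\<^sup>+x. ennreal \<bar>time_mollify (h j) \<beta> (x, t) - \<beta> (x, t)\<bar> \<partial>lborel) \<longlonglongrightarrow> 0}"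
  have "AE t in lborel. t \<in> S"
    using h(3) integral_lborel_pair(4)[OF \<beta>] by eventually_elim (simp add: S_def)
  moreover have "(LINT x|lborel. (\<beta> (x, t2) - \<beta> (x, t1)) * \<phi> x) = - (LINT z|lborel. indicator {t1<..t2} (snd z) * (A z \<bullet> grad \<phi> (fst z)))"
    if t: "t1 \<in> S" "t2 \<in> S" "0 < t1" "t1 < t2" "t2 < T" and \<phi>: "\<phi> \<in> test_functions \<Omega>" for t1 t2 \<phi>
  proof -
    have \<phi>s: "smooth \<phi>" using test_functionsD(1)[OF \<phi>] .
    note [measurable] = smooth_borel[OF \<phi>s] smooth_grad_borel[OF \<phi>s]
    obtain M where M: "M > 0" "\<And>x. \<bar>\<phi> x\<bar> \<le> M" "\<And>x. norm (grad \<phi> x) \<le> M" using test_function_bounded[OF \<phi>] by metis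
    have intK: "integrable lborel (\<lambda>z. (mollifier (h j) (snd z - t) * \<beta> z) * \<phi> (fst z))" for j t
    proof -
      obtain B where B: "B > 0" "\<And>s::real. mollifier (h j) s \<le> B" using mollifier_bounded[OF h(1)] by blast
      have "integrable lborel (\<lambda>z. (B * M) * \<bar>\<beta> z\<bar>)" using \<beta> by auto
      then show ?thesis
      proof (rule Bochner_Integration.integrable_bound)
        show "AE z in lborel. norm ((mollifier (h j) (snd z - t) * \<beta> z) * \<phi> (fst z)) \<le> norm ((B * M) * \<bar>\<beta> z\<bar>)"
        proof (rule AE_I2)
          fix z :: "'a \<times> real"
          have "\<bar>mollifier (h j) (snd z - t)\<bar> * \<bar>\<phi> (fst z)\<bar> \<le> B * M"
            using B M mollifier_nonneg[OF h(1)[of j], of "snd z - t"] by (intro mult_mono) auto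
          from mult_right_mono[OF this abs_ge_zero[of "\<beta> z"]] B(1) M(1)
          show "norm ((mollifier (h j) (snd z - t) * \<beta> z) * \<phi> (fst z)) \<le> norm ((B * M) * \<bar>\<beta> z\<bar>)"
            by (simp add: abs_mult mult_ac)
        qed
      qed simp
    qed
    define m where "m j t = (LINT z|lborel. (mollifier (h j) (snd z - t) * \<beta> z) * \<phi> (fst z))" for j t
    have m_eq: "m j t = (LINT x|lborel. time_mollify (h j) \<beta> (x, t) * \<phi> x)" for j t
      unfolding m_def using integral_lborel_pair(1)[OF intK[of j t]] by (simp add: time_mollify_def)
    have m_int: "integrable lborel (\<lambda>x. time_mollify (h j) \<beta> (x, t) * \<phi> x)" for j t
      using integral_lborel_pair(5)[OF intK[of j t]] by (simp add: time_mollify_def)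
    have m_lim: "(\<lambda>j. m j t) \<longlonglongrightarrow> (LINT x|lborel. \<beta> (x, t) * \<phi> x)" if "t \<in> S" for t
    proof -
      have bi: "integrable lborel (\<lambda>x. \<beta> (x, t))" and bl: "(\<lambda>j. \<integral>\<^sup>+x. ennreal \<bar>time_mollify (h j) \<beta> (x, t) - \<beta> (x, t)\<bar> \<partial>lborel) \<longlonglongrightarrow> 0"
        using that by (auto simp: S_def)
      have "integrable lborel (\<lambda>x. M * \<bar>\<beta> (x, t)\<bar>)" using bi by auto
      then have bfi: "integrable lborel (\<lambda>x. \<beta> (x, t) * \<phi> x)"
        by (rule Bochner_Integration.integrable_bound) (use M in \<open>auto simp: abs_mult mult.commute[of M] intro!: AE_I2 mult_left_mono\<close>)
      have "(\<lambda>j. ennreal \<bar>m j t - (LINT x|lborel. \<beta> (x, t) * \<phi> x)\<bar>) \<longlonglongrightarrow> 0"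
      proof (rule tendsto_0_le_ennreal)
        show "(\<lambda>j. ennreal M * (\<integral>\<^sup>+x. ennreal \<bar>time_mollify (h j) \<beta> (x, t) - \<beta> (x, t)\<bar> \<partial>lborel)) \<longlonglongrightarrow> 0"
          using ennreal_tendsto_cmult[OF _ bl, of "ennreal M"] by simp
        fix j
        have "m j t - (LINT x|lborel. \<beta> (x, t) * \<phi> x) = (LINT x|lborel. time_mollify (h j) \<beta> (x, t) * \<phi> x - \<beta> (x, t) * \<phi> x)"
          unfolding m_eq using m_int bfi by simp
        then have "ennreal \<bar>m j t - (LINT x|lborel. \<beta> (x, t) * \<phi> x)\<bar> = ennreal (norm (LINT x|lborel. time_mollify (h j) \<beta> (x, t) * \<phi> x - \<beta> (x, t) * \<phi> x))"
          by simp
        also have "\<dots> \<le> (\<integral>\<^sup>+x. ennreal (norm (time_mollify (h j) \<beta> (x, t) * \<phi> x - \<beta> (x, t) * \<phi> x)) \<partial>lborel)"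
          by (rule integral_norm_bound_ennreal) (use m_int bfi in auto)
        also have "\<dots> \<le> (\<integral>\<^sup>+x. ennreal M * ennreal \<bar>time_mollify (h j) \<beta> (x, t) - \<beta> (x, t)\<bar> \<partial>lborel)"
        proof (rule nn_integral_mono)
          fix x
          have "\<bar>time_mollify (h j) \<beta> (x, t) * \<phi> x - \<beta> (x, t) * \<phi> x\<bar> = \<bar>\<phi> x\<bar> * \<bar>time_mollify (h j) \<beta> (x, t) - \<beta> (x, t)\<bar>"
            by (simp add: abs_mult[symmetric] algebra_simps)
          also have "\<dots> \<le> M * \<bar>time_mollify (h j) \<beta> (x, t) - \<beta> (x, t)\<bar>" using M by (intro mult_right_mono) auto
          finally show "ennreal (norm (time_mollify (h j) \<beta> (x, t) * \<phi> x - \<beta> (x, t) * \<phi> x)) \<le> ennreal M * ennreal \<bar>time_mollify (h j) \<beta> (x, t) - \<beta> (x, t)\<bar>"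
            using M(1) by (simp add: ennreal_mult'[symmetric] ennreal_leI)
        qed
        also have "\<dots> = ennreal M * (\<integral>\<^sup>+x. ennreal \<bar>time_mollify (h j) \<beta> (x, t) - \<beta> (x, t)\<bar> \<partial>lborel)"
          by (rule nn_integral_cmult) measurable
        finally show "ennreal \<bar>m j t - (LINT x|lborel. \<beta> (x, t) * \<phi> x)\<bar> \<le> ennreal M * (\<integral>\<^sup>+x. ennreal \<bar>time_mollify (h j) \<beta> (x, t) - \<beta> (x, t)\<bar> \<partial>lborel)" .
      qed
      then have "(\<lambda>j. ennreal \<bar>m j t - (LINT x|lborel. \<beta> (x, t) * \<phi> x)\<bar>) \<longlonglongrightarrow> ennreal 0" by simp
      then have "(\<lambda>j. \<bar>m j t - (LINT x|lborel. \<beta> (x, t) * \<phi> x)\<bar>) \<longlonglongrightarrow> 0"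
        by (subst (asm) tendsto_ennreal_iff) (auto intro!: always_eventually)
      then have "(\<lambda>j. m j t - (LINT x|lborel. \<beta> (x, t) * \<phi> x)) \<longlonglongrightarrow> 0" by (rule tendsto_rabs_zero_cancel)
      then show ?thesis by (rule LIM_zero_cancel)
    qed
    \<comment> \<open>The ramps lie to the right of \<open>t1\<close> and of \<open>t2\<close>, so
      the pointwise limit is the indicator of the half-open interval
      \<open>{t1<..t2}\<close>.\<close>
    define \<theta> where "\<theta> j \<tau> = smooth_step ((\<tau> - t1) / h j) - smooth_step ((\<tau> - t2) / h j)" for j \<tau>
    have \<theta>b: "\<bar>\<theta> j \<tau>\<bar> \<le> 1" for j \<tau>
      using smooth_step_bounds[of "(\<tau> - t1) / h j"] smooth_step_bounds[of "(\<tau> - t2) / h j"] by (simp add: \<theta>_def abs_le_iff)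
    have \<theta>m[measurable]: "\<theta> j \<in> borel_measurable borel" for j unfolding \<theta>_def by measurable
    have dom: "integrable lborel (\<lambda>z. M * norm (A z))" using A by auto
    have Ab: "\<bar>A z \<bullet> grad \<phi> (fst z)\<bar> \<le> M * norm (A z)" for z
      using Cauchy_Schwarz_ineq2[of "A z" "grad \<phi> (fst z)"] mult_left_mono[OF M(3)[of "fst z"] norm_ge_zero[of "A z"]]
      by (simp add: mult.commute)
    have Ai: "integrable lborel (\<lambda>z. \<theta> j (snd z) * (A z \<bullet> grad \<phi> (fst z)))" for j
    proof (rule Bochner_Integration.integrable_bound[OF dom])
      show "AE z in lborel. norm (\<theta> j (snd z) * (A z \<bullet> grad \<phi> (fst z))) \<le> norm (M * norm (A z))"
        using mult_mono[OF \<theta>b Ab] by (intro AE_I2) (auto simp: abs_mult M(1) less_imp_le)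
    qed measurable
    \<comment> \<open>The descending ramp ends at \<open>t2 + h j\<close>, which must stay below
      \<open>T\<close> for \<open>\<theta> j\<close> to be admissible; this is the case for all
      large \<open>j\<close>.\<close>
    have id: "m j t1 - m j t2 = (LINT z|lborel. \<theta> j (snd z) * (A z \<bullet> grad \<phi> (fst z)))" if "h j < T - t2" for j
    proof -
      have d: "deriv (\<theta> j) \<tau> = mollifier (h j) (\<tau> - t1) - mollifier (h j) (\<tau> - t2)" for \<tau>
        unfolding \<theta>_def by (intro DERIV_imp_deriv DERIV_diff smooth_step_scaled_derivative h(1))
      have "\<theta> j \<in> test_functions {0<..<T}"
      proof (rule test_functionsI)
        show "smooth (\<theta> j)" unfolding \<theta>_def by (intro smooth_diff smooth_scaled_step)
        show "compact {t1..t2 + h j}" by simp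
        show "{t1..t2 + h j} \<subseteq> {0<..<T}" using t that by auto
        fix \<tau> assume "\<tau> \<notin> {t1..t2 + h j}"
        then consider "\<tau> < t1" | "\<tau> > t2 + h j" by fastforce
        then show "\<theta> j \<tau> = 0"
        proof cases
          case 1
          then show ?thesis unfolding \<theta>_def using t h(1)[of j] by (simp add: smooth_step_0 divide_nonpos_pos)
        next
          case 2
          then show ?thesis unfolding \<theta>_def using t h(1)[of j] by (simp add: smooth_step_1 pos_le_divide_eq)
        qed
      qed
      from eq[OF \<phi> this]
      have "0 = (LINT z|lborel. \<theta> j (snd z) * (A z \<bullet> grad \<phi> (fst z)) -
         ((mollifier (h j) (snd z - t1) * \<beta> z) * \<phi> (fst z) - (mollifier (h j) (snd z - t2) * \<beta> z) * \<phi> (fst z)))"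
        unfolding d by (simp add: algebra_simps)
      also have "\<dots> = (LINT z|lborel. \<theta> j (snd z) * (A z \<bullet> grad \<phi> (fst z))) - (m j t1 - m j t2)"
        unfolding m_def using Ai[of j] intK[of j t1] intK[of j t2] by simp
      finally show ?thesis by simp
    qed
    have L1: "(\<lambda>j. LINT z|lborel. \<theta> j (snd z) * (A z \<bullet> grad \<phi> (fst z))) \<longlonglongrightarrow> (LINT z|lborel. indicator {t1<..t2} (snd z) * (A z \<bullet> grad \<phi> (fst z)))"
    proof (rule integral_dominated_convergence[OF _ _ dom])
      show "AE z in lborel. (\<lambda>j. \<theta> j (snd z) * (A z \<bullet> grad \<phi> (fst z))) \<longlonglongrightarrow> indicator {t1<..t2} (snd z) * (A z \<bullet> grad \<phi> (fst z))"
      proof (intro AE_I2 tendsto_mult tendsto_const)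
        fix z :: "'a \<times> real"
        have "(\<lambda>j. \<theta> j (snd z)) \<longlonglongrightarrow> (if snd z - t1 > 0 then 1 else 0) - (if snd z - t2 > 0 then 1 else 0)"
          unfolding \<theta>_def by (intro tendsto_diff smooth_step_tendsto h)
        also have "(if snd z - t1 > 0 then 1 else 0) - (if snd z - t2 > 0 then 1 else 0) = (indicator {t1<..t2} (snd z) :: real)"
          using t by (auto simp: indicator_def)
        finally show "(\<lambda>j. \<theta> j (snd z)) \<longlonglongrightarrow> indicator {t1<..t2} (snd z)" .
      qed
      show "AE z in lborel. norm (\<theta> j (snd z) * (A z \<bullet> grad \<phi> (fst z))) \<le> M * norm (A z)" for j
        using mult_mono[OF \<theta>b Ab] by (intro AE_I2) (auto simp: abs_mult)
    qed measurable
    have L2: "(\<lambda>j. m j t1 - m j t2) \<longlonglongrightarrow> (LINT x|lborel. \<beta> (x, t1) * \<phi> x) - (LINT x|lborel. \<beta> (x, t2) * \<phi> x)"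
      using t by (intro tendsto_diff m_lim)
    have L3: "eventually (\<lambda>j. m j t1 - m j t2 = (LINT z|lborel. \<theta> j (snd z) * (A z \<bullet> grad \<phi> (fst z)))) sequentially"
      using order_tendstoD(2)[OF h(2), of "T - t2"] t by (auto elim!: eventually_mono intro: id)
    have "(LINT x|lborel. \<beta> (x, t1) * \<phi> x) - (LINT x|lborel. \<beta> (x, t2) * \<phi> x) = (LINT z|lborel. indicator {t1<..t2} (snd z) * (A z \<bullet> grad \<phi> (fst z)))"
      by (rule LIMSEQ_unique[OF Lim_transform_eventually[OF L2 L3] L1])
    moreover have "integrable lborel (\<lambda>x. \<beta> (x, t) * \<phi> x)" if "t \<in> S" for t
    proof -
      have "integrable lborel (\<lambda>x. M * \<bar>\<beta> (x, t)\<bar>)" using that by (auto simp: S_def)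
      then show ?thesis
        by (rule Bochner_Integration.integrable_bound) (use M in \<open>auto simp: abs_mult mult.commute[of M] intro!: AE_I2 mult_left_mono\<close>)
    qed
    ultimately show ?thesis using t by (simp add: left_diff_distrib)
  qed
  ultimately show ?thesis by (intro that[of S]) (auto simp: S_def)
qed

section \<open>Functions of \<open>W_0^{1,p}\<close> as test functions\<close>

lemma Np_strip:
  fixes f :: "'a::euclidean_space \<Rightarrow> 'b::euclidean_space"
  assumes "t1 \<le> t2" and [measurable]: "f \<in> borel_measurable borel"
  shows "Np p (\<lambda>z. indicator {t1<..t2} (snd z :: real) *\<^sub>R f (fst z)) = ennreal (t2 - t1) * Np p f"
proof -
  have "Np p (\<lambda>z. indicator {t1<..t2} (snd z :: real) *\<^sub>R f (fst z)) =
    (\<integral>\<^sup>+z. indicator {t1<..t2} (snd z) * ennreal (norm (f (fst z)) powr p) \<partial>lborel)"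
    unfolding Np_def by (intro nn_integral_cong) (auto simp: indicator_def)
  also have "\<dots> = (\<integral>\<^sup>+x. \<integral>\<^sup>+t. ennreal (norm (f x) powr p) * indicator {t1<..t2} t \<partial>lborel \<partial>lborel)"
    by (subst nn_integral_lborel_pair(1)) (auto simp: mult.commute)
  also have "\<dots> = (\<integral>\<^sup>+x. ennreal (norm (f x) powr p) * ennreal (t2 - t1) \<partial>lborel)"
    using assms(1) by (simp add: nn_integral_cmult_indicator)
  also have "\<dots> = ennreal (t2 - t1) * Np p f"
    unfolding Np_def by (subst nn_integral_multc) (auto simp: mult.commute)
  finally show ?thesis .
qed

lemma AE_lborel_fst:
  assumes "AE x in (lborel :: 'a::euclidean_space measure). P x"
  shows "AE z in (lborel :: ('a \<times> 'b::euclidean_space) measure). P (fst z)"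
proof -
  obtain N where N0: "{x \<in> space lborel. \<not> P x} \<subseteq> N" "emeasure (lborel :: 'a measure) N = 0" "N \<in> sets (lborel :: 'a measure)"
    using AE_E[OF assms] by blast
  then have N: "{x. \<not> P x} \<subseteq> N" "N \<in> null_sets (lborel :: 'a measure)" by (simp_all add: null_sets_def)
  have "emeasure ((lborel :: 'a measure) \<Otimes>\<^sub>M (lborel :: 'b measure)) (N \<times> UNIV) = 0"
    using N(2) by (subst lborel.emeasure_pair_measure_Times) auto
  moreover have "N \<times> UNIV \<in> sets ((lborel :: 'a measure) \<Otimes>\<^sub>M (lborel :: 'b measure))"
    using N(2) by (intro pair_measureI) auto
  ultimately have "N \<times> UNIV \<in> null_sets (lborel :: ('a \<times> 'b) measure)"
    unfolding null_sets_def lborel_prod by blast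
  then show ?thesis by (rule AE_I') (use N(1) in auto)
qed

lemma Young_integrable:
  fixes F :: "'a \<Rightarrow> 'b::euclidean_space" and G :: "'a \<Rightarrow> 'c::euclidean_space"
  assumes "p > 1" and [measurable]: "F \<in> borel_measurable M" "G \<in> borel_measurable M"
    and "(\<integral>\<^sup>+x. ennreal (norm (F x) powr (p / (p - 1))) \<partial>M) < \<infinity>" "(\<integral>\<^sup>+x. ennreal (norm (G x) powr p) \<partial>M) < \<infinity>"
  shows "integrable M (\<lambda>x. norm (F x) * norm (G x))"
proof (rule integrableI_bounded)
  have "(\<integral>\<^sup>+x. ennreal (norm (norm (F x) * norm (G x))) \<partial>M) = (\<integral>\<^sup>+x. ennreal (norm (F x) * norm (G x)) \<partial>M)"
    by (intro nn_integral_cong) simp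
  also have "\<dots> \<le> ennreal (1 powr (p / (p - 1))) * (\<integral>\<^sup>+x. ennreal (norm (F x) powr (p / (p - 1))) \<partial>M) +
    ennreal (1 powr (- p)) * (\<integral>\<^sup>+x. ennreal (norm (G x) powr p) \<partial>M)"
    by (rule nn_integral_scaled_Young) (use assms in auto)
  also have "\<dots> < \<infinity>" using assms(4,5) by simp
  finally show "(\<integral>\<^sup>+x. ennreal (norm (norm (F x) * norm (G x))) \<partial>M) < \<infinity>" .
qed simp

text \<open>It suffices that \<open>W\<close> is nonpositive off \<open>K\<close>, because
  \<open>smooth_step\<close> vanishes on \<open>{..0}\<close>. Here the untruncated approximants pay
  off: the composition is smooth and has compact support at once.\<close>

lemma test_functions_smooth_step:
  assumes "smooth W" "compact K" "K \<subseteq> \<Omega>" "\<And>x. x \<notin> K \<Longrightarrow> W x \<le> 0" "\<delta> > 0"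
  shows "(\<lambda>x. smooth_step (W x / \<delta>)) \<in> test_functions \<Omega>"
    and "grad (\<lambda>x. smooth_step (W x / \<delta>)) x = (bump (W x / \<delta>) / \<delta>) *\<^sub>R grad W x"
proof -
  have s: "smooth (\<lambda>t. smooth_step (t / \<delta>))" using smooth_scaled_step[of 0 \<delta>] by simp
  show "(\<lambda>x. smooth_step (W x / \<delta>)) \<in> test_functions \<Omega>"
    by (rule test_functionsI[OF smooth_compose_real[OF s assms(1)] assms(2,3)])
      (use assms(4,5) in \<open>auto intro!: smooth_step_0 divide_nonpos_pos\<close>)
  have "((\<lambda>t. smooth_step (t / \<delta>)) has_field_derivative bump (W x / \<delta>) / \<delta>) (at (W x))"
    using smooth_step_scaled_derivative[OF assms(5), of 0 "W x"] by (simp add: mollifier_real)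
  then have "((\<lambda>t. smooth_step (t / \<delta>)) has_derivative (\<lambda>v. (bump (W x / \<delta>) / \<delta>) * v)) (at (W x))"
    unfolding has_field_derivative_def .
  from diff_chain_at[OF smooth_has_derivative[OF assms(1)] this]
  have "((\<lambda>x. smooth_step (W x / \<delta>)) has_derivative (\<lambda>h. h \<bullet> ((bump (W x / \<delta>) / \<delta>) *\<^sub>R grad W x))) (at x)"
    by (simp add: o_def smooth_grad(2)[OF assms(1)])
  then show "grad (\<lambda>x. smooth_step (W x / \<delta>)) x = (bump (W x / \<delta>) / \<delta>) *\<^sub>R grad W x"
    by (intro GDERIV_grad) (simp add: gderiv_def)
qed

text \<open>The approximants converge almost everywhere along a subsequence, their gradients only in
  \<open>L^p\<close> on \<open>{W j > 0}\<close>. So \<open>grad (W j)\<close> is first replaced by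
  \<open>G\<close> while the scalar factor still contains \<open>W j\<close>, at the cost of a
  Hoelder error against \<open>A\<close>; dominated convergence then takes care of the scalar
  factor.\<close>

lemma evolution_identity_approximable:
  fixes b w :: "'a::euclidean_space \<Rightarrow> real" and A :: "'a \<times> real \<Rightarrow> 'a"
  assumes p: "p > 1" and t: "t1 < t2" and \<delta>: "\<delta> > 0" and \<Omega>[measurable]: "\<Omega> \<in> sets borel"
    and b: "integrable lborel b" "\<And>x. x \<notin> \<Omega> \<Longrightarrow> b x = 0"
    and A: "integrable lborel A" "Np (p / (p - 1)) A < \<infinity>" "\<And>z. fst z \<notin> \<Omega> \<Longrightarrow> A z = 0"
    and id: "\<And>\<phi>. \<phi> \<in> test_functions \<Omega> \<Longrightarrow> (LINT x|lborel. b x * \<phi> x) = - (LINT z|lborel. indicator {t1<..t2} (snd z) * (A z \<bullet> grad \<phi> (fst z)))"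
    and w: "approximable p \<Omega> w G" and [measurable]: "w \<in> borel_measurable borel" "G \<in> borel_measurable borel"
    and G: "Np p G < \<infinity>"
  shows "(LINT x|lborel. b x * smooth_step (w x / \<delta>)) =
    - (LINT x|lborel. LINT s|lborel. indicator {0..<t2 - t1} s * (A (x, t2 - s) \<bullet> ((bump (w x / \<delta>) / \<delta>) *\<^sub>R G x)))"
proof -
  have [measurable]: "b \<in> borel_measurable borel" "A \<in> borel_measurable borel" using b A by auto
  obtain W where W: "\<And>j::nat. smooth (W j)" "\<And>j. \<exists>K. compact K \<and> K \<subseteq> \<Omega> \<and> (\<forall>x. x \<notin> K \<longrightarrow> W j x \<le> 0)"
    "(\<lambda>j. Np p (\<lambda>x. indicator \<Omega> x *\<^sub>R (W j x - w x))) \<longlonglongrightarrow> 0"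
    "(\<lambda>j. Np p (\<lambda>x. indicator {x. W j x > 0} x *\<^sub>R (grad (W j) x - G x))) \<longlonglongrightarrow> 0"
    using w unfolding approximable_def by blast
  note [measurable] = smooth_borel[OF W(1)] smooth_grad_borel[OF W(1)]
  have m: "(\<lambda>x. ennreal (norm (indicator \<Omega> x *\<^sub>R (W j x - w x)) powr p)) \<in> borel_measurable lborel" for j by measurable
  obtain r where r: "strict_mono r" "AE x in lborel. (\<lambda>j. ennreal (norm (indicator \<Omega> x *\<^sub>R (W (r j) x - w x)) powr p)) \<longlonglongrightarrow> 0"
    by (rule nn_integral_tendsto_0_AE_subseq[OF m W(3)[unfolded Np_def]])
  have ptw: "AE x in lborel. x \<in> \<Omega> \<longrightarrow> (\<lambda>j. W (r j) x) \<longlonglongrightarrow> w x"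
    using r(2)
  proof eventually_elim
    case (elim x)
    show ?case
    proof
      assume x: "x \<in> \<Omega>"
      have "(\<lambda>j. ennreal (\<bar>W (r j) x - w x\<bar> powr p)) \<longlonglongrightarrow> ennreal 0" using elim x by simp
      then have "(\<lambda>j. \<bar>W (r j) x - w x\<bar> powr p) \<longlonglongrightarrow> 0"
        by (subst (asm) tendsto_ennreal_iff) (auto intro!: always_eventually)
      then have "(\<lambda>j. (\<bar>W (r j) x - w x\<bar> powr p) powr (1 / p)) \<longlonglongrightarrow> 0 powr (1 / p)"
        using p by (intro tendsto_powr') auto
      then have "(\<lambda>j. \<bar>W (r j) x - w x\<bar>) \<longlonglongrightarrow> 0" using p by (simp add: powr_powr)
      then show "(\<lambda>j. W (r j) x) \<longlonglongrightarrow> w x"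
        by (rule LIM_zero_cancel[OF tendsto_rabs_zero_cancel])
    qed
  qed
  define H where "H y = bump (y / \<delta>) / \<delta>" for y
  obtain M0 where M0: "M0 > 0" "\<And>x. bump x \<le> M0" using bump_bounded by blast
  define M where "M = M0 / \<delta>"
  have M: "M > 0" "\<And>y. \<bar>H y\<bar> \<le> M"
    using M0 \<delta> bump_nonneg by (auto simp: H_def M_def abs_of_nonneg intro!: divide_right_mono)
  have Hm[measurable]: "H \<in> borel_measurable borel" unfolding H_def by measurable
  have Hc: "continuous_on UNIV H"
    unfolding H_def using \<delta> by (intro continuous_intros continuous_on_compose2[OF smooth_continuous[OF smooth_bump]]) auto
  have H0: "H y = 0" if "y \<le> 0" for y using that \<delta> by (simp add: H_def bump_0 divide_nonpos_pos)
  define I where "I = (\<lambda>z::'a \<times> real. indicator {t1<..t2} (snd z) :: real)"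
  have Im[measurable]: "I \<in> borel_measurable borel" unfolding I_def by measurable
  have Ib: "\<bar>I z\<bar> \<le> 1" "I z \<ge> 0" for z by (auto simp: I_def indicator_def)
  have AG: "integrable lborel (\<lambda>z. norm (A z) * norm (I z *\<^sub>R G (fst z)))"
  proof (rule Young_integrable[OF p])
    show "(\<integral>\<^sup>+z. ennreal (norm (A z) powr (p / (p - 1))) \<partial>lborel) < \<infinity>" using A(2) by (simp add: Np_def)
    show "(\<integral>\<^sup>+z. ennreal (norm (I z *\<^sub>R G (fst z)) powr p) \<partial>lborel) < \<infinity>"
      using Np_strip[of t1 t2 G p] t G by (simp add: Np_def I_def ennreal_mult_less_top)
  qed auto
  have dom: "integrable lborel (\<lambda>z. M * (norm (A z) * norm (I z *\<^sub>R G (fst z))))" using AG by auto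
  have bnd: "norm (I z * (A z \<bullet> (H y *\<^sub>R G (fst z)))) \<le> M * (norm (A z) * norm (I z *\<^sub>R G (fst z)))" for z y
  proof -
    have "norm (I z * (A z \<bullet> (H y *\<^sub>R G (fst z)))) = \<bar>H y\<bar> * (\<bar>I z\<bar> * \<bar>A z \<bullet> G (fst z)\<bar>)"
      by (simp add: abs_mult)
    also have "\<dots> \<le> M * (\<bar>I z\<bar> * (norm (A z) * norm (G (fst z))))"
      using M by (intro mult_mono mult_left_mono Cauchy_Schwarz_ineq2) auto
    finally show ?thesis by (simp add: mult_ac)
  qed
  have Ji: "integrable lborel (\<lambda>z. I z * (A z \<bullet> (H (y (fst z)) *\<^sub>R G (fst z))))" if [measurable]: "y \<in> borel_measurable borel" for y
  proof (rule Bochner_Integration.integrable_bound[OF dom])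
    show "AE z in lborel. norm (I z * (A z \<bullet> (H (y (fst z)) *\<^sub>R G (fst z)))) \<le> norm (M * (norm (A z) * norm (I z *\<^sub>R G (fst z))))"
      unfolding real_norm_def[of "M * _"] by (intro AE_I2 order_trans[OF bnd] abs_ge_self)
  qed measurable
  define Fj where "Fj j = (LINT z|lborel. I z * (A z \<bullet> (H (W j (fst z)) *\<^sub>R grad (W j) (fst z))))" for j
  define Jj where "Jj j = (LINT z|lborel. I z * (A z \<bullet> (H (W j (fst z)) *\<^sub>R G (fst z))))" for j
  have idj: "(LINT x|lborel. b x * smooth_step (W j x / \<delta>)) = - Fj j"
    and Fi: "integrable lborel (\<lambda>z. I z * (A z \<bullet> (H (W j (fst z)) *\<^sub>R grad (W j) (fst z))))" for j
  proof -
    obtain K where K: "compact K" "K \<subseteq> \<Omega>" "\<And>x. x \<notin> K \<Longrightarrow> W j x \<le> 0" using W(2) by metis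
    note tf = test_functions_smooth_step[OF W(1) K \<delta>]
    show "(LINT x|lborel. b x * smooth_step (W j x / \<delta>)) = - Fj j"
      using id[OF tf(1)] by (simp add: tf(2) Fj_def I_def H_def)
    obtain L where L: "L > 0" "\<And>x. norm (grad (\<lambda>x. smooth_step (W j x / \<delta>)) x) \<le> L" using test_function_bounded[OF tf(1)] by metis
    have "integrable lborel (\<lambda>z. L * norm (A z))" using A by auto
    then show "integrable lborel (\<lambda>z. I z * (A z \<bullet> (H (W j (fst z)) *\<^sub>R grad (W j) (fst z))))"
    proof (rule Bochner_Integration.integrable_bound)
      show "AE z in lborel. norm (I z * (A z \<bullet> (H (W j (fst z)) *\<^sub>R grad (W j) (fst z)))) \<le> norm (L * norm (A z))"
      proof (rule AE_I2)
        fix z :: "'a \<times> real"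
        let ?g = "H (W j (fst z)) *\<^sub>R grad (W j) (fst z)"
        have g: "norm ?g \<le> L" using L(2)[of "fst z"] by (simp add: tf(2) H_def)
        have "norm (I z * (A z \<bullet> ?g)) \<le> 1 * (norm (A z) * norm ?g)"
          unfolding real_norm_def abs_mult by (intro mult_mono Ib Cauchy_Schwarz_ineq2) auto
        also have "\<dots> \<le> 1 * (norm (A z) * L)" by (intro mult_left_mono g) auto
        finally show "norm (I z * (A z \<bullet> ?g)) \<le> norm (L * norm (A z))" using L(1) by (simp add: mult.commute abs_mult)
      qed
    qed measurable
  qed
  \<comment> \<open>As \<open>H\<close> vanishes on \<open>{..0}\<close>, only points with
    \<open>W j > 0\<close> contribute, exactly where the gradients converge.\<close>
  have diff: "(\<lambda>j. Fj j - Jj j) \<longlonglongrightarrow> 0"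
  proof -
    define V where "V j z = I z *\<^sub>R (indicator {x. W j x > 0} (fst z) *\<^sub>R (grad (W j) (fst z) - G (fst z)))" for j z
    have Vm[measurable]: "V j \<in> borel_measurable borel" for j unfolding V_def by measurable
    have "(\<lambda>j. \<integral>\<^sup>+z. ennreal (norm (A z) * norm (V j z)) \<partial>lborel) \<longlonglongrightarrow> 0"
    proof (rule Holder_tendsto_0[OF p])
      show "(\<integral>\<^sup>+z. ennreal (norm (A z) powr (p / (p - 1))) \<partial>lborel) < \<infinity>" using A(2) by (simp add: Np_def)
      have "Np p (V j) = ennreal (t2 - t1) * Np p (\<lambda>x. indicator {x. W j x > 0} x *\<^sub>R (grad (W j) x - G x))" for j
        unfolding V_def I_def using t by (intro Np_strip) auto
      then show "(\<lambda>j. \<integral>\<^sup>+z. ennreal (norm (V j z) powr p) \<partial>lborel) \<longlonglongrightarrow> 0"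
        using ennreal_tendsto_cmult[OF _ W(4), of "ennreal (t2 - t1)"] by (simp add: Np_def)
    qed auto
    then have lim: "(\<lambda>j. ennreal M * (\<integral>\<^sup>+z. ennreal (norm (A z) * norm (V j z)) \<partial>lborel)) \<longlonglongrightarrow> 0"
      using ennreal_tendsto_cmult[of "ennreal M"] by fastforce
    have "(\<lambda>j. ennreal \<bar>Fj j - Jj j\<bar>) \<longlonglongrightarrow> 0"
    proof (rule tendsto_0_le_ennreal[OF lim])
      fix j
      have eq: "I z * (A z \<bullet> (H (W j (fst z)) *\<^sub>R grad (W j) (fst z))) - I z * (A z \<bullet> (H (W j (fst z)) *\<^sub>R G (fst z)))
        = H (W j (fst z)) * (A z \<bullet> V j z)" for z
        using H0[of "W j (fst z)"] by (auto simp: V_def indicator_def inner_diff_right algebra_simps)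
      have i: "integrable lborel (\<lambda>z. H (W j (fst z)) * (A z \<bullet> V j z))"
        using Bochner_Integration.integrable_diff[OF Fi[of j] Ji[OF smooth_borel[OF W(1)], of j]] unfolding eq .
      have "Fj j - Jj j = (LINT z|lborel. H (W j (fst z)) * (A z \<bullet> V j z))"
        unfolding Fj_def Jj_def eq[symmetric] using Fi[of j] Ji[OF smooth_borel[OF W(1)], of j] by simp
      then have "ennreal \<bar>Fj j - Jj j\<bar> \<le> (\<integral>\<^sup>+z. ennreal (norm (H (W j (fst z)) * (A z \<bullet> V j z))) \<partial>lborel)"
        using integral_norm_bound_ennreal[OF i] by simp
      also have "\<dots> \<le> (\<integral>\<^sup>+z. ennreal M * ennreal (norm (A z) * norm (V j z)) \<partial>lborel)"
      proof (rule nn_integral_mono)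
        fix z
        have "norm (H (W j (fst z)) * (A z \<bullet> V j z)) \<le> M * (norm (A z) * norm (V j z))"
          unfolding real_norm_def abs_mult using M by (intro mult_mono Cauchy_Schwarz_ineq2) auto
        then show "ennreal (norm (H (W j (fst z)) * (A z \<bullet> V j z))) \<le> ennreal M * ennreal (norm (A z) * norm (V j z))"
          using M(1) by (simp add: ennreal_mult'[symmetric] ennreal_leI)
      qed
      also have "\<dots> = ennreal M * (\<integral>\<^sup>+z. ennreal (norm (A z) * norm (V j z)) \<partial>lborel)"
        by (rule nn_integral_cmult) measurable
      finally show "ennreal \<bar>Fj j - Jj j\<bar> \<le> ennreal M * (\<integral>\<^sup>+z. ennreal (norm (A z) * norm (V j z)) \<partial>lborel)" .
    qed
    then have "(\<lambda>j. ennreal \<bar>Fj j - Jj j\<bar>) \<longlonglongrightarrow> ennreal 0" by simp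
    then have "(\<lambda>j. \<bar>Fj j - Jj j\<bar>) \<longlonglongrightarrow> 0"
      by (subst (asm) tendsto_ennreal_iff) (auto intro!: always_eventually)
    then show ?thesis by (rule tendsto_rabs_zero_cancel)
  qed
  define J where "J = (LINT z|lborel. I z * (A z \<bullet> (H (w (fst z)) *\<^sub>R G (fst z))))"
  have JJ: "(\<lambda>j. Jj (r j)) \<longlonglongrightarrow> J"
    unfolding Jj_def J_def
  proof (rule integral_dominated_convergence[OF _ _ dom])
    have "AE z in (lborel :: ('a \<times> real) measure). fst z \<in> \<Omega> \<longrightarrow> (\<lambda>j. W (r j) (fst z)) \<longlonglongrightarrow> w (fst z)"
      by (rule AE_lborel_fst[OF ptw])
    then show "AE z in lborel. (\<lambda>j. I z * (A z \<bullet> (H (W (r j) (fst z)) *\<^sub>R G (fst z)))) \<longlonglongrightarrow> I z * (A z \<bullet> (H (w (fst z)) *\<^sub>R G (fst z)))"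
    proof eventually_elim
      case (elim z)
      show ?case
      proof (cases "fst z \<in> \<Omega>")
        case True
        then have "(\<lambda>j. H (W (r j) (fst z))) \<longlonglongrightarrow> H (w (fst z))"
          using elim Hc by (auto intro: continuous_on_tendsto_compose)
        then show ?thesis by (intro tendsto_intros)
      qed (simp add: A(3))
    qed
  qed (use bnd in auto)
  have "(\<lambda>j. LINT x|lborel. b x * smooth_step (W (r j) x / \<delta>)) \<longlonglongrightarrow> (LINT x|lborel. b x * smooth_step (w x / \<delta>))"
  proof (rule integral_dominated_convergence[where w="\<lambda>x. \<bar>b x\<bar>"])
    show "AE x in lborel. (\<lambda>j. b x * smooth_step (W (r j) x / \<delta>)) \<longlonglongrightarrow> b x * smooth_step (w x / \<delta>)"
      using ptw
    proof eventually_elim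
      case (elim x)
      show ?case
      proof (cases "x \<in> \<Omega>")
        case True
        have "(\<lambda>j. smooth_step (W (r j) x / \<delta>)) \<longlonglongrightarrow> smooth_step (w x / \<delta>)"
          by (rule continuous_on_tendsto_compose[OF smooth_continuous[OF smooth_smooth_step]])
            (use elim True \<delta> in \<open>auto intro!: tendsto_intros\<close>)
        then show ?thesis by (intro tendsto_intros)
      qed (simp add: b(2))
    qed
    show "AE x in lborel. norm (b x * smooth_step (W (r j) x / \<delta>)) \<le> \<bar>b x\<bar>" for j
      using smooth_step_bounds by (auto simp: abs_mult intro!: mult_left_le)
  qed (use b in auto)
  then have L1: "(\<lambda>j. - Fj (r j)) \<longlonglongrightarrow> (LINT x|lborel. b x * smooth_step (w x / \<delta>))" unfolding idj .
  have "(\<lambda>j. (Fj (r j) - Jj (r j)) + Jj (r j)) \<longlonglongrightarrow> 0 + J"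
    using LIMSEQ_subseq_LIMSEQ[OF diff r(1)] JJ by (intro tendsto_add) (simp_all add: o_def)
  then have "(\<lambda>j. - Fj (r j)) \<longlonglongrightarrow> - J" by (intro tendsto_minus) simp
  with L1 have "(LINT x|lborel. b x * smooth_step (w x / \<delta>)) = - J" by (rule LIMSEQ_unique)
  \<comment> \<open>The substitution \<open>s = t2 - t\<close> carries \<open>{t1<..t2}\<close> to
    \<open>{0..<t2 - t1}\<close> and displays the flux at delays \<open>s\<close> before
    \<open>t2\<close>, the form in which translation continuity can be applied later.\<close>
  also have "J = (LINT x|lborel. LINT s|lborel. indicator {0..<t2 - t1} s * (A (x, t2 - s) \<bullet> ((bump (w x / \<delta>) / \<delta>) *\<^sub>R G x)))"
  proof -
    have "J = (LINT x|lborel. LINT t|lborel. I (x, t) * (A (x, t) \<bullet> (H (w x) *\<^sub>R G x)))"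
      unfolding J_def using integral_lborel_pair(1)[OF Ji[of w]] by simp
    also have "\<dots> = (LINT x|lborel. LINT s|lborel. I (x, t2 - s) * (A (x, t2 - s) \<bullet> (H (w x) *\<^sub>R G x)))"
      by (intro Bochner_Integration.integral_cong refl lborel_integral_reflect[symmetric]) measurable
    also have "\<dots> = (LINT x|lborel. LINT s|lborel. indicator {0..<t2 - t1} s * (A (x, t2 - s) \<bullet> (H (w x) *\<^sub>R G x)))"
    proof -
      have "I (x, t2 - s) = indicator {0..<t2 - t1} s" for x s by (auto simp: I_def indicator_def)
      then show ?thesis by simp
    qed
    finally show ?thesis by (simp add: H_def)
  qed
  finally show ?thesis .
qed

section \<open>The chain rule in time\<close>

lemma b_pow_eq: "b_pow p z = sgn z * \<bar>z\<bar> powr (p - 1)"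
proof (cases "z = 0")
  case False
  have "\<bar>z\<bar> powr (p - 2) * z = sgn z * (\<bar>z\<bar> powr (p - 2) * \<bar>z\<bar> powr 1)"
    using False by (simp add: sgn_real_def abs_real_def)
  also have "\<dots> = sgn z * \<bar>z\<bar> powr (p - 1)" using False by (simp only: powr_add[symmetric]) simp
  finally show ?thesis by (simp add: b_pow_def)
qed (simp add: b_pow_def)

lemma b_pow_abs: "\<bar>b_pow p z\<bar> = \<bar>z\<bar> powr (p - 1)"
  by (auto simp: b_pow_eq abs_mult sgn_real_def)

lemma b_pow_0 [simp]: "b_pow p 0 = 0" by (simp add: b_pow_def)

lemma b_pow_strict_mono:
  assumes "p > 1" "x < y" shows "b_pow p x < b_pow p y"
proof -
  consider "0 \<le> x" | "x < 0" "0 \<le> y" | "y < 0" using assms by linarith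
  then show ?thesis
  proof cases
    case 1
    then have "x powr (p - 1) < y powr (p - 1)" using assms by (intro powr_less_mono2) auto
    with 1 assms show ?thesis by (cases "x = 0") (auto simp: b_pow_eq sgn_real_def)
  next
    case 2
    then have "b_pow p x < 0" by (auto simp: b_pow_eq sgn_real_def)
    also have "0 \<le> b_pow p y" using 2 by (auto simp: b_pow_eq sgn_real_def)
    finally show ?thesis .
  next
    case 3
    then have "(- y) powr (p - 1) < (- x) powr (p - 1)" using assms by (intro powr_less_mono2) auto
    with 3 assms show ?thesis by (auto simp: b_pow_eq sgn_real_def)
  qed
qed

lemma b_pow_mono: "p > 1 \<Longrightarrow> x \<le> y \<Longrightarrow> b_pow p x \<le> b_pow p y"
  using b_pow_strict_mono[of p x y] by (cases "x = y") auto

lemma b_pow_le_iff: "p > 1 \<Longrightarrow> b_pow p x \<le> b_pow p y \<longleftrightarrow> x \<le> y"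
  using b_pow_strict_mono[of p y x] b_pow_mono[of p x y] by linarith

lemma b_pow_continuous: "p > 1 \<Longrightarrow> continuous_on UNIV (b_pow p)"
proof -
  assume p: "p > 1"
  have "b_pow p = (\<lambda>z. (max z 0) powr (p - 1) - (max (- z) 0) powr (p - 1))"
    by (auto simp: b_pow_eq sgn_real_def max_def)
  moreover have "continuous_on UNIV (\<lambda>z::real. (max z 0) powr (p - 1) - (max (- z) 0) powr (p - 1))"
    using p by (intro continuous_intros continuous_on_powr') auto
  ultimately show ?thesis by simp
qed

lemma b_pow_borel[measurable]: "b_pow p \<in> borel_measurable borel"
  unfolding b_pow_def[abs_def] by measurable

definition flux :: "real \<Rightarrow> 'a::real_inner \<Rightarrow> 'a" where
  "flux p U = norm U powr (p - 2) *\<^sub>R U"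

lemma flux_borel[measurable]: "flux p \<in> borel_measurable (borel :: 'a::euclidean_space measure)"
  unfolding flux_def[abs_def] by measurable

lemma norm_flux: "norm (flux p U) = norm U powr (p - 1)"
proof (cases "U = 0")
  case False
  have "norm (flux p U) = norm U powr (p - 2) * norm U powr 1" using False by (simp add: flux_def)
  also have "\<dots> = norm U powr (p - 1)" by (simp only: powr_add[symmetric]) simp
  finally show ?thesis .
qed (simp add: flux_def)

lemma norm_flux_powr: "p > 1 \<Longrightarrow> norm (flux p U) powr (p / (p - 1)) = norm U powr p"
  by (simp add: norm_flux powr_powr)

lemma flux_0 [simp]: "flux p 0 = 0" by (simp add: flux_def)

text \<open>Cauchy-Schwarz applied to the mixed terms reduces the vector inequality to the norms,
  where it reads \<open>(a powr (p - 1) - b powr (p - 1)) * (a - b) \<ge> 0\<close>. This covers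
  \<open>p < 2\<close> and \<open>p \<ge> 2\<close> alike.\<close>

lemma flux_monotone:
  assumes "p > 1"
  shows "(flux p U - flux p V) \<bullet> (U - V) \<ge> 0"
proof -
  define a b where "a = norm U" and "b = norm V"
  have ab: "a \<ge> 0" "b \<ge> 0" by (auto simp: a_def b_def)
  have sq: "norm W powr (p - 2) * (W \<bullet> W) = norm W powr (p - 1) * norm W" for W :: 'a
  proof (cases "W = 0")
    case False
    then have "norm W powr (p - 1) = norm W powr (p - 2) * norm W"
      using powr_add[of "norm W" "p - 2" 1] by simp
    then show ?thesis by (simp add: dot_square_norm power2_eq_square)
  qed simp
  have mixed: "norm W powr (p - 2) * (W \<bullet> X) \<le> norm W powr (p - 1) * norm X" for W X :: 'a
  proof (cases "W = 0")
    case False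
    then have e: "norm W powr (p - 1) = norm W powr (p - 2) * norm W"
      using powr_add[of "norm W" "p - 2" 1] by simp
    have "norm W powr (p - 2) * (W \<bullet> X) \<le> norm W powr (p - 2) * (norm W * norm X)"
      by (intro mult_left_mono norm_cauchy_schwarz) simp
    then show ?thesis by (simp add: e mult.assoc)
  qed simp
  have "(flux p U - flux p V) \<bullet> (U - V) = norm U powr (p - 2) * (U \<bullet> U) + norm V powr (p - 2) * (V \<bullet> V)
      - norm U powr (p - 2) * (U \<bullet> V) - norm V powr (p - 2) * (V \<bullet> U)"
    by (simp add: flux_def algebra_simps)
  also have "\<dots> \<ge> a powr (p - 1) * a + b powr (p - 1) * b - a powr (p - 1) * b - b powr (p - 1) * a"
    using mixed[of U V] mixed[of V U] unfolding sq a_def b_def by linarith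
  also have "a powr (p - 1) * a + b powr (p - 1) * b - a powr (p - 1) * b - b powr (p - 1) * a = (a powr (p - 1) - b powr (p - 1)) * (a - b)"
    by (simp add: algebra_simps)
  also have "\<dots> \<ge> 0"
  proof (cases "a \<le> b")
    case True
    then have "a powr (p - 1) \<le> b powr (p - 1)" using ab assms by (intro powr_mono2) auto
    with True show ?thesis by (intro mult_nonpos_nonpos) auto
  next
    case False
    then have "b powr (p - 1) \<le> a powr (p - 1)" using ab assms by (intro powr_mono2) auto
    with False show ?thesis by (intro mult_nonneg_nonneg) auto
  qed
  finally show ?thesis .
qed

lemma Np_conj_tendsto:
  assumes "p > 1" and [measurable]: "A \<in> borel_measurable borel" and A: "Np (p / (p - 1)) A < \<infinity>"
  shows "translation_continuous (p / (p - 1)) A"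
proof -
  have "p / (p - 1) \<ge> 1" using assms(1) by (simp add: pos_le_divide_eq)
  then show ?thesis by (rule translation_continuous_Lp) (use A in auto)
qed

text \<open>The limit \<open>h \<rightarrow> 0\<close> in the discrete chain rule: difference quotients of \<open>e\<close> are
  moved to the weight \<open>\<phi>\<close>, while the time averages of \<open>A\<close> converge in the dual exponent.\<close>

lemma difference_quotient_limit:
  fixes A Z :: "'a::euclidean_space \<times> real \<Rightarrow> 'a" and e \<phi> \<phi>' :: "real \<Rightarrow> real"
  assumes p: "p > 1"
    and Am[measurable]: "A \<in> borel_measurable borel" and A: "Np (p / (p - 1)) A < \<infinity>"
    and Zm[measurable]: "Z \<in> borel_measurable borel" and Z: "Np p Z < \<infinity>"
    and e: "integrable lborel e"
    and \<phi>: "\<And>t. (\<phi> has_field_derivative \<phi>' t) (at t)" "\<And>t. 0 \<le> \<phi> t" "\<And>t. \<phi> t \<le> M" "\<And>t. \<bar>\<phi>' t\<bar> \<le> M"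
    and M: "M > 0" and h0: "h0 > 0"
    and ineq: "\<And>h. 0 < h \<Longrightarrow> h < h0 \<Longrightarrow> AE t in lborel. \<phi> t \<noteq> 0 \<longrightarrow>
      e t - e (t - h) \<le> - (LINT x|lborel. LINT s|lborel. indicator {0..<h} s * (A (x, t - s) \<bullet> Z (x, t)))"
  shows "- (LINT t|lborel. e t * \<phi>' t) \<le> - (LINT z|lborel. \<phi> (snd z) * (A z \<bullet> Z z))"
proof -
  have \<phi>c: "continuous_on UNIV \<phi>" using \<phi>(1) DERIV_continuous_on by blast
  have \<phi>m[measurable]: "\<phi> \<in> borel_measurable borel" by (rule borel_measurable_continuous_onI[OF \<phi>c])
  have em[measurable]: "e \<in> borel_measurable borel" using e by auto
  \<comment> \<open>The pairing of \<open>Z\<close> with the flux delayed by \<open>s\<close>. Only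
    continuity at \<open>s = 0\<close> is needed; it follows from continuity of translations of
    \<open>A\<close> in the dual exponent and Hoelder's inequality.\<close>
  define R where "R s = (LINT z|lborel. \<phi> (snd z) * (A (z - (0, s)) \<bullet> Z z))" for s
  have mz: "z - (0::'a, s) = z + (0, - s)" for z :: "'a \<times> real" and s by (cases z) simp
  have shift: "Np (p / (p - 1)) (\<lambda>z. A (z - (0, s))) = Np (p / (p - 1)) A" for s
    unfolding mz by (rule Np_translate[OF Am])
  have AZi: "integrable lborel (\<lambda>z. norm (A (z - (0, s))) * norm (Z z))" for s
    by (rule Young_integrable[OF p]) (use shift[of s] A Z in \<open>auto simp: Np_def\<close>)
  have Ri: "integrable lborel (\<lambda>z. \<phi> (snd z) * (A (z - (0, s)) \<bullet> Z z))" for s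
  proof (rule Bochner_Integration.integrable_bound)
    show "integrable lborel (\<lambda>z. M * (norm (A (z - (0, s))) * norm (Z z)))" using AZi by auto
    show "AE z in lborel. norm (\<phi> (snd z) * (A (z - (0, s)) \<bullet> Z z)) \<le> norm (M * (norm (A (z - (0, s))) * norm (Z z)))"
    proof (rule AE_I2)
      fix z :: "'a \<times> real"
      have "norm (\<phi> (snd z) * (A (z - (0, s)) \<bullet> Z z)) \<le> M * (norm (A (z - (0, s))) * norm (Z z))"
        unfolding real_norm_def abs_mult using \<phi>(2,3) M by (intro mult_mono Cauchy_Schwarz_ineq2) auto
      then show "norm (\<phi> (snd z) * (A (z - (0, s)) \<bullet> Z z)) \<le> norm (M * (norm (A (z - (0, s))) * norm (Z z)))"
        unfolding real_norm_def[of "M * _"] by (rule order_trans) (rule abs_ge_self)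
    qed
  qed measurable
  have Rlim: "(R \<longlongrightarrow> R 0) (nhds 0)"
  proof -
    have q: "(p / (p - 1)) > 1" "(p / (p - 1)) / (p / (p - 1) - 1) = p"
      using p by (simp_all add: pos_less_divide_eq field_simps)
    have tc: "((\<lambda>s. Np (p / (p - 1)) (\<lambda>z. A (z - (0, s)) - A z)) \<longlongrightarrow> 0) (nhds 0)"
    proof -
      have "((\<lambda>s. (0::'a, - s)) \<longlongrightarrow> (0, - 0)) (nhds (0::real))"
        by (intro tendsto_Pair tendsto_minus tendsto_const) (simp add: filterlim_ident)
      then have f: "filterlim (\<lambda>s. (0::'a, - s)) (nhds 0) (nhds (0::real))" by (simp add: zero_prod_def)
      show ?thesis
        unfolding mz by (rule filterlim_compose[OF Np_conj_tendsto[OF p Am A, unfolded translation_continuous_def] f])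
    qed
    have "((\<lambda>s. \<integral>\<^sup>+z. ennreal (norm (Z z) * norm (A (z - (0, s)) - A z)) \<partial>lborel) \<longlongrightarrow> 0) (nhds 0)"
    proof (rule Holder_tendsto_0[OF q(1)])
      show "(\<integral>\<^sup>+z. ennreal (norm (Z z) powr (p / (p - 1) / (p / (p - 1) - 1))) \<partial>lborel) < \<infinity>"
        unfolding q(2) using Z by (simp add: Np_def)
      show "((\<lambda>s. \<integral>\<^sup>+z. ennreal (norm (A (z - (0, s)) - A z) powr (p / (p - 1))) \<partial>lborel) \<longlongrightarrow> 0) (nhds 0)"
        using tc by (simp add: Np_def)
    qed auto
    then have lim: "((\<lambda>s. ennreal M * (\<integral>\<^sup>+z. ennreal (norm (Z z) * norm (A (z - (0, s)) - A z)) \<partial>lborel)) \<longlongrightarrow> 0) (nhds 0)"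
      using ennreal_tendsto_cmult[of "ennreal M"] by fastforce
    have R0: "R 0 = (LINT z|lborel. \<phi> (snd z) * (A z \<bullet> Z z))" "integrable lborel (\<lambda>z. \<phi> (snd z) * (A z \<bullet> Z z))"
      using Ri[of 0] by (simp_all add: R_def flip: zero_prod_def)
    have "((\<lambda>s. ennreal \<bar>R s - R 0\<bar>) \<longlongrightarrow> 0) (nhds 0)"
    proof (rule tendsto_0_le_ennreal[OF lim])
      fix s
      have i: "integrable lborel (\<lambda>z. \<phi> (snd z) * (A (z - (0, s)) \<bullet> Z z) - \<phi> (snd z) * (A z \<bullet> Z z))"
        using Ri[of s] R0(2) by auto
      have "R s - R 0 = (LINT z|lborel. \<phi> (snd z) * (A (z - (0, s)) \<bullet> Z z) - \<phi> (snd z) * (A z \<bullet> Z z))"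
        unfolding R0(1) unfolding R_def using Ri[of s] R0(2) by simp
      then have "ennreal \<bar>R s - R 0\<bar> \<le> (\<integral>\<^sup>+z. ennreal (norm (\<phi> (snd z) * (A (z - (0, s)) \<bullet> Z z) - \<phi> (snd z) * (A z \<bullet> Z z))) \<partial>lborel)"
        using integral_norm_bound_ennreal[OF i] by simp
      also have "\<dots> \<le> (\<integral>\<^sup>+z. ennreal M * ennreal (norm (Z z) * norm (A (z - (0, s)) - A z)) \<partial>lborel)"
      proof (rule nn_integral_mono)
        fix z :: "'a \<times> real"
        have "\<phi> (snd z) * (A (z - (0, s)) \<bullet> Z z) - \<phi> (snd z) * (A z \<bullet> Z z) = \<phi> (snd z) * (Z z \<bullet> (A (z - (0, s)) - A z))"
          by (simp add: inner_diff_right inner_commute algebra_simps)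
        then have "norm (\<phi> (snd z) * (A (z - (0, s)) \<bullet> Z z) - \<phi> (snd z) * (A z \<bullet> Z z)) = \<bar>\<phi> (snd z)\<bar> * \<bar>Z z \<bullet> (A (z - (0, s)) - A z)\<bar>"
          by (simp add: abs_mult)
        also have "\<dots> \<le> M * (norm (Z z) * norm (A (z - (0, s)) - A z))"
          using \<phi>(2,3) M by (intro mult_mono Cauchy_Schwarz_ineq2) auto
        finally show "ennreal (norm (\<phi> (snd z) * (A (z - (0, s)) \<bullet> Z z) - \<phi> (snd z) * (A z \<bullet> Z z))) \<le> ennreal M * ennreal (norm (Z z) * norm (A (z - (0, s)) - A z))"
          using M by (simp add: ennreal_mult'[symmetric] ennreal_leI)
      qed
      also have "\<dots> = ennreal M * (\<integral>\<^sup>+z. ennreal (norm (Z z) * norm (A (z - (0, s)) - A z)) \<partial>lborel)"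
        by (rule nn_integral_cmult) measurable
      finally show "ennreal \<bar>R s - R 0\<bar> \<le> ennreal M * (\<integral>\<^sup>+z. ennreal (norm (Z z) * norm (A (z - (0, s)) - A z)) \<partial>lborel)" .
    qed
    then have "((\<lambda>s. ennreal \<bar>R s - R 0\<bar>) \<longlongrightarrow> ennreal 0) (nhds 0)" by simp
    then have "((\<lambda>s. \<bar>R s - R 0\<bar>) \<longlongrightarrow> 0) (nhds 0)"
      by (subst (asm) tendsto_ennreal_iff) (auto intro!: always_eventually)
    then show ?thesis by (rule LIM_zero_cancel[OF tendsto_rabs_zero_cancel])
  qed
  \<comment> \<open>The hypothesis is multiplied by \<open>\<phi> t\<close> and integrated in time.
    A change of variables moves the shift by \<open>h\<close> from \<open>e\<close> to
    \<open>\<phi>\<close>, and Fubini collects the right side into the integral of \<open>R\<close>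
    over the delays below \<open>h\<close>.\<close>
  have step: "(LINT t|lborel. e t * (\<phi> t - \<phi> (t + h))) \<le> - (LINT s|lborel. indicator {0..<h} s * R s)"
    and Rint: "integrable lborel (\<lambda>s. indicator {0..<h} s * R s)" if h: "0 < h" "h < h0" for h
  proof -
    define f where "f = (\<lambda>y::real \<times> ('a \<times> real). indicator {0..<h} (fst y) * (\<phi> (snd (snd y)) * (A (snd y - (0, fst y)) \<bullet> Z (snd y))))"
    have fm[measurable]: "f \<in> borel_measurable borel" unfolding f_def by measurable
    have fi: "integrable lborel f"
    proof (rule integrableI_bounded)
      have "(\<integral>\<^sup>+y. ennreal (norm (f y)) \<partial>lborel) \<le> (\<integral>\<^sup>+y. indicator {0..<h} (fst y) * (ennreal M * ennreal (norm (A (snd y - (0, fst y))) * norm (Z (snd y)))) \<partial>lborel)"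
      proof (rule nn_integral_mono)
        fix y :: "real \<times> ('a \<times> real)"
        have "norm (\<phi> (snd (snd y)) * (A (snd y - (0, fst y)) \<bullet> Z (snd y))) \<le> M * (norm (A (snd y - (0, fst y))) * norm (Z (snd y)))"
          unfolding real_norm_def abs_mult using \<phi>(2,3) M by (intro mult_mono Cauchy_Schwarz_ineq2) auto
        then show "ennreal (norm (f y)) \<le> indicator {0..<h} (fst y) * (ennreal M * ennreal (norm (A (snd y - (0, fst y))) * norm (Z (snd y))))"
          using M by (auto simp: f_def indicator_def ennreal_mult'[symmetric] ennreal_leI)
      qed
      also have "\<dots> = (\<integral>\<^sup>+s. \<integral>\<^sup>+z. indicator {0..<h} s * (ennreal M * ennreal (norm (A (z - (0, s))) * norm (Z z))) \<partial>lborel \<partial>lborel)"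
        by (subst nn_integral_lborel_pair(1)) simp_all
      also have "\<dots> \<le> (\<integral>\<^sup>+s. (ennreal M * (Np (p / (p - 1)) A + Np p Z)) * indicator {0..<h} s \<partial>lborel)"
      proof (rule nn_integral_mono)
        fix s :: real
        have "(\<integral>\<^sup>+z. ennreal (norm (A (z - (0, s))) * norm (Z z)) \<partial>lborel) \<le> Np (p / (p - 1)) A + Np p Z"
          using nn_integral_scaled_Young[OF p zero_less_one, of "\<lambda>z. A (z - (0, s))" lborel Z] shift[of s] by (simp add: Np_def)
        then have "indicator {0..<h} s * (ennreal M * (\<integral>\<^sup>+z. ennreal (norm (A (z - (0, s))) * norm (Z z)) \<partial>lborel)) \<le> indicator {0..<h} s * (ennreal M * (Np (p / (p - 1)) A + Np p Z))"
          by (intro mult_left_mono) auto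
        then show "(\<integral>\<^sup>+z. indicator {0..<h} s * (ennreal M * ennreal (norm (A (z - (0, s))) * norm (Z z))) \<partial>lborel) \<le> (ennreal M * (Np (p / (p - 1)) A + Np p Z)) * indicator {0..<h} s"
          by (simp add: nn_integral_cmult mult.commute)
      qed
      also have "\<dots> = (ennreal M * (Np (p / (p - 1)) A + Np p Z)) * ennreal h"
        using h(1) by (simp add: nn_integral_cmult_indicator)
      also have "\<dots> < \<infinity>" using A Z by (simp add: ennreal_mult_less_top)
      finally show "(\<integral>\<^sup>+y. ennreal (norm (f y)) \<partial>lborel) < \<infinity>" .
    qed simp
    have fR: "(LINT z|lborel. f (s, z)) = indicator {0..<h} s * R s" for s
      by (simp add: f_def R_def)
    show "integrable lborel (\<lambda>s. indicator {0..<h} s * R s)"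
      using integral_lborel_pair(5)[OF fi] by (simp add: fR)
    have g: "integrable lborel (\<lambda>z. LINT s|lborel. f (s, z))" by (rule integral_lborel_pair(6)[OF fi])
    have eqf: "(LINT x|lborel. LINT s|lborel. f (s, (x, t))) = \<phi> t * (LINT x|lborel. LINT s|lborel. indicator {0..<h} s * (A (x, t - s) \<bullet> Z (x, t)))" for t
    proof -
      have "f (s, (x, t)) = \<phi> t * (indicator {0..<h} s * (A (x, t - s) \<bullet> Z (x, t)))" for s x by (simp add: f_def)
      then show ?thesis by simp
    qed
    have "(LINT s|lborel. indicator {0..<h} s * R s) = (LINT s|lborel. LINT z|lborel. f (s, z))" by (simp add: fR)
    also have "\<dots> = (LINT z|lborel. LINT s|lborel. f (s, z))"
      using integral_lborel_pair(1,2)[OF fi] by simp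
    also have "\<dots> = (LINT t|lborel. LINT x|lborel. LINT s|lborel. f (s, (x, t)))"
      by (rule integral_lborel_pair(2)[OF g])
    finally have eq1: "(LINT s|lborel. indicator {0..<h} s * R s) = (LINT t|lborel. \<phi> t * (LINT x|lborel. LINT s|lborel. indicator {0..<h} s * (A (x, t - s) \<bullet> Z (x, t))))"
      unfolding eqf .
    have i2: "integrable lborel (\<lambda>t. \<phi> t * (LINT x|lborel. LINT s|lborel. indicator {0..<h} s * (A (x, t - s) \<bullet> Z (x, t))))"
      using integral_lborel_pair(6)[OF g] unfolding eqf .
    have eb: "integrable lborel (\<lambda>t. k t * e t)" if [measurable]: "k \<in> borel_measurable borel" and k: "\<And>t. 0 \<le> k t" "\<And>t. k t \<le> M" for k
      by (rule Bochner_Integration.integrable_bound[of _ "\<lambda>t. M * \<bar>e t\<bar>"])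
        (use e k M in \<open>auto simp: abs_mult intro!: AE_I2 mult_right_mono\<close>)
    have e1: "integrable lborel (\<lambda>t. \<phi> t * e t)" by (rule eb) (use \<phi> in auto)
    have e2: "integrable lborel (\<lambda>t. \<phi> (t + h) * e t)" by (rule eb) (use \<phi> in auto)
    have "integrable lborel (\<lambda>t. \<phi> ((- h + 1 * t) + h) * e (- h + 1 * t))"
      by (rule lborel_integrable_real_affine[OF e2]) simp
    then have e3: "integrable lborel (\<lambda>t. \<phi> t * e (t - h))" by simp
    have "(LINT t|lborel. \<phi> (t + h) * e t) = (LINT t|lborel. \<phi> t * e (t - h))"
      using lborel_integral_real_affine[of 1 "\<lambda>t. \<phi> (t + h) * e t" "- h"] by simp
    then have "(LINT t|lborel. e t * (\<phi> t - \<phi> (t + h))) = (LINT t|lborel. \<phi> t * e t - \<phi> t * e (t - h))"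
      using e1 e2 e3 by (simp add: right_diff_distrib mult.commute[of "e _"])
    also have "\<dots> \<le> (LINT t|lborel. - (\<phi> t * (LINT x|lborel. LINT s|lborel. indicator {0..<h} s * (A (x, t - s) \<bullet> Z (x, t)))))"
    proof (rule integral_mono_AE)
      show "AE t in lborel. \<phi> t * e t - \<phi> t * e (t - h) \<le> - (\<phi> t * (LINT x|lborel. LINT s|lborel. indicator {0..<h} s * (A (x, t - s) \<bullet> Z (x, t))))"
        using ineq[OF h]
      proof eventually_elim
        case (elim t)
        show ?case
        proof (cases "\<phi> t = 0")
          case False
          with elim have "e t - e (t - h) \<le> - (LINT x|lborel. LINT s|lborel. indicator {0..<h} s * (A (x, t - s) \<bullet> Z (x, t)))" by blast
          from mult_left_mono[OF this \<phi>(2)[of t]] show ?thesis by (simp add: right_diff_distrib)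
        qed simp
      qed
    qed (use e1 e3 i2 in auto)
    also have "\<dots> = - (LINT s|lborel. indicator {0..<h} s * R s)" unfolding eq1 by simp
    finally show "(LINT t|lborel. e t * (\<phi> t - \<phi> (t + h))) \<le> - (LINT s|lborel. indicator {0..<h} s * R s)" .
  qed
  \<comment> \<open>The offset 2 keeps \<open>h n\<close> strictly below \<open>h0\<close> already
    for \<open>n = 0\<close>.\<close>
  define h where "h n = h0 / real (n + 2)" for n
  have h: "0 < h n" "h n < h0" for n using h0 by (auto simp: h_def divide_less_eq)
  have hl: "h \<longlonglongrightarrow> 0"
    unfolding h_def using LIMSEQ_ignore_initial_segment[OF lim_const_over_n[of h0], of 2] by simp
  have lip: "\<bar>\<phi> t - \<phi> (t + h n)\<bar> \<le> M * h n" for t n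
  proof -
    have "\<exists>z. t < z \<and> z < t + h n \<and> \<phi> (t + h n) - \<phi> t = (t + h n - t) * \<phi>' z"
      using h(1)[of n] \<phi>(1) by (intro MVT2) auto
    then obtain z where z: "\<phi> (t + h n) - \<phi> t = h n * \<phi>' z" by auto
    have "\<bar>\<phi> (t + h n) - \<phi> t\<bar> = h n * \<bar>\<phi>' z\<bar>" unfolding z using h(1)[of n] by (simp add: abs_mult)
    also have "\<dots> \<le> h n * M" using \<phi>(4) h(1)[of n] by (intro mult_left_mono) auto
    finally show ?thesis by (simp add: abs_minus_commute mult.commute)
  qed
  have L: "(\<lambda>n. LINT t|lborel. e t * ((\<phi> t - \<phi> (t + h n)) / h n)) \<longlonglongrightarrow> (LINT t|lborel. e t * (- \<phi>' t))"
  proof (rule integral_dominated_convergence[where w="\<lambda>t. M * \<bar>e t\<bar>"])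
    have \<phi>'lim: "(\<lambda>n. (\<phi> t - \<phi> (t + h n)) / h n) \<longlonglongrightarrow> - \<phi>' t" for t
    proof -
      have "(\<lambda>y. (\<phi> (t + y) - \<phi> t) / y) \<midarrow>0\<rightarrow> \<phi>' t" using \<phi>(1)[of t] by (simp add: DERIV_def)
      moreover have "filterlim h (at 0) sequentially"
        using hl h(1) by (auto simp: filterlim_at intro!: always_eventually less_imp_neq[THEN not_sym])
      ultimately have "(\<lambda>n. (\<phi> (t + h n) - \<phi> t) / h n) \<longlonglongrightarrow> \<phi>' t" by (rule filterlim_compose)
      from tendsto_minus[OF this] show ?thesis by (simp add: minus_divide_left)
    qed
    then show "AE t in lborel. (\<lambda>n. e t * ((\<phi> t - \<phi> (t + h n)) / h n)) \<longlonglongrightarrow> e t * (- \<phi>' t)"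
      by (intro AE_I2 tendsto_intros)
    have "\<phi>' \<in> borel_measurable borel"
      by (rule borel_measurable_LIMSEQ_real[where u="\<lambda>n t. - ((\<phi> t - \<phi> (t + h n)) / h n)"])
        (use tendsto_minus[OF \<phi>'lim] in simp_all)
    then show "(\<lambda>t. e t * (- \<phi>' t)) \<in> borel_measurable lborel" by measurable
    show "AE t in lborel. norm (e t * ((\<phi> t - \<phi> (t + h n)) / h n)) \<le> M * \<bar>e t\<bar>" for n
    proof (rule AE_I2)
      fix t
      have "\<bar>(\<phi> t - \<phi> (t + h n)) / h n\<bar> \<le> M"
        using lip[of t n] h(1)[of n] by (simp add: pos_divide_le_eq)
      then show "norm (e t * ((\<phi> t - \<phi> (t + h n)) / h n)) \<le> M * \<bar>e t\<bar>"
        unfolding real_norm_def abs_mult[of "e t"] by (subst mult.commute) (rule mult_right_mono, simp_all)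
    qed
  qed (use e in auto)
  \<comment> \<open>After division by \<open>h n\<close> the right side of \<open>step\<close> is
    minus the mean of \<open>R\<close> over \<open>{0..<h n}\<close>, and near 0 this mean is at
    least \<open>R 0 - \<epsilon>\<close>.\<close>
  have le: "(LINT t|lborel. e t * (- \<phi>' t)) \<le> - R 0 + \<epsilon>" if \<epsilon>: "\<epsilon> > 0" for \<epsilon>
  proof (rule LIMSEQ_le_const2[OF L])
    have "eventually (\<lambda>s. dist (R s) (R 0) < \<epsilon>) (nhds 0)" using Rlim \<epsilon> by (rule tendstoD)
    then obtain d where d: "d > 0" "\<And>s. dist s 0 < d \<Longrightarrow> dist (R s) (R 0) < \<epsilon>"
      unfolding eventually_nhds_metric by blast
    have "eventually (\<lambda>n. h n < d) sequentially" using hl d(1) by (rule order_tendstoD)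
    then obtain n0 where n0: "\<And>n. n \<ge> n0 \<Longrightarrow> h n < d" unfolding eventually_sequentially by blast
    show "\<exists>N. \<forall>n\<ge>N. (LINT t|lborel. e t * ((\<phi> t - \<phi> (t + h n)) / h n)) \<le> - R 0 + \<epsilon>"
    proof (intro exI[of _ n0] allI impI)
      fix n assume n: "n \<ge> n0"
      have "(LINT t|lborel. e t * ((\<phi> t - \<phi> (t + h n)) / h n)) = (LINT t|lborel. e t * (\<phi> t - \<phi> (t + h n))) / h n"
        by simp
      also have "\<dots> \<le> - (LINT s|lborel. indicator {0..<h n} s * R s) / h n"
        by (intro divide_right_mono step h less_imp_le[OF h(1)])
      also have "(LINT s|lborel. indicator {0..<h n} s * R s) \<ge> (LINT s|lborel. indicator {0..<h n} s * (R 0 - \<epsilon>))"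
      proof (rule integral_mono)
        show "integrable lborel (\<lambda>s. indicator {0..<h n} s * (R 0 - \<epsilon>))" using h(1)[of n] by simp
        show "integrable lborel (\<lambda>s. indicator {0..<h n} s * R s)" by (rule Rint[OF h])
        fix s :: real
        show "indicator {0..<h n} s * (R 0 - \<epsilon>) \<le> indicator {0..<h n} s * R s"
          using d(2)[of s] n0[OF n] by (auto simp: indicator_def dist_real_def)
      qed
      then have "- (LINT s|lborel. indicator {0..<h n} s * R s) / h n \<le> - (LINT s|lborel. indicator {0..<h n} s * (R 0 - \<epsilon>)) / h n"
        using h(1)[of n] by (intro divide_right_mono) auto
      also have "\<dots> = - R 0 + \<epsilon>" using h(1)[of n] by simp
      finally show "(LINT t|lborel. e t * ((\<phi> t - \<phi> (t + h n)) / h n)) \<le> - R 0 + \<epsilon>" .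
    qed
  qed
  have "(LINT t|lborel. e t * (- \<phi>' t)) \<le> - R 0" by (rule field_le_epsilon) (rule le)
  moreover have "R 0 = (LINT z|lborel. \<phi> (snd z) * (A z \<bullet> Z z))" by (simp add: R_def flip: zero_prod_def)
  ultimately show ?thesis by simp
qed

lemma AE_lborel_translate:
  fixes h :: "'a::euclidean_space"
  assumes "AE t in lborel. P t"
  shows "AE t in lborel. P (t + h)"
proof -
  have "AE t in distr lborel borel ((+) h). P t" by (subst lborel_distr_plus) (rule assms)
  then have "AE t in lborel. P (h + t)" by (rule AE_distrD[rotated]) simp
  then show ?thesis by (simp add: add.commute)
qed

lemma Np_scaleR:
  assumes [measurable]: "f \<in> borel_measurable borel"
  shows "Np p (\<lambda>x. c *\<^sub>R f x) = ennreal (\<bar>c\<bar> powr p) * Np p f"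
  unfolding Np_def by (subst nn_integral_cmult[symmetric]) (auto simp: powr_mult ennreal_mult' intro!: nn_integral_cong)

text \<open>To be used with one of the two times frozen: \<open>w\<close> is \<open>u - v\<close> as a function of the other one, and
  \<open>c\<close> is \<open>1\<close> when that is the time of \<open>u\<close> and \<open>- 1\<close> when it is the time of \<open>v\<close>.\<close>

lemma half_doubling:
  fixes \<beta> w L :: "'a::euclidean_space \<times> real \<Rightarrow> real" and A G :: "'a \<times> real \<Rightarrow> 'a" and \<phi> \<phi>' :: "real \<Rightarrow> real"
  assumes p: "p > 1" and \<delta>: "\<delta> > 0" and \<Omega>: "\<Omega> \<in> sets borel"
    and \<beta>: "\<And>t. t \<in> S \<Longrightarrow> integrable lborel (\<lambda>x. \<beta> (x, t))" "\<And>x t. x \<notin> \<Omega> \<Longrightarrow> \<beta> (x, t) = 0"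
    and A: "integrable lborel A" "Np (p / (p - 1)) A < \<infinity>" "\<And>z. fst z \<notin> \<Omega> \<Longrightarrow> A z = 0"
    and S: "AE t in lborel. t \<in> S"
    and evo: "\<And>t1 t2 \<phi>. t1 \<in> S \<Longrightarrow> t2 \<in> S \<Longrightarrow> 0 < t1 \<Longrightarrow> t1 < t2 \<Longrightarrow> t2 < T \<Longrightarrow> \<phi> \<in> test_functions \<Omega> \<Longrightarrow>
      (LINT x|lborel. (\<beta> (x, t2) - \<beta> (x, t1)) * \<phi> x) = - (LINT z|lborel. indicator {t1<..t2} (snd z) * (A z \<bullet> grad \<phi> (fst z)))"
    and L: "integrable lborel L"
    and Lle: "\<And>x t1 t2. 0 < t1 \<Longrightarrow> t1 < t2 \<Longrightarrow> t2 < T \<Longrightarrow>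
      L (x, t2) - L (x, t1) \<le> c * ((\<beta> (x, t2) - \<beta> (x, t1)) * smooth_step (w (x, t2) / \<delta>))"
    and wm[measurable]: "w \<in> borel_measurable borel" and Gm[measurable]: "G \<in> borel_measurable borel" and G: "Np p G < \<infinity>"
    and GS: "\<And>t. t \<in> S \<Longrightarrow> \<phi> t \<noteq> 0 \<Longrightarrow> Np p (\<lambda>x. G (x, t)) < \<infinity>"
    and approx: "\<And>t. t \<in> S \<Longrightarrow> \<phi> t \<noteq> 0 \<Longrightarrow> approximable p \<Omega> (\<lambda>x. w (x, t)) (\<lambda>x. G (x, t))"
    and \<phi>: "\<And>t. (\<phi> has_field_derivative \<phi>' t) (at t)" "\<And>t. 0 \<le> \<phi> t" "\<And>t. \<phi> t \<le> M" "\<And>t. \<bar>\<phi>' t\<bar> \<le> M"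
    and M: "M > 0" and h0: "h0 > 0" and supp: "\<And>t. \<phi> t \<noteq> 0 \<Longrightarrow> h0 \<le> t \<and> t < T"
  shows "- (LINT t|lborel. (LINT x|lborel. L (x, t)) * \<phi>' t) \<le>
    - (LINT t|lborel. \<phi> t * (LINT x|lborel. c * (A (x, t) \<bullet> ((bump (w (x, t) / \<delta>) / \<delta>) *\<^sub>R G (x, t)))))"
proof -
  have Am[measurable]: "A \<in> borel_measurable borel" using A by auto
  define Z where "Z z = (bump (w z / \<delta>) / \<delta>) *\<^sub>R G z" for z
  have Zm[measurable]: "Z \<in> borel_measurable borel" unfolding Z_def by measurable
  obtain M0 where M0: "M0 > 0" "\<And>x. bump x \<le> M0" using bump_bounded by blast
  have "Np p Z \<le> Np p (\<lambda>z. (M0 / \<delta>) *\<^sub>R G z)"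
    using p M0 \<delta> bump_nonneg by (intro Np_mono) (auto simp: Z_def abs_of_nonneg intro!: mult_right_mono divide_right_mono)
  also have "\<dots> < \<infinity>" using G by (simp add: Np_scaleR ennreal_mult_less_top)
  finally have ZN: "Np p Z < \<infinity>" .
  have AN: "Np (p / (p - 1)) (\<lambda>z. c *\<^sub>R A z) < \<infinity>" using A(2) by (simp add: Np_scaleR ennreal_mult_less_top)
  define e where "e t = (LINT x|lborel. L (x, t))" for t
  have ei: "integrable lborel e" unfolding e_def by (rule integral_lborel_pair(6)[OF L])
  have LS: "AE t in lborel. t \<in> S \<and> integrable lborel (\<lambda>x. L (x, t))"
    using S integral_lborel_pair(4)[OF L] by eventually_elim simp
  have "- (LINT t|lborel. e t * \<phi>' t) \<le> - (LINT z|lborel. \<phi> (snd z) * ((c *\<^sub>R A z) \<bullet> Z z))"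
  proof (rule difference_quotient_limit[OF p _ AN Zm ZN ei \<phi> M h0])
    fix h assume h: "0 < h" "h < h0"
    from AE_lborel_translate[OF LS, of "- h"] LS
    show "AE t in lborel. \<phi> t \<noteq> 0 \<longrightarrow> e t - e (t - h) \<le> - (LINT x|lborel. LINT s|lborel. indicator {0..<h} s * ((c *\<^sub>R A (x, t - s)) \<bullet> Z (x, t)))"
    proof eventually_elim
      case (elim t)
      show ?case
      proof
        assume \<phi>t: "\<phi> t \<noteq> 0"
        have t: "0 < t - h" "t - h < t" "t < T" using supp[OF \<phi>t] h by auto
        have tS: "t \<in> S" "t - h \<in> S" and Li: "integrable lborel (\<lambda>x. L (x, t))" "integrable lborel (\<lambda>x. L (x, t - h))"
          using elim by auto
        have bi: "integrable lborel (\<lambda>x. \<beta> (x, t) - \<beta> (x, t - h))" using \<beta>(1) tS by auto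
        have bsi: "integrable lborel (\<lambda>x. (\<beta> (x, t) - \<beta> (x, t - h)) * smooth_step (w (x, t) / \<delta>))"
          by (rule Bochner_Integration.integrable_bound[OF bi])
            (use bi smooth_step_bounds in \<open>auto simp: abs_mult intro!: AE_I2 mult_left_le\<close>)
        have "e t - e (t - h) = (LINT x|lborel. L (x, t) - L (x, t - h))" unfolding e_def using Li by simp
        \<comment> \<open>\<open>Lle\<close> is the discrete chain rule. Its
          \<open>smooth_step\<close> is evaluated at the later time only, so the right side is the
          evolution identity between \<open>t - h\<close> and \<open>t\<close> with a test function
          independent of the intermediate time.\<close>
        also have "\<dots> \<le> (LINT x|lborel. c * ((\<beta> (x, t) - \<beta> (x, t - h)) * smooth_step (w (x, t) / \<delta>)))"
          using Li bsi Lle[OF t] by (intro integral_mono) auto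
        also have "\<dots> = c * (LINT x|lborel. (\<beta> (x, t) - \<beta> (x, t - h)) * smooth_step (w (x, t) / \<delta>))" by simp
        also have "(LINT x|lborel. (\<beta> (x, t) - \<beta> (x, t - h)) * smooth_step (w (x, t) / \<delta>)) =
           - (LINT x|lborel. LINT s|lborel. indicator {0..<t - (t - h)} s * (A (x, t - s) \<bullet> ((bump (w (x, t) / \<delta>) / \<delta>) *\<^sub>R G (x, t))))"
          by (rule evolution_identity_approximable[OF p t(2) \<delta> \<Omega> bi _ A])
            (use \<beta>(2) evo[OF tS(2,1) t] approx[OF tS(1) \<phi>t] GS[OF tS(1) \<phi>t] in auto)
        finally show "e t - e (t - h) \<le> - (LINT x|lborel. LINT s|lborel. indicator {0..<h} s * ((c *\<^sub>R A (x, t - s)) \<bullet> Z (x, t)))"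
          unfolding Z_def by (simp add: mult.left_commute[of _ c])
      qed
    qed
  qed measurable
  moreover have "(LINT z|lborel. \<phi> (snd z) * ((c *\<^sub>R A z) \<bullet> Z z)) =
    (LINT t|lborel. \<phi> t * (LINT x|lborel. c * (A (x, t) \<bullet> ((bump (w (x, t) / \<delta>) / \<delta>) *\<^sub>R G (x, t)))))"
  proof -
    have "continuous_on UNIV \<phi>" using \<phi>(1) DERIV_continuous_on by blast
    then have [measurable]: "\<phi> \<in> borel_measurable borel" by (rule borel_measurable_continuous_onI)
    have Y: "integrable lborel (\<lambda>z. norm (c *\<^sub>R A z) * norm (Z z))"
      by (rule Young_integrable[OF p]) (use AN ZN in \<open>auto simp: Np_def\<close>)
    then have "integrable lborel (\<lambda>z. M * (norm (c *\<^sub>R A z) * norm (Z z)))" by (rule integrable_mult_right)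
    then have i: "integrable lborel (\<lambda>z. \<phi> (snd z) * ((c *\<^sub>R A z) \<bullet> Z z))"
    proof (rule Bochner_Integration.integrable_bound)
      show "AE z in lborel. norm (\<phi> (snd z) * ((c *\<^sub>R A z) \<bullet> Z z)) \<le> norm (M * (norm (c *\<^sub>R A z) * norm (Z z)))"
      proof (rule AE_I2)
        fix z
        have "norm (\<phi> (snd z) * ((c *\<^sub>R A z) \<bullet> Z z)) \<le> M * (norm (c *\<^sub>R A z) * norm (Z z))"
          unfolding real_norm_def abs_mult[of "\<phi> _"] using \<phi>(2,3) M by (intro mult_mono Cauchy_Schwarz_ineq2) auto
        then show "norm (\<phi> (snd z) * ((c *\<^sub>R A z) \<bullet> Z z)) \<le> norm (M * (norm (c *\<^sub>R A z) * norm (Z z)))"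
          unfolding real_norm_def[of "M * _"] by (rule order_trans) (rule abs_ge_self)
      qed
    qed measurable
    have eq: "(c *\<^sub>R A (x, t)) \<bullet> Z (x, t) = c * (A (x, t) \<bullet> ((bump (w (x, t) / \<delta>) / \<delta>) *\<^sub>R G (x, t)))" for x t
      by (simp add: Z_def)
    show ?thesis unfolding integral_lborel_pair(2)[OF i] by (simp only: snd_conv eq integral_mult_right_zero)
  qed
  ultimately show ?thesis by (simp add: e_def)
qed

section \<open>Doubling the time variable\<close>

text \<open>Two primitives of \<open>smooth_step ((a - k) / \<delta>)\<close>, with respect to \<open>b_pow p a\<close> and to
  \<open>- b_pow p k\<close>; writing \<open>smooth_step\<close> as a superposition of Heaviside functions avoids
  inverting \<open>b_pow\<close>.\<close>

definition upper_primitive :: "real \<Rightarrow> real \<Rightarrow> real \<times> real \<Rightarrow> real" where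
  "upper_primitive p \<delta> y = (LINT l|lborel. bump l * max 0 (b_pow p (fst y) - b_pow p (snd y + \<delta> * l)))"

definition lower_primitive :: "real \<Rightarrow> real \<Rightarrow> real \<times> real \<Rightarrow> real" where
  "lower_primitive p \<delta> y = (LINT l|lborel. bump l * max 0 (b_pow p (fst y - \<delta> * l) - b_pow p (snd y)))"

lemma primitive_borel[measurable]:
  "upper_primitive p \<delta> \<in> borel_measurable borel" "lower_primitive p \<delta> \<in> borel_measurable borel"
proof -
  have "(\<lambda>y. LINT l|lborel. bump l * max 0 (b_pow p (fst y) - b_pow p (snd y + \<delta> * l))) \<in> borel_measurable (borel :: (real \<times> real) measure)"
    by (rule lborel.borel_measurable_lebesgue_integral) (simp add: case_prod_beta borel_prod[symmetric])
  then show "upper_primitive p \<delta> \<in> borel_measurable borel" by (simp add: upper_primitive_def[abs_def])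
  have "(\<lambda>y. LINT l|lborel. bump l * max 0 (b_pow p (fst y - \<delta> * l) - b_pow p (snd y))) \<in> borel_measurable (borel :: (real \<times> real) measure)"
    by (rule lborel.borel_measurable_lebesgue_integral) (simp add: case_prod_beta borel_prod[symmetric])
  then show "lower_primitive p \<delta> \<in> borel_measurable borel" by (simp add: lower_primitive_def[abs_def])
qed

lemma bump_times_le:
  assumes "\<And>l. 0 < l \<Longrightarrow> l < 1 \<Longrightarrow> f l \<le> (g l :: real)"
  shows "bump l * f l \<le> bump l * g l"
proof (cases "0 < l \<and> l < 1")
  case True
  then show ?thesis using assms bump_nonneg by (intro mult_left_mono) auto
next
  case False
  then have "bump l = 0" by (intro bump_0) auto
  then show ?thesis by simp
qed

lemma primitive_integrand:
  assumes p: "p > 1" and \<delta>: "\<delta> \<ge> 0"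
  shows "bump l * max 0 (b_pow p a - b_pow p (k + \<delta> * l)) \<le> bump l * max 0 (b_pow p a - b_pow p k)"
    and "bump l * max 0 (b_pow p (a - \<delta> * l) - b_pow p k) \<le> bump l * max 0 (b_pow p a - b_pow p k)"
    and "integrable lborel (\<lambda>l. bump l * max 0 (b_pow p a - b_pow p (k + \<delta> * l)))"
    and "integrable lborel (\<lambda>l. bump l * max 0 (b_pow p (a - \<delta> * l) - b_pow p k))"
proof -
  have m1: "b_pow p k \<le> b_pow p (k + \<delta> * l)" and m2: "b_pow p (a - \<delta> * l) \<le> b_pow p a" if "0 < l" for l
    using p \<delta> that by (auto intro!: b_pow_mono)
  show le1: "bump l * max 0 (b_pow p a - b_pow p (k + \<delta> * l)) \<le> bump l * max 0 (b_pow p a - b_pow p k)" for l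
    by (intro bump_times_le max.mono order_refl diff_left_mono m1)
  show le2: "bump l * max 0 (b_pow p (a - \<delta> * l) - b_pow p k) \<le> bump l * max 0 (b_pow p a - b_pow p k)" for l
    by (intro bump_times_le max.mono order_refl diff_right_mono m2)
  have i: "integrable lborel (\<lambda>l. bump l * max 0 (b_pow p a - b_pow p k))"
    by (rule integrable_mult_left) (simp add: bump_integrable)
  show "integrable lborel (\<lambda>l. bump l * max 0 (b_pow p a - b_pow p (k + \<delta> * l)))"
    by (rule Bochner_Integration.integrable_bound[OF i])
      (use le1 bump_nonneg in \<open>auto simp: abs_of_nonneg intro!: AE_I2\<close>)
  show "integrable lborel (\<lambda>l. bump l * max 0 (b_pow p (a - \<delta> * l) - b_pow p k))"
    by (rule Bochner_Integration.integrable_bound[OF i])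
      (use le2 bump_nonneg in \<open>auto simp: abs_of_nonneg intro!: AE_I2\<close>)
qed

lemma primitive_bounds:
  assumes p: "p > 1" and \<delta>: "\<delta> \<ge> 0"
  shows "0 \<le> upper_primitive p \<delta> (a, k)" "upper_primitive p \<delta> (a, k) \<le> max 0 (b_pow p a - b_pow p k)"
    and "0 \<le> lower_primitive p \<delta> (a, k)" "lower_primitive p \<delta> (a, k) \<le> max 0 (b_pow p a - b_pow p k)"
proof -
  note pi = primitive_integrand[OF p \<delta>]
  have i: "integrable lborel (\<lambda>l. bump l * max 0 (b_pow p a - b_pow p k))"
    by (rule integrable_mult_left) (simp add: bump_integrable)
  have s: "(LINT l|lborel. bump l * max 0 (b_pow p a - b_pow p k)) = max 0 (b_pow p a - b_pow p k)"
    by (simp add: bump_integral)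
  show "0 \<le> upper_primitive p \<delta> (a, k)" "0 \<le> lower_primitive p \<delta> (a, k)"
    unfolding upper_primitive_def lower_primitive_def using bump_nonneg by (auto intro!: integral_nonneg_AE AE_I2)
  have "upper_primitive p \<delta> (a, k) \<le> (LINT l|lborel. bump l * max 0 (b_pow p a - b_pow p k))"
    unfolding upper_primitive_def fst_conv snd_conv by (rule integral_mono[OF pi(3) i pi(1)])
  then show "upper_primitive p \<delta> (a, k) \<le> max 0 (b_pow p a - b_pow p k)" unfolding s .
  have "lower_primitive p \<delta> (a, k) \<le> (LINT l|lborel. bump l * max 0 (b_pow p a - b_pow p k))"
    unfolding lower_primitive_def fst_conv snd_conv by (rule integral_mono[OF pi(4) i pi(2)])
  then show "lower_primitive p \<delta> (a, k) \<le> max 0 (b_pow p a - b_pow p k)" unfolding s .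
qed

text \<open>For each \<open>l\<close> the integrand is a convex function of
  \<open>b_pow p a\<close>, whose slope at \<open>a2\<close> is 1 if
  \<open>k + \<delta> * l \<le> a2\<close> and 0 otherwise. Averaging these tangent inequalities
  over \<open>l\<close> with density \<open>bump\<close> turns the slopes into
  \<open>smooth_step ((a2 - k) / \<delta>)\<close>. Convexity thus does the work of a chain rule,
  and the increment from \<open>a1\<close> to \<open>a2\<close> may be arbitrary.\<close>

lemma upper_primitive_diff:
  assumes p: "p > 1" and \<delta>: "\<delta> > 0"
  shows "upper_primitive p \<delta> (a2, k) - upper_primitive p \<delta> (a1, k) \<le> (b_pow p a2 - b_pow p a1) * smooth_step ((a2 - k) / \<delta>)"
proof -
  note i = primitive_integrand(3)[OF p less_imp_le[OF \<delta>]]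
  have "upper_primitive p \<delta> (a2, k) - upper_primitive p \<delta> (a1, k) =
    (LINT l|lborel. bump l * max 0 (b_pow p a2 - b_pow p (k + \<delta> * l)) - bump l * max 0 (b_pow p a1 - b_pow p (k + \<delta> * l)))"
    unfolding upper_primitive_def using i by simp
  also have "\<dots> \<le> (LINT l|lborel. (b_pow p a2 - b_pow p a1) * (bump l * indicator {..(a2 - k) / \<delta>} l))"
  proof (rule integral_mono)
    fix l
    let ?m = "b_pow p (k + \<delta> * l)"
    have "max 0 (b_pow p a2 - ?m) - max 0 (b_pow p a1 - ?m) \<le> (b_pow p a2 - b_pow p a1) * indicator {..(a2 - k) / \<delta>} l"
    proof (cases "l \<le> (a2 - k) / \<delta>")
      case True
      then have "?m \<le> b_pow p a2" using p \<delta> by (intro b_pow_mono) (auto simp: field_simps)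
      with True show ?thesis by (simp add: max_def)
    next
      case False
      then have "b_pow p a2 \<le> ?m" using p \<delta> by (intro b_pow_mono) (auto simp: field_simps)
      with False show ?thesis by (simp add: max_def)
    qed
    from mult_left_mono[OF this bump_nonneg[of l]]
    show "bump l * max 0 (b_pow p a2 - ?m) - bump l * max 0 (b_pow p a1 - ?m) \<le> (b_pow p a2 - b_pow p a1) * (bump l * indicator {..(a2 - k) / \<delta>} l)"
      by (simp add: algebra_simps)
  qed (use i bump_ind_integrable in auto)
  also have "\<dots> = (b_pow p a2 - b_pow p a1) * smooth_step ((a2 - k) / \<delta>)" by (simp add: smooth_step_def)
  finally show ?thesis .
qed

text \<open>The mirror image: the integrand is convex in \<open>b_pow p k\<close> with slope 0 or
  -1, and the tangent is again taken at the new value. Lowering \<open>a\<close> by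
  \<open>\<delta> * l\<close>, rather than raising \<open>k\<close>, makes the same
  \<open>smooth_step ((a - k2) / \<delta>)\<close> appear, so one test function serves both
  equations.\<close>

lemma lower_primitive_diff:
  assumes p: "p > 1" and \<delta>: "\<delta> > 0"
  shows "lower_primitive p \<delta> (a, k2) - lower_primitive p \<delta> (a, k1) \<le> - ((b_pow p k2 - b_pow p k1) * smooth_step ((a - k2) / \<delta>))"
proof -
  note i = primitive_integrand(4)[OF p less_imp_le[OF \<delta>]]
  have "lower_primitive p \<delta> (a, k2) - lower_primitive p \<delta> (a, k1) =
    (LINT l|lborel. bump l * max 0 (b_pow p (a - \<delta> * l) - b_pow p k2) - bump l * max 0 (b_pow p (a - \<delta> * l) - b_pow p k1))"
    unfolding lower_primitive_def using i by simp
  also have "\<dots> \<le> (LINT l|lborel. - (b_pow p k2 - b_pow p k1) * (bump l * indicator {..(a - k2) / \<delta>} l))"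
  proof (rule integral_mono)
    fix l
    let ?m = "b_pow p (a - \<delta> * l)"
    have "max 0 (?m - b_pow p k2) - max 0 (?m - b_pow p k1) \<le> - (b_pow p k2 - b_pow p k1) * indicator {..(a - k2) / \<delta>} l"
    proof (cases "l \<le> (a - k2) / \<delta>")
      case True
      then have "b_pow p k2 \<le> ?m" using p \<delta> by (intro b_pow_mono) (auto simp: field_simps)
      with True show ?thesis by (simp add: max_def)
    next
      case False
      then have "?m \<le> b_pow p k2" using p \<delta> by (intro b_pow_mono) (auto simp: field_simps)
      with False show ?thesis by (simp add: max_def)
    qed
    from mult_left_mono[OF this bump_nonneg[of l]]
    show "bump l * max 0 (?m - b_pow p k2) - bump l * max 0 (?m - b_pow p k1) \<le> - (b_pow p k2 - b_pow p k1) * (bump l * indicator {..(a - k2) / \<delta>} l)"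
      by (simp add: algebra_simps)
  qed (use i bump_ind_integrable in auto)
  also have "\<dots> = - (b_pow p k2 - b_pow p k1) * smooth_step ((a - k2) / \<delta>)" by (simp add: smooth_step_def)
  finally show ?thesis by (simp only: mult_minus_left)
qed

text \<open>The two primitives need not agree for \<open>\<delta> > 0\<close>. Their common limit is
  what allows the two time derivatives of the doubled weight to be added.\<close>

lemma primitive_tendsto:
  assumes p: "p > 1" and \<delta>: "\<And>n. \<delta> n > 0" "\<delta> \<longlonglongrightarrow> 0"
  shows "(\<lambda>n. upper_primitive p (\<delta> n) (a, k)) \<longlonglongrightarrow> max 0 (b_pow p a - b_pow p k)"
    and "(\<lambda>n. lower_primitive p (\<delta> n) (a, k)) \<longlonglongrightarrow> max 0 (b_pow p a - b_pow p k)"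
proof -
  have i: "integrable lborel (\<lambda>l. bump l * max 0 (b_pow p a - b_pow p k))"
    by (rule integrable_mult_left) (simp add: bump_integrable)
  have s: "(LINT l|lborel. bump l * max 0 (b_pow p a - b_pow p k)) = max 0 (b_pow p a - b_pow p k)"
    by (simp add: bump_integral)
  have bc: "(\<lambda>n. b_pow p (x n)) \<longlonglongrightarrow> b_pow p y" if "x \<longlonglongrightarrow> y" for x y
    by (rule continuous_on_tendsto_compose[OF b_pow_continuous[OF p] that]) auto
  have "(\<lambda>n. LINT l|lborel. bump l * max 0 (b_pow p a - b_pow p (k + \<delta> n * l))) \<longlonglongrightarrow> (LINT l|lborel. bump l * max 0 (b_pow p a - b_pow p k))"
  proof (rule integral_dominated_convergence[OF _ _ i])
    have "(\<lambda>n. k + \<delta> n * l) \<longlonglongrightarrow> k + 0 * l" for l by (intro tendsto_intros \<delta>)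
    then show "AE l in lborel. (\<lambda>n. bump l * max 0 (b_pow p a - b_pow p (k + \<delta> n * l))) \<longlonglongrightarrow> bump l * max 0 (b_pow p a - b_pow p k)"
      by (intro AE_I2 tendsto_intros bc) simp
    show "AE l in lborel. norm (bump l * max 0 (b_pow p a - b_pow p (k + \<delta> n * l))) \<le> bump l * max 0 (b_pow p a - b_pow p k)" for n
      using primitive_integrand(1)[OF p less_imp_le[OF \<delta>(1)]] bump_nonneg by (intro AE_I2) (simp add: abs_mult)
  qed auto
  then show "(\<lambda>n. upper_primitive p (\<delta> n) (a, k)) \<longlonglongrightarrow> max 0 (b_pow p a - b_pow p k)"
    unfolding s upper_primitive_def by simp
  have "(\<lambda>n. LINT l|lborel. bump l * max 0 (b_pow p (a - \<delta> n * l) - b_pow p k)) \<longlonglongrightarrow> (LINT l|lborel. bump l * max 0 (b_pow p a - b_pow p k))"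
  proof (rule integral_dominated_convergence[OF _ _ i])
    have "(\<lambda>n. a - \<delta> n * l) \<longlonglongrightarrow> a - 0 * l" for l by (intro tendsto_intros \<delta>)
    then show "AE l in lborel. (\<lambda>n. bump l * max 0 (b_pow p (a - \<delta> n * l) - b_pow p k)) \<longlonglongrightarrow> bump l * max 0 (b_pow p a - b_pow p k)"
      by (intro AE_I2 tendsto_intros bc) simp
    show "AE l in lborel. norm (bump l * max 0 (b_pow p (a - \<delta> n * l) - b_pow p k)) \<le> bump l * max 0 (b_pow p a - b_pow p k)" for n
      using primitive_integrand(2)[OF p less_imp_le[OF \<delta>(1)]] bump_nonneg by (intro AE_I2) (simp add: abs_mult)
  qed auto
  then show "(\<lambda>n. lower_primitive p (\<delta> n) (a, k)) \<longlonglongrightarrow> max 0 (b_pow p a - b_pow p k)"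
    unfolding s lower_primitive_def by simp
qed

lemma bump_derivative:
  obtains bump' M where "\<And>x. (bump has_field_derivative bump' x) (at x)" "continuous_on UNIV bump'"
    "M > 0" "\<And>x. \<bar>bump' x\<bar> \<le> M" "\<And>x. x < 0 \<or> x > 1 \<Longrightarrow> bump' x = 0"
proof -
  define bump' where "bump' x = frechet_derivative bump (at x) 1" for x
  have t: "bump \<in> test_functions UNIV"
    by (rule test_functionsI[OF smooth_bump compact_Icc[of 0 1]]) (auto intro: bump_0)
  have t': "bump' \<in> test_functions UNIV"
    using test_functions_derivative[OF t, of 1] by (simp add: bump'_def[abs_def])
  have d: "(bump has_field_derivative bump' x) (at x)" for x
  proof -
    have "frechet_derivative bump (at x) = (*) (bump' x)"
      using smooth_grad(2)[OF smooth_bump, of x] by (auto simp: bump'_def)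
    then show ?thesis using smooth_has_derivative[OF smooth_bump, of x] by (simp add: has_field_derivative_def)
  qed
  obtain M where "M > 0" "\<And>x. \<bar>bump' x\<bar> \<le> M" using test_function_bounded[OF t'] by metis
  moreover have "bump' x = 0" if "x < 0 \<or> x > 1" for x
  proof -
    have "(bump has_field_derivative 0) (at x)"
    proof (rule has_field_derivative_transform_within_open[of "\<lambda>_. 0" 0 x "{..<0} \<union> {1<..}"])
      show "0 = bump y" if "y \<in> {..<0} \<union> {1<..}" for y using that by (intro bump_0[symmetric]) auto
    qed (use that in auto)
    with d show ?thesis by (rule DERIV_unique)
  qed
  ultimately show ?thesis using that[OF d smooth_continuous[OF test_functionsD(1)[OF t']]] by blast
qed

text \<open>A function of one time, read as a function of both, has no decay in the other time; the
  indicator confines that time to a bounded interval, and Tonelli gives the factor of its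
  length.\<close>

lemma integrable_lift:
  fixes f :: "'a::euclidean_space \<times> real \<Rightarrow> real"
  assumes "integrable lborel f"
  shows "integrable lborel (\<lambda>y::'a \<times> (real \<times> real). indicator {0<..<T} (snd (snd y)) * f (fst y, fst (snd y)))"
    and "integrable lborel (\<lambda>y::'a \<times> (real \<times> real). indicator {0<..<T} (fst (snd y)) * f (fst y, snd (snd y)))"
proof -
  have [measurable]: "f \<in> borel_measurable borel" using assms by auto
  have fin: "(\<integral>\<^sup>+z. ennreal \<bar>f z\<bar> \<partial>lborel) < \<infinity>" using assms by (simp add: integrable_iff_bounded)
  have I: "(\<integral>\<^sup>+s. indicator {0<..<T} s \<partial>lborel) < (\<infinity>::ennreal)" by (cases "0 \<le> T") (simp_all add: emeasure_lborel_Ioo)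
  have fxt: "(\<integral>\<^sup>+z. ennreal \<bar>f z\<bar> \<partial>lborel) = (\<integral>\<^sup>+x. \<integral>\<^sup>+t. ennreal \<bar>f (x, t)\<bar> \<partial>lborel \<partial>lborel)"
    by (rule nn_integral_lborel_pair(1)) simp
  have tr: "(\<integral>\<^sup>+y. indicator {0<..<T} (k (snd y)) * ennreal \<bar>f (fst y, k' (snd y))\<bar> \<partial>(lborel :: ('a \<times> (real \<times> real)) measure)) < \<infinity>"
    if k: "(k = snd \<and> k' = fst) \<or> (k = fst \<and> k' = snd)" for k k' :: "real \<times> real \<Rightarrow> real"
  proof -
    have [measurable]: "k \<in> borel_measurable borel" "k' \<in> borel_measurable borel" using k by auto
    have "(\<integral>\<^sup>+y. indicator {0<..<T} (k (snd y)) * ennreal \<bar>f (fst y, k' (snd y))\<bar> \<partial>(lborel :: ('a \<times> (real \<times> real)) measure))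
      = (\<integral>\<^sup>+x. \<integral>\<^sup>+ts. indicator {0<..<T} (k ts) * ennreal \<bar>f (x, k' ts)\<bar> \<partial>lborel \<partial>lborel)"
      by (subst nn_integral_lborel_pair(1)) simp_all
    also have "\<dots> = (\<integral>\<^sup>+x. (\<integral>\<^sup>+t. ennreal \<bar>f (x, t)\<bar> \<partial>lborel) * (\<integral>\<^sup>+s. indicator {0<..<T} s \<partial>lborel) \<partial>lborel)"
    proof (rule nn_integral_cong)
      fix x
      show "(\<integral>\<^sup>+ts. indicator {0<..<T} (k ts) * ennreal \<bar>f (x, k' ts)\<bar> \<partial>lborel) = (\<integral>\<^sup>+t. ennreal \<bar>f (x, t)\<bar> \<partial>lborel) * (\<integral>\<^sup>+s. indicator {0<..<T} s \<partial>lborel)"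
        using k
      proof
        assume "k = snd \<and> k' = fst"
        then show ?thesis
          by (subst nn_integral_lborel_pair(1)) (simp_all add: nn_integral_multc nn_integral_cmult mult.commute)
      next
        assume "k = fst \<and> k' = snd"
        then show ?thesis
          by (subst nn_integral_lborel_pair(2)) (simp_all add: nn_integral_multc nn_integral_cmult mult.commute)
      qed
    qed
    also have "\<dots> = (\<integral>\<^sup>+z. ennreal \<bar>f z\<bar> \<partial>lborel) * (\<integral>\<^sup>+s. indicator {0<..<T} s \<partial>lborel)"
      unfolding fxt by (rule nn_integral_multc) measurable
    also have "\<dots> < \<infinity>" using fin I by (simp add: ennreal_mult_less_top)
    finally show ?thesis .
  qed
  have n: "ennreal (norm (indicator {0<..<T} s * r)) = indicator {0<..<T} s * ennreal \<bar>r\<bar>" for s r :: real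
    by (auto simp: indicator_def)
  show "integrable lborel (\<lambda>y::'a \<times> (real \<times> real). indicator {0<..<T} (snd (snd y)) * f (fst y, fst (snd y)))"
    using tr[of snd fst] by (intro integrableI_bounded) (simp_all only: n, measurable)
  show "integrable lborel (\<lambda>y::'a \<times> (real \<times> real). indicator {0<..<T} (fst (snd y)) * f (fst y, snd (snd y)))"
    using tr[of fst snd] by (intro integrableI_bounded) (simp_all only: n, measurable)
qed

lemma triple_integral:
  fixes F :: "'a::euclidean_space \<times> (real \<times> real) \<Rightarrow> real"
  assumes "integrable lborel F"
  shows "(LINT y|lborel. F y) = (LINT s|lborel. LINT t|lborel. LINT x|lborel. F (x, (t, s)))"
    and "integrable lborel (\<lambda>s. LINT t|lborel. LINT x|lborel. F (x, (t, s)))"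
    and "(LINT y|lborel. F y) = (LINT t|lborel. LINT s|lborel. LINT x|lborel. F (x, (t, s)))"
    and "integrable lborel (\<lambda>t. LINT s|lborel. LINT x|lborel. F (x, (t, s)))"
proof -
  note i = integral_lborel_pair(6)[OF assms]
  show "(LINT y|lborel. F y) = (LINT s|lborel. LINT t|lborel. LINT x|lborel. F (x, (t, s)))"
    unfolding integral_lborel_pair(2)[OF assms] by (rule integral_lborel_pair(2)[OF i])
  show "(LINT y|lborel. F y) = (LINT t|lborel. LINT s|lborel. LINT x|lborel. F (x, (t, s)))"
    unfolding integral_lborel_pair(2)[OF assms] by (rule integral_lborel_pair(1)[OF i])
  show "integrable lborel (\<lambda>s. LINT t|lborel. LINT x|lborel. F (x, (t, s)))"
    by (rule integral_lborel_pair(6)[OF i])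
  show "integrable lborel (\<lambda>t. LINT s|lborel. LINT x|lborel. F (x, (t, s)))"
    by (rule integral_lborel_pair(5)[OF i])
qed

lemma integrable_dominated:
  fixes F D :: "'a::euclidean_space \<Rightarrow> real"
  assumes "integrable lborel D" "F \<in> borel_measurable borel" "\<And>y. \<bar>F y\<bar> \<le> D y"
  shows "integrable lborel F"
  by (rule Bochner_Integration.integrable_bound[OF assms(1)])
    (use assms(2,3) in \<open>auto intro!: AE_I2 order_trans[OF assms(3)]\<close>)

text \<open>Two solutions reduced to what the doubling uses: the lateral data survive only in
  \<open>approx\<close>, the differential equation only in \<open>evo_u\<close> and
  \<open>evo_v\<close>. Everything vanishes off the cylinder, so integrals may run over the whole
  space. \<open>S\<close> is one set of good times common to both solutions.\<close>

locale solution_pair =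
  fixes p T \<sigma> :: real and \<Omega> :: "'a::euclidean_space set"
    and u v :: "'a \<times> real \<Rightarrow> real" and U V :: "'a \<times> real \<Rightarrow> 'a" and S :: "real set"
  assumes p: "p > 1" and T: "T > 0" and sigma: "\<sigma> = 1 \<or> \<sigma> = -1" and Om[measurable]: "\<Omega> \<in> sets borel"
    and meas[measurable]: "u \<in> borel_measurable borel" "v \<in> borel_measurable borel"
      "U \<in> borel_measurable borel" "V \<in> borel_measurable borel"
    and outside: "\<And>z. z \<notin> cylinder \<Omega> T \<Longrightarrow> u z = 0" "\<And>z. z \<notin> cylinder \<Omega> T \<Longrightarrow> v z = 0"
      "\<And>z. z \<notin> cylinder \<Omega> T \<Longrightarrow> U z = 0" "\<And>z. z \<notin> cylinder \<Omega> T \<Longrightarrow> V z = 0"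
    and fin: "Np p U < \<infinity>" "Np p V < \<infinity>"
    and bint: "integrable lborel (\<lambda>z. b_pow p (u z))" "integrable lborel (\<lambda>z. b_pow p (v z))"
    and fluxint: "integrable lborel (\<lambda>z. flux p (U z))" "integrable lborel (\<lambda>z. flux p (V z))"
    and S: "AE t in lborel. t \<in> S"
    and slices: "\<And>t. t \<in> S \<Longrightarrow> integrable lborel (\<lambda>x. b_pow p (u (x, t)))" "\<And>t. t \<in> S \<Longrightarrow> integrable lborel (\<lambda>x. b_pow p (v (x, t)))"
      "\<And>t. t \<in> S \<Longrightarrow> Np p (\<lambda>x. U (x, t)) < \<infinity>" "\<And>t. t \<in> S \<Longrightarrow> Np p (\<lambda>x. V (x, t)) < \<infinity>"
    and evo_u: "\<And>t1 t2 \<phi>. t1 \<in> S \<Longrightarrow> t2 \<in> S \<Longrightarrow> 0 < t1 \<Longrightarrow> t1 < t2 \<Longrightarrow> t2 < T \<Longrightarrow> \<phi> \<in> test_functions \<Omega> \<Longrightarrow>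
      (LINT x|lborel. (b_pow p (u (x, t2)) - b_pow p (u (x, t1))) * \<phi> x) = - (LINT z|lborel. indicator {t1<..t2} (snd z) * (flux p (U z) \<bullet> grad \<phi> (fst z)))"
    and evo_v: "\<And>t1 t2 \<phi>. t1 \<in> S \<Longrightarrow> t2 \<in> S \<Longrightarrow> 0 < t1 \<Longrightarrow> t1 < t2 \<Longrightarrow> t2 < T \<Longrightarrow> \<phi> \<in> test_functions \<Omega> \<Longrightarrow>
      (LINT x|lborel. (b_pow p (v (x, t2)) - b_pow p (v (x, t1))) * \<phi> x) = - (LINT z|lborel. indicator {t1<..t2} (snd z) * (flux p (V z) \<bullet> grad \<phi> (fst z)))"
    and approx: "\<And>t s. t \<in> S \<Longrightarrow> s \<in> S \<Longrightarrow> 0 < t \<Longrightarrow> t < T \<Longrightarrow> 0 < s \<Longrightarrow> s < T \<Longrightarrow> 0 < \<sigma> * (s - t) \<Longrightarrow>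
      approximable p \<Omega> (\<lambda>x. u (x, t) - v (x, s)) (\<lambda>x. U (x, t) - V (x, s))"
begin

text \<open>The weight is \<open>\<omega> t * \<rho> (s - t)\<close> with a bump
  \<open>\<rho>\<close> of width \<open>\<epsilon>\<close> on the side of 0 selected by
  \<open>\<sigma>\<close>. The operator that adds the two time derivatives annihilates functions of
  \<open>s - t\<close>, so in the sum only \<open>\<omega>\<close> is differentiated.\<close>

lemma doubling_weight:
  fixes \<omega> \<omega>' :: "real \<Rightarrow> real"
  assumes \<omega>: "\<And>t. (\<omega> has_field_derivative \<omega>' t) (at t)" "continuous_on UNIV \<omega>'" "\<And>t. 0 \<le> \<omega> t" "\<And>t. \<omega> t \<le> M1" "\<And>t. \<bar>\<omega>' t\<bar> \<le> M1"
    and \<omega>0: "\<And>t. t < c \<or> d < t \<Longrightarrow> \<omega> t = 0 \<and> \<omega>' t = 0" and \<epsilon>: "\<epsilon> > 0" and M1: "M1 > 0"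
  obtains \<phi> \<phi>t \<phi>s :: "real \<Rightarrow> real \<Rightarrow> real" and M where
    "\<And>t s. ((\<lambda>t. \<phi> t s) has_field_derivative \<phi>t t s) (at t)" "\<And>t s. ((\<lambda>s. \<phi> t s) has_field_derivative \<phi>s t s) (at s)"
    "\<And>t s. 0 \<le> \<phi> t s" "\<And>t s. \<phi> t s \<le> M" "\<And>t s. \<bar>\<phi>t t s\<bar> \<le> M" "\<And>t s. \<bar>\<phi>s t s\<bar> \<le> M" "M > 0"
    "\<And>t s. \<phi> t s \<noteq> 0 \<or> \<phi>t t s \<noteq> 0 \<or> \<phi>s t s \<noteq> 0 \<Longrightarrow> c \<le> t \<and> t \<le> d \<and> c - \<epsilon> \<le> s \<and> s \<le> d + \<epsilon>"
    "\<And>t s. \<phi> t s \<noteq> 0 \<Longrightarrow> 0 < \<sigma> * (s - t)"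
    "\<And>t s. \<phi>t t s + \<phi>s t s = \<omega>' t * mollifier \<epsilon> (\<sigma> * (s - t))"
    "(\<lambda>y. \<phi> (fst y) (snd y)) \<in> borel_measurable borel" "(\<lambda>y. \<phi>t (fst y) (snd y)) \<in> borel_measurable borel"
    "(\<lambda>y. \<phi>s (fst y) (snd y)) \<in> borel_measurable borel"
proof -
  obtain bump' Mb where b': "\<And>x. (bump has_field_derivative bump' x) (at x)" "continuous_on UNIV bump'"
    "Mb > 0" "\<And>x. \<bar>bump' x\<bar> \<le> Mb" "\<And>x. x < 0 \<or> x > 1 \<Longrightarrow> bump' x = 0" using bump_derivative by metis
  obtain M0 where M0: "M0 > 0" "\<And>x. bump x \<le> M0" using bump_bounded by blast
  define \<rho> where "\<rho> r = bump (\<sigma> * r / \<epsilon>) / \<epsilon>" for r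
  define \<rho>' where "\<rho>' r = (bump' (\<sigma> * r / \<epsilon>) * (\<sigma> / \<epsilon>)) / \<epsilon>" for r
  have \<rho>d: "(\<rho> has_field_derivative \<rho>' r) (at r)" for r
  proof -
    have "((\<lambda>r. \<sigma> * r / \<epsilon>) has_field_derivative \<sigma> / \<epsilon>) (at r)"
      using \<epsilon> by (auto intro!: derivative_eq_intros)
    from DERIV_cdivide[OF DERIV_chain2[OF b'(1) this]] show ?thesis unfolding \<rho>_def \<rho>'_def .
  qed
  have s1: "\<bar>\<sigma>\<bar> = 1" using sigma by auto
  have \<rho>b: "0 \<le> \<rho> r" "\<rho> r \<le> M0 / \<epsilon>" for r using M0 bump_nonneg \<epsilon> by (auto simp: \<rho>_def intro!: divide_right_mono)
  have \<rho>'b: "\<bar>\<rho>' r\<bar> \<le> Mb / \<epsilon> / \<epsilon>" for r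
    using b'(4)[of "\<sigma> * r / \<epsilon>"] \<epsilon> s1 by (simp add: \<rho>'_def abs_mult divide_right_mono)
  have \<rho>0: "0 < \<sigma> * r \<and> \<sigma> * r < \<epsilon>" if "\<rho> r \<noteq> 0" for r
    using that \<epsilon> bump_0[of "\<sigma> * r / \<epsilon>"] by (auto simp: \<rho>_def not_le[symmetric] zero_less_divide_iff divide_less_eq_1 intro!: ccontr[of "_ < _"]) (simp_all add: divide_le_0_iff le_divide_eq_1)
  have \<rho>'0: "\<bar>r\<bar> \<le> \<epsilon>" if "\<rho>' r \<noteq> 0" for r
  proof -
    have "0 \<le> \<sigma> * r / \<epsilon> \<and> \<sigma> * r / \<epsilon> \<le> 1" using that b'(5)[of "\<sigma> * r / \<epsilon>"] by (auto simp: \<rho>'_def not_less[symmetric])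
    then have "0 \<le> \<sigma> * r" "\<sigma> * r \<le> \<epsilon>" using \<epsilon> by (simp_all add: zero_le_divide_iff divide_le_eq_1)
    then show ?thesis using sigma by auto
  qed
  have \<rho>1: "\<bar>r\<bar> \<le> \<epsilon>" if "\<rho> r \<noteq> 0" for r using \<rho>0[OF that] sigma by auto
  define \<phi> where "\<phi> t s = \<omega> t * \<rho> (s - t)" for t s
  define \<phi>t where "\<phi>t t s = \<omega>' t * \<rho> (s - t) - \<omega> t * \<rho>' (s - t)" for t s
  define \<phi>s where "\<phi>s t s = \<omega> t * \<rho>' (s - t)" for t s
  define M where "M = M1 * (M0 / \<epsilon>) + M1 * (Mb / \<epsilon> / \<epsilon>)"
  have Mp: "M1 * (M0 / \<epsilon>) > 0" "M1 * (Mb / \<epsilon> / \<epsilon>) > 0" using M1 M0 b'(3) \<epsilon> by simp_all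
  have b1: "\<bar>\<omega> t * \<rho> r\<bar> \<le> M1 * (M0 / \<epsilon>)" "\<bar>\<omega>' t * \<rho> r\<bar> \<le> M1 * (M0 / \<epsilon>)" "\<bar>\<omega> t * \<rho>' r\<bar> \<le> M1 * (Mb / \<epsilon> / \<epsilon>)" for t r
    unfolding abs_mult using \<omega>(3,4,5) \<rho>b \<rho>'b M1 by (intro mult_mono; simp add: abs_of_nonneg)+
  have \<omega>m[measurable]: "\<omega> \<in> borel_measurable borel" "\<omega>' \<in> borel_measurable borel" "\<rho> \<in> borel_measurable borel" "\<rho>' \<in> borel_measurable borel"
  proof -
    show "\<omega> \<in> borel_measurable borel" using \<omega>(1) DERIV_continuous_on borel_measurable_continuous_onI by blast
    show "\<omega>' \<in> borel_measurable borel" by (rule borel_measurable_continuous_onI[OF \<omega>(2)])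
    show "\<rho> \<in> borel_measurable borel" unfolding \<rho>_def by measurable
    have [measurable]: "bump' \<in> borel_measurable borel" by (rule borel_measurable_continuous_onI[OF b'(2)])
    show "\<rho>' \<in> borel_measurable borel" unfolding \<rho>'_def by measurable
  qed
  show ?thesis
  proof (rule that[of \<phi> \<phi>t \<phi>s M])
    fix t s
    have d1: "((\<lambda>t. \<rho> (s - t)) has_field_derivative \<rho>' (s - t) * (- 1)) (at t)"
      by (rule DERIV_chain2[OF \<rho>d]) (auto intro!: derivative_eq_intros)
    show "((\<lambda>t. \<phi> t s) has_field_derivative \<phi>t t s) (at t)"
      unfolding \<phi>_def \<phi>t_def using DERIV_mult[OF \<omega>(1) d1] by (simp add: algebra_simps)
    have d2: "((\<lambda>s. \<rho> (s - t)) has_field_derivative \<rho>' (s - t) * 1) (at s)"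
      by (rule DERIV_chain2[OF \<rho>d]) (auto intro!: derivative_eq_intros)
    show "((\<lambda>s. \<phi> t s) has_field_derivative \<phi>s t s) (at s)"
      unfolding \<phi>_def \<phi>s_def using DERIV_cmult[OF d2, of "\<omega> t"] by simp
    show "0 \<le> \<phi> t s" unfolding \<phi>_def using \<omega>(3) \<rho>b by simp
    show "\<phi> t s \<le> M" unfolding \<phi>_def M_def using b1(1)[of t "s - t"] Mp by linarith
    show "\<bar>\<phi>t t s\<bar> \<le> M" unfolding \<phi>t_def M_def using b1(2)[of t "s - t"] b1(3)[of t "s - t"] by linarith
    show "\<bar>\<phi>s t s\<bar> \<le> M" unfolding \<phi>s_def M_def using b1(3)[of t "s - t"] Mp by linarith
    show "M > 0" unfolding M_def using Mp by linarith
    show "c \<le> t \<and> t \<le> d \<and> c - \<epsilon> \<le> s \<and> s \<le> d + \<epsilon>" if "\<phi> t s \<noteq> 0 \<or> \<phi>t t s \<noteq> 0 \<or> \<phi>s t s \<noteq> 0"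
    proof -
      have "\<omega> t \<noteq> 0 \<or> \<omega>' t \<noteq> 0" using that by (auto simp: \<phi>_def \<phi>t_def \<phi>s_def)
      then have t: "c \<le> t" "t \<le> d" using \<omega>0[of t] by (auto simp: not_less[symmetric])
      have "\<rho> (s - t) \<noteq> 0 \<or> \<rho>' (s - t) \<noteq> 0" using that by (auto simp: \<phi>_def \<phi>t_def \<phi>s_def)
      then have "\<bar>s - t\<bar> \<le> \<epsilon>" using \<rho>1 \<rho>'0 by blast
      then show ?thesis using t by auto
    qed
    show "0 < \<sigma> * (s - t)" if "\<phi> t s \<noteq> 0" using that \<rho>0[of "s - t"] by (auto simp: \<phi>_def)
    show "\<phi>t t s + \<phi>s t s = \<omega>' t * mollifier \<epsilon> (\<sigma> * (s - t))"
      by (simp add: \<phi>t_def \<phi>s_def \<rho>_def mollifier_real)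
  next
    show "(\<lambda>y. \<phi> (fst y) (snd y)) \<in> borel_measurable borel" unfolding \<phi>_def by measurable
    show "(\<lambda>y. \<phi>t (fst y) (snd y)) \<in> borel_measurable borel" unfolding \<phi>t_def by measurable
    show "(\<lambda>y. \<phi>s (fst y) (snd y)) \<in> borel_measurable borel" unfolding \<phi>s_def by measurable
  qed
qed

lemma doubled_inequality:
  fixes \<phi> \<phi>t \<phi>s :: "real \<Rightarrow> real \<Rightarrow> real"
  assumes \<delta>: "\<delta> > 0" and
    \<phi>: "\<And>t s. ((\<lambda>t. \<phi> t s) has_field_derivative \<phi>t t s) (at t)" "\<And>t s. ((\<lambda>s. \<phi> t s) has_field_derivative \<phi>s t s) (at s)"
    "\<And>t s. 0 \<le> \<phi> t s" "\<And>t s. \<phi> t s \<le> M" "\<And>t s. \<bar>\<phi>t t s\<bar> \<le> M" "\<And>t s. \<bar>\<phi>s t s\<bar> \<le> M" and M: "M > 0"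
    and supp: "\<And>t s. \<phi> t s \<noteq> 0 \<or> \<phi>t t s \<noteq> 0 \<or> \<phi>s t s \<noteq> 0 \<Longrightarrow> h0 \<le> t \<and> t < T \<and> h0 \<le> s \<and> s < T" and h0: "h0 > 0"
    and order: "\<And>t s. \<phi> t s \<noteq> 0 \<Longrightarrow> 0 < \<sigma> * (s - t)"
    and m[measurable]: "(\<lambda>y. \<phi> (fst y) (snd y)) \<in> borel_measurable borel" "(\<lambda>y. \<phi>t (fst y) (snd y)) \<in> borel_measurable borel"
    "(\<lambda>y. \<phi>s (fst y) (snd y)) \<in> borel_measurable borel"
  shows "0 \<le> (LINT y|lborel. upper_primitive p \<delta> (u (fst y, fst (snd y)), v (fst y, snd (snd y))) * \<phi>t (fst (snd y)) (snd (snd y))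
      + lower_primitive p \<delta> (u (fst y, fst (snd y)), v (fst y, snd (snd y))) * \<phi>s (fst (snd y)) (snd (snd y)))"
proof -
  have supp0: "\<phi> t s = 0 \<and> \<phi>t t s = 0 \<and> \<phi>s t s = 0" if "\<not> (0 < t \<and> t < T \<and> 0 < s \<and> s < T)" for t s
    using supp[of t s] h0 that by (meson less_le_trans)
  define F1 where "F1 y = upper_primitive p \<delta> (u (fst y, fst (snd y)), v (fst y, snd (snd y))) * \<phi>t (fst (snd y)) (snd (snd y))" for y :: "'a \<times> (real \<times> real)"
  define F2 where "F2 y = lower_primitive p \<delta> (u (fst y, fst (snd y)), v (fst y, snd (snd y))) * \<phi>s (fst (snd y)) (snd (snd y))" for y :: "'a \<times> (real \<times> real)"
  define Z where "Z y = (bump ((u (fst y, fst (snd y)) - v (fst y, snd (snd y))) / \<delta>) / \<delta>) *\<^sub>R (U (fst y, fst (snd y)) - V (fst y, snd (snd y)))" for y :: "'a \<times> (real \<times> real)"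
  define P1 where "P1 y = \<phi> (fst (snd y)) (snd (snd y)) * (flux p (U (fst y, fst (snd y))) \<bullet> Z y)" for y
  define P2 where "P2 y = \<phi> (fst (snd y)) (snd (snd y)) * (flux p (V (fst y, snd (snd y))) \<bullet> Z y)" for y
  have [measurable]: "(\<lambda>y::'a \<times> (real \<times> real). \<phi> (fst (snd y)) (snd (snd y))) \<in> borel_measurable borel"
    "(\<lambda>y::'a \<times> (real \<times> real). \<phi>t (fst (snd y)) (snd (snd y))) \<in> borel_measurable borel"
    "(\<lambda>y::'a \<times> (real \<times> real). \<phi>s (fst (snd y)) (snd (snd y))) \<in> borel_measurable borel"
    using measurable_compose[OF snd_borel m(1)] measurable_compose[OF snd_borel m(2)] measurable_compose[OF snd_borel m(3)] by simp_all
  have Zm[measurable]: "Z \<in> borel_measurable borel" unfolding Z_def by measurable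
  have Fm: "F1 \<in> borel_measurable borel" "F2 \<in> borel_measurable borel" "P1 \<in> borel_measurable borel" "P2 \<in> borel_measurable borel"
    unfolding F1_def F2_def P1_def P2_def by measurable
  \<comment> \<open>Each summand depends on one of the two times only, and the indicator of the
    other makes it integrable. The weight and its derivatives live where both indicators are 1, so
    nothing is lost in the domination.\<close>
  define D1 where "D1 y = indicator {0<..<T} (snd (snd y)) * \<bar>b_pow p (u (fst y, fst (snd y)))\<bar> + indicator {0<..<T} (fst (snd y)) * \<bar>b_pow p (v (fst y, snd (snd y)))\<bar>" for y :: "'a \<times> (real \<times> real)"
  have D1i: "integrable lborel (\<lambda>y. M * D1 y)"
    unfolding D1_def
    using integrable_lift(1)[of "\<lambda>z. \<bar>b_pow p (u z)\<bar>" T] integrable_lift(2)[of "\<lambda>z. \<bar>b_pow p (v z)\<bar>" T] bint by auto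
  have prim: "\<bar>upper_primitive p \<delta> (a, k)\<bar> \<le> \<bar>b_pow p a\<bar> + \<bar>b_pow p k\<bar>" "\<bar>lower_primitive p \<delta> (a, k)\<bar> \<le> \<bar>b_pow p a\<bar> + \<bar>b_pow p k\<bar>" for a k
    using primitive_bounds[OF p less_imp_le[OF \<delta>], of a k] by auto
  have FD: "\<bar>k * f\<bar> \<le> M * D1 y"
    if "\<bar>k\<bar> \<le> \<bar>b_pow p (u (fst y, fst (snd y)))\<bar> + \<bar>b_pow p (v (fst y, snd (snd y)))\<bar>" "\<bar>f\<bar> \<le> M"
      "f \<noteq> 0 \<Longrightarrow> h0 \<le> fst (snd y) \<and> fst (snd y) < T \<and> h0 \<le> snd (snd y) \<and> snd (snd y) < T" for k f y
  proof (cases "f = 0")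
    case False
    have "\<bar>k * f\<bar> \<le> (\<bar>b_pow p (u (fst y, fst (snd y)))\<bar> + \<bar>b_pow p (v (fst y, snd (snd y)))\<bar>) * M"
      unfolding abs_mult using that by (intro mult_mono) auto
    also have "\<dots> = M * D1 y" using that(3)[OF False] h0 by (simp add: D1_def)
    finally show ?thesis .
  qed (use M in \<open>simp add: D1_def\<close>)
  have F1i: "integrable lborel F1" and F2i: "integrable lborel F2"
    using supp \<phi>(5,6) prim by (intro integrable_dominated[OF D1i] Fm; simp only: F1_def F2_def; intro FD; blast)+
  define D2 where "D2 y = indicator {0<..<T} (snd (snd y)) * (norm (U (fst y, fst (snd y))) powr p) + indicator {0<..<T} (fst (snd y)) * (norm (V (fst y, snd (snd y))) powr p)" for y :: "'a \<times> (real \<times> real)"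
  have UVi: "integrable lborel (\<lambda>z. norm (U z) powr p)" "integrable lborel (\<lambda>z. norm (V z) powr p)"
    using fin by (auto intro!: integrableI_nonneg simp: Np_def)
  obtain M0 where M0: "M0 > 0" "\<And>x. bump x \<le> M0" using bump_bounded by blast
  \<comment> \<open>Bound of the weight, times the bound \<open>M0 / \<delta>\<close> of the
    derivative of the smoothed Heaviside function, times the constant from \<open>FXY\<close>: 1 for
    the flux and \<open>2 powr p\<close> for the difference of the gradients.\<close>
  define B where "B = M * ((M0 / \<delta>) * (1 + 2 powr p))"
  have Bp: "B > 0" unfolding B_def using M M0 \<delta> by (intro mult_pos_pos add_pos_pos) auto
  have D2i: "integrable lborel (\<lambda>y. B * D2 y)"
    unfolding D2_def using integrable_lift(1)[OF UVi(1), of T] integrable_lift(2)[OF UVi(2), of T] by auto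
  have FXY: "norm (flux p W) * norm (X - Y) \<le> (1 + 2 powr p) * (norm X powr p + norm Y powr p)" if "W = X \<or> W = Y" for W X Y :: 'a
  proof -
    have "norm (flux p W) * norm (X - Y) \<le> norm (flux p W) powr (p / (p - 1)) + norm (X - Y) powr p"
      using scaled_Young[OF p zero_less_one, of "norm (flux p W)" "norm (X - Y)"] by simp
    also have "norm (flux p W) powr (p / (p - 1)) = norm W powr p" by (rule norm_flux_powr[OF p])
    also have "norm W powr p \<le> norm X powr p + norm Y powr p" using that by auto
    also have "norm (X - Y) powr p \<le> 2 powr p * (norm X powr p + norm Y powr p)"
      using norm_add_powr_le[of p X "- Y"] p by simp
    finally show ?thesis by (simp add: algebra_simps)
  qed
  have PD: "\<bar>\<phi> (fst (snd y)) (snd (snd y)) * (flux p W \<bullet> Z y)\<bar> \<le> B * D2 y"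
    if W: "W = U (fst y, fst (snd y)) \<or> W = V (fst y, snd (snd y))" for W y
  proof (cases "\<phi> (fst (snd y)) (snd (snd y)) = 0")
    case False
    define X where "X = U (fst y, fst (snd y))"
    define Y where "Y = V (fst y, snd (snd y))"
    have "norm (Z y) \<le> (M0 / \<delta>) * norm (X - Y)"
      using M0 bump_nonneg \<delta> by (auto simp: Z_def X_def Y_def intro!: mult_right_mono divide_right_mono)
    then have "norm (flux p W) * norm (Z y) \<le> norm (flux p W) * ((M0 / \<delta>) * norm (X - Y))" by (rule mult_left_mono) simp
    also have "\<dots> = (M0 / \<delta>) * (norm (flux p W) * norm (X - Y))" by simp
    also have "\<dots> \<le> (M0 / \<delta>) * ((1 + 2 powr p) * (norm X powr p + norm Y powr p))"
      using M0 \<delta> W by (intro mult_left_mono FXY) (auto simp: X_def Y_def)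
    finally have a: "\<bar>flux p W \<bullet> Z y\<bar> \<le> (M0 / \<delta>) * ((1 + 2 powr p) * (norm X powr p + norm Y powr p))"
      using Cauchy_Schwarz_ineq2[of "flux p W" "Z y"] by linarith
    have "\<bar>\<phi> (fst (snd y)) (snd (snd y)) * (flux p W \<bullet> Z y)\<bar> \<le> M * ((M0 / \<delta>) * ((1 + 2 powr p) * (norm X powr p + norm Y powr p)))"
      unfolding abs_mult using \<phi>(3,4) M by (intro mult_mono a) auto
    also have "\<dots> = B * D2 y" using supp[of "fst (snd y)" "snd (snd y)"] False h0 by (simp add: B_def D2_def X_def Y_def)
    finally show ?thesis .
  qed (use Bp in \<open>simp add: D2_def\<close>)
  have P1i: "integrable lborel P1" and P2i: "integrable lborel P2"
    unfolding P1_def P2_def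
    by (intro integrable_dominated[OF D2i _ PD] Fm[unfolded P1_def P2_def]; simp)+
  have step1: "AE s in lborel. - (LINT t|lborel. LINT x|lborel. F1 (x, (t, s))) \<le> - (LINT t|lborel. LINT x|lborel. P1 (x, (t, s)))"
    using S
  proof eventually_elim
    case (elim s)
    show ?case
    proof (cases "0 < s \<and> s < T")
      case False
      then have "\<phi>t t s = 0" "\<phi> t s = 0" for t using supp0[of t s] by blast+
      then show ?thesis by (simp add: F1_def P1_def)
    next
      case True
      define L where "L z = indicator {0<..<T} (snd z) * upper_primitive p \<delta> (u z, v (fst z, s))" for z
      define w where "w z = u z - v (fst z, s)" for z
      define G where "G z = indicator {0<..<T} (snd z) *\<^sub>R (U z - V (fst z, s))" for z
      have [measurable]: "w \<in> borel_measurable borel" "G \<in> borel_measurable borel" "L \<in> borel_measurable borel"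
        unfolding w_def G_def L_def by measurable
      have bvs: "integrable lborel (\<lambda>z::'a \<times> real. indicator {0<..T} (snd z) * b_pow p (v (fst z, s)))"
      proof (rule integrableI_bounded)
        have "(\<integral>\<^sup>+z. ennreal (norm (indicator {0<..T} (snd z) * b_pow p (v (fst z, s)))) \<partial>(lborel :: ('a \<times> real) measure))
          = Np 1 (\<lambda>z. indicator {0<..T} (snd z) *\<^sub>R b_pow p (v (fst z, s)))" by (simp add: Np_def)
        also have "\<dots> = ennreal (T - 0) * Np 1 (\<lambda>x. b_pow p (v (x, s)))" by (rule Np_strip) (use T in auto)
        also have "\<dots> < \<infinity>" using Np_1[OF slices(2)[OF elim]] by (simp add: ennreal_mult_less_top)
        finally show "(\<integral>\<^sup>+z. ennreal (norm (indicator {0<..T} (snd z) * b_pow p (v (fst z, s)))) \<partial>(lborel :: ('a \<times> real) measure)) < \<infinity>" .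
      qed measurable
      have Li: "integrable lborel L"
      proof (rule integrable_dominated)
        show "integrable lborel (\<lambda>z. \<bar>b_pow p (u z)\<bar> + \<bar>indicator {0<..T} (snd z) * b_pow p (v (fst z, s))\<bar>)"
          using bint bvs by auto
        show "\<bar>L z\<bar> \<le> \<bar>b_pow p (u z)\<bar> + \<bar>indicator {0<..T} (snd z) * b_pow p (v (fst z, s))\<bar>" for z
          using prim(1)[of "u z" "v (fst z, s)"] by (auto simp: L_def indicator_def)
      qed simp
      have GN: "Np p G < \<infinity>"
      proof -
        have "Np p G \<le> Np p (\<lambda>z. U z + (- (indicator {0<..T} (snd z) *\<^sub>R V (fst z, s))))"
        proof (rule Np_mono)
          fix z
          show "norm (G z) \<le> norm (U z + (- (indicator {0<..T} (snd z) *\<^sub>R V (fst z, s))))"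
            by (auto simp: G_def indicator_def)
        qed (use p in simp)
        also have "\<dots> \<le> ennreal (2 powr p) * (Np p U + Np p (\<lambda>z. - (indicator {0<..T} (snd z) *\<^sub>R V (fst z, s))))"
          by (rule Np_add) (use p in auto)
        also have "Np p (\<lambda>z. - (indicator {0<..T} (snd z) *\<^sub>R V (fst z, s))) = ennreal (T - 0) * Np p (\<lambda>x. V (x, s))"
          unfolding Np_uminus by (rule Np_strip) (use T in auto)
        also have "ennreal (2 powr p) * (Np p U + ennreal (T - 0) * Np p (\<lambda>x. V (x, s))) < \<infinity>"
          using fin slices(4)[OF elim] by (simp add: ennreal_mult_less_top)
        finally show ?thesis .
      qed
      have "- (LINT t|lborel. (LINT x|lborel. L (x, t)) * \<phi>t t s) \<le>
        - (LINT t|lborel. \<phi> t s * (LINT x|lborel. 1 * (flux p (U (x, t)) \<bullet> ((bump (w (x, t) / \<delta>) / \<delta>) *\<^sub>R G (x, t)))))"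
      proof (rule half_doubling[where \<beta>="\<lambda>z. b_pow p (u z)" and \<phi>="\<lambda>t. \<phi> t s" and \<phi>'="\<lambda>t. \<phi>t t s" and c=1 and A="\<lambda>z. flux p (U z)",
          OF p \<delta> Om slices(1) _ fluxint(1) _ _ S evo_u Li _ _ _ GN _ _ \<phi>(1) \<phi>(3) \<phi>(4) \<phi>(5) M h0])
        show "b_pow p (u (x, t)) = 0" if "x \<notin> \<Omega>" for x t using outside(1)[of "(x, t)"] that by simp
        show "flux p (U z) = 0" if "fst z \<notin> \<Omega>" for z using outside(3)[of z] that by (cases z) simp
        show "h0 \<le> t \<and> t < T" if "\<phi> t s \<noteq> 0" for t using supp[of t s] that by simp
        show "Np (p / (p - 1)) (\<lambda>z. flux p (U z)) < \<infinity>" using fin(1) by (simp add: Np_def norm_flux_powr[OF p])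
        show "L (x, t2) - L (x, t1) \<le> 1 * ((b_pow p (u (x, t2)) - b_pow p (u (x, t1))) * smooth_step (w (x, t2) / \<delta>))"
          if "0 < t1" "t1 < t2" "t2 < T" for x t1 t2
          using upper_primitive_diff[OF p \<delta>] that by (simp add: L_def w_def)
        show "Np p (\<lambda>x. G (x, t)) < \<infinity>" if "t \<in> S" for t
        proof -
          have "Np p (\<lambda>x. G (x, t)) \<le> Np p (\<lambda>x. U (x, t) + (- V (x, s)))"
            by (rule Np_mono) (use p in \<open>auto simp: G_def indicator_def\<close>)
          also have "\<dots> \<le> ennreal (2 powr p) * (Np p (\<lambda>x. U (x, t)) + Np p (\<lambda>x. - V (x, s)))"
            by (rule Np_add) (use p in auto)
          also have "\<dots> < \<infinity>" unfolding Np_uminus using slices(3)[OF that] slices(4)[OF elim] by (simp add: ennreal_mult_less_top)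
          finally show ?thesis .
        qed
        show "approximable p \<Omega> (\<lambda>x. w (x, t)) (\<lambda>x. G (x, t))" if "t \<in> S" "\<phi> t s \<noteq> 0" for t
          using approx[OF that(1) elim] supp[of t s] order[of t s] that(2) h0 True by (simp add: w_def G_def)
      qed measurable
      moreover have "(LINT x|lborel. L (x, t)) * \<phi>t t s = (LINT x|lborel. F1 (x, (t, s)))" for t
      proof -
        have "L (x, t) * \<phi>t t s = F1 (x, (t, s))" for x
          using supp[of t s] h0 by (auto simp: L_def F1_def indicator_def)
        then show ?thesis by (simp flip: integral_mult_left_zero)
      qed
      moreover have "\<phi> t s * (LINT x|lborel. 1 * (flux p (U (x, t)) \<bullet> ((bump (w (x, t) / \<delta>) / \<delta>) *\<^sub>R G (x, t)))) = (LINT x|lborel. P1 (x, (t, s)))" for t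
      proof -
        have "\<phi> t s * (1 * (flux p (U (x, t)) \<bullet> ((bump (w (x, t) / \<delta>) / \<delta>) *\<^sub>R G (x, t)))) = P1 (x, (t, s))" for x
          using supp[of t s] h0 by (cases "\<phi> t s = 0") (auto simp: G_def P1_def Z_def w_def)
        then show ?thesis by (simp only: flip: integral_mult_right_zero)
      qed
      ultimately show ?thesis by (simp only:)
    qed
  qed
  \<comment> \<open>Now \<open>t\<close> is frozen and \<open>lower_primitive\<close> plays the part
    of the primitive. The constant \<open>c = - 1\<close> records that \<open>v\<close> enters
    \<open>u - v\<close> negatively, which gives the second elliptic term the sign opposite to the
    first.\<close>
  have step2: "AE t in lborel. - (LINT s|lborel. LINT x|lborel. F2 (x, (t, s))) \<le> (LINT s|lborel. LINT x|lborel. P2 (x, (t, s)))"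
    using S
  proof eventually_elim
    case (elim t)
    show ?case
    proof (cases "0 < t \<and> t < T")
      case False
      then have "\<phi>s t s = 0" "\<phi> t s = 0" for s using supp0[of t s] by blast+
      then show ?thesis by (simp add: F2_def P2_def)
    next
      case True
      define L where "L z = indicator {0<..<T} (snd z) * lower_primitive p \<delta> (u (fst z, t), v z)" for z
      define w where "w z = u (fst z, t) - v z" for z
      define G where "G z = indicator {0<..<T} (snd z) *\<^sub>R (U (fst z, t) - V z)" for z
      have [measurable]: "w \<in> borel_measurable borel" "G \<in> borel_measurable borel" "L \<in> borel_measurable borel"
        unfolding w_def G_def L_def by measurable
      have bvs: "integrable lborel (\<lambda>z::'a \<times> real. indicator {0<..T} (snd z) * b_pow p (u (fst z, t)))"
      proof (rule integrableI_bounded)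
        have "(\<integral>\<^sup>+z. ennreal (norm (indicator {0<..T} (snd z) * b_pow p (u (fst z, t)))) \<partial>(lborel :: ('a \<times> real) measure))
          = Np 1 (\<lambda>z. indicator {0<..T} (snd z) *\<^sub>R b_pow p (u (fst z, t)))" by (simp add: Np_def)
        also have "\<dots> = ennreal (T - 0) * Np 1 (\<lambda>x. b_pow p (u (x, t)))" by (rule Np_strip) (use T in auto)
        also have "\<dots> < \<infinity>" using Np_1[OF slices(1)[OF elim]] by (simp add: ennreal_mult_less_top)
        finally show "(\<integral>\<^sup>+z. ennreal (norm (indicator {0<..T} (snd z) * b_pow p (u (fst z, t)))) \<partial>(lborel :: ('a \<times> real) measure)) < \<infinity>" .
      qed measurable
      have Li: "integrable lborel L"
      proof (rule integrable_dominated)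
        show "integrable lborel (\<lambda>z. \<bar>b_pow p (v z)\<bar> + \<bar>indicator {0<..T} (snd z) * b_pow p (u (fst z, t))\<bar>)"
          using bint bvs by auto
        show "\<bar>L z\<bar> \<le> \<bar>b_pow p (v z)\<bar> + \<bar>indicator {0<..T} (snd z) * b_pow p (u (fst z, t))\<bar>" for z
          using prim(2)[of "u (fst z, t)" "v z"] by (auto simp: L_def indicator_def)
      qed simp
      have GN: "Np p G < \<infinity>"
      proof -
        have "Np p G \<le> Np p (\<lambda>z. V z + (- (indicator {0<..T} (snd z) *\<^sub>R U (fst z, t))))"
        proof (rule Np_mono)
          fix z
          show "norm (G z) \<le> norm (V z + (- (indicator {0<..T} (snd z) *\<^sub>R U (fst z, t))))"
            by (auto simp: G_def indicator_def norm_minus_commute)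
        qed (use p in simp)
        also have "\<dots> \<le> ennreal (2 powr p) * (Np p V + Np p (\<lambda>z. - (indicator {0<..T} (snd z) *\<^sub>R U (fst z, t))))"
          by (rule Np_add) (use p in auto)
        also have "Np p (\<lambda>z. - (indicator {0<..T} (snd z) *\<^sub>R U (fst z, t))) = ennreal (T - 0) * Np p (\<lambda>x. U (x, t))"
          unfolding Np_uminus by (rule Np_strip) (use T in auto)
        also have "ennreal (2 powr p) * (Np p V + ennreal (T - 0) * Np p (\<lambda>x. U (x, t))) < \<infinity>"
          using fin slices(3)[OF elim] by (simp add: ennreal_mult_less_top)
        finally show ?thesis .
      qed
      have "- (LINT s|lborel. (LINT x|lborel. L (x, s)) * \<phi>s t s) \<le>
        - (LINT s|lborel. \<phi> t s * (LINT x|lborel. (- 1) * (flux p (V (x, s)) \<bullet> ((bump (w (x, s) / \<delta>) / \<delta>) *\<^sub>R G (x, s)))))"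
      proof (rule half_doubling[where \<beta>="\<lambda>z. b_pow p (v z)" and \<phi>="\<lambda>s. \<phi> t s" and \<phi>'="\<lambda>s. \<phi>s t s" and c="-1" and A="\<lambda>z. flux p (V z)",
          OF p \<delta> Om slices(2) _ fluxint(2) _ _ S evo_v Li _ _ _ GN _ _ \<phi>(2) \<phi>(3) \<phi>(4) \<phi>(6) M h0])
        show "b_pow p (v (x, s)) = 0" if "x \<notin> \<Omega>" for x s using outside(2)[of "(x, s)"] that by simp
        show "flux p (V z) = 0" if "fst z \<notin> \<Omega>" for z using outside(4)[of z] that by (cases z) simp
        show "h0 \<le> s \<and> s < T" if "\<phi> t s \<noteq> 0" for s using supp[of t s] that by simp
        show "Np (p / (p - 1)) (\<lambda>z. flux p (V z)) < \<infinity>" using fin(2) by (simp add: Np_def norm_flux_powr[OF p])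
        show "L (x, t2) - L (x, t1) \<le> (- 1) * ((b_pow p (v (x, t2)) - b_pow p (v (x, t1))) * smooth_step (w (x, t2) / \<delta>))"
          if "0 < t1" "t1 < t2" "t2 < T" for x t1 t2
          using lower_primitive_diff[OF p \<delta>] that by (simp add: L_def w_def)
        show "Np p (\<lambda>x. G (x, s)) < \<infinity>" if "s \<in> S" for s
        proof -
          have "Np p (\<lambda>x. G (x, s)) \<le> Np p (\<lambda>x. U (x, t) + (- V (x, s)))"
            by (rule Np_mono) (use p in \<open>auto simp: G_def indicator_def\<close>)
          also have "\<dots> \<le> ennreal (2 powr p) * (Np p (\<lambda>x. U (x, t)) + Np p (\<lambda>x. - V (x, s)))"
            by (rule Np_add) (use p in auto)
          also have "\<dots> < \<infinity>" unfolding Np_uminus using slices(4)[OF that] slices(3)[OF elim] by (simp add: ennreal_mult_less_top)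
          finally show ?thesis .
        qed
        show "approximable p \<Omega> (\<lambda>x. w (x, s)) (\<lambda>x. G (x, s))" if "s \<in> S" "\<phi> t s \<noteq> 0" for s
          using approx[OF elim that(1)] supp[of t s] order[of t s] that(2) h0 True by (simp add: w_def G_def)
      qed measurable
      moreover have "(LINT x|lborel. L (x, s)) * \<phi>s t s = (LINT x|lborel. F2 (x, (t, s)))" for s
      proof -
        have "L (x, s) * \<phi>s t s = F2 (x, (t, s))" for x
          using supp[of t s] h0 by (auto simp: L_def F2_def indicator_def)
        then show ?thesis by (simp flip: integral_mult_left_zero)
      qed
      moreover have "\<phi> t s * (LINT x|lborel. (- 1) * (flux p (V (x, s)) \<bullet> ((bump (w (x, s) / \<delta>) / \<delta>) *\<^sub>R G (x, s)))) = - (LINT x|lborel. P2 (x, (t, s)))" for s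
      proof -
        have "\<phi> t s * ((- 1) * (flux p (V (x, s)) \<bullet> ((bump (w (x, s) / \<delta>) / \<delta>) *\<^sub>R G (x, s)))) = (- 1) * P2 (x, (t, s))" for x
          using supp[of t s] h0 by (cases "\<phi> t s = 0") (auto simp: G_def P2_def Z_def w_def)
        then have "\<phi> t s * (LINT x|lborel. (- 1) * (flux p (V (x, s)) \<bullet> ((bump (w (x, s) / \<delta>) / \<delta>) *\<^sub>R G (x, s)))) = (LINT x|lborel. (- 1) * P2 (x, (t, s)))"
          by (simp only: flip: integral_mult_right_zero)
        then show ?thesis by simp
      qed
      ultimately show ?thesis by (simp only: integral_minus minus_minus)
    qed
  qed
  have "- (LINT y|lborel. F1 y) \<le> - (LINT y|lborel. P1 y)"
    unfolding triple_integral(1)[OF F1i] triple_integral(1)[OF P1i] integral_minus[symmetric]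
    by (rule integral_mono_AE) (use step1 triple_integral(2)[OF F1i] triple_integral(2)[OF P1i] in auto)
  moreover have "- (LINT y|lborel. F2 y) \<le> (LINT y|lborel. P2 y)"
    unfolding triple_integral(3)[OF F2i] triple_integral(3)[OF P2i] integral_minus[symmetric]
    by (rule integral_mono_AE) (use step2 triple_integral(4)[OF F2i] triple_integral(4)[OF P2i] in auto)
  \<comment> \<open>Both elliptic terms carry the same vector \<open>Z\<close>, a nonnegative
    multiple of \<open>U - V\<close>, so monotonicity of the flux applies pointwise, even though
    \<open>U\<close> and \<open>V\<close> are taken at different times.\<close>
  moreover have "0 \<le> (LINT y|lborel. P1 y - P2 y)"
  proof (intro integral_nonneg_AE AE_I2)
    fix y :: "'a \<times> (real \<times> real)"
    have "P1 y - P2 y = \<phi> (fst (snd y)) (snd (snd y)) * ((bump ((u (fst y, fst (snd y)) - v (fst y, snd (snd y))) / \<delta>) / \<delta>) *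
      ((flux p (U (fst y, fst (snd y))) - flux p (V (fst y, snd (snd y)))) \<bullet> (U (fst y, fst (snd y)) - V (fst y, snd (snd y)))))"
      by (simp add: P1_def P2_def Z_def inner_diff_left right_diff_distrib)
    also have "\<dots> \<ge> 0" using \<phi>(3) bump_nonneg \<delta> flux_monotone[OF p] by (intro mult_nonneg_nonneg) auto
    finally show "0 \<le> P1 y - P2 y" .
  qed
  moreover have "(LINT y|lborel. P1 y - P2 y) = (LINT y|lborel. P1 y) - (LINT y|lborel. P2 y)" using P1i P2i by simp
  moreover have "(LINT y|lborel. F1 y + F2 y) = (LINT y|lborel. F1 y) + (LINT y|lborel. F2 y)" using F1i F2i by simp
  ultimately show ?thesis unfolding F1_def[symmetric] F2_def[symmetric] by linarith
qed

text \<open>As \<open>\<delta> \<rightarrow> 0\<close> both primitives tend to the positive part of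
  \<open>b_pow p (u) - b_pow p (v)\<close> under a bound independent of \<open>\<delta>\<close>.
  Their weights then add up to \<open>\<phi>t t s + \<phi>s t s\<close>, which no longer contains
  the derivative of the mollifier in \<open>s - t\<close>.\<close>

lemma doubled_limit:
  fixes \<omega> \<omega>' :: "real \<Rightarrow> real"
  assumes \<omega>: "\<And>t. (\<omega> has_field_derivative \<omega>' t) (at t)" "continuous_on UNIV \<omega>'" "\<And>t. 0 \<le> \<omega> t" "\<And>t. \<omega> t \<le> M1" "\<And>t. \<bar>\<omega>' t\<bar> \<le> M1"
    and \<omega>0: "\<And>t. t < c \<or> d < t \<Longrightarrow> \<omega> t = 0 \<and> \<omega>' t = 0" and cd: "\<epsilon> < c" "d + \<epsilon> < T" and \<epsilon>: "\<epsilon> > 0" and M1: "M1 > 0"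
  defines "f \<equiv> \<lambda>y::'a \<times> (real \<times> real). max 0 (b_pow p (u (fst y, fst (snd y))) - b_pow p (v (fst y, snd (snd y)))) *
      (\<omega>' (fst (snd y)) * mollifier \<epsilon> (\<sigma> * (snd (snd y) - fst (snd y))))"
  shows "0 \<le> (LINT y|lborel. f y)" "integrable lborel f"
proof -
  obtain \<phi> \<phi>t \<phi>s M where \<phi>:
    "\<And>t s. ((\<lambda>t. \<phi> t s) has_field_derivative \<phi>t t s) (at t)" "\<And>t s. ((\<lambda>s. \<phi> t s) has_field_derivative \<phi>s t s) (at s)"
    "\<And>t s. 0 \<le> \<phi> t s" "\<And>t s. \<phi> t s \<le> M" "\<And>t s. \<bar>\<phi>t t s\<bar> \<le> M" "\<And>t s. \<bar>\<phi>s t s\<bar> \<le> M" "M > 0"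
    and supp: "\<And>t s. \<phi> t s \<noteq> 0 \<or> \<phi>t t s \<noteq> 0 \<or> \<phi>s t s \<noteq> 0 \<Longrightarrow> c \<le> t \<and> t \<le> d \<and> c - \<epsilon> \<le> s \<and> s \<le> d + \<epsilon>"
    and ord: "\<And>t s. \<phi> t s \<noteq> 0 \<Longrightarrow> 0 < \<sigma> * (s - t)"
    and sum: "\<And>t s. \<phi>t t s + \<phi>s t s = \<omega>' t * mollifier \<epsilon> (\<sigma> * (s - t))"
    and m[measurable]: "(\<lambda>y. \<phi> (fst y) (snd y)) \<in> borel_measurable borel" "(\<lambda>y. \<phi>t (fst y) (snd y)) \<in> borel_measurable borel"
    "(\<lambda>y. \<phi>s (fst y) (snd y)) \<in> borel_measurable borel"
    by (rule doubling_weight[OF \<omega> \<omega>0 \<epsilon> M1]) blast+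
  have h0: "c - \<epsilon> > 0" using cd by simp
  have supp': "c - \<epsilon> \<le> t \<and> t < T \<and> c - \<epsilon> \<le> s \<and> s < T" if "\<phi> t s \<noteq> 0 \<or> \<phi>t t s \<noteq> 0 \<or> \<phi>s t s \<noteq> 0" for t s
    using supp[OF that] cd \<epsilon> by linarith
  have m3[measurable]: "(\<lambda>y::'a \<times> (real \<times> real). \<phi>t (fst (snd y)) (snd (snd y))) \<in> borel_measurable borel"
    "(\<lambda>y::'a \<times> (real \<times> real). \<phi>s (fst (snd y)) (snd (snd y))) \<in> borel_measurable borel"
    using measurable_compose[OF snd_borel m(2)] measurable_compose[OF snd_borel m(3)] by simp_all
  define D1 where "D1 y = indicator {0<..<T} (snd (snd y)) * \<bar>b_pow p (u (fst y, fst (snd y)))\<bar> + indicator {0<..<T} (fst (snd y)) * \<bar>b_pow p (v (fst y, snd (snd y)))\<bar>" for y :: "'a \<times> (real \<times> real)"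
  have D1i: "integrable lborel (\<lambda>y. 2 * M * D1 y)"
    unfolding D1_def
    using integrable_lift(1)[of "\<lambda>z. \<bar>b_pow p (u z)\<bar>" T] integrable_lift(2)[of "\<lambda>z. \<bar>b_pow p (v z)\<bar>" T] bint by auto
  define X where "X \<delta> y = upper_primitive p \<delta> (u (fst y, fst (snd y)), v (fst y, snd (snd y))) * \<phi>t (fst (snd y)) (snd (snd y))
      + lower_primitive p \<delta> (u (fst y, fst (snd y)), v (fst y, snd (snd y))) * \<phi>s (fst (snd y)) (snd (snd y))" for \<delta> and y :: "'a \<times> (real \<times> real)"
  have Xm: "X \<delta> \<in> borel_measurable borel" for \<delta> unfolding X_def by measurable
  have XD: "\<bar>k1 * \<phi>t t s + k2 * \<phi>s t s\<bar> \<le> 2 * M * D1 (x, (t, s))"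
    if k: "0 \<le> k1" "k1 \<le> max 0 (b_pow p (u (x, t)) - b_pow p (v (x, s)))" "0 \<le> k2" "k2 \<le> max 0 (b_pow p (u (x, t)) - b_pow p (v (x, s)))" for k1 k2 x t s
  proof (cases "\<phi>t t s \<noteq> 0 \<or> \<phi>s t s \<noteq> 0")
    case True
    then have "0 < t" "t < T" "0 < s" "s < T" using supp'[of t s] h0 by auto
    then have D: "D1 (x, (t, s)) = \<bar>b_pow p (u (x, t))\<bar> + \<bar>b_pow p (v (x, s))\<bar>" by (simp add: D1_def)
    have "\<bar>k1 * \<phi>t t s\<bar> \<le> D1 (x, (t, s)) * M" "\<bar>k2 * \<phi>s t s\<bar> \<le> D1 (x, (t, s)) * M"
      unfolding abs_mult using k \<phi>(5,6) by (intro mult_mono; auto simp: D)+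
    then show ?thesis by (simp add: algebra_simps)
  next
    case False
    then have "\<phi>t t s = 0" "\<phi>s t s = 0" by auto
    moreover have "0 \<le> D1 (x, (t, s))" by (simp add: D1_def)
    ultimately show ?thesis using \<phi>(7) by simp
  qed
  define \<delta> where "\<delta> n = 1 / real (Suc n)" for n
  have \<delta>: "\<delta> n > 0" "\<delta> \<longlonglongrightarrow> 0" for n
    unfolding \<delta>_def by (simp, rule LIMSEQ_Suc[OF lim_1_over_n])
  have fX: "f y = max 0 (b_pow p (u (fst y, fst (snd y))) - b_pow p (v (fst y, snd (snd y)))) * \<phi>t (fst (snd y)) (snd (snd y))
      + max 0 (b_pow p (u (fst y, fst (snd y))) - b_pow p (v (fst y, snd (snd y)))) * \<phi>s (fst (snd y)) (snd (snd y))" for y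
    unfolding f_def sum[symmetric] by (rule distrib_left)
  have fm: "f \<in> borel_measurable borel" unfolding fX[abs_def] by measurable
  show "integrable lborel f"
  proof (rule integrable_dominated[OF D1i fm])
    fix y :: "'a \<times> (real \<times> real)"
    obtain x t s where y: "y = (x, (t, s))" by (cases y) auto
    show "\<bar>f y\<bar> \<le> 2 * M * D1 y" unfolding fX unfolding y fst_conv snd_conv by (rule XD) auto
  qed
  have "(\<lambda>n. LINT y|lborel. X (\<delta> n) y) \<longlonglongrightarrow> (LINT y|lborel. f y)"
  proof (rule integral_dominated_convergence[OF _ _ D1i])
    show "AE y in lborel. (\<lambda>n. X (\<delta> n) y) \<longlonglongrightarrow> f y"
      unfolding X_def fX by (intro AE_I2 tendsto_add tendsto_mult tendsto_const primitive_tendsto[OF p \<delta>])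
    show "AE y in lborel. norm (X (\<delta> n) y) \<le> 2 * M * D1 y" for n
    proof (rule AE_I2)
      fix y :: "'a \<times> (real \<times> real)"
      obtain x t s where y: "y = (x, (t, s))" by (cases y) auto
      show "norm (X (\<delta> n) y) \<le> 2 * M * D1 y" unfolding X_def y fst_conv snd_conv real_norm_def
        by (rule XD) (rule primitive_bounds[OF p less_imp_le[OF \<delta>(1)]])+
    qed
  qed (use fm Xm in auto)
  moreover have "0 \<le> (LINT y|lborel. X (\<delta> n) y)" for n
    unfolding X_def by (rule doubled_inequality[OF \<delta>(1) \<phi>(1-6) \<phi>(7) supp' h0 ord m])
  ultimately show "0 \<le> (LINT y|lborel. f y)" by (intro LIMSEQ_le_const) auto
qed

section \<open>Returning to a single time\<close>

lemma mollifier_shift: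
  assumes "\<epsilon> > 0"
  shows "integrable lborel (\<lambda>s. mollifier \<epsilon> (\<sigma> * (s - t)))" "(LINT s|lborel. mollifier \<epsilon> (\<sigma> * (s - t))) = 1"
proof -
  have s0: "\<sigma> \<noteq> 0" "\<bar>\<sigma>\<bar> = 1" using sigma by auto
  have eq: "\<sigma> * (s - t) = (- \<sigma> * t) + \<sigma> * s" for s by (simp add: algebra_simps)
  show "integrable lborel (\<lambda>s. mollifier \<epsilon> (\<sigma> * (s - t)))"
    unfolding eq by (rule lborel_integrable_real_affine[OF mollifier_integrable[OF assms] s0(1)])
  show "(LINT s|lborel. mollifier \<epsilon> (\<sigma> * (s - t))) = 1"
    using lborel_integral_real_affine[OF s0(1), of "mollifier \<epsilon>" "- \<sigma> * t"] mollifier_integral[OF assms, where 'a=real] s0(2)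
    unfolding eq by simp
qed

text \<open>The substitution \<open>s = t + \<sigma> * r\<close> exhibits the integral as an
  average, with density \<open>mollifier \<epsilon> r\<close>, of translation errors of
  \<open>\<beta>\<close> in time; only \<open>0 < r < \<epsilon>\<close> contributes.\<close>

lemma undoubling_error:
  fixes \<beta> :: "'a \<times> real \<Rightarrow> real"
  assumes [measurable]: "\<beta> \<in> borel_measurable borel" and \<epsilon>: "\<epsilon> > 0"
    and e: "\<And>r. 0 \<le> r \<Longrightarrow> r \<le> \<epsilon> \<Longrightarrow> Np 1 (\<lambda>z. \<beta> (z + (0, \<sigma> * r)) - \<beta> z) \<le> e"
  shows "(\<integral>\<^sup>+y. ennreal (mollifier \<epsilon> (\<sigma> * (snd (snd y) - fst (snd y))) * \<bar>\<beta> (fst y, snd (snd y)) - \<beta> (fst y, fst (snd y))\<bar>) \<partial>lborel) \<le> e"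
proof -
  have s0: "\<sigma> \<noteq> 0" "\<bar>\<sigma>\<bar> = 1" "\<sigma> * (\<sigma> * r) = r" for r using sigma by auto
  have m0: "mollifier \<epsilon> r = 0" if "r \<le> 0 \<or> r \<ge> \<epsilon>" for r :: real
    using that \<epsilon> by (auto simp: mollifier_real intro!: bump_0 simp: divide_nonpos_pos)
  have "(\<integral>\<^sup>+y. ennreal (mollifier \<epsilon> (\<sigma> * (snd (snd y) - fst (snd y))) * \<bar>\<beta> (fst y, snd (snd y)) - \<beta> (fst y, fst (snd y))\<bar>) \<partial>lborel)
    = (\<integral>\<^sup>+x. \<integral>\<^sup>+y. ennreal (mollifier \<epsilon> (\<sigma> * (snd y - fst y)) * \<bar>\<beta> (x, snd y) - \<beta> (x, fst y)\<bar>) \<partial>lborel \<partial>lborel)"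
    by (subst nn_integral_lborel_pair(1)) simp_all
  also have "\<dots> = (\<integral>\<^sup>+x. \<integral>\<^sup>+t. \<integral>\<^sup>+s. ennreal (mollifier \<epsilon> (\<sigma> * (s - t)) * \<bar>\<beta> (x, s) - \<beta> (x, t)\<bar>) \<partial>lborel \<partial>lborel \<partial>lborel)"
    by (subst nn_integral_lborel_pair(1)) simp_all
  also have "\<dots> = (\<integral>\<^sup>+x. \<integral>\<^sup>+t. \<integral>\<^sup>+r. ennreal (mollifier \<epsilon> r * \<bar>\<beta> (x, t + \<sigma> * r) - \<beta> (x, t)\<bar>) \<partial>lborel \<partial>lborel \<partial>lborel)"
  proof (rule nn_integral_cong, rule nn_integral_cong)
    fix x :: 'a and t :: real
    show "(\<integral>\<^sup>+s. ennreal (mollifier \<epsilon> (\<sigma> * (s - t)) * \<bar>\<beta> (x, s) - \<beta> (x, t)\<bar>) \<partial>lborel) = (\<integral>\<^sup>+r. ennreal (mollifier \<epsilon> r * \<bar>\<beta> (x, t + \<sigma> * r) - \<beta> (x, t)\<bar>) \<partial>lborel)"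
      using nn_integral_real_affine[of "\<lambda>s. ennreal (mollifier \<epsilon> (\<sigma> * (s - t)) * \<bar>\<beta> (x, s) - \<beta> (x, t)\<bar>)" \<sigma> t] s0 by simp
  qed
  also have "\<dots> = (\<integral>\<^sup>+x. \<integral>\<^sup>+r. \<integral>\<^sup>+t. ennreal (mollifier \<epsilon> r * \<bar>\<beta> (x, t + \<sigma> * r) - \<beta> (x, t)\<bar>) \<partial>lborel \<partial>lborel \<partial>lborel)"
    by (rule nn_integral_cong, rule lborel_pair.Fubini', measurable)
  also have "\<dots> = (\<integral>\<^sup>+r. \<integral>\<^sup>+x. \<integral>\<^sup>+t. ennreal (mollifier \<epsilon> r * \<bar>\<beta> (x, t + \<sigma> * r) - \<beta> (x, t)\<bar>) \<partial>lborel \<partial>lborel \<partial>lborel)"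
    by (rule lborel_pair.Fubini') measurable
  also have "\<dots> = (\<integral>\<^sup>+r. ennreal (mollifier \<epsilon> r) * Np 1 (\<lambda>z. \<beta> (z + (0, \<sigma> * r)) - \<beta> z) \<partial>lborel)"
  proof (rule nn_integral_cong)
    fix r :: real
    have "(\<integral>\<^sup>+x. \<integral>\<^sup>+t. ennreal (mollifier \<epsilon> r * \<bar>\<beta> (x, t + \<sigma> * r) - \<beta> (x, t)\<bar>) \<partial>lborel \<partial>lborel)
      = (\<integral>\<^sup>+x. \<integral>\<^sup>+t. ennreal (mollifier \<epsilon> r) * ennreal \<bar>\<beta> ((x, t) + (0, \<sigma> * r)) - \<beta> (x, t)\<bar> \<partial>lborel \<partial>lborel)"
      using mollifier_nonneg[OF \<epsilon>, where 'a=real] by (simp add: ennreal_mult')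
    also have "\<dots> = (\<integral>\<^sup>+z. ennreal (mollifier \<epsilon> r) * ennreal \<bar>\<beta> (z + (0, \<sigma> * r)) - \<beta> z\<bar> \<partial>lborel)"
      by (rule nn_integral_lborel_pair(1)[symmetric]) measurable
    also have "\<dots> = ennreal (mollifier \<epsilon> r) * Np 1 (\<lambda>z. \<beta> (z + (0, \<sigma> * r)) - \<beta> z)"
      unfolding Np_def by (subst nn_integral_cmult) auto
    finally show "(\<integral>\<^sup>+x. \<integral>\<^sup>+t. ennreal (mollifier \<epsilon> r * \<bar>\<beta> (x, t + \<sigma> * r) - \<beta> (x, t)\<bar>) \<partial>lborel \<partial>lborel)
      = ennreal (mollifier \<epsilon> r) * Np 1 (\<lambda>z. \<beta> (z + (0, \<sigma> * r)) - \<beta> z)" .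
  qed
  also have "\<dots> \<le> (\<integral>\<^sup>+r. ennreal (mollifier \<epsilon> (r::real)) * e \<partial>lborel)"
  proof (rule nn_integral_mono)
    fix r :: real
    show "ennreal (mollifier \<epsilon> r) * Np 1 (\<lambda>z. \<beta> (z + (0, \<sigma> * r)) - \<beta> z) \<le> ennreal (mollifier \<epsilon> r) * e"
      using e[of r] m0[of r] by (cases "0 \<le> r \<and> r \<le> \<epsilon>") (auto intro: mult_left_mono)
  qed
  also have "\<dots> = e" using mollifier_nn_integral[OF \<epsilon>, where 'a=real] by (simp add: nn_integral_multc)
  finally show ?thesis .
qed

lemma excess_integrable: "integrable lborel (\<lambda>z. max 0 (b_pow p (u z) - b_pow p (v z)))"
proof (rule integrable_dominated)
  show "integrable lborel (\<lambda>z. \<bar>b_pow p (u z)\<bar> + \<bar>b_pow p (v z)\<bar>)" using bint by auto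
qed auto

text \<open>The limit \<open>\<epsilon> \<rightarrow> 0\<close>. Since \<open>max 0 (a - k)\<close>
  is 1-Lipschitz in \<open>k\<close>, replacing \<open>v(s)\<close> by \<open>v(t)\<close> costs at
  most \<open>M1\<close> times a translation error of \<open>b_pow p (v)\<close> in
  \<open>L^1\<close>, which is small by continuity of translations.\<close>

lemma Kato_inequality:
  fixes \<omega> \<omega>' :: "real \<Rightarrow> real"
  assumes \<omega>: "\<And>t. (\<omega> has_field_derivative \<omega>' t) (at t)" "continuous_on UNIV \<omega>'" "\<And>t. 0 \<le> \<omega> t" "\<And>t. \<omega> t \<le> M1" "\<And>t. \<bar>\<omega>' t\<bar> \<le> M1"
    and \<omega>0: "\<And>t. t < c \<or> d < t \<Longrightarrow> \<omega> t = 0 \<and> \<omega>' t = 0" and cd: "0 < c" "d < T" and M1: "M1 > 0"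
  shows "0 \<le> (LINT z|lborel. max 0 (b_pow p (u z) - b_pow p (v z)) * \<omega>' (snd z))"
proof -
  define J where "J = (LINT z|lborel. max 0 (b_pow p (u z) - b_pow p (v z)) * \<omega>' (snd z))"
  define \<beta> where "\<beta> z = b_pow p (v z)" for z
  have \<beta>i: "integrable lborel \<beta>" unfolding \<beta>_def using bint by simp
  have [measurable]: "\<omega>' \<in> borel_measurable borel" by (rule borel_measurable_continuous_onI[OF \<omega>(2)])
  have [measurable]: "\<beta> \<in> borel_measurable borel" using \<beta>i by auto
  have Ji: "integrable lborel (\<lambda>z. max 0 (b_pow p (u z) - b_pow p (v z)) * \<omega>' (snd z))"
  proof (rule integrable_dominated)
    show "integrable lborel (\<lambda>z. max 0 (b_pow p (u z) - b_pow p (v z)) * M1)" using excess_integrable by auto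
    show "\<bar>max 0 (b_pow p (u z) - b_pow p (v z)) * \<omega>' (snd z)\<bar> \<le> max 0 (b_pow p (u z) - b_pow p (v z)) * M1" for z
      unfolding abs_mult using \<omega>(5) by (intro mult_mono) auto
  qed measurable
  have main: "0 \<le> J + M1 * e" if e: "e > 0" for e
  proof -
    from translation_continuous_L1[OF \<beta>i, unfolded translation_continuous_def ennreal_tendsto_0_iff, rule_format, OF e]
    obtain d0 where d0: "d0 > 0" "\<And>h. dist h 0 < d0 \<Longrightarrow> Np 1 (\<lambda>z. \<beta> (z + h) - \<beta> z) < ennreal e"
      unfolding eventually_nhds_metric by blast
    \<comment> \<open>The first two bounds keep \<open>s\<close> in \<open>(0, T)\<close> while
      \<open>t\<close> ranges over \<open>[c, d]\<close> and \<open>s\<close> differs from it by at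
      most \<open>\<epsilon>\<close>, whichever sign \<open>\<sigma>\<close> has; the third makes
      the translation error smaller than \<open>e\<close>.\<close>
    define \<epsilon> where "\<epsilon> = min (c / 2) (min ((T - d) / 2) (d0 / 2))"
    have \<epsilon>le: "\<epsilon> \<le> c / 2" "\<epsilon> \<le> (T - d) / 2" "\<epsilon> \<le> d0 / 2"
      unfolding \<epsilon>_def by (meson min.cobounded1 min.cobounded2 order_trans)+
    have \<epsilon>: "\<epsilon> > 0" "\<epsilon> < c" "d + \<epsilon> < T" "\<epsilon> < d0"
    proof -
      show "\<epsilon> > 0" using cd d0(1) by (simp add: \<epsilon>_def)
      show "\<epsilon> < c" using \<epsilon>le(1) cd(1) by simp
      show "d + \<epsilon> < T" using \<epsilon>le(2) cd(2) by (simp add: field_simps)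
      show "\<epsilon> < d0" using \<epsilon>le(3) d0(1) by simp
    qed
    define f where "f = (\<lambda>y::'a \<times> (real \<times> real). max 0 (b_pow p (u (fst y, fst (snd y))) - b_pow p (v (fst y, snd (snd y)))) *
      (\<omega>' (fst (snd y)) * mollifier \<epsilon> (\<sigma> * (snd (snd y) - fst (snd y)))))"
    define g where "g = (\<lambda>y::'a \<times> (real \<times> real). max 0 (b_pow p (u (fst y, fst (snd y))) - b_pow p (v (fst y, fst (snd y)))) *
      (\<omega>' (fst (snd y)) * mollifier \<epsilon> (\<sigma> * (snd (snd y) - fst (snd y)))))"
    have f: "0 \<le> (LINT y|lborel. f y)" "integrable lborel f"
      using doubled_limit[OF \<omega> \<omega>0 \<epsilon>(2,3,1) M1] unfolding f_def by blast+
    obtain B where B: "B > 0" "\<And>s::real. mollifier \<epsilon> s \<le> B" using mollifier_bounded[OF \<epsilon>(1)] by blast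
    have mn: "0 \<le> mollifier \<epsilon> r" for r :: real by (rule mollifier_nonneg[OF \<epsilon>(1)])
    have m0: "mollifier \<epsilon> r = 0" if "r \<le> 0 \<or> r \<ge> \<epsilon>" for r :: real
      using that \<epsilon>(1) by (auto simp: mollifier_real intro!: bump_0 simp: divide_nonpos_pos)
    have g: "integrable lborel g"
    proof (rule integrable_dominated)
      show "integrable lborel (\<lambda>y::'a \<times> (real \<times> real). (M1 * B) * (indicator {0<..<T} (snd (snd y)) * max 0 (b_pow p (u (fst y, fst (snd y))) - b_pow p (v (fst y, fst (snd y))))))"
        by (intro integrable_mult_right integrable_lift(1)[of "\<lambda>z. max 0 (b_pow p (u z) - b_pow p (v z))"] excess_integrable)
      show "g \<in> borel_measurable borel" unfolding g_def by measurable
      fix y :: "'a \<times> (real \<times> real)"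
      obtain x t s where y: "y = (x, (t, s))" by (cases y) auto
      have "\<bar>\<omega>' t * mollifier \<epsilon> (\<sigma> * (s - t))\<bar> \<le> (M1 * B) * indicator {0<..<T} s"
      proof (cases "\<omega>' t = 0 \<or> mollifier \<epsilon> (\<sigma> * (s - t)) = 0")
        case True
        then show ?thesis using M1 B(1) by auto
      next
        case False
        then have "c \<le> t" "t \<le> d" using \<omega>0[of t] by (auto simp: not_less[symmetric])
        moreover have "0 < \<sigma> * (s - t)" "\<sigma> * (s - t) < \<epsilon>" using False m0[of "\<sigma> * (s - t)"] by (auto simp: not_le[symmetric])
        ultimately have "0 < s" "s < T" using sigma \<epsilon> by auto
        moreover have "\<bar>\<omega>' t * mollifier \<epsilon> (\<sigma> * (s - t))\<bar> \<le> M1 * B"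
          unfolding abs_mult using \<omega>(5) B mn M1 by (intro mult_mono) auto
        ultimately show ?thesis by simp
      qed
      from mult_left_mono[OF this, of "max 0 (b_pow p (u (x, t)) - b_pow p (v (x, t)))"]
      show "\<bar>g y\<bar> \<le> (M1 * B) * (indicator {0<..<T} (snd (snd y)) * max 0 (b_pow p (u (fst y, fst (snd y))) - b_pow p (v (fst y, fst (snd y)))))"
        unfolding g_def y fst_conv snd_conv abs_mult[of "max 0 _"] by (simp add: mult_ac)
    qed
    \<comment> \<open>With \<open>v\<close> moved to the time \<open>t\<close>, the variable
      \<open>s\<close> occurs only in the mollifier, whose integral is 1.\<close>
    have gJ: "(LINT y|lborel. g y) = J"
    proof -
      have "(LINT x|lborel. g (x, (t, s))) = mollifier \<epsilon> (\<sigma> * (s - t)) * (LINT x|lborel. max 0 (b_pow p (u (x, t)) - b_pow p (v (x, t))) * \<omega>' t)" for t s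
      proof -
        have "g (x, (t, s)) = mollifier \<epsilon> (\<sigma> * (s - t)) * (max 0 (b_pow p (u (x, t)) - b_pow p (v (x, t))) * \<omega>' t)" for x
          by (simp add: g_def)
        then show ?thesis by (simp only: integral_mult_right_zero)
      qed
      then have "(LINT y|lborel. g y) = (LINT t|lborel. LINT s|lborel. mollifier \<epsilon> (\<sigma> * (s - t)) * (LINT x|lborel. max 0 (b_pow p (u (x, t)) - b_pow p (v (x, t))) * \<omega>' t))"
        unfolding triple_integral(3)[OF g] by (simp only:)
      also have "\<dots> = (LINT t|lborel. LINT x|lborel. max 0 (b_pow p (u (x, t)) - b_pow p (v (x, t))) * \<omega>' t)"
        by (simp only: integral_mult_left_zero mollifier_shift(2)[OF \<epsilon>(1)] mult_1)
      also have "\<dots> = J" unfolding J_def integral_lborel_pair(2)[OF Ji] by simp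
      finally show ?thesis .
    qed
    have fgi: "integrable lborel (\<lambda>y. f y - g y)" using f(2) g by auto
    have "ennreal (norm (LINT y|lborel. f y - g y)) \<le> (\<integral>\<^sup>+y. ennreal (norm (f y - g y)) \<partial>lborel)"
      by (rule integral_norm_bound_ennreal[OF fgi])
    also have "\<dots> \<le> (\<integral>\<^sup>+y. ennreal M1 * ennreal (mollifier \<epsilon> (\<sigma> * (snd (snd y) - fst (snd y))) * \<bar>\<beta> (fst y, snd (snd y)) - \<beta> (fst y, fst (snd y))\<bar>) \<partial>(lborel :: ('a \<times> (real \<times> real)) measure))"
    proof (rule nn_integral_mono)
      fix y :: "'a \<times> (real \<times> real)"
      obtain x t s where y: "y = (x, (t, s))" by (cases y) auto
      have "f y - g y = (max 0 (b_pow p (u (x, t)) - b_pow p (v (x, s))) - max 0 (b_pow p (u (x, t)) - b_pow p (v (x, t)))) * (\<omega>' t * mollifier \<epsilon> (\<sigma> * (s - t)))"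
        by (simp add: f_def g_def y left_diff_distrib)
      then have "norm (f y - g y) = \<bar>max 0 (b_pow p (u (x, t)) - b_pow p (v (x, s))) - max 0 (b_pow p (u (x, t)) - b_pow p (v (x, t)))\<bar> * (\<bar>\<omega>' t\<bar> * mollifier \<epsilon> (\<sigma> * (s - t)))"
        using mn by (simp add: abs_mult)
      also have "\<dots> \<le> \<bar>\<beta> (x, s) - \<beta> (x, t)\<bar> * (M1 * mollifier \<epsilon> (\<sigma> * (s - t)))"
        using \<omega>(5) mn M1 by (intro mult_mono mult_right_mono) (auto simp: \<beta>_def max_def)
      also have "\<dots> = M1 * (mollifier \<epsilon> (\<sigma> * (s - t)) * \<bar>\<beta> (x, s) - \<beta> (x, t)\<bar>)" by simp
      finally show "ennreal (norm (f y - g y)) \<le> ennreal M1 * ennreal (mollifier \<epsilon> (\<sigma> * (snd (snd y) - fst (snd y))) * \<bar>\<beta> (fst y, snd (snd y)) - \<beta> (fst y, fst (snd y))\<bar>)"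
        using M1 mn unfolding y by (simp add: ennreal_mult'[symmetric] ennreal_leI)
    qed
    also have "\<dots> = ennreal M1 * (\<integral>\<^sup>+y. ennreal (mollifier \<epsilon> (\<sigma> * (snd (snd y) - fst (snd y))) * \<bar>\<beta> (fst y, snd (snd y)) - \<beta> (fst y, fst (snd y))\<bar>) \<partial>(lborel :: ('a \<times> (real \<times> real)) measure))"
      by (rule nn_integral_cmult) measurable
    also have "\<dots> \<le> ennreal M1 * ennreal e"
    proof (rule mult_left_mono[OF undoubling_error[OF _ \<epsilon>(1)]])
      fix r assume "0 \<le> r" "r \<le> \<epsilon>"
      then have "dist (0::'a, \<sigma> * r) 0 < d0" using \<epsilon>(4) sigma by (auto simp: dist_norm norm_Pair)
      then show "Np 1 (\<lambda>z. \<beta> (z + (0, \<sigma> * r)) - \<beta> z) \<le> ennreal e" using d0(2) less_imp_le by blast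
    qed auto
    finally have "norm (LINT y|lborel. f y - g y) \<le> M1 * e"
      using M1 e by (simp add: ennreal_mult'[symmetric])
    moreover have "(LINT y|lborel. f y - g y) = (LINT y|lborel. f y) - J" using f(2) g gJ by simp
    ultimately show ?thesis using f(1) by simp
  qed
  have "0 \<le> J"
  proof (rule field_le_epsilon)
    fix e :: real assume "e > 0"
    then show "0 \<le> J + e" using main[of "e / M1"] M1 by simp
  qed
  then show ?thesis by (simp add: J_def)
qed

text \<open>The time cut-off rises near 0 and descends over \<open>(a, b)\<close>.
  \<open>Kato_inequality\<close> then bounds a weighted mean of the excess \<open>q\<close> over
  \<open>(a, b)\<close> by one over times close to 0, which the initial condition makes arbitrarily
  small. As the weight is positive inside \<open>(a, b)\<close> and \<open>q \<ge> 0\<close>,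
  \<open>q\<close> vanishes there almost everywhere.\<close>

lemma comparison:
  assumes init: "\<And>e. e > 0 \<Longrightarrow> \<exists>t0>0. AE t in lborel. 0 < t \<and> t < t0 \<longrightarrow> (\<integral>\<^sup>+x. ennreal \<bar>b_pow p (u (x, t)) - b_pow p (v (x, t))\<bar> \<partial>lborel) < ennreal e"
  shows "AE z in lborel. u z \<le> v z"
proof -
  define m where "m z = max 0 (b_pow p (u z) - b_pow p (v z))" for z
  have mi: "integrable lborel m" unfolding m_def by (rule excess_integrable)
  define q where "q t = (LINT x|lborel. m (x, t))" for t
  have qi: "integrable lborel q" unfolding q_def by (rule integral_lborel_pair(6)[OF mi])
  have [measurable]: "q \<in> borel_measurable borel" using qi by auto
  have q0: "0 \<le> q t" for t unfolding q_def m_def by (intro integral_nonneg_AE AE_I2) simp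
  have qm: "integrable lborel (\<lambda>t. q t * mollifier r (t - c))" if r: "r > 0" for r c :: real
  proof -
    obtain B where B: "B > 0" "\<And>s::real. mollifier r s \<le> B" using mollifier_bounded[OF r] by blast
    show ?thesis
      by (rule integrable_dominated[of "\<lambda>t. q t * B"])
        (use qi B q0 mollifier_nonneg[OF r, where 'a=real] in \<open>auto simp: abs_mult intro!: mult_left_mono\<close>)
  qed
  have mzero: "mollifier r s = 0" if "r > 0" "s \<le> 0 \<or> s \<ge> r" for r s :: real
    using that by (auto simp: mollifier_real intro!: bump_0 simp: divide_nonpos_pos)
  have key: "AE t in lborel. a < t \<and> t < b \<longrightarrow> q t = 0" if ab: "0 < a" "a < b" "b < T" for a b
  proof -
    have ba: "b - a > 0" using ab by simp
    have le: "(LINT t|lborel. q t * mollifier (b - a) (t - a)) \<le> 0 + e" if e: "e > 0" for e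
    proof -
      obtain t0 where t0: "t0 > 0" "AE t in lborel. 0 < t \<and> t < t0 \<longrightarrow> (\<integral>\<^sup>+x. ennreal \<bar>b_pow p (u (x, t)) - b_pow p (v (x, t))\<bar> \<partial>lborel) < ennreal e"
        using init[OF e] by blast
      \<comment> \<open>The rising ramp occupies \<open>(\<kappa>, 2 * \<kappa>)\<close>. It has to
        end before the descent starts at \<open>a\<close>, which keeps \<open>\<omega>\<close>
        nonnegative, and within the range \<open>t0\<close> of the initial estimate.\<close>
      define \<kappa> where "\<kappa> = min (a / 2) (t0 / 2)"
      have \<kappa>: "\<kappa> > 0" "2 * \<kappa> \<le> a" "2 * \<kappa> \<le> t0" using ab t0 by (auto simp: \<kappa>_def)
      define \<omega> where "\<omega> t = smooth_step ((t - \<kappa>) / \<kappa>) - smooth_step ((t - a) / (b - a))" for t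
      define \<omega>' where "\<omega>' t = mollifier \<kappa> (t - \<kappa>) - mollifier (b - a) (t - a)" for t :: real
      obtain B1 where B1: "B1 > 0" "\<And>s::real. mollifier \<kappa> s \<le> B1" using mollifier_bounded[OF \<kappa>(1)] by blast
      obtain B2 where B2: "B2 > 0" "\<And>s::real. mollifier (b - a) s \<le> B2" using mollifier_bounded[OF ba] by blast
      have mn: "0 \<le> mollifier \<kappa> s" "0 \<le> mollifier (b - a) s" for s :: real
        using mollifier_nonneg[OF \<kappa>(1), where 'a=real] mollifier_nonneg[OF ba, where 'a=real] by auto
      have mc: "continuous_on UNIV (\<lambda>t::real. mollifier r (t - c))" for r c :: real
        by (intro continuous_on_compose2[OF smooth_continuous[OF smooth_mollifier]] continuous_intros) auto
      have "0 \<le> (LINT z|lborel. max 0 (b_pow p (u z) - b_pow p (v z)) * \<omega>' (snd z))"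
      proof (rule Kato_inequality[where \<omega>=\<omega> and c=\<kappa> and d=b and ?M1.0="1 + B1 + B2"])
        show "(\<omega> has_field_derivative \<omega>' t) (at t)" for t
          unfolding \<omega>_def \<omega>'_def by (intro DERIV_diff smooth_step_scaled_derivative \<kappa> ba)
        show "continuous_on UNIV \<omega>'" unfolding \<omega>'_def by (intro continuous_on_diff mc)
        show "0 \<le> \<omega> t" for t
        proof (cases "t \<le> a")
          case True
          then have "smooth_step ((t - a) / (b - a)) = 0" using ba by (intro smooth_step_0) (simp add: divide_nonpos_pos)
          then show ?thesis using smooth_step_bounds by (simp add: \<omega>_def)
        next
          case False
          then have "smooth_step ((t - \<kappa>) / \<kappa>) = 1" using \<kappa> by (intro smooth_step_1) (simp add: pos_le_divide_eq)
          then show ?thesis using smooth_step_bounds(2)[of "(t - a) / (b - a)"] by (simp add: \<omega>_def)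
        qed
        show "\<omega> t \<le> 1 + B1 + B2" for t
          using smooth_step_bounds(2)[of "(t - \<kappa>) / \<kappa>"] smooth_step_bounds(1)[of "(t - a) / (b - a)"] B1 B2 by (simp add: \<omega>_def)
        show "\<bar>\<omega>' t\<bar> \<le> 1 + B1 + B2" for t
          using mn(1)[of "t - \<kappa>"] mn(2)[of "t - a"] B1(2)[of "t - \<kappa>"] B2(2)[of "t - a"] B1(1) B2(1) unfolding \<omega>'_def by linarith
        show "\<omega> t = 0 \<and> \<omega>' t = 0" if "t < \<kappa> \<or> b < t" for t
          using that
        proof
          assume "t < \<kappa>"
          then show ?thesis using \<kappa> ba ab mzero[OF \<kappa>(1), of "t - \<kappa>"] mzero[OF ba, of "t - a"]
            by (simp add: \<omega>_def \<omega>'_def smooth_step_0 divide_nonpos_pos)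
        next
          assume "b < t"
          then show ?thesis using \<kappa> ba ab mzero[OF \<kappa>(1), of "t - \<kappa>"] mzero[OF ba, of "t - a"]
            by (simp add: \<omega>_def \<omega>'_def smooth_step_1 pos_le_divide_eq)
        qed
      qed (use \<kappa> ab B1 B2 in auto)
      also have "(LINT z|lborel. max 0 (b_pow p (u z) - b_pow p (v z)) * \<omega>' (snd z)) = (LINT t|lborel. q t * \<omega>' t)"
      proof -
        have [measurable]: "\<omega>' \<in> borel_measurable borel" unfolding \<omega>'_def by measurable
        have "integrable lborel (\<lambda>z. m z * \<omega>' (snd z))"
        proof (rule integrable_dominated[of "\<lambda>z. m z * (B1 + B2)"])
          show "integrable lborel (\<lambda>z. m z * (B1 + B2))" using mi by auto
          have [measurable]: "m \<in> borel_measurable borel" using mi by auto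
          show "(\<lambda>z. m z * \<omega>' (snd z)) \<in> borel_measurable borel" by measurable
          show "\<bar>m z * \<omega>' (snd z)\<bar> \<le> m z * (B1 + B2)" for z
          proof -
            have "\<bar>\<omega>' (snd z)\<bar> \<le> B1 + B2"
              using mn(1)[of "snd z - \<kappa>"] mn(2)[of "snd z - a"] B1(2)[of "snd z - \<kappa>"] B2(2)[of "snd z - a"] unfolding \<omega>'_def by linarith
            then show ?thesis unfolding abs_mult by (intro mult_mono) (auto simp: m_def)
          qed
        qed
        from integral_lborel_pair(2)[OF this] show ?thesis by (simp add: m_def q_def)
      qed
      also have "\<dots> = (LINT t|lborel. q t * mollifier \<kappa> (t - \<kappa>)) - (LINT t|lborel. q t * mollifier (b - a) (t - a))"
        unfolding \<omega>'_def right_diff_distrib using qm[OF \<kappa>(1)] qm[OF ba] by simp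
      finally have "(LINT t|lborel. q t * mollifier (b - a) (t - a)) \<le> (LINT t|lborel. q t * mollifier \<kappa> (t - \<kappa>))" by simp
      also have "\<dots> \<le> (LINT t|lborel. e * mollifier \<kappa> (t - \<kappa>))"
      proof (rule integral_mono_AE[OF qm[OF \<kappa>(1)]])
        have i: "integrable lborel (\<lambda>t. mollifier \<kappa> (- \<kappa> + 1 * t))"
          by (rule lborel_integrable_real_affine[OF mollifier_integrable[OF \<kappa>(1)]]) simp
        then show "integrable lborel (\<lambda>t. e * mollifier \<kappa> (t - \<kappa>))" by (intro integrable_mult_right) simp
        show "AE t in lborel. q t * mollifier \<kappa> (t - \<kappa>) \<le> e * mollifier \<kappa> (t - \<kappa>)"
          using t0(2) integral_lborel_pair(4)[OF mi]
        proof eventually_elim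
          case (elim t)
          show ?case
          proof (cases "\<kappa> < t \<and> t < 2 * \<kappa>")
            case True
            then have b: "(\<integral>\<^sup>+x. ennreal \<bar>b_pow p (u (x, t)) - b_pow p (v (x, t))\<bar> \<partial>lborel) < ennreal e" using elim(1) \<kappa> by auto
            have "ennreal (q t) = (\<integral>\<^sup>+x. ennreal (m (x, t)) \<partial>lborel)"
              unfolding q_def by (rule nn_integral_eq_integral[symmetric, OF elim(2)]) (simp add: m_def)
            also have "\<dots> \<le> (\<integral>\<^sup>+x. ennreal \<bar>b_pow p (u (x, t)) - b_pow p (v (x, t))\<bar> \<partial>lborel)"
              by (intro nn_integral_mono ennreal_leI) (simp add: m_def)
            finally have "ennreal (q t) < ennreal e" using b by (rule order.strict_trans1)
            then have "q t \<le> e" using q0[of t] by (simp add: ennreal_less_iff)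
            then show ?thesis using mn(1) by (rule mult_right_mono)
          next
            case False
            then show ?thesis using mzero[OF \<kappa>(1), of "t - \<kappa>"] by auto
          qed
        qed
      qed
      also have "\<dots> = e"
      proof -
        have "(LINT t|lborel. mollifier \<kappa> (t - \<kappa>)) = 1"
          using lborel_integral_real_affine[of 1 "mollifier \<kappa> :: real \<Rightarrow> real" "- \<kappa>"] mollifier_integral[OF \<kappa>(1), where 'a=real] by simp
        then show ?thesis by simp
      qed
      finally show ?thesis by simp
    qed
    have "(LINT t|lborel. q t * mollifier (b - a) (t - a)) \<le> 0" by (rule field_le_epsilon) (rule le)
    moreover have nn: "AE t in lborel. 0 \<le> q t * mollifier (b - a) (t - a)"
      using q0 mollifier_nonneg[OF ba, where 'a=real] by simp
    ultimately have "(LINT t|lborel. q t * mollifier (b - a) (t - a)) = 0"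
      using integral_nonneg_AE[OF nn] by linarith
    then have "AE t in lborel. q t * mollifier (b - a) (t - a) = 0"
      using integral_nonneg_eq_0_iff_AE[OF qm[OF ba] nn] by simp
    then show ?thesis
    proof eventually_elim
      case (elim t)
      show ?case
      proof
        assume t: "a < t \<and> t < b"
        then have "bump ((t - a) / (b - a)) > 0" by (intro bump_pos) auto
        then have "mollifier (b - a) (t - a) \<noteq> 0" using ba by (simp add: mollifier_real)
        with elim show "q t = 0" by simp
      qed
    qed
  qed
  \<comment> \<open>These intervals exhaust \<open>(0, T)\<close> and have closure inside it; the
    offset 3 makes them nonempty for every \<open>n\<close>, because
    \<open>T / 3 < T - T / 3\<close>.\<close>
  have "AE t in lborel. T / real (n + 3) < t \<and> t < T - T / real (n + 3) \<longrightarrow> q t = 0" for n :: nat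
  proof (rule key)
    have "T / real (n + 3) \<le> T / 3" using T by (intro divide_left_mono) auto
    then show "T / real (n + 3) < T - T / real (n + 3)" using T by linarith
  qed (use T in auto)
  then have "AE t in lborel. \<forall>n::nat. T / real (n + 3) < t \<and> t < T - T / real (n + 3) \<longrightarrow> q t = 0"
    by (subst AE_all_countable) blast
  then have "AE t in lborel. q t = 0"
  proof eventually_elim
    case (elim t)
    show ?case
    proof (cases "0 < t \<and> t < T")
      case True
      then have "min t (T - t) / T > 0" using T by simp
      then obtain n where "1 / real (Suc n) < min t (T - t) / T" using nat_approx_posE by metis
      then have "T / real (Suc n) < min t (T - t)" using T by (simp add: field_simps)
      moreover have "T / real (n + 3) \<le> T / real (Suc n)" using T by (intro divide_left_mono) auto
      ultimately show ?thesis using elim[rule_format, of n] by auto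
    next
      case False
      then have "m (x, t) = 0" for x using outside(1,2)[of "(x, t)"] by (auto simp: m_def)
      then show ?thesis by (simp add: q_def)
    qed
  qed
  then have "(LINT t|lborel. q t) = 0" by (simp add: integral_eq_zero_AE)
  then have "(LINT z|lborel. m z) = 0" unfolding q_def by (simp add: integral_lborel_pair(2)[OF mi])
  then have "AE z in lborel. m z = 0"
    by (subst (asm) integral_nonneg_eq_0_iff_AE[OF mi]) (simp_all add: m_def)
  then show ?thesis
  proof eventually_elim
    case (elim z)
    then have "b_pow p (u z) \<le> b_pow p (v z)" by (simp add: m_def)
    then show ?case by (simp add: b_pow_le_iff[OF p])
  qed
qed

end

section \<open>Borel representatives and uniqueness\<close>

lemma borel_version_on:
  fixes f :: "'a::euclidean_space \<Rightarrow> 'b::euclidean_space"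
  assumes "f \<in> borel_measurable (lebesgue_on C)" and C[measurable]: "C \<in> sets borel"
  obtains f' where "f' \<in> borel_measurable borel" "\<And>z. z \<notin> C \<Longrightarrow> f' z = 0" "AE z in lborel. z \<in> C \<longrightarrow> f z = f' z"
proof -
  have "(\<lambda>z. indicator C z *\<^sub>R f z) \<in> borel_measurable lebesgue"
    using assms(1) C by (subst (asm) borel_measurable_restrict_space_iff) auto
  then obtain f0 where f0[measurable]: "f0 \<in> borel_measurable borel" and ae: "AE z in lborel. indicator C z *\<^sub>R f z = f0 z"
    by (rule lebesgue_borel_version)
  show ?thesis
  proof (rule that[of "\<lambda>z. indicator C z *\<^sub>R f0 z"])
    show "AE z in lborel. z \<in> C \<longrightarrow> f z = indicator C z *\<^sub>R f0 z"
      using ae by eventually_elim auto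
  qed auto
qed

lemma AE_lebesgue_on_Ioo:
  "(AE t in lebesgue_on {0<..<T::real}. P t) \<longleftrightarrow> (AE t in lborel. 0 < t \<and> t < T \<longrightarrow> P t)"
  by (subst AE_restrict_space_iff) (auto simp: AE_completion_iff)

text \<open>For arbitrary sets, being null on almost every slice does not imply being null. Borel
  measurability of the exceptional set makes Tonelli applicable.\<close>

lemma AE_lborel_pairI:
  fixes P :: "'a::euclidean_space \<times> real \<Rightarrow> bool"
  assumes [measurable]: "{z. \<not> P z} \<in> sets borel" and ae: "AE t in lborel. AE x in lborel. P (x, t)"
  shows "AE z in lborel. P z"
proof -
  have "(\<integral>\<^sup>+z. indicator {z. \<not> P z} z \<partial>lborel) = (\<integral>\<^sup>+t. \<integral>\<^sup>+x. indicator {z. \<not> P z} (x, t) \<partial>(lborel :: 'a measure) \<partial>lborel)"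
    by (rule nn_integral_lborel_pair(2)) measurable
  also have "\<dots> = (\<integral>\<^sup>+t. 0 \<partial>(lborel :: real measure))"
  proof (rule nn_integral_cong_AE)
    show "AE t in lborel. (\<integral>\<^sup>+x. indicator {z. \<not> P z} (x, t) \<partial>(lborel :: 'a measure)) = 0"
      using ae
    proof eventually_elim
      case (elim t)
      have "(\<integral>\<^sup>+x. indicator {z. \<not> P z} (x, t) \<partial>(lborel :: 'a measure)) = (\<integral>\<^sup>+x. 0 \<partial>(lborel :: 'a measure))"
        by (rule nn_integral_cong_AE) (use elim in \<open>eventually_elim, simp\<close>)
      then show ?case by simp
    qed
  qed
  finally have "emeasure lborel {z. \<not> P z} = 0" by simp
  then show ?thesis by (intro AE_I[of _ _ "{z. \<not> P z}"]) auto
qed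

text \<open>A smaller power is dominated by the larger one plus the indicator of a set of finite
  measure. It is needed with exponent \<open>p - 1\<close> for \<open>b_pow\<close> and the flux,
  and with exponent 1 for the gradient of the data.\<close>

lemma integrable_powr_finite:
  fixes f :: "'a::euclidean_space \<Rightarrow> 'b::euclidean_space"
  assumes r: "0 \<le> r" "r \<le> p" and [measurable]: "f \<in> borel_measurable borel" "C \<in> sets borel" and C: "emeasure lborel C < \<infinity>"
    and f0: "\<And>x. x \<notin> C \<Longrightarrow> f x = 0" and N: "Np p f < \<infinity>"
  shows "integrable lborel (\<lambda>x. norm (f x) powr r)"
proof (rule integrable_dominated)
  have "integrable lborel (\<lambda>x. norm (f x) powr p)" using N by (auto intro!: integrableI_nonneg simp: Np_def)
  moreover have "integrable lborel (indicator C :: 'a \<Rightarrow> real)" using C by (auto simp: less_top)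
  ultimately show "integrable lborel (\<lambda>x. norm (f x) powr p + indicator C x)" by auto
  show "\<bar>norm (f x) powr r\<bar> \<le> norm (f x) powr p + indicator C x" for x
  proof (cases "x \<in> C")
    case True
    show ?thesis
    proof (cases "norm (f x) \<le> 1")
      case True
      then have "norm (f x) powr r \<le> 1" using r by (simp add: powr_le1)
      with \<open>x \<in> C\<close> show ?thesis by (simp add: add_increasing)
    next
      case False
      then have "norm (f x) powr r \<le> norm (f x) powr p" using r by (intro powr_mono) auto
      with \<open>x \<in> C\<close> show ?thesis by simp
    qed
  qed (simp add: f0)
qed measurable

lemma has_weak_gradient_cong_AE:
  fixes f f' :: "'a::euclidean_space \<Rightarrow> real"
  assumes w: "has_weak_gradient \<Omega> f G" and [measurable]: "\<Omega> \<in> sets borel" "f' \<in> borel_measurable borel" "G' \<in> borel_measurable borel"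
    and f: "AE x in lborel. x \<in> \<Omega> \<longrightarrow> f x = f' x" and G: "AE x in lborel. x \<in> \<Omega> \<longrightarrow> G x = G' x"
  shows "has_weak_gradient \<Omega> f' G'"
proof -
  have i: "set_integrable lebesgue K f" "set_integrable lebesgue K G" if "compact K" "K \<subseteq> \<Omega>" for K
    using w that by (auto simp: has_weak_gradient_def)
  have cong: "set_integrable lebesgue K h'"
    if K: "K \<in> sets borel" "K \<subseteq> \<Omega>" and h: "set_integrable lebesgue K h" and [measurable]: "h' \<in> borel_measurable borel"
      and ae: "AE x in lborel. x \<in> \<Omega> \<longrightarrow> h x = h' x" for K and h h' :: "'a \<Rightarrow> 'c::euclidean_space"
  proof -
    have [measurable]: "K \<in> sets borel" by (rule K(1))
    have "integrable lborel (\<lambda>x. indicator K x *\<^sub>R h' x)"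
    proof (rule integrable_lebesgue_AE_borel(1))
      show "integrable lebesgue (\<lambda>x. indicator K x *\<^sub>R h x)" using h by (simp add: set_integrable_def)
      show "AE x in lborel. indicator K x *\<^sub>R h x = indicator K x *\<^sub>R h' x"
        using ae by eventually_elim (use K(2) in \<open>auto simp: indicator_def\<close>)
    qed measurable
    then show ?thesis unfolding set_integrable_def by (subst integrable_completion) auto
  qed
  have eqi: "(LINT x:\<Omega>|lebesgue. h x) = (LINT x:\<Omega>|lebesgue. h' x)"
    if h: "set_integrable lebesgue \<Omega> h" and [measurable]: "h' \<in> borel_measurable borel"
      and ae: "AE x in lborel. x \<in> \<Omega> \<longrightarrow> h x = h' x" for h h' :: "'a \<Rightarrow> 'c::euclidean_space"
  proof -
    have "(LINT x|lebesgue. indicator \<Omega> x *\<^sub>R h x) = (LINT x|lborel. indicator \<Omega> x *\<^sub>R h' x)"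
    proof (rule integrable_lebesgue_AE_borel(2))
      show "integrable lebesgue (\<lambda>x. indicator \<Omega> x *\<^sub>R h x)" using h by (simp add: set_integrable_def)
      show "AE x in lborel. indicator \<Omega> x *\<^sub>R h x = indicator \<Omega> x *\<^sub>R h' x"
        using ae by eventually_elim (auto simp: indicator_def)
    qed measurable
    then show ?thesis unfolding set_lebesgue_integral_def by (subst (2) integral_completion) auto
  qed
  show ?thesis
    unfolding has_weak_gradient_def
  proof (intro conjI allI impI ballI)
    fix K assume K: "compact K \<and> K \<subseteq> \<Omega>"
    then have Kb: "K \<in> sets borel" by (auto simp: compact_imp_closed borel_closed)
    show "set_integrable lebesgue K f'" using K i by (intro cong[OF Kb _ _ _ f]) auto
    show "set_integrable lebesgue K G'" using K i by (intro cong[OF Kb _ _ _ G]) auto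
  next
    fix \<phi> assume t: "\<phi> \<in> test_functions \<Omega>"
    note [measurable] = smooth_borel[OF test_functionsD(1)[OF t]] smooth_grad_borel[OF test_functionsD(1)[OF t]]
    have "(LINT x:\<Omega>|lebesgue. f' x *\<^sub>R grad \<phi> x) = (LINT x:\<Omega>|lebesgue. f x *\<^sub>R grad \<phi> x)"
      by (rule eqi[symmetric, OF test_function_grad_set_integrable[OF i(1) t]]) (use f in \<open>auto elim!: eventually_mono\<close>)
    also have "\<dots> = - (LINT x:\<Omega>|lebesgue. \<phi> x *\<^sub>R G x)" using w t unfolding has_weak_gradient_def by blast
    also have "(LINT x:\<Omega>|lebesgue. \<phi> x *\<^sub>R G x) = (LINT x:\<Omega>|lebesgue. \<phi> x *\<^sub>R G' x)"
      by (rule eqi[OF test_function_set_integrable[OF i(2) t]]) (use G in \<open>auto elim!: eventually_mono\<close>)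
    finally show "(LINT x:\<Omega>|lebesgue. f' x *\<^sub>R grad \<phi> x) = - (LINT x:\<Omega>|lebesgue. \<phi> x *\<^sub>R G' x)" .
  qed
qed

lemma test_functions_product:
  fixes \<phi> :: "'a::euclidean_space \<Rightarrow> real" and \<theta> :: "real \<Rightarrow> real"
  assumes \<phi>: "\<phi> \<in> test_functions A" and \<theta>: "\<theta> \<in> test_functions B"
  defines "\<gamma> \<equiv> \<lambda>z. \<phi> (fst z) * \<theta> (snd z)"
  shows "\<gamma> \<in> test_functions (A \<times> B)" "time_deriv \<gamma> z = \<phi> (fst z) * deriv \<theta> (snd z)"
    "space_grad \<gamma> z = \<theta> (snd z) *\<^sub>R grad \<phi> (fst z)"
proof -
  note p = test_functionsD[OF \<phi>] and q = test_functionsD[OF \<theta>]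
  have "smooth (\<lambda>z::'a \<times> real. \<phi> (0 + fst z))" by (rule smooth_affine[OF bounded_linear_fst p(1)])
  moreover have "smooth (\<lambda>z::'a \<times> real. \<theta> (0 + snd z))" by (rule smooth_affine[OF bounded_linear_snd q(1)])
  ultimately have s: "smooth \<gamma>" unfolding \<gamma>_def by (intro smooth_mult) simp_all
  show "\<gamma> \<in> test_functions (A \<times> B)"
  proof (rule test_functionsI[OF s compact_Times[OF p(2) q(2)]])
    show "closure {x. \<phi> x \<noteq> 0} \<times> closure {x. \<theta> x \<noteq> 0} \<subseteq> A \<times> B" using p(3) q(3) by blast
    show "\<gamma> z = 0" if "z \<notin> closure {x. \<phi> x \<noteq> 0} \<times> closure {x. \<theta> x \<noteq> 0}" for z
    proof -
      have "fst z \<notin> closure {x. \<phi> x \<noteq> 0} \<or> snd z \<notin> closure {x. \<theta> x \<noteq> 0}" using that by (metis mem_Times_iff)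
      then have "\<phi> (fst z) = 0 \<or> \<theta> (snd z) = 0" using p(4) q(4) by blast
      then show ?thesis by (auto simp: \<gamma>_def)
    qed
  qed
  have "\<theta> field_differentiable at (snd z)"
  proof -
    have "(\<theta> has_derivative (\<lambda>h. grad \<theta> (snd z) * h)) (at (snd z))"
      using smooth_has_derivative[OF q(1), of "snd z"] by (simp add: smooth_grad(2)[OF q(1)] mult.commute)
    then have "(\<theta> has_field_derivative grad \<theta> (snd z)) (at (snd z))" by (simp add: has_field_derivative_def)
    then show ?thesis by (auto simp: field_differentiable_def)
  qed
  then show "time_deriv \<gamma> z = \<phi> (fst z) * deriv \<theta> (snd z)"
    unfolding time_deriv_def \<gamma>_def by (simp add: deriv_cmult)
  have "((\<lambda>y. \<phi> y * \<theta> (snd z)) has_derivative (\<lambda>h. (h \<bullet> grad \<phi> (fst z)) * \<theta> (snd z))) (at (fst z))"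
    using smooth_has_derivative[OF p(1), of "fst z"] by (intro has_derivative_mult_left) (simp add: smooth_grad(2)[OF p(1)])
  then show "space_grad \<gamma> z = \<theta> (snd z) *\<^sub>R grad \<phi> (fst z)"
    unfolding space_grad_def \<gamma>_def by (intro GDERIV_grad) (simp add: gderiv_def mult.commute)
qed

lemma approximable_cong:
  assumes "approximable p \<Omega> w G" "\<And>x. x \<in> \<Omega> \<Longrightarrow> w x = w' x" "\<And>x. G x = G' x"
  shows "approximable p \<Omega> w' G'"
proof -
  have "indicator \<Omega> x *\<^sub>R (W x - w x) = indicator \<Omega> x *\<^sub>R (W x - w' x)" for W x
    using assms(2) by (auto simp: indicator_def)
  moreover have "G = G'" using assms(3) by auto
  ultimately show ?thesis using assms(1) unfolding approximable_def by (simp only:)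
qed

text \<open>\<open>Lp_time\<close> and \<open>weak_solution\<close> each assert that some spatial
  gradient exists, a priori not the same one. A single Borel gradient \<open>U\<close> is fixed
  here, and uniqueness of weak gradients on the slices identifies every other choice with it almost
  everywhere.\<close>

lemma Lp_time_borel_versions:
  fixes u :: "'a::euclidean_space \<times> real \<Rightarrow> real"
  assumes p: "p > 1" and "open \<Omega>" and u: "u \<in> Lp_time p \<Omega> T X"
  obtains u' U where "u' \<in> borel_measurable borel" "U \<in> borel_measurable borel"
    "\<And>z. z \<notin> cylinder \<Omega> T \<Longrightarrow> u' z = 0" "\<And>z. z \<notin> cylinder \<Omega> T \<Longrightarrow> U z = 0"
    "AE z in lborel. z \<in> cylinder \<Omega> T \<longrightarrow> u z = u' z"
    "Np p u' < \<infinity>" "Np p U < \<infinity>"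
    "\<And>G. has_spatial_gradient \<Omega> T u G \<Longrightarrow> AE z in lborel. z \<in> cylinder \<Omega> T \<longrightarrow> G z = U z"
    "AE t in lborel. 0 < t \<and> t < T \<longrightarrow> has_weak_gradient \<Omega> (\<lambda>x. u' (x, t)) (\<lambda>x. U (x, t)) \<and> (AE x in lborel. x \<in> \<Omega> \<longrightarrow> u (x, t) = u' (x, t))"
proof -
  let ?C = "cylinder \<Omega> T"
  have \<Omega>m[measurable]: "\<Omega> \<in> sets borel" using assms(2) by auto
  have "open ?C" using assms(2) by (intro open_Times) auto
  then have C[measurable]: "?C \<in> sets borel" by auto
  obtain G where um: "u \<in> borel_measurable (lebesgue_on ?C)" and G: "has_spatial_gradient \<Omega> T u G"
    and int: "integrable (lebesgue_on ?C) (\<lambda>z. \<bar>u z\<bar> powr p + norm (G z) powr p)"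
    using u unfolding Lp_time_def by blast
  have Gm: "G \<in> borel_measurable (lebesgue_on ?C)" using G by (simp add: has_spatial_gradient_def)
  obtain u' where u': "u' \<in> borel_measurable borel" "\<And>z. z \<notin> ?C \<Longrightarrow> u' z = 0" "AE z in lborel. z \<in> ?C \<longrightarrow> u z = u' z"
    using borel_version_on[OF um C] by blast
  obtain U where U: "U \<in> borel_measurable borel" "\<And>z. z \<notin> ?C \<Longrightarrow> U z = 0" "AE z in lborel. z \<in> ?C \<longrightarrow> G z = U z"
    using borel_version_on[OF Gm C] by blast
  note [measurable] = u'(1) U(1)
  have "integrable lborel (\<lambda>z. \<bar>u' z\<bar> powr p + norm (U z) powr p)"
  proof (rule integrable_lebesgue_AE_borel(1))
    show "integrable lebesgue (\<lambda>z. indicator ?C z *\<^sub>R (\<bar>u z\<bar> powr p + norm (G z) powr p))"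
      using int C by (subst (asm) integrable_restrict_space) auto
    show "AE z in lborel. indicator ?C z *\<^sub>R (\<bar>u z\<bar> powr p + norm (G z) powr p) = \<bar>u' z\<bar> powr p + norm (U z) powr p"
      using u'(3) U(3)
    proof eventually_elim
      case (elim z)
      show ?case
      proof (cases "z \<in> ?C")
        case True
        with elim show ?thesis by simp
      next
        case False
        then have "u' z = 0" "U z = 0" using u'(2) U(2) by blast+
        with False show ?thesis by simp
      qed
    qed
  qed measurable
  then have fin: "(\<integral>\<^sup>+z. ennreal (\<bar>u' z\<bar> powr p + norm (U z) powr p) \<partial>lborel) < \<infinity>"
    by (simp add: integrable_iff_bounded)
  have "Np p u' \<le> (\<integral>\<^sup>+z. ennreal (\<bar>u' z\<bar> powr p + norm (U z) powr p) \<partial>lborel)" "Np p U \<le> (\<integral>\<^sup>+z. ennreal (\<bar>u' z\<bar> powr p + norm (U z) powr p) \<partial>lborel)"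
    unfolding Np_def by (intro nn_integral_mono ennreal_leI; simp)+
  then have N: "Np p u' < \<infinity>" "Np p U < \<infinity>" using fin by (auto intro: order.strict_trans1)
  have sl: "AE t in lborel. AE x in lborel. x \<in> \<Omega> \<and> 0 < t \<and> t < T \<longrightarrow> u (x, t) = u' (x, t) \<and> G (x, t) = U (x, t)"
  proof -
    have "AE z in lborel. z \<in> ?C \<longrightarrow> u z = u' z \<and> G z = U z" using u'(3) U(3) by eventually_elim simp
    from AE_lborel_pair(2)[OF this] show ?thesis by simp
  qed
  have wg: "AE t in lborel. 0 < t \<and> t < T \<longrightarrow> has_weak_gradient \<Omega> (\<lambda>x. u (x, t)) (\<lambda>x. G (x, t))"
    using G unfolding has_spatial_gradient_def AE_lebesgue_on_Ioo by blast
  have wg': "AE t in lborel. 0 < t \<and> t < T \<longrightarrow> has_weak_gradient \<Omega> (\<lambda>x. u' (x, t)) (\<lambda>x. U (x, t)) \<and> (AE x in lborel. x \<in> \<Omega> \<longrightarrow> u (x, t) = u' (x, t))"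
    using sl wg
  proof eventually_elim
    case (elim t)
    show ?case
    proof
      assume t: "0 < t \<and> t < T"
      have a1: "AE x in lborel. x \<in> \<Omega> \<longrightarrow> u (x, t) = u' (x, t)" using elim(1) by eventually_elim (use t in auto)
      have a2: "AE x in lborel. x \<in> \<Omega> \<longrightarrow> G (x, t) = U (x, t)" using elim(1) by eventually_elim (use t in auto)
      have "has_weak_gradient \<Omega> (\<lambda>x. u (x, t)) (\<lambda>x. G (x, t))" using elim(2) t by blast
      from has_weak_gradient_cong_AE[OF this \<Omega>m _ _ a1 a2] a1
      show "has_weak_gradient \<Omega> (\<lambda>x. u' (x, t)) (\<lambda>x. U (x, t)) \<and> (AE x in lborel. x \<in> \<Omega> \<longrightarrow> u (x, t) = u' (x, t))" by simp
    qed
  qed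
  have uniq: "AE z in lborel. z \<in> ?C \<longrightarrow> G2 z = U z" if G2: "has_spatial_gradient \<Omega> T u G2" for G2
  proof -
    have G2m: "G2 \<in> borel_measurable (lebesgue_on ?C)" using G2 by (simp add: has_spatial_gradient_def)
    obtain V where V: "V \<in> borel_measurable borel" "\<And>z. z \<notin> ?C \<Longrightarrow> V z = 0" "AE z in lborel. z \<in> ?C \<longrightarrow> G2 z = V z"
      using borel_version_on[OF G2m C] by blast
    have wg2: "AE t in lborel. 0 < t \<and> t < T \<longrightarrow> has_weak_gradient \<Omega> (\<lambda>x. u (x, t)) (\<lambda>x. G2 (x, t))"
      using G2 unfolding has_spatial_gradient_def AE_lebesgue_on_Ioo by blast
    note [measurable] = V(1)
    have sl2: "AE t in lborel. AE x in lborel. (x, t) \<in> ?C \<longrightarrow> G2 (x, t) = V (x, t)" by (rule AE_lborel_pair(2)[OF V(3)])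
    have "AE z in lborel. V z = U z"
    proof (rule AE_lborel_pairI)
      show "{z. V z \<noteq> U z} \<in> sets borel" by measurable
      show "AE t in lborel. AE x in lborel. V (x, t) = U (x, t)"
        using sl sl2 wg wg2
      proof eventually_elim
        case (elim t)
        show ?case
        proof (cases "0 < t \<and> t < T")
          case True
          have "AE x in lborel. x \<in> \<Omega> \<longrightarrow> G (x, t) = G2 (x, t)"
            using weak_gradient_unique[OF assms(2), of "\<lambda>x. u (x, t)" "\<lambda>x. G (x, t)" "\<lambda>x. G2 (x, t)"] elim(3,4) True by blast
          with elim(1,2) show ?thesis
          proof eventually_elim
            case (elim x)
            show ?case
            proof (cases "x \<in> \<Omega>")
              case True
              with elim \<open>0 < t \<and> t < T\<close> show ?thesis by simp
            next
              case False
              then show ?thesis using V(2)[of "(x, t)"] U(2)[of "(x, t)"] by simp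
            qed
          qed
        next
          case False
          then show ?thesis using V(2)[of "(_, t)"] U(2)[of "(_, t)"] by (intro AE_I2) auto
        qed
      qed
    qed
    with V(3) show ?thesis by eventually_elim simp
  qed
  show ?thesis
    by (rule that[OF u'(1) U(1) u'(2) U(2) u'(3) N uniq wg'])
qed

lemma has_weak_gradient_cong:
  assumes "has_weak_gradient \<Omega> f G" "\<And>x. x \<in> \<Omega> \<Longrightarrow> f x = f' x"
  shows "has_weak_gradient \<Omega> f' G"
proof -
  have "indicator \<Omega> x *\<^sub>R (f x *\<^sub>R h x) = indicator \<Omega> x *\<^sub>R (f' x *\<^sub>R h x)" for h :: "'a \<Rightarrow> 'a" and x
    using assms(2)[of x] by (cases "x \<in> \<Omega>") auto
  then have "(LINT x:\<Omega>|lebesgue. f x *\<^sub>R h x) = (LINT x:\<Omega>|lebesgue. f' x *\<^sub>R h x)" for h :: "'a \<Rightarrow> 'a"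
    unfolding set_lebesgue_integral_def by (simp only:)
  moreover have "set_integrable lebesgue K f = set_integrable lebesgue K f'" if "K \<subseteq> \<Omega>" for K
  proof -
    have "indicator K x *\<^sub>R f x = indicator K x *\<^sub>R f' x" for x
      using assms(2)[of x] that by (cases "x \<in> K") auto
    then show ?thesis unfolding set_integrable_def by (simp only:)
  qed
  ultimately show ?thesis using assms(1) unfolding has_weak_gradient_def by simp
qed

lemma nn_integral_lebesgue_on:
  assumes "\<Omega> \<in> sets borel"
  shows "(\<integral>\<^sup>+x. f x \<partial>lebesgue_on \<Omega>) = (\<integral>\<^sup>+x. f x * indicator \<Omega> x \<partial>lborel)"
  by (subst nn_integral_restrict_space) (use assms in \<open>auto simp: nn_integral_completion\<close>)

text \<open>\<open>W1p0\<close> brings its own gradient on each slice; uniqueness of the weak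
  gradient lets the prescribed \<open>F'\<close> take its place in the limit.\<close>

lemma W1p0_W0_limit:
  fixes f f' :: "'a::euclidean_space \<Rightarrow> real"
  assumes p: "p > 1" and "open \<Omega>" and f: "f \<in> W1p0 p \<Omega>" and [measurable]: "f' \<in> borel_measurable borel" "F' \<in> borel_measurable borel"
    and ae: "AE x in lborel. x \<in> \<Omega> \<longrightarrow> f x = f' x" and wg: "has_weak_gradient \<Omega> f' F'"
  shows "W0_limit p \<Omega> f' F'"
proof -
  have \<Omega>[measurable]: "\<Omega> \<in> sets borel" using assms(2) by auto
  obtain G \<phi> where G: "has_weak_gradient \<Omega> f G" "G \<in> Lp p \<Omega>" and \<phi>: "\<And>k::nat. \<phi> k \<in> test_functions \<Omega>"
    and lim: "(\<lambda>k. \<integral>\<^sup>+x. ennreal (\<bar>f x - \<phi> k x\<bar> powr p + norm (G x - grad (\<phi> k) x) powr p) \<partial>lebesgue_on \<Omega>) \<longlonglongrightarrow> 0"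
    using f unfolding W1p0_def by blast
  have Gm: "G \<in> borel_measurable (lebesgue_on \<Omega>)" using G(2) by (simp add: Lp_def)
  obtain G' where G': "G' \<in> borel_measurable borel" "\<And>z. z \<notin> \<Omega> \<Longrightarrow> G' z = 0" "AE z in lborel. z \<in> \<Omega> \<longrightarrow> G z = G' z"
    using borel_version_on[OF Gm \<Omega>] by blast
  have "has_weak_gradient \<Omega> f' G'" by (rule has_weak_gradient_cong_AE[OF G(1) \<Omega> _ G'(1) ae G'(3)]) simp
  from weak_gradient_unique[OF assms(2) this wg] G'(3)
  have ae2: "AE x in lborel. x \<in> \<Omega> \<longrightarrow> G x = F' x" by eventually_elim simp
  have both: "AE x in lborel. x \<in> \<Omega> \<longrightarrow> f x = f' x \<and> G x = F' x" using ae ae2 by eventually_elim simp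
  have le1: "Np p (\<lambda>x. indicator \<Omega> x *\<^sub>R (\<phi> k x - f' x)) \<le> (\<integral>\<^sup>+x. ennreal (\<bar>f x - \<phi> k x\<bar> powr p + norm (G x - grad (\<phi> k) x) powr p) \<partial>lebesgue_on \<Omega>)" for k
    unfolding Np_def nn_integral_lebesgue_on[OF \<Omega>]
  proof (rule nn_integral_mono_AE)
    show "AE x in lborel. ennreal (norm (indicator \<Omega> x *\<^sub>R (\<phi> k x - f' x)) powr p) \<le> ennreal (\<bar>f x - \<phi> k x\<bar> powr p + norm (G x - grad (\<phi> k) x) powr p) * indicator \<Omega> x"
      using both by eventually_elim (auto simp: indicator_def abs_minus_commute intro!: ennreal_leI)
  qed
  have le2: "Np p (\<lambda>x. indicator \<Omega> x *\<^sub>R (grad (\<phi> k) x - F' x)) \<le> (\<integral>\<^sup>+x. ennreal (\<bar>f x - \<phi> k x\<bar> powr p + norm (G x - grad (\<phi> k) x) powr p) \<partial>lebesgue_on \<Omega>)" for k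
    unfolding Np_def nn_integral_lebesgue_on[OF \<Omega>]
  proof (rule nn_integral_mono_AE)
    show "AE x in lborel. ennreal (norm (indicator \<Omega> x *\<^sub>R (grad (\<phi> k) x - F' x)) powr p) \<le> ennreal (\<bar>f x - \<phi> k x\<bar> powr p + norm (G x - grad (\<phi> k) x) powr p) * indicator \<Omega> x"
      using both by eventually_elim (auto simp: indicator_def norm_minus_commute intro!: ennreal_leI)
  qed
  show ?thesis
    unfolding W0_limit_def using \<phi> tendsto_0_le_ennreal[OF lim le1] tendsto_0_le_ennreal[OF lim le2] by blast
qed

text \<open>What the comparison uses of a weak solution, for Borel functions vanishing off the
  cylinder; product test functions suffice for the evolution identity. \<open>\<Psi>\<close> is one
  gradient of \<open>\<psi>\<close> shared by all solutions, so that it cancels between two of them.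
  \<open>\<psi>\<close> is cut off to \<open>\<Omega>\<close> to match \<open>u\<close>, which is 0
  outside.\<close>

definition borel_solution :: "real \<Rightarrow> 'a::euclidean_space set \<Rightarrow> real \<Rightarrow> ('a \<times> real \<Rightarrow> real) \<Rightarrow> ('a \<times> real \<Rightarrow> 'a) \<Rightarrow>
    ('a \<times> real \<Rightarrow> real) \<Rightarrow> ('a \<times> real \<Rightarrow> 'a) \<Rightarrow> bool" where
  "borel_solution p \<Omega> T \<psi> \<Psi> u U \<longleftrightarrow> u \<in> borel_measurable borel \<and> U \<in> borel_measurable borel \<and>
    (\<forall>z. z \<notin> cylinder \<Omega> T \<longrightarrow> u z = 0 \<and> U z = 0) \<and> Np p u < \<infinity> \<and> Np p U < \<infinity> \<and>
    (AE t in lborel. 0 < t \<and> t < T \<longrightarrow> W0_limit p \<Omega> (\<lambda>x. u (x, t) - indicator \<Omega> x *\<^sub>R \<psi> (x, t)) (\<lambda>x. U (x, t) - \<Psi> (x, t))) \<and>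
    (\<forall>\<phi>\<in>test_functions \<Omega>. \<forall>\<theta>\<in>test_functions {0<..<T}.
      (LINT z|lborel. - b_pow p (u z) * (\<phi> (fst z) * deriv \<theta> (snd z)) + flux p (U z) \<bullet> (\<theta> (snd z) *\<^sub>R grad \<phi> (fst z))) = 0) \<and>
    (\<forall>e>0. \<exists>t0>0. AE t in lborel. 0 < t \<and> t < t0 \<longrightarrow>
      (\<integral>\<^sup>+x. ennreal \<bar>b_pow p (u (x, t)) - b_pow p (indicator \<Omega> x *\<^sub>R \<psi> (x, t))\<bar> \<partial>lborel) < ennreal e)"

lemma weak_solution_borel:
  fixes u \<psi> :: "'a::euclidean_space \<times> real \<Rightarrow> real"
  assumes p: "p > 1" and T: "T > 0" and "open \<Omega>" and sol: "weak_solution p \<Omega> T \<psi> u"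
    and \<psi>c: "\<And>t. 0 < t \<Longrightarrow> t < T \<Longrightarrow> continuous_on \<Omega> (\<lambda>x. \<psi> (x, t))"
    and \<Psi>m[measurable]: "\<Psi> \<in> borel_measurable borel"
    and \<Psi>: "AE t in lborel. 0 < t \<and> t < T \<longrightarrow> has_weak_gradient \<Omega> (\<lambda>x. indicator \<Omega> x *\<^sub>R \<psi> (x, t)) (\<lambda>x. \<Psi> (x, t))"
  obtains u' U where "borel_solution p \<Omega> T \<psi> \<Psi> u' U" "AE z in lborel. z \<in> cylinder \<Omega> T \<longrightarrow> u z = u' z"
proof -
  let ?C = "cylinder \<Omega> T"
  have \<Omega>m[measurable]: "\<Omega> \<in> sets borel" using assms(3) by auto
  have "open ?C" using assms(3) by (intro open_Times) auto
  then have C[measurable]: "?C \<in> sets borel" by auto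
  have uL: "u \<in> Lp_time p \<Omega> T (W1p p \<Omega>)" and W0: "(\<lambda>z. u z - \<psi> z) \<in> Lp_time p \<Omega> T (W1p0 p \<Omega>)"
    and ini: "((\<lambda>t. \<integral>\<^sup>+x. ennreal \<bar>b_pow p (u (x, t)) - b_pow p (\<psi> (x, t))\<bar> \<partial>lebesgue_on \<Omega>) \<longlongrightarrow> 0) (at_right 0)"
    using sol unfolding weak_solution_def by blast+
  obtain G where G: "has_spatial_gradient \<Omega> T u G"
    and eq: "\<And>\<gamma>. \<gamma> \<in> test_functions ?C \<Longrightarrow> (LINT z:?C|lebesgue. - b_pow p (u z) * time_deriv \<gamma> z
              + (norm (G z) powr (p - 2) *\<^sub>R G z) \<bullet> space_grad \<gamma> z) = 0"
    using sol unfolding weak_solution_def by blast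
  obtain u' U where u': "u' \<in> borel_measurable borel" "U \<in> borel_measurable borel"
    "\<And>z. z \<notin> ?C \<Longrightarrow> u' z = 0" "\<And>z. z \<notin> ?C \<Longrightarrow> U z = 0"
    "AE z in lborel. z \<in> ?C \<longrightarrow> u z = u' z" "Np p u' < \<infinity>" "Np p U < \<infinity>"
    "\<And>G. has_spatial_gradient \<Omega> T u G \<Longrightarrow> AE z in lborel. z \<in> ?C \<longrightarrow> G z = U z"
    "AE t in lborel. 0 < t \<and> t < T \<longrightarrow> has_weak_gradient \<Omega> (\<lambda>x. u' (x, t)) (\<lambda>x. U (x, t)) \<and> (AE x in lborel. x \<in> \<Omega> \<longrightarrow> u (x, t) = u' (x, t))"
    using Lp_time_borel_versions[OF p assms(3) uL] by blast
  note [measurable] = u'(1,2)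
  have \<psi>m: "(\<lambda>x. indicator \<Omega> x *\<^sub>R \<psi> (x, t)) \<in> borel_measurable borel" if "0 < t" "t < T" for t
    by (rule borel_measurable_continuous_on_indicator[OF _ \<psi>c[OF that]]) simp
  have "AE t in lborel. 0 < t \<and> t < T \<longrightarrow> (\<lambda>x. u (x, t) - \<psi> (x, t)) \<in> W1p0 p \<Omega>"
    using W0 unfolding Lp_time_def AE_lebesgue_on_Ioo by blast
  then have w0: "AE t in lborel. 0 < t \<and> t < T \<longrightarrow> W0_limit p \<Omega> (\<lambda>x. u' (x, t) - indicator \<Omega> x *\<^sub>R \<psi> (x, t)) (\<lambda>x. U (x, t) - \<Psi> (x, t))"
    using u'(9) \<Psi>
  proof eventually_elim
    case (elim t)
    show ?case
    proof
      assume t: "0 < t \<and> t < T"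
      have [measurable]: "(\<lambda>x. indicator \<Omega> x *\<^sub>R \<psi> (x, t)) \<in> borel_measurable borel" using \<psi>m t by blast
      show "W0_limit p \<Omega> (\<lambda>x. u' (x, t) - indicator \<Omega> x *\<^sub>R \<psi> (x, t)) (\<lambda>x. U (x, t) - \<Psi> (x, t))"
      proof (rule W1p0_W0_limit[OF p assms(3)])
        show "(\<lambda>x. u (x, t) - \<psi> (x, t)) \<in> W1p0 p \<Omega>" using elim(1) t by blast
        have "AE x in lborel. x \<in> \<Omega> \<longrightarrow> u (x, t) = u' (x, t)" using elim(2) t by blast
        then show "AE x in lborel. x \<in> \<Omega> \<longrightarrow> u (x, t) - \<psi> (x, t) = u' (x, t) - indicator \<Omega> x *\<^sub>R \<psi> (x, t)"
          by eventually_elim simp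
        show "has_weak_gradient \<Omega> (\<lambda>x. u' (x, t) - indicator \<Omega> x *\<^sub>R \<psi> (x, t)) (\<lambda>x. U (x, t) - \<Psi> (x, t))"
          using elim(2,3) t by (intro has_weak_gradient_diff) blast+
      qed measurable
    qed
  qed
  have weak: "(LINT z|lborel. - b_pow p (u' z) * (\<phi> (fst z) * deriv \<theta> (snd z)) + flux p (U z) \<bullet> (\<theta> (snd z) *\<^sub>R grad \<phi> (fst z))) = 0"
    if \<phi>: "\<phi> \<in> test_functions \<Omega>" and \<theta>: "\<theta> \<in> test_functions {0<..<T}" for \<phi> \<theta>
  proof -
    have s: "smooth \<phi>" "smooth \<theta>" using test_functionsD(1) \<phi> \<theta> by auto
    have \<theta>': "deriv \<theta> = (\<lambda>t. grad \<theta> t)"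
    proof
      fix t
      have "(\<theta> has_derivative (\<lambda>h. grad \<theta> t * h)) (at t)"
        using smooth_has_derivative[OF s(2), of t] by (simp add: smooth_grad(2)[OF s(2)] mult.commute)
      then have "(\<theta> has_field_derivative grad \<theta> t) (at t)" by (simp add: has_field_derivative_def)
      then show "deriv \<theta> t = grad \<theta> t" by (rule DERIV_imp_deriv)
    qed
    have [measurable]: "deriv \<theta> \<in> borel_measurable borel" unfolding \<theta>' using smooth_grad_borel[OF s(2)] by simp
    note [measurable] = smooth_borel[OF s(1)] smooth_borel[OF s(2)] smooth_grad_borel[OF s(1)]
    define f where "f z = - b_pow p (u z) * (\<phi> (fst z) * deriv \<theta> (snd z)) + flux p (G z) \<bullet> (\<theta> (snd z) *\<^sub>R grad \<phi> (fst z))" for z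
    define f' where "f' z = - b_pow p (u' z) * (\<phi> (fst z) * deriv \<theta> (snd z)) + flux p (U z) \<bullet> (\<theta> (snd z) *\<^sub>R grad \<phi> (fst z))" for z
    have f'm: "f' \<in> borel_measurable borel" unfolding f'_def by measurable
    have "(LINT z:?C|lebesgue. f z) = 0"
      using eq[OF test_functions_product(1)[OF \<phi> \<theta>]] unfolding test_functions_product(2,3)[OF \<phi> \<theta>] f_def flux_def .
    moreover have "(LINT z:?C|lebesgue. f z) = (LINT z|lborel. f' z)"
    proof -
      have fm: "f \<in> borel_measurable (lebesgue_on ?C)"
      proof -
        have um: "u \<in> borel_measurable (lebesgue_on ?C)" using uL by (simp add: Lp_time_def)
        have Gm: "G \<in> borel_measurable (lebesgue_on ?C)" using G by (simp add: has_spatial_gradient_def)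
        have bm: "h \<in> borel_measurable (lebesgue_on ?C)" if "h \<in> borel_measurable borel" for h :: "'a \<times> real \<Rightarrow> 'b::euclidean_space"
          using that by (intro measurable_restrict_space1 measurable_completion) simp
        have k1: "(\<lambda>z::'a \<times> real. \<phi> (fst z) * deriv \<theta> (snd z)) \<in> borel_measurable (lebesgue_on ?C)" by (rule bm) measurable
        have k2: "(\<lambda>z::'a \<times> real. \<theta> (snd z) *\<^sub>R grad \<phi> (fst z)) \<in> borel_measurable (lebesgue_on ?C)" by (rule bm) measurable
        have k3: "(\<lambda>z. b_pow p (u z)) \<in> borel_measurable (lebesgue_on ?C)" by (rule measurable_compose[OF um b_pow_borel])
        have k4: "(\<lambda>z. flux p (G z)) \<in> borel_measurable (lebesgue_on ?C)" by (rule measurable_compose[OF Gm flux_borel])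
        show ?thesis unfolding f_def
          by (intro borel_measurable_add borel_measurable_times borel_measurable_uminus borel_measurable_inner k1 k2 k3 k4)
      qed
      then have m1: "(\<lambda>z. indicator ?C z *\<^sub>R f z) \<in> borel_measurable lebesgue"
        using C by (subst (asm) borel_measurable_restrict_space_iff) auto
      have m2: "f' \<in> borel_measurable lebesgue" using f'm by (intro measurable_completion) simp
      have "AE z in lborel. indicator ?C z *\<^sub>R f z = f' z"
        using u'(5) u'(8)[OF G]
      proof eventually_elim
        case (elim z)
        show ?case
        proof (cases "z \<in> ?C")
          case True
          then show ?thesis using elim by (simp add: f_def f'_def)
        next
          case False
          then have "u' z = 0" "U z = 0" using u'(3,4) by blast+
          then show ?thesis using False by (simp add: f'_def)
        qed
      qed
      then have "AE z in lebesgue. indicator ?C z *\<^sub>R f z = f' z" by (rule AE_completion)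
      then have "(LINT z|lebesgue. indicator ?C z *\<^sub>R f z) = (LINT z|lebesgue. f' z)"
        by (rule integral_cong_AE[OF m1 m2])
      also have "\<dots> = (LINT z|lborel. f' z)" by (rule integral_completion) (use f'm in simp)
      finally show ?thesis by (simp only: set_lebesgue_integral_def)
    qed
    ultimately show ?thesis by (simp add: f'_def)
  qed
  have init: "\<exists>t0>0. AE t in lborel. 0 < t \<and> t < t0 \<longrightarrow>
      (\<integral>\<^sup>+x. ennreal \<bar>b_pow p (u' (x, t)) - b_pow p (indicator \<Omega> x *\<^sub>R \<psi> (x, t))\<bar> \<partial>lborel) < ennreal e" if e: "e > 0" for e
  proof -
    have "eventually (\<lambda>t. (\<integral>\<^sup>+x. ennreal \<bar>b_pow p (u (x, t)) - b_pow p (\<psi> (x, t))\<bar> \<partial>lebesgue_on \<Omega>) < ennreal e) (at_right 0)"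
      using ini e unfolding ennreal_tendsto_0_iff by blast
    then obtain b where b: "b > 0" "\<And>t. 0 < t \<Longrightarrow> t < b \<Longrightarrow> (\<integral>\<^sup>+x. ennreal \<bar>b_pow p (u (x, t)) - b_pow p (\<psi> (x, t))\<bar> \<partial>lebesgue_on \<Omega>) < ennreal e"
      unfolding eventually_at_right_field by blast
    show ?thesis
    proof (intro exI[of _ "min b T"] conjI)
      show "0 < min b T" using b(1) T by simp
      show "AE t in lborel. 0 < t \<and> t < min b T \<longrightarrow> (\<integral>\<^sup>+x. ennreal \<bar>b_pow p (u' (x, t)) - b_pow p (indicator \<Omega> x *\<^sub>R \<psi> (x, t))\<bar> \<partial>lborel) < ennreal e"
        using u'(9)
      proof eventually_elim
        case (elim t)
        show ?case
        proof
          assume t: "0 < t \<and> t < min b T"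
          then have "AE x in lborel. x \<in> \<Omega> \<longrightarrow> u (x, t) = u' (x, t)" using elim by auto
          then have "AE x in lborel. ennreal \<bar>b_pow p (u' (x, t)) - b_pow p (indicator \<Omega> x *\<^sub>R \<psi> (x, t))\<bar> \<le> ennreal \<bar>b_pow p (u (x, t)) - b_pow p (\<psi> (x, t))\<bar> * indicator \<Omega> x"
          proof eventually_elim
            case (elim x)
            show ?case
            proof (cases "x \<in> \<Omega>")
              case True
              then show ?thesis using elim by simp
            next
              case False
              then have "u' (x, t) = 0" using u'(3)[of "(x, t)"] by simp
              then show ?thesis using False by simp
            qed
          qed
          then have "(\<integral>\<^sup>+x. ennreal \<bar>b_pow p (u' (x, t)) - b_pow p (indicator \<Omega> x *\<^sub>R \<psi> (x, t))\<bar> \<partial>lborel) \<le> (\<integral>\<^sup>+x. ennreal \<bar>b_pow p (u (x, t)) - b_pow p (\<psi> (x, t))\<bar> * indicator \<Omega> x \<partial>lborel)"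
            by (rule nn_integral_mono_AE)
          also have "\<dots> < ennreal e" using b(2)[of t] t unfolding nn_integral_lebesgue_on[OF \<Omega>m] by simp
          finally show "(\<integral>\<^sup>+x. ennreal \<bar>b_pow p (u' (x, t)) - b_pow p (indicator \<Omega> x *\<^sub>R \<psi> (x, t))\<bar> \<partial>lborel) < ennreal e" .
        qed
      qed
    qed
  qed
  have "borel_solution p \<Omega> T \<psi> \<Psi> u' U"
    unfolding borel_solution_def using u'(1-4,6,7) w0 weak init by blast
  then show ?thesis using u'(5) that by blast
qed

lemma Np_slice_finite:
  fixes f :: "'a::euclidean_space \<times> real \<Rightarrow> 'b::euclidean_space"
  assumes [measurable]: "f \<in> borel_measurable borel" and "Np p f < \<infinity>"
  shows "AE t in lborel. Np p (\<lambda>x. f (x, t)) < \<infinity>"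
proof -
  have "Np p f = (\<integral>\<^sup>+t. Np p (\<lambda>x. f (x, t)) \<partial>lborel)"
    unfolding Np_def by (rule nn_integral_lborel_pair(2)) measurable
  then have "(\<integral>\<^sup>+t. Np p (\<lambda>x. f (x, t)) \<partial>lborel) \<noteq> \<infinity>" using assms(2) by auto
  then have "AE t in lborel. Np p (\<lambda>x. f (x, t)) \<noteq> \<infinity>"
    by (intro nn_integral_PInf_AE) (simp_all add: Np_def)
  then show ?thesis by eventually_elim (simp add: less_top)
qed

section \<open>Comparison of solutions with the same data\<close>

lemma borel_solution_comparison:
  fixes u v \<psi> :: "'a::euclidean_space \<times> real \<Rightarrow> real"
  assumes p: "p > 1" and T: "T > 0" and O: "open \<Omega>" "bounded \<Omega>"
    and \<psi>c: "\<And>t. 0 < t \<Longrightarrow> t < T \<Longrightarrow> continuous_on (closure \<Omega>) (\<lambda>x. \<psi> (x, t))"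
    and \<sigma>: "\<sigma> = 1 \<or> \<sigma> = -1"
    and mono: "\<And>x t s. x \<in> frontier \<Omega> \<Longrightarrow> 0 < t \<Longrightarrow> t < T \<Longrightarrow> 0 < s \<Longrightarrow> s < T \<Longrightarrow> 0 < \<sigma> * (s - t) \<Longrightarrow> \<psi> (x, t) \<le> \<psi> (x, s)"
    and \<Psi>m[measurable]: "\<Psi> \<in> borel_measurable borel" and \<Psi>0: "\<And>z. z \<notin> cylinder \<Omega> T \<Longrightarrow> \<Psi> z = 0" and \<Psi>N: "Np p \<Psi> < \<infinity>"
    and \<Psi>: "AE t in lborel. 0 < t \<and> t < T \<longrightarrow> has_weak_gradient \<Omega> (\<lambda>x. indicator \<Omega> x *\<^sub>R \<psi> (x, t)) (\<lambda>x. \<Psi> (x, t))"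
    and u: "borel_solution p \<Omega> T \<psi> \<Psi> u U" and v: "borel_solution p \<Omega> T \<psi> \<Psi> v V"
  shows "AE z in lborel. u z \<le> v z"
proof -
  let ?C = "cylinder \<Omega> T"
  have \<Omega>m[measurable]: "\<Omega> \<in> sets borel" using O by auto
  have "open ?C" using O by (intro open_Times) auto
  then have C[measurable]: "?C \<in> sets borel" by auto
  have Cfin: "emeasure lborel ?C < \<infinity>" using O(2) by (intro emeasure_bounded_finite bounded_Times) auto
  have bfin: "integrable lborel (\<lambda>z. b_pow p (w z))"
    if [measurable]: "w \<in> borel_measurable borel" and "\<And>z. z \<notin> ?C \<Longrightarrow> w z = 0" "Np p w < \<infinity>" for w
  proof (rule integrable_dominated)
    show "integrable lborel (\<lambda>z. norm (w z) powr (p - 1))"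
      by (rule integrable_powr_finite[OF _ _ _ C Cfin]) (use p that in auto)
    show "\<bar>b_pow p (w z)\<bar> \<le> norm (w z) powr (p - 1)" for z by (simp add: b_pow_abs)
  qed measurable
  have ffin: "integrable lborel (\<lambda>z. flux p (W z))"
    if [measurable]: "W \<in> borel_measurable borel" and "\<And>z. z \<notin> ?C \<Longrightarrow> W z = 0" "Np p W < \<infinity>" for W :: "'a \<times> real \<Rightarrow> 'a"
  proof (rule Bochner_Integration.integrable_bound)
    show "integrable lborel (\<lambda>z. norm (W z) powr (p - 1))"
      by (rule integrable_powr_finite[OF _ _ _ C Cfin]) (use p that in auto)
  qed (auto simp: norm_flux)
  have U: "u \<in> borel_measurable borel" "U \<in> borel_measurable borel" "\<And>z. z \<notin> ?C \<Longrightarrow> u z = 0" "\<And>z. z \<notin> ?C \<Longrightarrow> U z = 0"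
    "Np p u < \<infinity>" "Np p U < \<infinity>"
    "AE t in lborel. 0 < t \<and> t < T \<longrightarrow> W0_limit p \<Omega> (\<lambda>x. u (x, t) - indicator \<Omega> x *\<^sub>R \<psi> (x, t)) (\<lambda>x. U (x, t) - \<Psi> (x, t))"
    "\<And>\<phi> \<theta>. \<phi> \<in> test_functions \<Omega> \<Longrightarrow> \<theta> \<in> test_functions {0<..<T} \<Longrightarrow>
      (LINT z|lborel. - b_pow p (u z) * (\<phi> (fst z) * deriv \<theta> (snd z)) + flux p (U z) \<bullet> (\<theta> (snd z) *\<^sub>R grad \<phi> (fst z))) = 0"
    "\<And>e. e > 0 \<Longrightarrow> \<exists>t0>0. AE t in lborel. 0 < t \<and> t < t0 \<longrightarrow>
      (\<integral>\<^sup>+x. ennreal \<bar>b_pow p (u (x, t)) - b_pow p (indicator \<Omega> x *\<^sub>R \<psi> (x, t))\<bar> \<partial>lborel) < ennreal e"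
    using u unfolding borel_solution_def by blast+
  have V: "v \<in> borel_measurable borel" "V \<in> borel_measurable borel" "\<And>z. z \<notin> ?C \<Longrightarrow> v z = 0" "\<And>z. z \<notin> ?C \<Longrightarrow> V z = 0"
    "Np p v < \<infinity>" "Np p V < \<infinity>"
    "AE t in lborel. 0 < t \<and> t < T \<longrightarrow> W0_limit p \<Omega> (\<lambda>x. v (x, t) - indicator \<Omega> x *\<^sub>R \<psi> (x, t)) (\<lambda>x. V (x, t) - \<Psi> (x, t))"
    "\<And>\<phi> \<theta>. \<phi> \<in> test_functions \<Omega> \<Longrightarrow> \<theta> \<in> test_functions {0<..<T} \<Longrightarrow>
      (LINT z|lborel. - b_pow p (v z) * (\<phi> (fst z) * deriv \<theta> (snd z)) + flux p (V z) \<bullet> (\<theta> (snd z) *\<^sub>R grad \<phi> (fst z))) = 0"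
    "\<And>e. e > 0 \<Longrightarrow> \<exists>t0>0. AE t in lborel. 0 < t \<and> t < t0 \<longrightarrow>
      (\<integral>\<^sup>+x. ennreal \<bar>b_pow p (v (x, t)) - b_pow p (indicator \<Omega> x *\<^sub>R \<psi> (x, t))\<bar> \<partial>lborel) < ennreal e"
    using v unfolding borel_solution_def by blast+
  note [measurable] = U(1,2) V(1,2)
  note bu = bfin[OF U(1,3,5)] and bv = bfin[OF V(1,3,5)] and fu = ffin[OF U(2,4,6)] and fv = ffin[OF V(2,4,6)]
  obtain Su where Su: "AE t in lborel. t \<in> Su" "\<And>t. t \<in> Su \<Longrightarrow> integrable lborel (\<lambda>x. b_pow p (u (x, t)))"
    "\<And>t1 t2 \<phi>. t1 \<in> Su \<Longrightarrow> t2 \<in> Su \<Longrightarrow> 0 < t1 \<Longrightarrow> t1 < t2 \<Longrightarrow> t2 < T \<Longrightarrow> \<phi> \<in> test_functions \<Omega> \<Longrightarrow>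
      (LINT x|lborel. (b_pow p (u (x, t2)) - b_pow p (u (x, t1))) * \<phi> x) = - (LINT z|lborel. indicator {t1<..t2} (snd z) * (flux p (U z) \<bullet> grad \<phi> (fst z)))"
    using evolution_identity[OF bu fu U(8)] by blast
  obtain Sv where Sv: "AE t in lborel. t \<in> Sv" "\<And>t. t \<in> Sv \<Longrightarrow> integrable lborel (\<lambda>x. b_pow p (v (x, t)))"
    "\<And>t1 t2 \<phi>. t1 \<in> Sv \<Longrightarrow> t2 \<in> Sv \<Longrightarrow> 0 < t1 \<Longrightarrow> t1 < t2 \<Longrightarrow> t2 < T \<Longrightarrow> \<phi> \<in> test_functions \<Omega> \<Longrightarrow>
      (LINT x|lborel. (b_pow p (v (x, t2)) - b_pow p (v (x, t1))) * \<phi> x) = - (LINT z|lborel. indicator {t1<..t2} (snd z) * (flux p (V z) \<bullet> grad \<phi> (fst z)))"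
    using evolution_identity[OF bv fv V(8)] by blast
  have \<Psi>i: "integrable lborel \<Psi>"
  proof -
    have "integrable lborel (\<lambda>z. norm (\<Psi> z) powr 1)"
      by (rule integrable_powr_finite[OF _ _ _ C Cfin \<Psi>0 \<Psi>N]) (use p in auto)
    then show ?thesis by (simp add: integrable_norm_iff)
  qed
  \<comment> \<open>All slice properties are gathered in one set of full measure, so that the two
    times of the doubling can be picked from it independently of each other.\<close>
  define S where "S = {t. t \<in> Su \<and> t \<in> Sv \<and> Np p (\<lambda>x. U (x, t)) < \<infinity> \<and> Np p (\<lambda>x. V (x, t)) < \<infinity> \<and> Np p (\<lambda>x. \<Psi> (x, t)) < \<infinity> \<and>
    integrable lborel (\<lambda>x. \<Psi> (x, t)) \<and> (0 < t \<and> t < T \<longrightarrow>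
      W0_limit p \<Omega> (\<lambda>x. u (x, t) - indicator \<Omega> x *\<^sub>R \<psi> (x, t)) (\<lambda>x. U (x, t) - \<Psi> (x, t)) \<and>
      W0_limit p \<Omega> (\<lambda>x. v (x, t) - indicator \<Omega> x *\<^sub>R \<psi> (x, t)) (\<lambda>x. V (x, t) - \<Psi> (x, t)) \<and>
      has_weak_gradient \<Omega> (\<lambda>x. indicator \<Omega> x *\<^sub>R \<psi> (x, t)) (\<lambda>x. \<Psi> (x, t)))}"
  have S: "AE t in lborel. t \<in> S"
    using Su(1) Sv(1) Np_slice_finite[OF U(2,6)] Np_slice_finite[OF V(2,6)] Np_slice_finite[OF \<Psi>m \<Psi>N] integral_lborel_pair(4)[OF \<Psi>i]
      U(7) V(7) \<Psi>
    unfolding S_def mem_Collect_eq by eventually_elim blast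
  have \<psi>m: "(\<lambda>x. indicator \<Omega> x *\<^sub>R \<psi> (x, t)) \<in> borel_measurable borel" if "0 < t" "t < T" for t
    by (rule borel_measurable_continuous_on_indicator[OF _ continuous_on_subset[OF \<psi>c[OF that] closure_subset]]) simp
  have approx: "approximable p \<Omega> (\<lambda>x. u (x, t) - v (x, s)) (\<lambda>x. U (x, t) - V (x, s))"
    if ts: "t \<in> S" "s \<in> S" "0 < t" "t < T" "0 < s" "s < T" "0 < \<sigma> * (s - t)" for t s
  proof -
    note [measurable] = \<psi>m[OF ts(3,4)] \<psi>m[OF ts(5,6)]
    have A: "Np p (\<lambda>x. \<Psi> (x, t)) < \<infinity>" "Np p (\<lambda>x. \<Psi> (x, s)) < \<infinity>" "integrable lborel (\<lambda>x. \<Psi> (x, t))" "integrable lborel (\<lambda>x. \<Psi> (x, s))"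
      "W0_limit p \<Omega> (\<lambda>x. u (x, t) - indicator \<Omega> x *\<^sub>R \<psi> (x, t)) (\<lambda>x. U (x, t) - \<Psi> (x, t))"
      "W0_limit p \<Omega> (\<lambda>x. v (x, s) - indicator \<Omega> x *\<^sub>R \<psi> (x, s)) (\<lambda>x. V (x, s) - \<Psi> (x, s))"
      "has_weak_gradient \<Omega> (\<lambda>x. indicator \<Omega> x *\<^sub>R \<psi> (x, t)) (\<lambda>x. \<Psi> (x, t))"
      "has_weak_gradient \<Omega> (\<lambda>x. indicator \<Omega> x *\<^sub>R \<psi> (x, s)) (\<lambda>x. \<Psi> (x, s))"
      using ts unfolding S_def by blast+
    \<comment> \<open>\<open>\<psi>\<close> is added and subtracted at both times. This leaves two
      functions with zero boundary values and the difference \<open>\<psi>(t) - \<psi>(s)\<close>,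
      which is continuous up to the boundary and nonpositive there by \<open>mono\<close>.\<close>
    have "approximable p \<Omega> (\<lambda>x. (u (x, t) - indicator \<Omega> x *\<^sub>R \<psi> (x, t)) - (v (x, s) - indicator \<Omega> x *\<^sub>R \<psi> (x, s)) + (\<psi> (x, t) - \<psi> (x, s)))
      (\<lambda>x. (U (x, t) - \<Psi> (x, t)) - (V (x, s) - \<Psi> (x, s)) + (\<Psi> (x, t) - \<Psi> (x, s)))"
    proof (rule approximable_if_W0_limits[OF less_imp_le[OF p] O _ _ _ _ A(5,6)])
      show "continuous_on (closure \<Omega>) (\<lambda>x. \<psi> (x, t) - \<psi> (x, s))" using \<psi>c ts by (intro continuous_on_diff) auto
      show "\<psi> (x, t) - \<psi> (x, s) \<le> 0" if "x \<in> frontier \<Omega>" for x using mono[OF that ts(3-7)] by simp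
      show "has_weak_gradient \<Omega> (\<lambda>x. \<psi> (x, t) - \<psi> (x, s)) (\<lambda>x. \<Psi> (x, t) - \<Psi> (x, s))"
        by (rule has_weak_gradient_cong[OF has_weak_gradient_diff[OF A(7,8)]]) simp
      show "\<Psi> (x, t) - \<Psi> (x, s) = 0" if "x \<notin> \<Omega>" for x using \<Psi>0[of "(x, t)"] \<Psi>0[of "(x, s)"] that by simp
      show "integrable lborel (\<lambda>x. \<Psi> (x, t) - \<Psi> (x, s))" using A(3,4) by simp
      have "Np p (\<lambda>x. \<Psi> (x, t) + (- \<Psi> (x, s))) \<le> ennreal (2 powr p) * (Np p (\<lambda>x. \<Psi> (x, t)) + Np p (\<lambda>x. - \<Psi> (x, s)))"
        by (rule Np_add) (use p in auto)
      also have "\<dots> < \<infinity>" unfolding Np_uminus using A(1,2) by (simp add: ennreal_mult_less_top)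
      finally show "Np p (\<lambda>x. \<Psi> (x, t) - \<Psi> (x, s)) < \<infinity>" by simp
    qed measurable
    then show ?thesis by (rule approximable_cong) (auto simp: indicator_def)
  qed
  interpret solution_pair p T \<sigma> \<Omega> u v U V S
  proof
    show "integrable lborel (\<lambda>x. b_pow p (u (x, t)))" "integrable lborel (\<lambda>x. b_pow p (v (x, t)))" "Np p (\<lambda>x. U (x, t)) < \<infinity>" "Np p (\<lambda>x. V (x, t)) < \<infinity>"
      if "t \<in> S" for t using that Su(2) Sv(2) unfolding S_def by blast+
    show "(LINT x|lborel. (b_pow p (u (x, t2)) - b_pow p (u (x, t1))) * \<phi> x) = - (LINT z|lborel. indicator {t1<..t2} (snd z) * (flux p (U z) \<bullet> grad \<phi> (fst z)))"
      if "t1 \<in> S" "t2 \<in> S" "0 < t1" "t1 < t2" "t2 < T" "\<phi> \<in> test_functions \<Omega>" for t1 t2 \<phi>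
      by (rule Su(3)) (use that in \<open>simp_all add: S_def\<close>)
    show "(LINT x|lborel. (b_pow p (v (x, t2)) - b_pow p (v (x, t1))) * \<phi> x) = - (LINT z|lborel. indicator {t1<..t2} (snd z) * (flux p (V z) \<bullet> grad \<phi> (fst z)))"
      if "t1 \<in> S" "t2 \<in> S" "0 < t1" "t1 < t2" "t2 < T" "\<phi> \<in> test_functions \<Omega>" for t1 t2 \<phi>
      by (rule Sv(3)) (use that in \<open>simp_all add: S_def\<close>)
    show "approximable p \<Omega> (\<lambda>x. u (x, t) - v (x, s)) (\<lambda>x. U (x, t) - V (x, s))"
      if "t \<in> S" "s \<in> S" "0 < t" "t < T" "0 < s" "s < T" "0 < \<sigma> * (s - t)" for t s
      by (rule approx[OF that])
    show "1 < p" "0 < T" "\<sigma> = 1 \<or> \<sigma> = -1" "\<Omega> \<in> sets borel" "u \<in> borel_measurable borel" "v \<in> borel_measurable borel"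
      "U \<in> borel_measurable borel" "V \<in> borel_measurable borel" "Np p U < \<infinity>" "Np p V < \<infinity>"
      by fact+
    show "integrable lborel (\<lambda>z. b_pow p (u z))" by (rule bu)
    show "integrable lborel (\<lambda>z. b_pow p (v z))" by (rule bv)
    show "integrable lborel (\<lambda>z. flux p (U z))" by (rule fu)
    show "integrable lborel (\<lambda>z. flux p (V z))" by (rule fv)
    show "AE t in lborel. t \<in> S" by (rule S)
  qed (fact U(3) V(3) U(4) V(4))+
  show ?thesis
  proof (rule comparison)
    fix e :: real assume "e > 0"
    then have e2: "e / 2 > 0" by simp
    obtain tu where tu: "tu > 0" "AE t in lborel. 0 < t \<and> t < tu \<longrightarrow>
      (\<integral>\<^sup>+x. ennreal \<bar>b_pow p (u (x, t)) - b_pow p (indicator \<Omega> x *\<^sub>R \<psi> (x, t))\<bar> \<partial>lborel) < ennreal (e / 2)" using U(9)[OF e2] by blast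
    obtain tv where tv: "tv > 0" "AE t in lborel. 0 < t \<and> t < tv \<longrightarrow>
      (\<integral>\<^sup>+x. ennreal \<bar>b_pow p (v (x, t)) - b_pow p (indicator \<Omega> x *\<^sub>R \<psi> (x, t))\<bar> \<partial>lborel) < ennreal (e / 2)" using V(9)[OF e2] by blast
    show "\<exists>t0>0. AE t in lborel. 0 < t \<and> t < t0 \<longrightarrow> (\<integral>\<^sup>+x. ennreal \<bar>b_pow p (u (x, t)) - b_pow p (v (x, t))\<bar> \<partial>lborel) < ennreal e"
    proof (intro exI[of _ "min T (min tu tv)"] conjI)
      show "0 < min T (min tu tv)" using T tu(1) tv(1) by simp
      show "AE t in lborel. 0 < t \<and> t < min T (min tu tv) \<longrightarrow> (\<integral>\<^sup>+x. ennreal \<bar>b_pow p (u (x, t)) - b_pow p (v (x, t))\<bar> \<partial>lborel) < ennreal e"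
        using tu(2) tv(2)
      proof eventually_elim
        case (elim t)
        show ?case
        proof
          assume t: "0 < t \<and> t < min T (min tu tv)"
          then have [measurable]: "(\<lambda>x. indicator \<Omega> x *\<^sub>R \<psi> (x, t)) \<in> borel_measurable borel" using \<psi>m[of t] by simp
          let ?Iu = "\<integral>\<^sup>+x. ennreal \<bar>b_pow p (u (x, t)) - b_pow p (indicator \<Omega> x *\<^sub>R \<psi> (x, t))\<bar> \<partial>lborel"
          let ?Iv = "\<integral>\<^sup>+x. ennreal \<bar>b_pow p (v (x, t)) - b_pow p (indicator \<Omega> x *\<^sub>R \<psi> (x, t))\<bar> \<partial>lborel"
          have "(\<integral>\<^sup>+x. ennreal \<bar>b_pow p (u (x, t)) - b_pow p (v (x, t))\<bar> \<partial>lborel) \<le>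
            (\<integral>\<^sup>+x. ennreal \<bar>b_pow p (u (x, t)) - b_pow p (indicator \<Omega> x *\<^sub>R \<psi> (x, t))\<bar> + ennreal \<bar>b_pow p (v (x, t)) - b_pow p (indicator \<Omega> x *\<^sub>R \<psi> (x, t))\<bar> \<partial>lborel)"
            by (intro nn_integral_mono) (simp add: ennreal_plus[symmetric] ennreal_leI del: ennreal_plus)
          also have "\<dots> = ?Iu + ?Iv" by (rule nn_integral_add) measurable
          also have "\<dots> < ennreal (e / 2) + ennreal (e / 2)"
            using elim t by (intro add_strict_mono) auto
          also have "\<dots> = ennreal e" using e2 by (simp add: ennreal_plus[symmetric] del: ennreal_plus)
          finally show "(\<integral>\<^sup>+x. ennreal \<bar>b_pow p (u (x, t)) - b_pow p (v (x, t))\<bar> \<partial>lborel) < ennreal e" .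
        qed
      qed
    qed
  qed
qed

theorem proposition3p6:
  fixes p T :: real
    and \<Omega> :: "(real ^ 'n) set"
    and \<psi> u v :: "(real ^ 'n) \<times> real \<Rightarrow> real"
  assumes "1 < p" and "0 < T"
    and "bounded \<Omega>" and "lipschitz_domain \<Omega>"
    and "continuous_on (closure (cylinder \<Omega> T)) \<psi>"
    and "\<psi> \<in> Lp_time p \<Omega> T (W1p p \<Omega>)"
    and "(\<forall>x\<in>frontier \<Omega>. \<forall>t s. 0 < t \<and> t < s \<and> s < T \<longrightarrow> \<psi> (x, t) \<le> \<psi> (x, s)) \<or>
         (\<forall>x\<in>frontier \<Omega>. \<forall>t s. 0 < t \<and> t < s \<and> s < T \<longrightarrow> \<psi> (x, t) \<ge> \<psi> (x, s))"
    and "weak_solution p \<Omega> T \<psi> u"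
    and "weak_solution p \<Omega> T \<psi> v"
  shows "AE z in lebesgue_on (cylinder \<Omega> T). u z = v z"
proof -
  let ?C = "cylinder \<Omega> T"
  have O: "open \<Omega>" using assms(4) by (simp add: lipschitz_domain_def)
  have \<Omega>m: "\<Omega> \<in> sets borel" using O by auto
  have "open ?C" using O by (intro open_Times) auto
  then have C: "?C \<in> sets borel" by auto
  have clC: "closure ?C = closure \<Omega> \<times> {0..T}" using assms(2) by (simp add: closure_Times)
  have \<psi>c: "continuous_on (closure \<Omega>) (\<lambda>x. \<psi> (x, t))" if "0 < t" "t < T" for t
    by (rule continuous_on_compose2[OF assms(5)]) (use that in \<open>auto simp: clC intro!: continuous_intros\<close>)
  have \<psi>c': "continuous_on \<Omega> (\<lambda>x. \<psi> (x, t))" if "0 < t" "t < T" for t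
    using continuous_on_subset[OF \<psi>c[OF that] closure_subset] .
  obtain \<psi>' \<Psi> where \<Psi>: "\<psi>' \<in> borel_measurable borel" "\<Psi> \<in> borel_measurable borel"
    "\<And>z. z \<notin> ?C \<Longrightarrow> \<psi>' z = 0" "\<And>z. z \<notin> ?C \<Longrightarrow> \<Psi> z = 0"
    "AE z in lborel. z \<in> ?C \<longrightarrow> \<psi> z = \<psi>' z" "Np p \<psi>' < \<infinity>" "Np p \<Psi> < \<infinity>"
    "\<And>G. has_spatial_gradient \<Omega> T \<psi> G \<Longrightarrow> AE z in lborel. z \<in> ?C \<longrightarrow> G z = \<Psi> z"
    "AE t in lborel. 0 < t \<and> t < T \<longrightarrow> has_weak_gradient \<Omega> (\<lambda>x. \<psi>' (x, t)) (\<lambda>x. \<Psi> (x, t)) \<and> (AE x in lborel. x \<in> \<Omega> \<longrightarrow> \<psi> (x, t) = \<psi>' (x, t))"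
    using Lp_time_borel_versions[OF assms(1) O assms(6)] by blast
  have \<Psi>w: "AE t in lborel. 0 < t \<and> t < T \<longrightarrow> has_weak_gradient \<Omega> (\<lambda>x. indicator \<Omega> x *\<^sub>R \<psi> (x, t)) (\<lambda>x. \<Psi> (x, t))"
    using \<Psi>(9)
  proof eventually_elim
    case (elim t)
    show ?case
    proof
      assume t: "0 < t \<and> t < T"
      show "has_weak_gradient \<Omega> (\<lambda>x. indicator \<Omega> x *\<^sub>R \<psi> (x, t)) (\<lambda>x. \<Psi> (x, t))"
      proof (rule has_weak_gradient_cong_AE[OF _ \<Omega>m])
        show "has_weak_gradient \<Omega> (\<lambda>x. \<psi>' (x, t)) (\<lambda>x. \<Psi> (x, t))" using elim t by blast
        show "(\<lambda>x. indicator \<Omega> x *\<^sub>R \<psi> (x, t)) \<in> borel_measurable borel"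
          using t by (intro borel_measurable_continuous_on_indicator[OF _ \<psi>c']) (simp_all add: \<Omega>m)
        show "(\<lambda>x. \<Psi> (x, t)) \<in> borel_measurable borel" using \<Psi>(2) by simp
        have "AE x in lborel. x \<in> \<Omega> \<longrightarrow> \<psi> (x, t) = \<psi>' (x, t)" using elim t by blast
        then show "AE x in lborel. x \<in> \<Omega> \<longrightarrow> \<psi>' (x, t) = indicator \<Omega> x *\<^sub>R \<psi> (x, t)"
          by eventually_elim simp
      qed simp
    qed
  qed
  \<comment> \<open>The sign covers both directions of monotonicity through the order imposed on the
    two times; the equation itself is not reversed in time.\<close>
  obtain \<sigma> :: real where \<sigma>: "\<sigma> = 1 \<or> \<sigma> = -1"
    and mono: "\<And>x t s. x \<in> frontier \<Omega> \<Longrightarrow> 0 < t \<Longrightarrow> t < T \<Longrightarrow> 0 < s \<Longrightarrow> s < T \<Longrightarrow> 0 < \<sigma> * (s - t) \<Longrightarrow> \<psi> (x, t) \<le> \<psi> (x, s)"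
    using assms(7)
  proof
    assume a: "\<forall>x\<in>frontier \<Omega>. \<forall>t s. 0 < t \<and> t < s \<and> s < T \<longrightarrow> \<psi> (x, t) \<le> \<psi> (x, s)"
    show ?thesis by (rule that[of 1]) (use a in auto)
  next
    assume a: "\<forall>x\<in>frontier \<Omega>. \<forall>t s. 0 < t \<and> t < s \<and> s < T \<longrightarrow> \<psi> (x, t) \<ge> \<psi> (x, s)"
    show ?thesis by (rule that[of "-1"]) (use a in auto)
  qed
  obtain u' U where u: "borel_solution p \<Omega> T \<psi> \<Psi> u' U" "AE z in lborel. z \<in> ?C \<longrightarrow> u z = u' z"
    using weak_solution_borel[OF assms(1,2) O assms(8) \<psi>c' \<Psi>(2) \<Psi>w] by blast
  obtain v' V where v: "borel_solution p \<Omega> T \<psi> \<Psi> v' V" "AE z in lborel. z \<in> ?C \<longrightarrow> v z = v' z"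
    using weak_solution_borel[OF assms(1,2) O assms(9) \<psi>c' \<Psi>(2) \<Psi>w] by blast
  \<comment> \<open>The order condition concerns the data alone, so \<open>\<sigma>\<close> is
    unchanged when the two solutions are exchanged, and the inequality is available both
    ways.\<close>
  have cmp: "AE z in lborel. w1 z \<le> w2 z"
    if w: "borel_solution p \<Omega> T \<psi> \<Psi> w1 W1" "borel_solution p \<Omega> T \<psi> \<Psi> w2 W2" for w1 W1 w2 W2
    by (rule borel_solution_comparison[OF assms(1,2) O assms(3) _ \<sigma> _ \<Psi>(2) _ \<Psi>(7) \<Psi>w w])
      (fact \<psi>c mono \<Psi>(4))+
  have "AE z in lborel. z \<in> ?C \<longrightarrow> u z = v z"
    using u(2) v(2) cmp[OF u(1) v(1)] cmp[OF v(1) u(1)] by eventually_elim auto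
  then have "AE z in lebesgue. z \<in> ?C \<longrightarrow> u z = v z" by (rule AE_completion)
  then show ?thesis using C by (subst AE_restrict_space_iff) auto
qed

end
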